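(* Let $p>1$ and let $u$ be a locally bounded, local, weak solution to $\partial_t u+\mathscr{L}u=0$ in $E_T$, where $\mathscr{L}$ and the kernel $K$ are as described in the context. Then $u$ is locally Hölder continuous in $E_T$. More precisely, there exist constants $\gamma>1$ and $\beta\in(0,1)$, depending only on the data $\{s,p,N,C_o,C_1\}$, such that for any $0<\rho<R<\widetilde R$, $$\operatorname*{ess\,osc}_{(x_o,t_o)+Q_\rho(\omega^{2-p})} u\le \gamma\,\omega\Big(\frac{\rho}{R}\Big)^{\beta},$$ provided the cylinders satisfy $(x_o,t_o)+Q_R(\omega^{2-p})\subset (x_o,t_o)+Q_{\widetilde R}\subset E_T$, where $$\omega=2\operatorname*{ess\,sup}_{(x_o,t_o)+Q_{\widetilde R}}|u|+\mathrm{Tail}\big(u;(x_o,t_o)+Q_{\widetilde R}\big).$$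
   Context: $E\subset\mathbb{R}^N$ is open, $T>0$, $E_T=E\times(0,T]$. Fix $p>1$, $s\in(0,1)$, $0<C_o\le C_1$. The kernel $K:\mathbb{R}^N\times\mathbb{R}^N\times(0,T]\to[0,\infty)$ is measurable with $K(x,y,t)=K(y,x,t)$ and $C_o|x-y|^{-N-sp}\le K(x,y,t)\le C_1|x-y|^{-N-sp}$ for a.e. $x,y$, uniformly in $t$. The operator is $\mathscr{L}u(x,t)=\mathrm{P.V.}\int_{\mathbb{R}^N}K(x,y,t)|u(x,t)-u(y,t)|^{p-2}(u(x,t)-u(y,t))\,dy$. The "data" are $\{s,p,N,C_o,C_1\}$. Function spaces: $W^{s,p}(\mathbb{R}^N)=\{v\in L^p: \iint |v(x)-v(y)|^p|x-y|^{-N-sp}dxdy<\infty\}$, similarly $W^{s,p}(E)$; $W^{s,p}_o(E)=\{v\in W^{s,p}(\mathbb{R}^N): v=0 \text{ a.e. in }\mathbb{R}^N\setminus E\}$. Weak sub(super)-solution: $u\in C_{loc}(0,T;L^2_{loc}(E))\cap L^p_{loc}(0,T;W^{s,p}_{loc}(E))$ such that for every compact $\mathcal K\subset E$ and every $[t_1,t_2]\subset(0,T]$: $\operatorname*{ess\,sup}_{t_1<t<t_2}\int_{\mathbb{R}^N}\frac{|u(x,t)|^{p-1}}{1+|x|^{N+sp}}dx<\infty$, and $\int_{\mathcal K}u\varphi\,dx\big|_{t_1}^{t_2}-\int_{t_1}^{t_2}\int_{\mathcal K}u\,\partial_t\varphi\,dxdt+\int_{t_1}^{t_2}\mathscr{E}(u(\cdot,t),\varphi(\cdot,t))dt\le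 0$ ($\ge0$), where $\mathscr E=\int\int K(x,y,t)|u(x,t)-u(y,t)|^{p-2}(u(x,t)-u(y,t))(\varphi(x,t)-\varphi(y,t))dydx$, for all nonnegative $\varphi\in W^{1,2}_{loc}(0,T;L^2(\mathcal K))\cap L^p_{loc}(0,T;W^{s,p}_o(\mathcal K))$. A weak solution is both a sub- and a super-solution. Notation: $K_\rho(x_o)$ is the open ball of radius $\rho$ centered at $x_o$; $(x_o,t_o)+Q_\rho(\theta)=K_\rho(x_o)\times(t_o-\theta\rho^{sp},t_o)$, $Q_\rho=Q_\rho(1)$; $(x_o,t_o)+Q(R,S)=K_R(x_o)\times(t_o-S,t_o)$. The tail is $\mathrm{Tail}(u;Q(R,S))=\operatorname*{ess\,sup}_{t_o-S<t<t_o}\Big(R^{sp}\int_{\mathbb{R}^N\setminus K_R(x_o)}\frac{|u(x,t)|^{p-1}}{|x-x_o|^{N+sp}}dx\Big)^{1/(p-1)}$. *)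

theory Defs
  imports "HOL-Analysis.Analysis"
begin

definition ess_sup_on :: "'b::euclidean_space set \<Rightarrow> ('b \<Rightarrow> ereal) \<Rightarrow> ereal" where
  "ess_sup_on S f = Inf {c. AE z in lebesgue. z \<in> S \<longrightarrow> f z \<le> c}"

definition ess_inf_on :: "'b::euclidean_space set \<Rightarrow> ('b \<Rightarrow> ereal) \<Rightarrow> ereal" where
  "ess_inf_on S f = - ess_sup_on S (\<lambda>z. - f z)"

definition ess_osc_on :: "'b::euclidean_space set \<Rightarrow> ('b \<Rightarrow> ereal) \<Rightarrow> ereal" where
  "ess_osc_on S f = ess_sup_on S f - ess_inf_on S f"

definition ereal_powr :: "ereal \<Rightarrow> real \<Rightarrow> ereal" where
  "ereal_powr x a = (if x = \<infinity> then \<infinity> else ereal (real_of_ereal x powr a))"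

definition cyl :: "real \<Rightarrow> real \<Rightarrow> 'a::euclidean_space \<Rightarrow> real \<Rightarrow> real \<Rightarrow> real \<Rightarrow> ('a \<times> real) set" where
  "cyl s p xo to \<rho> \<theta> = ball xo \<rho> \<times> {to - \<theta> * \<rho> powr (s * p) <..< to}"

definition tail :: "real \<Rightarrow> real \<Rightarrow> ('a::euclidean_space \<Rightarrow> real \<Rightarrow> real) \<Rightarrow> 'a \<Rightarrow> real \<Rightarrow> real \<Rightarrow> real \<Rightarrow> ereal" where
  "tail s p u xo to R S = ess_sup_on {to - S <..< to}
     (\<lambda>t. ereal_powr (ereal (R powr (s * p)) *
        enn2ereal (\<integral>\<^sup>+ x \<in> - ball xo R. ennreal (\<bar>u x t\<bar> powr (p - 1) /
                     norm (x - xo) powr (real DIM('a) + s * p)) \<partial>lebesgue)) (1 / (p - 1)))"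

definition Lp_pow :: "real \<Rightarrow> 'a::euclidean_space set \<Rightarrow> ('a \<Rightarrow> real) \<Rightarrow> ennreal" where
  "Lp_pow p A v = (\<integral>\<^sup>+ x \<in> A. ennreal (\<bar>v x\<bar> powr p) \<partial>lebesgue)"

definition gagliardo :: "real \<Rightarrow> real \<Rightarrow> 'a::euclidean_space set \<Rightarrow> ('a \<Rightarrow> real) \<Rightarrow> ennreal" where
  "gagliardo s p A v = (\<integral>\<^sup>+ x \<in> A. (\<integral>\<^sup>+ y \<in> A. ennreal (\<bar>v x - v y\<bar> powr p /
       norm (x - y) powr (real DIM('a) + s * p)) \<partial>lebesgue) \<partial>lebesgue)"

definition admissible_kernel :: "real \<Rightarrow> real \<Rightarrow> real \<Rightarrow> real \<Rightarrow> real \<Rightarrow>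
    ('a::euclidean_space \<Rightarrow> 'a \<Rightarrow> real \<Rightarrow> real) \<Rightarrow> bool" where
  "admissible_kernel s p Co C1 T K \<longleftrightarrow>
     set_borel_measurable lebesgue (UNIV \<times> UNIV \<times> {0<..T})
        (\<lambda>z. K (fst z) (fst (snd z)) (snd (snd z))) \<and>
     (\<forall>x y. \<forall>t\<in>{0<..T}. 0 \<le> K x y t \<and> K x y t = K y x t) \<and>
     (\<forall>t\<in>{0<..T}. AE z in lebesgue.
        Co / norm (fst z - snd z) powr (real DIM('a) + s * p) \<le> K (fst z) (snd z) t \<and>
        K (fst z) (snd z) t \<le> C1 / norm (fst z - snd z) powr (real DIM('a) + s * p))"

definition time_cont_L2 :: "'a::euclidean_space set \<Rightarrow> real set \<Rightarrow> ('a \<Rightarrow> real \<Rightarrow> real) \<Rightarrow> bool" where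
  "time_cont_L2 C I w \<longleftrightarrow>
     (\<forall>t\<in>I. set_borel_measurable lebesgue C (\<lambda>x. w x t) \<and>
             (\<integral>\<^sup>+ x \<in> C. ennreal ((w x t)\<^sup>2) \<partial>lebesgue) < \<infinity>) \<and>
     (\<forall>t0\<in>I. ((\<lambda>t. \<integral>\<^sup>+ x \<in> C. ennreal ((w x t - w x t0)\<^sup>2) \<partial>lebesgue) \<longlongrightarrow> 0) (at t0 within I))"

text \<open>Admissible test functions on C x [t1,t2]: nonnegative phi in
  W^{1,2}(t1,t2; L^2(C)) \<inter> L^p(t1,t2; W^{s,p}_o(C)), phi taken as its continuous
  representative in C([t1,t2]; L^2(C)); dphi is its weak time derivative.\<close>
definition test_fun :: "real \<Rightarrow> real \<Rightarrow> 'a::euclidean_space set \<Rightarrow> real \<Rightarrow> real \<Rightarrow>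
    ('a \<Rightarrow> real \<Rightarrow> real) \<Rightarrow> ('a \<Rightarrow> real \<Rightarrow> real) \<Rightarrow> bool" where
  "test_fun s p C t1 t2 \<phi> d\<phi> \<longleftrightarrow>
     (\<forall>x t. 0 \<le> \<phi> x t) \<and>
     (\<lambda>z. \<phi> (fst z) (snd z)) \<in> borel_measurable lebesgue \<and>
     (\<lambda>z. d\<phi> (fst z) (snd z)) \<in> borel_measurable lebesgue \<and>
     time_cont_L2 C {t1..t2} \<phi> \<and>
     (\<integral>\<^sup>+ z \<in> C \<times> {t1..t2}. ennreal ((d\<phi> (fst z) (snd z))\<^sup>2) \<partial>lebesgue) < \<infinity> \<and>
     (\<forall>\<eta> \<eta>' g. (\<forall>t. (\<eta> has_real_derivative \<eta>' t) (at t)) \<and> continuous_on UNIV \<eta>' \<and>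
          (\<exists>a b. t1 < a \<and> b < t2 \<and> (\<forall>t. t \<notin> {a..b} \<longrightarrow> \<eta> t = 0)) \<and>
          g \<in> borel_measurable lebesgue \<and> (\<integral>\<^sup>+ x \<in> C. ennreal ((g x)\<^sup>2) \<partial>lebesgue) < \<infinity> \<longrightarrow>
        (LINT z:C \<times> {t1..t2}|lebesgue. \<phi> (fst z) (snd z) * g (fst z) * \<eta>' (snd z)) =
        - (LINT z:C \<times> {t1..t2}|lebesgue. d\<phi> (fst z) (snd z) * g (fst z) * \<eta> (snd z))) \<and>
     (\<forall>t\<in>{t1..t2}. AE x in lebesgue. x \<notin> C \<longrightarrow> \<phi> x t = 0) \<and>
     (\<integral>\<^sup>+ t \<in> {t1..t2}. Lp_pow p UNIV (\<lambda>x. \<phi> x t) + gagliardo s p UNIV (\<lambda>x. \<phi> x t) \<partial>lebesgue) < \<infinity>"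

definition energy_integrand :: "real \<Rightarrow> ('a \<Rightarrow> 'a \<Rightarrow> real \<Rightarrow> real) \<Rightarrow> ('a \<Rightarrow> real \<Rightarrow> real) \<Rightarrow>
    ('a \<Rightarrow> real \<Rightarrow> real) \<Rightarrow> 'a \<times> 'a \<times> real \<Rightarrow> real" where
  "energy_integrand p K u \<phi> z = (case z of (x, y, t) \<Rightarrow>
     K x y t * (\<bar>u x t - u y t\<bar> powr (p - 2) * (u x t - u y t)) * (\<phi> x t - \<phi> y t))"

definition weak_integrable :: "real \<Rightarrow> ('a::euclidean_space \<Rightarrow> 'a \<Rightarrow> real \<Rightarrow> real) \<Rightarrow>
    ('a \<Rightarrow> real \<Rightarrow> real) \<Rightarrow> 'a set \<Rightarrow> real \<Rightarrow> real \<Rightarrow> ('a \<Rightarrow> real \<Rightarrow> real) \<Rightarrow> ('a \<Rightarrow> real \<Rightarrow> real) \<Rightarrow> bool" where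
  "weak_integrable p K u C t1 t2 \<phi> d\<phi> \<longleftrightarrow>
     set_integrable lebesgue C (\<lambda>x. u x t2 * \<phi> x t2) \<and>
     set_integrable lebesgue C (\<lambda>x. u x t1 * \<phi> x t1) \<and>
     set_integrable lebesgue (C \<times> {t1..t2}) (\<lambda>z. u (fst z) (snd z) * d\<phi> (fst z) (snd z)) \<and>
     set_integrable lebesgue (UNIV \<times> UNIV \<times> {t1..t2}) (energy_integrand p K u \<phi>)"

definition weak_lhs :: "real \<Rightarrow> ('a::euclidean_space \<Rightarrow> 'a \<Rightarrow> real \<Rightarrow> real) \<Rightarrow>
    ('a \<Rightarrow> real \<Rightarrow> real) \<Rightarrow> 'a set \<Rightarrow> real \<Rightarrow> real \<Rightarrow> ('a \<Rightarrow> real \<Rightarrow> real) \<Rightarrow> ('a \<Rightarrow> real \<Rightarrow> real) \<Rightarrow> real" where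
  "weak_lhs p K u C t1 t2 \<phi> d\<phi> =
     (LINT x:C|lebesgue. u x t2 * \<phi> x t2) - (LINT x:C|lebesgue. u x t1 * \<phi> x t1)
     - (LINT z:C \<times> {t1..t2}|lebesgue. u (fst z) (snd z) * d\<phi> (fst z) (snd z))
     + (LINT z:UNIV \<times> UNIV \<times> {t1..t2}|lebesgue. energy_integrand p K u \<phi> z)"

definition weak_regular :: "real \<Rightarrow> real \<Rightarrow> 'a::euclidean_space set \<Rightarrow> real \<Rightarrow> ('a \<Rightarrow> real \<Rightarrow> real) \<Rightarrow> bool" where
  "weak_regular s p E T u \<longleftrightarrow>
     set_borel_measurable lebesgue (UNIV \<times> {0<..T}) (\<lambda>z. u (fst z) (snd z)) \<and>
     (\<forall>C. compact C \<and> C \<subseteq> E \<longrightarrow> time_cont_L2 C {0<..<T} u) \<and>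
     (\<forall>C t1 t2. compact C \<and> C \<subseteq> E \<and> 0 < t1 \<and> t1 \<le> t2 \<and> t2 < T \<longrightarrow>
        (\<integral>\<^sup>+ t \<in> {t1..t2}. Lp_pow p C (\<lambda>x. u x t) + gagliardo s p C (\<lambda>x. u x t) \<partial>lebesgue) < \<infinity>) \<and>
     (\<forall>t1 t2. 0 < t1 \<and> t1 < t2 \<and> t2 \<le> T \<longrightarrow>
        ess_sup_on {t1<..<t2} (\<lambda>t. enn2ereal (\<integral>\<^sup>+ x. ennreal (\<bar>u x t\<bar> powr (p - 1) /
            (1 + norm x powr (real DIM('a) + s * p))) \<partial>lebesgue)) < \<infinity>)"

definition weak_subsolution :: "real \<Rightarrow> real \<Rightarrow> 'a::euclidean_space set \<Rightarrow> real \<Rightarrow>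
    ('a \<Rightarrow> 'a \<Rightarrow> real \<Rightarrow> real) \<Rightarrow> ('a \<Rightarrow> real \<Rightarrow> real) \<Rightarrow> bool" where
  "weak_subsolution s p E T K u \<longleftrightarrow> weak_regular s p E T u \<and>
     (\<forall>C t1 t2 \<phi> d\<phi>. compact C \<and> C \<subseteq> E \<and> 0 < t1 \<and> t1 < t2 \<and> t2 \<le> T \<and>
        test_fun s p C t1 t2 \<phi> d\<phi> \<longrightarrow>
        weak_integrable p K u C t1 t2 \<phi> d\<phi> \<and> weak_lhs p K u C t1 t2 \<phi> d\<phi> \<le> 0)"

definition weak_supersolution :: "real \<Rightarrow> real \<Rightarrow> 'a::euclidean_space set \<Rightarrow> real \<Rightarrow>
    ('a \<Rightarrow> 'a \<Rightarrow> real \<Rightarrow> real) \<Rightarrow> ('a \<Rightarrow> real \<Rightarrow> real) \<Rightarrow> bool" where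
  "weak_supersolution s p E T K u \<longleftrightarrow> weak_regular s p E T u \<and>
     (\<forall>C t1 t2 \<phi> d\<phi>. compact C \<and> C \<subseteq> E \<and> 0 < t1 \<and> t1 < t2 \<and> t2 \<le> T \<and>
        test_fun s p C t1 t2 \<phi> d\<phi> \<longrightarrow>
        weak_integrable p K u C t1 t2 \<phi> d\<phi> \<and> weak_lhs p K u C t1 t2 \<phi> d\<phi> \<ge> 0)"

definition weak_solution :: "real \<Rightarrow> real \<Rightarrow> 'a::euclidean_space set \<Rightarrow> real \<Rightarrow>
    ('a \<Rightarrow> 'a \<Rightarrow> real \<Rightarrow> real) \<Rightarrow> ('a \<Rightarrow> real \<Rightarrow> real) \<Rightarrow> bool" where
  "weak_solution s p E T K u \<longleftrightarrow> weak_subsolution s p E T K u \<and> weak_supersolution s p E T K u"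

definition locally_bounded :: "'a::euclidean_space set \<Rightarrow> real \<Rightarrow> ('a \<Rightarrow> real \<Rightarrow> real) \<Rightarrow> bool" where
  "locally_bounded E T u \<longleftrightarrow>
     (\<forall>C. compact C \<and> C \<subseteq> E \<times> {0<..T} \<longrightarrow>
        ess_sup_on C (\<lambda>z. ereal \<bar>u (fst z) (snd z)\<bar>) < \<infinity>)"

definition locally_hoelder :: "'a::euclidean_space set \<Rightarrow> real \<Rightarrow> ('a \<Rightarrow> real \<Rightarrow> real) \<Rightarrow> bool" where
  "locally_hoelder E T u \<longleftrightarrow>
     (\<exists>v. (AE z in lebesgue. z \<in> E \<times> {0<..T} \<longrightarrow> u (fst z) (snd z) = v z) \<and>
          (\<forall>C. compact C \<and> C \<subseteq> E \<times> {0<..T} \<longrightarrow>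
             (\<exists>\<alpha> L. 0 < \<alpha> \<and> (\<forall>z\<in>C. \<forall>w\<in>C. \<bar>v z - v w\<bar> \<le> L * dist z w powr \<alpha>))))"

end

theory Submission
  imports Defs
begin

text \<open>Elementary De Giorgi argument. Testing only with time-independent functions on short windows and
  averaging in time gives, without mollification, the energy balance for truncations of u above a
  cone-shaped level. Let u lie below \<mu> up to a tail of size hM, and let it exceed \<mu> - M on at most half of a
  ball of radius r at one time. The balance propagates this over a time \<delta> M^(2-p) r^(sp). The nonlocal
  "good" term, bounded below by the mass of the sublevel set, makes the superlevel set at \<mu> - H smaller
  than any power of H/M, and a De Giorgi iteration turns this into u \<le> \<mu> - hM/2 near the final time.
  As one of u, -u satisfies the half-measure condition, the oscillation shrinks by a fixed factor on intrinsic
  cylinders, while the tail is carried along as an invariant. The Hoelder representative at z is the limit of the essential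
  suprema over backward cylinders at z.\<close>

text \<open>The truncation depends on a solution without time derivative, so it cannot be tested
  directly. On (t - h, t] it is frozen at time t: convexity of the square handles the time term, and
  the freezing error is o(h) after averaging over t. Using a cone as the level, instead of a product
  with a cutoff, keeps the truncation equal to (V minus a Lipschitz function) cut at 0, so
  coercivity loses only the slope of the cone.

  The De Giorgi iteration runs at height h M on cylinders whose time length is set by M. Its
  smallness threshold therefore degenerates like a fixed power of h, and one fixed gain in measure
  would not reach it. This is why the height is halved n times, each time gaining a power of H/M,
  with n fixed before h.

  A Sobolev inequality is replaced by the kernel itself: if the superlevel set has measure A, half
  of a ball of volume 2A about any of its points is sublevel, and the kernel there is at least of
  order A^(-1-\<sigma>/N). Hence the exponent \<sigma>/N in the iteration. The argument does not
  split at p = 2.\<close>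

abbreviation (input) borel2 :: "('a::topological_space \<times> 'b::topological_space) measure" where
  "borel2 \<equiv> borel \<Otimes>\<^sub>M borel"

abbreviation (input) borel3 :: "('a::topological_space \<times> 'b::topological_space \<times> 'c::topological_space) measure" where
  "borel3 \<equiv> borel \<Otimes>\<^sub>M borel2"

abbreviation (input) lborel2 :: "('a::euclidean_space \<times> 'b::euclidean_space) measure" where
  "lborel2 \<equiv> lborel \<Otimes>\<^sub>M lborel"

abbreviation (input) lborel3 :: "('a::euclidean_space \<times> 'b::euclidean_space \<times> 'c::euclidean_space) measure" where
  "lborel3 \<equiv> lborel \<Otimes>\<^sub>M lborel2"

abbreviation (input) lborel_nn_integral :: "('a::euclidean_space \<Rightarrow> ennreal) \<Rightarrow> ennreal" (binder "NINT " 10) where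
  "lborel_nn_integral f \<equiv> nn_integral lborel f"

section \<open>Kernel estimates\<close>

text \<open>On the diagonal the value is 0, because \<open>0 powr a = 0\<close> and
  \<open>1 / 0 = 0\<close>. Upper bounds are unaffected, but every lower bound has to assume
  \<open>x \<noteq> y\<close>.\<close>

definition fkernel :: "real \<Rightarrow> 'a::euclidean_space \<Rightarrow> 'a \<Rightarrow> real" where
  "fkernel \<sigma> x y = 1 / norm (x - y) powr (real DIM('a) + \<sigma>)"

abbreviation (input) far where
  "far \<sigma> xo R f x \<equiv> NINT y. ennreal (fkernel \<sigma> x y * f y) * indicator (- ball xo R) y"

abbreviation (input) between where
  "between Co C1 \<sigma> K x y t \<equiv> Co * fkernel \<sigma> x y \<le> K (x, y, t) \<and> K (x, y, t) \<le> C1 * fkernel \<sigma> x y"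

abbreviation (input) slab where
  "slab a b F \<equiv> NINT t. (NINT x. NINT y. ennreal (F (x, y, t))) * indicator {a..b} t"

abbreviation (input) outer_tail where
  "outer_tail s p u xo R t \<equiv> \<integral>\<^sup>+ x \<in> - ball xo R. ennreal (\<bar>u x t\<bar> powr (p - 1) / norm (x - (xo :: 'a::euclidean_space)) powr (real DIM('a) + s * p)) \<partial>lebesgue"

lemma fkernel_nonneg [simp]: "0 \<le> fkernel \<sigma> x y"
  by (simp add: fkernel_def)

lemma fkernel_commute: "fkernel \<sigma> x y = fkernel \<sigma> y x"
  by (simp add: fkernel_def norm_minus_commute)

lemma fkernel_measurable [measurable]:
  "(\<lambda>(x, y). fkernel \<sigma> x y) \<in> borel_measurable borel2" unfolding fkernel_def by measurable

lemma fkernel_measurable_comp [measurable (raw)]: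
  assumes [measurable]: "f \<in> borel_measurable M" "g \<in> borel_measurable M"
  shows "(\<lambda>z. fkernel \<sigma> (f z) (g z)) \<in> borel_measurable M" unfolding fkernel_def by measurable

lemma fkernel_le:
  fixes x y :: "'a::euclidean_space"
  assumes "0 < d" "d \<le> dist x y" "0 < \<sigma>"
  shows "fkernel \<sigma> x y \<le> d powr - (real DIM('a) + \<sigma>)"
proof -
  have "d powr (real DIM('a) + \<sigma>) \<le> norm (x - y) powr (real DIM('a) + \<sigma>)" using assms by (intro powr_mono2) (auto simp: dist_norm)
  then have "1 / norm (x - y) powr (real DIM('a) + \<sigma>) \<le> 1 / d powr (real DIM('a) + \<sigma>)"
    using assms by (intro divide_left_mono mult_pos_pos) (auto simp: dist_norm)
  then show ?thesis by (simp only: fkernel_def powr_minus_divide)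
qed

lemma fkernel_ge:
  fixes x y :: "'a::euclidean_space"
  assumes "x \<noteq> y" "dist x y \<le> d" "0 < \<sigma>"
  shows "d powr - (real DIM('a) + \<sigma>) \<le> fkernel \<sigma> x y"
proof -
  have "0 < dist x y" using assms by simp
  have "norm (x - y) powr (real DIM('a) + \<sigma>) \<le> d powr (real DIM('a) + \<sigma>)" using assms by (intro powr_mono2) (auto simp: dist_norm)
  then have "1 / d powr (real DIM('a) + \<sigma>) \<le> 1 / norm (x - y) powr (real DIM('a) + \<sigma>)"
    using assms \<open>0 < dist x y\<close> by (intro divide_left_mono mult_pos_pos) (auto simp: dist_norm)
  then show ?thesis by (simp only: fkernel_def powr_minus_divide)
qed

lemma powr_nat_shift:
  fixes r :: real assumes "0 < r"
  shows "(2 ^ j * r) powr a = (2 powr a) ^ j * r powr a" using assms by (simp add: powr_mult powr_realpow[symmetric] powr_powr mult.commute)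

lemma half_powr_minus: "(1 / 2 :: real) powr - a = 2 powr a"
  by (simp add: powr_divide powr_minus_divide)

lemma emeasure_ball_powr:
  fixes x :: "'a::euclidean_space"
  assumes "0 < r"
  shows "emeasure lborel (ball x r) = ennreal (unit_ball_vol (real DIM('a)) * r powr real DIM('a))"
  using assms by (simp add: emeasure_ball powr_realpow)

lemma ennreal_geometric_suminf:
  fixes c q :: real
  assumes "0 \<le> c" "0 \<le> q" "q < 1"
  shows "(\<Sum>j. ennreal (c * q ^ j)) = ennreal (c / (1 - q))"
proof (rule suminf_ennreal_eq)
  show "\<And>i. 0 \<le> c * q ^ i" using assms by simp
  show "(\<lambda>j. c * q ^ j) sums (c / (1 - q))" using sums_mult[OF geometric_sums[of q], of c] assms by simp
qed

text \<open>A geometric series over the dyadic annuli 2^j r <= |x - y| < 2^(j+1) r with ratio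
  2^(-\<sigma>). Each annulus is enlarged to its outer ball, which costs the factor 2^N.\<close>

definition tail_const :: "'a::euclidean_space itself \<Rightarrow> real \<Rightarrow> real" where
  "tail_const _ \<sigma> = unit_ball_vol (real DIM('a)) * 2 powr real DIM('a) / (1 - 2 powr - \<sigma>)"

lemma tail_const_nonneg: "0 < \<sigma> \<Longrightarrow> 0 < tail_const TYPE('a::euclidean_space) \<sigma>"
  unfolding tail_const_def by (intro divide_pos_pos mult_pos_pos) (auto simp: powr_less_one)

lemma nn_integral_kernel_far:
  fixes x :: "'a::euclidean_space"
  assumes "0 < r" "0 < \<sigma>"
  shows "(NINT y. ennreal (fkernel \<sigma> x y) * indicator (- ball x r) y)
     \<le> ennreal (tail_const TYPE('a) \<sigma> * r powr - \<sigma>)"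
proof -
  let ?N = "real DIM('a)"
  define a where "a j y = ennreal ((2 ^ j * r) powr - (?N + \<sigma>)) * indicator (ball x (2 ^ Suc j * r)) y" for j and y :: 'a
  have [measurable]: "a j \<in> borel_measurable lborel" for j unfolding a_def[abs_def] by (intro borel_measurable_times_ennreal measurable_const borel_measurable_indicator) auto
  have "ennreal (fkernel \<sigma> x y) * indicator (- ball x r) y \<le> (\<Sum>j. a j y)" for y
  proof (cases "y \<in> ball x r")
    case False
    then have d: "r \<le> dist x y" by simp
    have "\<exists>n. dist x y / r < 2 ^ n" by (rule real_arch_pow) simp
    then have ex: "\<exists>n. dist x y < 2 ^ n * r" using assms by (simp add: field_simps)
    \<comment> \<open>The point lies in the annulus whose index is the predecessor of n; n is not 0
      because \<open>r \<le> dist x y\<close>.\<close>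
    define n where "n = (LEAST n. dist x y < 2 ^ n * r)"
    have n: "dist x y < 2 ^ n * r" unfolding n_def using ex by (rule LeastI_ex)
    have "n \<noteq> 0" using n d by (cases n) auto
    then obtain j where j: "n = Suc j" by (cases n) auto
    have "\<not> dist x y < 2 ^ j * r" using j not_less_Least[of j "\<lambda>n. dist x y < 2 ^ n * r"] n_def by simp
    then have "fkernel \<sigma> x y \<le> (2 ^ j * r) powr - (?N + \<sigma>)" using assms by (intro fkernel_le) auto
    then have "ennreal (fkernel \<sigma> x y) * indicator (- ball x r) y \<le> a j y"
      unfolding a_def using n j False by (auto intro!: ennreal_leI)
    also have "\<dots> = sum (\<lambda>i. a i y) {j}" by simp
    also have "\<dots> \<le> (\<Sum>i. a i y)" by (rule sum_le_suminf) auto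
    finally show ?thesis .
  qed simp
  then have "(NINT y. ennreal (fkernel \<sigma> x y) * indicator (- ball x r) y) \<le> (NINT y. (\<Sum>j. a j y))" by (intro nn_integral_mono)
  also have "\<dots> = (\<Sum>j. NINT y. a j y)" by (rule nn_integral_suminf) measurable
  also have "\<dots> = (\<Sum>j. ennreal (unit_ball_vol ?N * 2 powr ?N * r powr - \<sigma> * (2 powr - \<sigma>) ^ j))"
  proof (rule arg_cong[where f = suminf], rule ext)
    fix j
    have "(NINT y. a j y) = ennreal ((2 ^ j * r) powr - (?N + \<sigma>)) * emeasure lborel (ball x (2 ^ Suc j * r))"
      unfolding a_def by (subst nn_integral_cmult_indicator) auto
    also have "\<dots> = ennreal ((2 ^ j * r) powr - (?N + \<sigma>) * (unit_ball_vol ?N * (2 * (2 ^ j * r)) powr ?N))"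
      using assms by (subst emeasure_ball_powr) (auto simp: ennreal_mult mult.assoc)
    also have "(2 ^ j * r) powr - (?N + \<sigma>) * (unit_ball_vol ?N * (2 * (2 ^ j * r)) powr ?N) =
        unit_ball_vol ?N * 2 powr ?N * ((2 ^ j * r) powr - (?N + \<sigma>) * (2 ^ j * r) powr ?N)"
      using assms by (subst powr_mult) (auto simp: algebra_simps)
    also have "(2 ^ j * r) powr - (?N + \<sigma>) * (2 ^ j * r) powr ?N = (2 ^ j * r) powr - \<sigma>" using assms by (simp flip: powr_add)
    also have "\<dots> = (2 powr - \<sigma>) ^ j * r powr - \<sigma>" using assms(1) by (rule powr_nat_shift)
    finally show "(NINT y. a j y) = ennreal (unit_ball_vol ?N * 2 powr ?N * r powr - \<sigma> * (2 powr - \<sigma>) ^ j)"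
      by (simp add: mult.assoc mult.commute mult.left_commute)
  qed
  also have "\<dots> = ennreal (unit_ball_vol ?N * 2 powr ?N * r powr - \<sigma> / (1 - 2 powr - \<sigma>))"
    using assms by (intro ennreal_geometric_suminf) (auto simp: powr_less_one)
  finally show ?thesis by (simp add: tail_const_def mult.assoc mult.commute)
qed

text \<open>The analogous series over annuli shrinking to x. The kernel is taken at the inner
  radius, half of the outer one, whence 2^(N+\<sigma>); the ratio 2^(-(p-\<sigma>)) is below 1
  because \<sigma> < p.\<close>

definition near_const :: "'a::euclidean_space itself \<Rightarrow> real \<Rightarrow> real \<Rightarrow> real" where
  "near_const _ \<sigma> p = unit_ball_vol (real DIM('a)) * 2 powr (real DIM('a) + \<sigma>) / (1 - 2 powr - (p - \<sigma>))"

lemma near_const_nonneg: "\<sigma> < p \<Longrightarrow> 0 < near_const TYPE('a::euclidean_space) \<sigma> p"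
  unfolding near_const_def by (intro divide_pos_pos mult_pos_pos) (auto simp: powr_less_one)

lemma nn_integral_kernel_near:
  fixes x :: "'a::euclidean_space"
  assumes "0 < r" "0 < \<sigma>" "\<sigma> < p"
  shows "(NINT y. ennreal (dist x y powr p * fkernel \<sigma> x y) * indicator (ball x r) y)
     \<le> ennreal (near_const TYPE('a) \<sigma> p * r powr (p - \<sigma>))"
proof -
  let ?N = "real DIM('a)"
  define d where "d j = r / 2 ^ j" for j
  have d0: "0 < d j" for j using assms by (simp add: d_def)
  define a where "a j y = ennreal (d j powr p * (d (Suc j)) powr - (?N + \<sigma>)) * indicator (ball x (d j)) y" for j and y :: 'a
  have [measurable]: "a j \<in> borel_measurable lborel" for j unfolding a_def[abs_def] by (intro borel_measurable_times_ennreal measurable_const borel_measurable_indicator) auto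
  have "ennreal (dist x y powr p * fkernel \<sigma> x y) * indicator (ball x r) y \<le> (\<Sum>j. a j y)" for y
  proof (cases "y \<in> ball x r \<and> x \<noteq> y")
    case True
    then have dr: "dist x y < r" and dp: "0 < dist x y" by auto
    have "\<exists>n. r / dist x y < 2 ^ n" by (rule real_arch_pow) simp
    then have ex: "\<exists>n. d n \<le> dist x y" unfolding d_def using dp by (auto simp: field_simps intro: less_imp_le)
    define n where "n = (LEAST n. d n \<le> dist x y)"
    have n: "d n \<le> dist x y" unfolding n_def using ex by (rule LeastI_ex)
    have "n \<noteq> 0" using n dr by (cases n) (auto simp: d_def)
    then obtain j where j: "n = Suc j" by (cases n) auto
    have "\<not> d j \<le> dist x y" using j not_less_Least[of j "\<lambda>n. d n \<le> dist x y"] n_def by simp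
    then have "dist x y < d j" by simp
    moreover have "fkernel \<sigma> x y \<le> (d (Suc j)) powr - (?N + \<sigma>)" using assms d0 n j by (intro fkernel_le) auto
    moreover have "dist x y powr p \<le> d j powr p" using \<open>dist x y < d j\<close> assms by (intro powr_mono2) auto
    ultimately have "ennreal (dist x y powr p * fkernel \<sigma> x y) * indicator (ball x r) y \<le> a j y"
      unfolding a_def using True by (auto intro!: ennreal_leI mult_mono)
    also have "\<dots> = sum (\<lambda>i. a i y) {j}" by simp
    also have "\<dots> \<le> (\<Sum>i. a i y)" by (rule sum_le_suminf) auto
    finally show ?thesis .
  next
    case False then show ?thesis using assms by (auto simp: indicator_def fkernel_def)
  qed
  then have "(NINT y. ennreal (dist x y powr p * fkernel \<sigma> x y) * indicator (ball x r) y) \<le> (NINT y. (\<Sum>j. a j y))"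
    by (intro nn_integral_mono)
  also have "\<dots> = (\<Sum>j. NINT y. a j y)" by (rule nn_integral_suminf) measurable
  also have "\<dots> = (\<Sum>j. ennreal (unit_ball_vol ?N * 2 powr (?N + \<sigma>) * r powr (p - \<sigma>) * (2 powr - (p - \<sigma>)) ^ j))"
  proof (rule arg_cong[where f = suminf], rule ext)
    fix j
    have "(NINT y. a j y) = ennreal (d j powr p * (d (Suc j)) powr - (?N + \<sigma>)) * emeasure lborel (ball x (d j))"
      unfolding a_def by (subst nn_integral_cmult_indicator) auto
    also have "\<dots> = ennreal (d j powr p * (d (Suc j)) powr - (?N + \<sigma>) * (unit_ball_vol ?N * (d j) powr ?N))"
      using d0 by (subst emeasure_ball_powr) (auto simp: ennreal_mult mult.assoc)
    also have "d (Suc j) = d j * (1/2)" by (simp add: d_def)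
    also have "(d j * (1/2)) powr - (?N + \<sigma>) = d j powr - (?N + \<sigma>) * 2 powr (?N + \<sigma>)" by (simp only: powr_mult half_powr_minus)
    also have "d j powr p * (d j powr - (?N + \<sigma>) * 2 powr (?N + \<sigma>)) * (unit_ball_vol ?N * (d j) powr ?N) =
       unit_ball_vol ?N * 2 powr (?N + \<sigma>) * (d j powr p * d j powr - (?N + \<sigma>) * d j powr ?N)" by (simp add: algebra_simps)
    also have "d j powr p * d j powr - (?N + \<sigma>) * d j powr ?N = d j powr (p - \<sigma>)" using d0[of j] by (simp flip: powr_add)
    also have "\<dots> = (2 powr - (p - \<sigma>)) ^ j * r powr (p - \<sigma>)"
    proof -
      have "(2 ^ j) powr - (p - \<sigma>) = (2 powr - (p - \<sigma>)) ^ j" using powr_nat_shift[of 1 j "- (p - \<sigma>)"] by simp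
      moreover have "d j powr (p - \<sigma>) = (2 ^ j) powr - (p - \<sigma>) * r powr (p - \<sigma>)"
        unfolding d_def powr_divide powr_minus_divide by simp
      ultimately show ?thesis by (simp only:)
    qed
    finally show "(NINT y. a j y) = ennreal (unit_ball_vol ?N * 2 powr (?N + \<sigma>) * r powr (p - \<sigma>) * (2 powr - (p - \<sigma>)) ^ j)"
      by (simp add: mult.assoc mult.commute mult.left_commute)
  qed
  also have "\<dots> = ennreal (unit_ball_vol ?N * 2 powr (?N + \<sigma>) * r powr (p - \<sigma>) / (1 - 2 powr - (p - \<sigma>)))"
    using assms by (intro ennreal_geometric_suminf) (auto simp: powr_less_one)
  finally show ?thesis by (simp add: near_const_def mult.assoc mult.commute)
qed

text \<open>The integral is split at distance d, where the two bounds on the increment cross. The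
  Lipschitz bound is integrated near x and the constant bound far from x; both parts scale like H^p
  d^(-\<sigma>).\<close>

lemma nn_integral_kernel_lipschitz:
  fixes x :: "'a::euclidean_space" and \<psi> :: "'a \<Rightarrow> real"
  assumes "0 < d" "0 < \<sigma>" "\<sigma> < p" "0 \<le> H"
    and [measurable]: "\<psi> \<in> borel_measurable borel"
    and lip: "\<And>y. \<bar>\<psi> x - \<psi> y\<bar> \<le> H / d * dist x y" and bd: "\<And>y. \<bar>\<psi> x - \<psi> y\<bar> \<le> H"
  shows "(NINT y. ennreal (\<bar>\<psi> x - \<psi> y\<bar> powr p * fkernel \<sigma> x y))
     \<le> ennreal ((near_const TYPE('a) \<sigma> p + tail_const TYPE('a) \<sigma>) * H powr p * d powr - \<sigma>)"
proof -
  have "ennreal (\<bar>\<psi> x - \<psi> y\<bar> powr p * fkernel \<sigma> x y) \<le>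
     ennreal ((H / d) powr p) * (ennreal (dist x y powr p * fkernel \<sigma> x y) * indicator (ball x d) y)
     + ennreal (H powr p) * (ennreal (fkernel \<sigma> x y) * indicator (- ball x d) y)" for y
  proof (cases "y \<in> ball x d")
    case True
    have "\<bar>\<psi> x - \<psi> y\<bar> powr p \<le> (H / d * dist x y) powr p" using assms lip by (intro powr_mono2) auto
    also have "\<dots> = (H / d) powr p * dist x y powr p" by (rule powr_mult)
    finally have "\<bar>\<psi> x - \<psi> y\<bar> powr p * fkernel \<sigma> x y \<le> (H / d) powr p * (dist x y powr p * fkernel \<sigma> x y)"
      by (simp add: mult_right_mono mult.assoc[symmetric])
    then show ?thesis using True by (simp add: ennreal_mult[symmetric] ennreal_leI)
  next
    case False
    have "\<bar>\<psi> x - \<psi> y\<bar> powr p \<le> H powr p" using assms bd by (intro powr_mono2) auto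
    then show ?thesis using False by (simp add: ennreal_mult[symmetric] ennreal_leI mult_right_mono)
  qed
  then have "(NINT y. ennreal (\<bar>\<psi> x - \<psi> y\<bar> powr p * fkernel \<sigma> x y))
    \<le> (NINT y. ennreal ((H / d) powr p) * (ennreal (dist x y powr p * fkernel \<sigma> x y) * indicator (ball x d) y)
     + ennreal (H powr p) * (ennreal (fkernel \<sigma> x y) * indicator (- ball x d) y))" by (intro nn_integral_mono)
  also have "\<dots> = ennreal ((H / d) powr p) * (NINT y. ennreal (dist x y powr p * fkernel \<sigma> x y) * indicator (ball x d) y)
     + ennreal (H powr p) * (NINT y. ennreal (fkernel \<sigma> x y) * indicator (- ball x d) y)"
    by (subst nn_integral_add; (subst nn_integral_cmult)?; (subst nn_integral_cmult)?; measurable?) simp_all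
  also have "\<dots> \<le> ennreal ((H / d) powr p) * ennreal (near_const TYPE('a) \<sigma> p * d powr (p - \<sigma>))
     + ennreal (H powr p) * ennreal (tail_const TYPE('a) \<sigma> * d powr - \<sigma>)"
    using assms by (intro add_mono mult_left_mono nn_integral_kernel_near nn_integral_kernel_far) auto
  also have "\<dots> = ennreal ((H / d) powr p * (near_const TYPE('a) \<sigma> p * d powr (p - \<sigma>)) + H powr p * (tail_const TYPE('a) \<sigma> * d powr - \<sigma>))"
    using assms near_const_nonneg[of \<sigma> p, where 'a='a] tail_const_nonneg[of \<sigma>, where 'a='a]
    by (subst ennreal_plus) (auto simp: ennreal_mult)
  also have "(H / d) powr p * (near_const TYPE('a) \<sigma> p * d powr (p - \<sigma>)) = near_const TYPE('a) \<sigma> p * H powr p * (d powr (p - \<sigma>) / d powr p)"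
    using assms by (simp add: powr_divide)
  also have "d powr (p - \<sigma>) / d powr p = d powr - \<sigma>" using assms by (simp flip: powr_diff)
  finally show ?thesis by (simp add: algebra_simps)
qed

section \<open>Power inequalities and coercivity of truncations\<close>

lemma powr_add_le:
  fixes a b q :: real
  assumes "0 \<le> a" "0 \<le> b" "0 < q"
  shows "(a + b) powr q \<le> 2 powr q * (a powr q + b powr q)"
proof -
  have "(a + b) powr q \<le> (2 * max a b) powr q" using assms by (intro powr_mono2) auto
  also have "\<dots> = 2 powr q * max a b powr q" using assms by (simp add: powr_mult)
  also have "max a b powr q \<le> a powr q + b powr q" by (auto simp: max_def)
  finally show ?thesis by (simp add: mult_left_mono)
qed

text \<open>According to whether B <= L A or not, one of the two summands on the right is already
  enough. The weight L stays free: taking it large makes the coefficient L^(1-p) of the second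
  summand small.\<close>

lemma powr_young:
  fixes A B L p :: real
  assumes "0 \<le> A" "0 \<le> B" "0 < L" "1 < p"
  shows "A powr (p - 1) * B \<le> L * A powr p + L powr (1 - p) * B powr p"
proof (cases "B \<le> L * A")
  case True
  have "A powr (p - 1) * B \<le> A powr (p - 1) * (L * A)" using True by (intro mult_left_mono) auto
  also have "\<dots> = L * A powr p" using assms by (cases "A = 0") (auto simp: powr_diff)
  finally show ?thesis using assms by (smt (verit) powr_ge_zero mult_nonneg_nonneg)
next
  case False
  then have B: "0 < B" using assms mult_nonneg_nonneg[of L A] by linarith
  have "A powr (p - 1) \<le> (B / L) powr (p - 1)" using False assms by (intro powr_mono2) (auto simp: field_simps)
  then have "A powr (p - 1) * B \<le> (B / L) powr (p - 1) * B" using B by (intro mult_right_mono) auto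
  also have "\<dots> = L powr (1 - p) * B powr p" using B assms by (simp add: powr_divide powr_diff field_simps)
  finally show ?thesis using assms by (smt (verit) powr_ge_zero mult_nonneg_nonneg)
qed

definition signed_powr :: "real \<Rightarrow> real \<Rightarrow> real" where
  "signed_powr p z = \<bar>z\<bar> powr (p - 2) * z"

lemma signed_powr_measurable [measurable]: "signed_powr p \<in> borel_measurable borel"
  unfolding signed_powr_def by measurable

lemma signed_powr_pos: "0 \<le> z \<Longrightarrow> signed_powr p z = z powr (p - 1)"
  by (cases "z = 0") (auto simp: signed_powr_def powr_diff power2_eq_square)

lemma signed_powr_minus: "signed_powr p (- z) = - signed_powr p z"
  by (simp add: signed_powr_def)

lemma signed_powr_neg: "z \<le> 0 \<Longrightarrow> signed_powr p z = - ((- z) powr (p - 1))"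
  using signed_powr_pos[of "- z" p] signed_powr_minus[of p z] by simp

lemma abs_signed_powr: "\<bar>signed_powr p z\<bar> = \<bar>z\<bar> powr (p - 1)"
  by (cases "0 \<le> z") (auto simp: signed_powr_pos signed_powr_neg)

lemma signed_powr_mono: "1 < p \<Longrightarrow> x \<le> y \<Longrightarrow> signed_powr p x \<le> signed_powr p y"
proof -
  assume "1 < p" "x \<le> y"
  consider "0 \<le> x" | "x \<le> 0" "0 \<le> y" | "y \<le> 0" by linarith
  then show ?thesis
  proof cases
    case 1 then show ?thesis using \<open>1 < p\<close> \<open>x \<le> y\<close> by (simp add: signed_powr_pos powr_mono2)
  next
    case 2 then show ?thesis by (auto simp: signed_powr_pos signed_powr_neg intro: order_trans[of _ 0])
  next
    case 3 then show ?thesis using \<open>1 < p\<close> \<open>x \<le> y\<close> by (simp add: signed_powr_neg powr_mono2)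
  qed
qed

text \<open>Here d plays the part of a difference of two levels. If |d| <= b/2, then b + d >= b/2
  and monotonicity gives the first term alone. Otherwise a <= b < 2|d| and everything has size
  |d|^p: the 3 consists of 2 for the first term and 1 for a right-hand side that may be
  negative.\<close>

lemma signed_powr_coercive:
  fixes a b d p :: real
  assumes "1 < p" "0 \<le> a" "a \<le> b"
  shows "2 powr (1 - p) * (a * b powr (p - 1)) - 3 * \<bar>d\<bar> powr p \<le> signed_powr p (b + d) * a"
proof (cases "\<bar>d\<bar> \<le> b / 2")
  case True
  have "2 powr (1 - p) * b powr (p - 1) = (b / 2) powr (p - 1)" using assms by (simp add: powr_divide powr_diff)
  also have "\<dots> = signed_powr p (b / 2)" using assms by (simp add: signed_powr_pos)
  also have "\<dots> \<le> signed_powr p (b + d)" using True assms by (intro signed_powr_mono) linarith+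
  finally have "2 powr (1 - p) * b powr (p - 1) * a \<le> signed_powr p (b + d) * a" using assms by (intro mult_right_mono)
  moreover have "2 powr (1 - p) * b powr (p - 1) * a = 2 powr (1 - p) * (a * b powr (p - 1))" by simp
  moreover have "0 \<le> \<bar>d\<bar> powr p" by simp
  ultimately show ?thesis by linarith
next
  case False
  then have bd: "b < 2 * \<bar>d\<bar>" by simp
  have d: "0 < \<bar>d\<bar>" using bd assms by linarith
  have s1: "\<bar>d\<bar> powr (p - 1) * \<bar>d\<bar> = \<bar>d\<bar> powr p" using d by (simp add: powr_diff)
  have "a * b powr (p - 1) \<le> 2 * \<bar>d\<bar> * (2 * \<bar>d\<bar>) powr (p - 1)" using assms bd by (intro mult_mono powr_mono2) auto
  also have "\<dots> = 2 powr p * \<bar>d\<bar> powr p" using d s1 by (simp add: powr_mult powr_diff)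
  finally have "2 powr (1 - p) * (a * b powr (p - 1)) \<le> 2 powr (1 - p) * (2 powr p * \<bar>d\<bar> powr p)" by (intro mult_left_mono) auto
  also have "\<dots> = 2 * \<bar>d\<bar> powr p" by (simp add: powr_diff)
  finally have 1: "2 powr (1 - p) * (a * b powr (p - 1)) \<le> 2 * \<bar>d\<bar> powr p" .
  have "- (\<bar>d\<bar> powr p) \<le> signed_powr p (b + d) * a"
  proof (cases "0 \<le> b + d")
    case True
    then have "0 \<le> signed_powr p (b + d) * a" using assms by (simp add: signed_powr_pos)
    then show ?thesis using powr_ge_zero[of "\<bar>d\<bar>" p] by linarith
  next
    case False
    have ad: "a \<le> \<bar>d\<bar>" "- (b + d) \<le> \<bar>d\<bar>" using False assms by linarith+
    have "(- (b + d)) powr (p - 1) * a \<le> \<bar>d\<bar> powr (p - 1) * \<bar>d\<bar>" using ad assms False by (intro mult_mono powr_mono2) auto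
    then show ?thesis using False s1 by (simp add: signed_powr_neg)
  qed
  then show ?thesis using 1 by linarith
qed

text \<open>The increment Ux - Uy is an increment b measured against the levels plus the level
  difference px - py, so \<open>signed_powr_coercive\<close> applies with a = |wx - wy|. The gain is
  kept only when x is above its level and y is not; in all other cases nonnegativity of the gain is
  used. The error is charged to the points above their level.\<close>

lemma truncation_coercive:
  fixes Ux Uy px py p :: real
  defines "wx \<equiv> max 0 (Ux - px)" and "wy \<equiv> max 0 (Uy - py)"
  assumes "1 < p"
  shows "2 powr (1 - p) * (if 0 < wx \<and> wy = 0 then wx * (wx + (py - Uy)) powr (p - 1) else 0)
     - 3 * \<bar>px - py\<bar> powr p * ((if 0 < wx then 1 else 0) + (if 0 < wy then 1 else 0))
     \<le> signed_powr p (Ux - Uy) * (wx - wy)"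
proof -
  have nn: "0 \<le> \<bar>px - py\<bar> powr p" by simp
  consider "wx = wy" | "wy < wx" | "wx < wy" by linarith
  then show ?thesis
  proof cases
    case 1 then show ?thesis using nn by auto
  next
    case 2
    \<comment> \<open>If wy = 0, the increment also contains the depth py - Uy of y below its level;
      this depth is what makes the nonlocal gain large.\<close>
    define b where "b = (wx - wy) + (if wy = 0 then py - Uy else 0)"
    have b: "wx - wy \<le> b" "Ux - Uy = b + (px - py)" using 2 unfolding b_def wx_def wy_def by (auto simp: max_def split: if_splits)
    have *: "2 powr (1 - p) * ((wx - wy) * b powr (p - 1)) - 3 * \<bar>px - py\<bar> powr p \<le> signed_powr p (Ux - Uy) * (wx - wy)"
      unfolding b(2) using 2 b(1) assms(3) by (intro signed_powr_coercive) auto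
    moreover have **: "0 \<le> 2 powr (1 - p) * ((wx - wy) * b powr (p - 1))" using 2 by simp
    moreover have "0 < wx" "0 \<le> wy" using 2 unfolding wy_def by linarith+
    moreover have "0 < wy \<or> wy = 0" using \<open>0 \<le> wy\<close> by linarith
    ultimately show ?thesis
    proof (elim disjE)
      assume "0 < wy"
      have "- (6 * \<bar>px - py\<bar> powr p) \<le> - (3 * \<bar>px - py\<bar> powr p)" using nn by linarith
      also have "\<dots> \<le> signed_powr p (Ux - Uy) * (wx - wy)" using * ** by linarith
      finally show ?thesis using \<open>0 < wx\<close> \<open>0 < wy\<close> by simp
    qed (simp add: b_def)
  next
    case 3
    define b where "b = (wy - wx) + (if wx = 0 then px - Ux else 0)"
    have b: "wy - wx \<le> b" "Uy - Ux = b + (py - px)" using 3 unfolding b_def wx_def wy_def by (auto simp: max_def split: if_splits)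
    have "2 powr (1 - p) * ((wy - wx) * b powr (p - 1)) - 3 * \<bar>py - px\<bar> powr p \<le> signed_powr p (Uy - Ux) * (wy - wx)"
      unfolding b(2) using 3 b(1) assms(3) by (intro signed_powr_coercive) auto
    moreover have "0 \<le> 2 powr (1 - p) * ((wy - wx) * b powr (p - 1))" using 3 by simp
    moreover have "signed_powr p (Uy - Ux) * (wy - wx) = signed_powr p (Ux - Uy) * (wx - wy)"
      using signed_powr_minus[of p "Ux - Uy"] by (simp add: algebra_simps)
    moreover have "0 < wy" using 3 unfolding wx_def by linarith
    moreover have "wy \<noteq> 0" using \<open>0 < wy\<close> by simp
    moreover have "\<bar>py - px\<bar> powr p = \<bar>px - py\<bar> powr p" by (simp add: abs_minus_commute)
    ultimately have "- (3 * \<bar>px - py\<bar> powr p) \<le> signed_powr p (Ux - Uy) * (wx - wy)" by linarith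
    moreover from this have "- (6 * \<bar>px - py\<bar> powr p) \<le> signed_powr p (Ux - Uy) * (wx - wy)" using nn by linarith
    ultimately show ?thesis using \<open>0 < wy\<close> \<open>wy \<noteq> 0\<close> by simp
  qed
qed

section \<open>Iterated integrals over two points and a time, and slices of null sets\<close>

lemma nn_integral_triple:
  fixes F :: "'a::euclidean_space \<times> 'a \<times> real \<Rightarrow> ennreal"
  assumes [measurable]: "F \<in> borel_measurable borel3"
  shows "(\<integral>\<^sup>+ z. F z \<partial>lborel3) = (NINT t. NINT x. NINT y. F (x, y, t))"
proof -
  have L: "sigma_finite_measure (lborel2 :: ('a \<times> real) measure)" by (intro sigma_finite_pair_measure sigma_finite_lborel)
  have "(\<integral>\<^sup>+ z. F z \<partial>lborel3) = (NINT x. \<integral>\<^sup>+ q. F (x, q) \<partial>lborel2)"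
    by (rule sigma_finite_measure.nn_integral_fst[OF L, symmetric]) simp
  also have "\<dots> = (NINT x. NINT y. NINT t. F (x, y, t))" by (intro nn_integral_cong lborel.nn_integral_fst[symmetric]) simp
  also have "\<dots> = (NINT x. NINT t. NINT y. F (x, y, t))" by (intro nn_integral_cong lborel_pair.Fubini') simp
  also have "\<dots> = (NINT t. NINT x. NINT y. F (x, y, t))" by (intro lborel_pair.Fubini') simp
  finally show ?thesis .
qed

lemma AE_pair_swap_slices:
  fixes P :: "'a::euclidean_space \<times> real \<Rightarrow> bool"
  assumes "AE z in lborel2. P z"
  shows "AE t in lborel. AE x in lborel. P (x, t)"
proof -
  obtain N where N: "{z \<in> space lborel2. \<not> P z} \<subseteq> N" "emeasure lborel2 N = 0" "N \<in> sets lborel2"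
    by (rule AE_E[OF assms]) (blast intro: that)
  have ind: "(\<lambda>z. indicator N z :: ennreal) \<in> borel_measurable lborel2" using N(3) by (rule borel_measurable_indicator)
  have [measurable]: "(\<lambda>z. indicator N z :: ennreal) \<in> borel_measurable borel2" using ind by (simp cong: measurable_cong_sets)
  have "(NINT t. NINT x. indicator N (x, t)) = (\<integral>\<^sup>+ z. indicator N z \<partial>lborel2)" by (rule lborel_pair.nn_integral_snd[OF ind])
  also have "\<dots> = 0" using N by simp
  finally have "AE t in lborel. (NINT x. indicator N (x, t)) = 0" by (subst (asm) nn_integral_0_iff_AE) simp_all
  then show ?thesis
  proof eventually_elim
    case (elim t)
    then have "AE x in lborel. indicator N (x, t) = (0::ennreal)" by (subst (asm) nn_integral_0_iff_AE) simp_all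
    then show ?case
    proof eventually_elim
      case (elim x)
      then have "(x, t) \<notin> N" by (auto simp: indicator_def split: if_splits)
      then show ?case using N(1) by (auto simp: space_pair_measure)
    qed
  qed
qed

lemma AE_tripleI:
  fixes P :: "'a::euclidean_space \<times> 'a \<times> real \<Rightarrow> bool"
  assumes [measurable]: "Measurable.pred borel3 P" and ae: "AE t in lborel. AE x in lborel. AE y in lborel. P (x, y, t)"
  shows "AE z in lborel3. P z"
proof -
  define F where "F z = (if P z then 0 else 1 :: ennreal)" for z
  have [measurable]: "F \<in> borel_measurable borel3" unfolding F_def[abs_def] by measurable
  have "(\<integral>\<^sup>+ z. F z \<partial>lborel3) = (NINT t. NINT x. NINT y. F (x, y, t))" by (rule nn_integral_triple) simp
  also have "\<dots> = (\<integral>\<^sup>+ t. 0 \<partial>(lborel :: real measure))"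
  proof (rule nn_integral_cong_AE)
    show "AE t in lborel. (NINT x. NINT y. F (x, y, t)) = 0" using ae
    proof eventually_elim
      case (elim t)
      then have "AE x in lborel. (NINT y. F (x, y, t)) = 0"
        by eventually_elim (subst nn_integral_0_iff_AE, auto simp: F_def)
      then show ?case by (subst nn_integral_0_iff_AE) simp_all
    qed
  qed
  finally have "AE z in lborel3. F z = 0" by (subst nn_integral_0_iff_AE[symmetric]) simp_all
  then show ?thesis by eventually_elim (simp add: F_def split: if_splits)
qed

text \<open>Argued through time slices: for almost every t the exceptional points form a null set,
  so almost every x and almost every y avoid it.\<close>

lemma AE_triple_of_pair:
  fixes P :: "'a::euclidean_space \<times> real \<Rightarrow> bool"
  assumes "AE z in lborel2. P z"
  shows "AE z in lborel3. P (fst z, snd (snd z)) \<and> P (fst (snd z), snd (snd z))"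
proof -
  obtain N where N: "{z \<in> space lborel2. \<not> P z} \<subseteq> N" "emeasure lborel2 N = 0" "N \<in> sets lborel2"
    by (rule AE_E[OF assms]) (blast intro: that)
  have [measurable]: "N \<in> sets borel2" using N(3) by (simp cong: sets_pair_measure_cong)
  have "AE z in lborel2. z \<notin> N" using N by (intro AE_not_in) (auto simp: null_sets_def)
  from AE_pair_swap_slices[OF this]
  have "AE t in lborel. AE x in lborel. AE y in lborel. (x, t) \<notin> N \<and> (y, t) \<notin> N" by eventually_elim (auto elim!: eventually_mono)
  then have "AE t in lborel. AE x in lborel. AE y in lborel. (fst (x, y, t), snd (snd (x, y, t))) \<notin> N \<and> (fst (snd (x, y, t)), snd (snd (x, y, t))) \<notin> N" by simp
  moreover have "Measurable.pred borel3 (\<lambda>z :: 'a \<times> 'a \<times> real. (fst z, snd (snd z)) \<notin> N \<and> (fst (snd z), snd (snd z)) \<notin> N)" by measurable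
  ultimately have "AE z in lborel3. (fst z, snd (snd z)) \<notin> N \<and> (fst (snd z), snd (snd z)) \<notin> N" by (intro AE_tripleI)
  then show ?thesis by eventually_elim (use N(1) in \<open>auto simp: space_pair_measure\<close>)
qed

lemma AE_time_neq: "AE z in lborel2. snd (z :: 'a::euclidean_space \<times> real) \<noteq> c"
proof (rule AE_I')
  have eq: "{z :: 'a \<times> real. snd z = c} = UNIV \<times> {c}" by auto
  have "emeasure lborel2 ((UNIV :: 'a set) \<times> {c}) = 0" by (subst lborel.emeasure_pair_measure_Times) auto
  then show "{z :: 'a \<times> real. snd z = c} \<in> null_sets lborel2" unfolding eq by (intro null_setsI) auto
qed auto

lemma AE_time_neq_triple: "AE z in lborel3. snd (snd (z :: 'a::euclidean_space \<times> 'a \<times> real)) \<noteq> c"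
  using AE_triple_of_pair[OF AE_time_neq] by eventually_elim simp

section \<open>Averages over short time windows\<close>

lemma window_indicator_measurable [measurable]: "(\<lambda>(t, u). indicator {t - h..t :: real} u :: ennreal) \<in> borel_measurable borel2"
proof -
  have "(\<lambda>(t, u). indicator {t - h..t} u :: ennreal) = (\<lambda>(t, u). if t - h \<le> u \<and> u \<le> t then 1 else 0)"
    by (auto simp: indicator_def fun_eq_iff)
  also have "\<dots> \<in> borel_measurable borel2" by measurable
  finally show ?thesis .
qed

text \<open>After exchanging the integrals, a time u is counted only by those t with u <= t <= u +
  h, a set of measure h.\<close>

lemma nn_integral_window:
  fixes \<phi> :: "real \<Rightarrow> ennreal"
  assumes [measurable]: "\<phi> \<in> borel_measurable borel" and "0 \<le> h" "a \<le> t1 - h" "t2 \<le> b"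
  shows "(NINT t. (NINT u. \<phi> u * indicator {t - h..t} u) * indicator {t1..t2} t)
    \<le> ennreal h * (NINT u. \<phi> u * indicator {a..b} u)"
proof -
  have "(NINT t. (NINT u. \<phi> u * indicator {t - h..t} u) * indicator {t1..t2} t)
    = (NINT t. NINT u. \<phi> u * indicator {t - h..t} u * indicator {t1..t2} t)" by (intro nn_integral_cong nn_integral_multc[symmetric]) simp
  also have "\<dots> = (NINT u. NINT t. \<phi> u * indicator {t - h..t} u * indicator {t1..t2} t)" by (intro lborel_pair.Fubini') simp
  also have "\<dots> \<le> (NINT u. NINT t. (\<phi> u * indicator {a..b} u) * indicator {u..u + h} t)"
    using assms by (intro nn_integral_mono) (auto simp: indicator_def)
  also have "\<dots> = (NINT u. ennreal h * (\<phi> u * indicator {a..b} u))"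
    using assms(2) by (intro nn_integral_cong) (simp add: nn_integral_cmult_indicator mult.commute[of "ennreal h"])
  also have "\<dots> = ennreal h * (NINT u. \<phi> u * indicator {a..b} u)" by (rule nn_integral_cmult) simp
  finally show ?thesis .
qed

text \<open>Dominated convergence with majorant \<alpha>: each fixed (x, y, t) leaves the
  exceptional set once n is large. It supplies a region where both points and P are bounded and
  outside of which \<alpha> has little mass.\<close>

lemma tail_vanishing:
  fixes \<alpha> P :: "'a::euclidean_space \<times> 'a \<times> real \<Rightarrow> real"
  assumes [measurable]: "\<alpha> \<in> borel_measurable borel3" "P \<in> borel_measurable borel3"
    and fin: "(slab a b \<alpha>) < \<infinity>"
    and "0 < \<epsilon>"
  shows "\<exists>n::nat. (NINT t. (NINT x. NINT y. ennreal (\<alpha> (x, y, t)) *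
      (if norm x \<le> real n \<and> norm y \<le> real n \<and> P (x, y, t) \<le> real n then 0 else 1)) * indicator {a..b} t) \<le> ennreal \<epsilon>"
proof -
  let ?M = "lborel3 :: ('a \<times> 'a \<times> real) measure"
  define F where "F n z = (case z of (x, y, t) \<Rightarrow> ennreal (\<alpha> (x, y, t)) *
      (if norm x \<le> real n \<and> norm y \<le> real n \<and> P (x, y, t) \<le> real n then 0 else 1) * indicator {a..b} t)" for n :: nat and z
  define G where "G z = (case z of (x, y, t) \<Rightarrow> ennreal (\<alpha> (x, y, t)) * indicator {a..b} t)" for z
  have [measurable]: "F n \<in> borel_measurable borel3" for n unfolding F_def[abs_def] by measurable
  have [measurable]: "G \<in> borel_measurable borel3" unfolding G_def[abs_def] by measurable
  have "(\<lambda>n. \<integral>\<^sup>+ z. F n z \<partial>?M) \<longlonglongrightarrow> (\<integral>\<^sup>+ z. 0 \<partial>?M)"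
  proof (rule nn_integral_dominated_convergence[where w = G])
    show "AE z in ?M. F n z \<le> G z" for n by (auto simp: F_def G_def indicator_def split: prod.splits)
    have "(\<integral>\<^sup>+ z. G z \<partial>?M) = (NINT t. NINT x. NINT y. G (x, y, t))" by (rule nn_integral_triple) simp
    also have "\<dots> = (slab a b \<alpha>)" by (simp add: G_def nn_integral_multc)
    finally show "(\<integral>\<^sup>+ z. G z \<partial>?M) < \<infinity>" using fin by simp
    show "AE z in ?M. (\<lambda>n. F n z) \<longlonglongrightarrow> 0"
    proof (rule AE_I2)
      fix z :: "'a \<times> 'a \<times> real"
      obtain x y t where z: "z = (x, y, t)" by (cases z)
      define m where "m = nat \<lceil>max (max (norm x) (norm y)) (P z)\<rceil>"
      have "F n z = 0" if "m \<le> n" for n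
      proof -
        have "max (max (norm x) (norm y)) (P z) \<le> real n" using that unfolding m_def by linarith
        then show ?thesis by (simp add: F_def z)
      qed
      then show "(\<lambda>n. F n z) \<longlonglongrightarrow> 0" by (intro tendsto_eventually eventually_sequentiallyI[of m])
    qed
  qed measurable
  then have "\<forall>\<^sub>F n in sequentially. (\<integral>\<^sup>+ z. F n z \<partial>?M) < ennreal \<epsilon>"
    using \<open>0 < \<epsilon>\<close> by (intro order_tendstoD) auto
  then obtain n where n: "(\<integral>\<^sup>+ z. F n z \<partial>?M) < ennreal \<epsilon>" by (auto simp: eventually_sequentially)
  have "(\<integral>\<^sup>+ z. F n z \<partial>?M) = (NINT t. NINT x. NINT y. F n (x, y, t))" by (rule nn_integral_triple) simp
  also have "\<dots> = (NINT t. (NINT x. NINT y. ennreal (\<alpha> (x, y, t)) *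
      (if norm x \<le> real n \<and> norm y \<le> real n \<and> P (x, y, t) \<le> real n then 0 else 1)) * indicator {a..b} t)"
    by (simp add: F_def nn_integral_multc)
  finally show ?thesis using n by (intro exI[of _ n]) simp
qed

text \<open>This is the cost of freezing w at time t: it is o(h). Where x, y and P are bounded by n,
  the L^1 continuity of w in time suffices. Elsewhere Young's inequality leaves \<alpha>, whose mass
  there is small by the choice of n, and \<beta>, whose whole mass is multiplied by the small number
  L^(1-p). Since \<alpha> carries the factor L, the weight L is chosen before n, and the continuity
  threshold \<open>e1\<close> last.\<close>

lemma time_shift_remainder:
  fixes P \<alpha> \<beta> :: "'a::euclidean_space \<times> 'a \<times> real \<Rightarrow> real" and w :: "'a \<times> real \<Rightarrow> real"
  assumes [measurable]: "P \<in> borel_measurable borel3"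
      "\<alpha> \<in> borel_measurable borel3" "\<beta> \<in> borel_measurable borel3"
      "w \<in> borel_measurable borel2"
    and nonneg: "\<And>z. 0 \<le> P z" "\<And>z. 0 \<le> \<alpha> z" "\<And>z. 0 \<le> \<beta> z"
    and "1 < p"
    and young: "\<And>x y t \<tau> L. a < t \<Longrightarrow> t < b \<Longrightarrow> 1 \<le> L \<Longrightarrow>
        P (x, y, \<tau>) * \<bar>w (x, t) - w (y, t)\<bar> \<le> L * \<alpha> (x, y, \<tau>) + L powr (1 - p) * \<beta> (x, y, t)"
    and fin\<alpha>: "(slab a b \<alpha>) < \<infinity>"
    and fin\<beta>: "(slab a b \<beta>) < \<infinity>"
    and Th: "AE t in lborel. a < t \<and> t < b \<longrightarrow> t \<in> \<Theta>"
    and cont: "\<And>\<epsilon>. 0 < \<epsilon> \<Longrightarrow> \<exists>d>0. \<forall>t\<in>\<Theta>. \<forall>\<tau>\<in>\<Theta>. a < t \<and> t < b \<and> a < \<tau> \<and> \<tau> < b \<and> \<bar>t - \<tau>\<bar> < d \<longrightarrow>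
        (NINT x. ennreal \<bar>w (x, t) - w (x, \<tau>)\<bar>) \<le> ennreal \<epsilon>"
    and "a < t1" "t1 < t2" "t2 < b" "0 < \<epsilon>"
  shows "\<exists>h0>0. \<forall>h. 0 < h \<and> h < h0 \<longrightarrow>
    (NINT t. (NINT \<tau>. (NINT x. NINT y. ennreal (P (x, y, \<tau>) * \<bar>(w (x, t) - w (y, t)) - (w (x, \<tau>) - w (y, \<tau>))\<bar>))
       * indicator {t - h..t} \<tau>) * indicator {t1..t2} t) \<le> ennreal (\<epsilon> * h)"
proof -
  define B where "B = enn2real (slab a b \<beta>)"
  have B: "(slab a b \<beta>) = ennreal B" "0 \<le> B"
    using fin\<beta> by (auto simp: B_def less_top)
  \<comment> \<open>Chosen so that L^(1-p) B <= \<epsilon>/6; the 1 added to B keeps the quotient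
    defined when B = 0.\<close>
  define L where "L = max 1 (((\<epsilon> / (6 * (B + 1)))) powr (1 / (1 - p)))"
  have L1: "1 \<le> L" by (simp add: L_def)
  have "L powr (1 - p) \<le> ((\<epsilon> / (6 * (B + 1))) powr (1 / (1 - p))) powr (1 - p)"
    using \<open>1 < p\<close> \<open>0 < \<epsilon>\<close> B by (intro powr_mono2') (auto simp: L_def)
  also have "\<dots> = \<epsilon> / (6 * (B + 1))" using \<open>1 < p\<close> \<open>0 < \<epsilon>\<close> B by (simp add: powr_powr)
  finally have LB: "L powr (1 - p) * B \<le> \<epsilon> / 6"
  proof -
    assume "L powr (1 - p) \<le> \<epsilon> / (6 * (B + 1))"
    then have "L powr (1 - p) * B \<le> \<epsilon> / (6 * (B + 1)) * B" using B by (intro mult_right_mono)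
    also have "\<dots> \<le> \<epsilon> / 6" using B \<open>0 < \<epsilon>\<close> by (simp add: field_simps)
    finally show ?thesis .
  qed
  obtain n :: nat where n: "(NINT t. (NINT x. NINT y. ennreal (\<alpha> (x, y, t)) *
      (if norm x \<le> real n \<and> norm y \<le> real n \<and> P (x, y, t) \<le> real n then 0 else 1)) * indicator {a..b} t) \<le> ennreal (\<epsilon> / (6 * L))"
    using tail_vanishing[of \<alpha> P a b "\<epsilon> / (6 * L)"] fin\<alpha> \<open>0 < \<epsilon>\<close> L1 by auto
  define aa where "aa \<tau> = (NINT x. NINT y. ennreal (\<alpha> (x, y, \<tau>)) *
      (if norm x \<le> real n \<and> norm y \<le> real n \<and> P (x, y, \<tau>) \<le> real n then 0 else 1))" for \<tau>
  define bb where "bb \<tau> = (NINT x. NINT y. ennreal (\<beta> (x, y, \<tau>)))" for \<tau>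
  have [measurable]: "aa \<in> borel_measurable borel" "bb \<in> borel_measurable borel" unfolding aa_def[abs_def] bb_def[abs_def] by measurable
  define vol where "vol = measure lborel (cball (0::'a) (real n))"
  have vol: "emeasure lborel (cball (0::'a) (real n)) = ennreal vol" "0 \<le> vol" using emeasure_lborel_cball_finite[of "0::'a" "real n"]
    by (auto simp: vol_def intro!: emeasure_eq_ennreal_measure)
  define q where "q = (real n + 1) * (vol + 1)"
  have q: "0 < q" "real n * vol \<le> q" using vol by (auto simp: q_def intro!: mult_mono)
  \<comment> \<open>The target \<epsilon> is shared out as 1/6 for the bounded region, 1/3 for the
    part of \<alpha> outside it, and 1/6 each for \<beta> at the times t and \<tau>.\<close>
  define e1 where "e1 = \<epsilon> / (12 * q * (t2 - t1))"
  have e1: "0 < e1" using assms q by (simp add: e1_def)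
  obtain d where d: "0 < d" and cd: "\<And>t \<tau>. t \<in> \<Theta> \<Longrightarrow> \<tau> \<in> \<Theta> \<Longrightarrow> a < t \<Longrightarrow> t < b \<Longrightarrow> a < \<tau> \<Longrightarrow> \<tau> < b \<Longrightarrow> \<bar>t - \<tau>\<bar> < d \<Longrightarrow>
        (NINT x. ennreal \<bar>w (x, t) - w (x, \<tau>)\<bar>) \<le> ennreal e1" using cont[OF e1] by blast
  define c where "c = 2 * real n * vol * e1"
  let ?W = "\<lambda>t \<tau> x y. P (x, y, \<tau>) * \<bar>(w (x, t) - w (y, t)) - (w (x, \<tau>) - w (y, \<tau>))\<bar>" and ?a = "ennreal (2 * L)" and ?b = "ennreal (L powr (1 - p))"
  let ?i = "\<lambda>h t \<tau>. indicator {t - h..t} \<tau>"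
  have slice: "(NINT x. NINT y. ennreal (?W t \<tau> x y))
      \<le> ennreal c + ?a * aa \<tau> + ?b * (bb t + bb \<tau>)"
    if t: "t \<in> \<Theta>" "a < t" "t < b" and \<tau>: "\<tau> \<in> \<Theta>" "a < \<tau>" "\<tau> < b" and dist: "\<bar>t - \<tau>\<bar> < d" for t \<tau>
  proof -
    have [measurable]: "cball (0::'a) (real n) \<in> sets borel" by simp
    define I where "I x = (indicator (cball 0 (real n)) x :: ennreal)" for x :: 'a
    have [measurable]: "I \<in> borel_measurable borel" unfolding I_def[abs_def] by measurable
    have pt: "ennreal (?W t \<tau> x y) \<le>
        ennreal (real n) * (I x * (I y * ennreal \<bar>w (x, t) - w (x, \<tau>)\<bar>)) + ennreal (real n) * (I x * (I y * ennreal \<bar>w (y, t) - w (y, \<tau>)\<bar>))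
        + ?a * (ennreal (\<alpha> (x, y, \<tau>)) * (if norm x \<le> real n \<and> norm y \<le> real n \<and> P (x, y, \<tau>) \<le> real n then 0 else 1))
        + ?b * (ennreal (\<beta> (x, y, t)) + ennreal (\<beta> (x, y, \<tau>)))" for x y
    proof (cases "norm x \<le> real n \<and> norm y \<le> real n \<and> P (x, y, \<tau>) \<le> real n")
      case True
      have "?W t \<tau> x y \<le> real n * (\<bar>w (x, t) - w (x, \<tau>)\<bar> + \<bar>w (y, t) - w (y, \<tau>)\<bar>)"
        using True nonneg(1) by (intro mult_mono) auto
      then have "ennreal (?W t \<tau> x y) \<le>
          ennreal (real n * (\<bar>w (x, t) - w (x, \<tau>)\<bar> + \<bar>w (y, t) - w (y, \<tau>)\<bar>))" by (rule ennreal_leI)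
      also have "\<dots> = ennreal (real n) * (I x * (I y * ennreal \<bar>w (x, t) - w (x, \<tau>)\<bar>)) + ennreal (real n) * (I x * (I y * ennreal \<bar>w (y, t) - w (y, \<tau>)\<bar>))"
        using True by (simp add: I_def ennreal_mult ennreal_plus distrib_left del: ennreal_plus_if)
      finally show ?thesis by (rule order_trans) (simp add: add.assoc)
    next
      case False
      have "?W t \<tau> x y \<le> P (x, y, \<tau>) * (\<bar>w (x, t) - w (y, t)\<bar> + \<bar>w (x, \<tau>) - w (y, \<tau>)\<bar>)"
        using nonneg(1) by (intro mult_left_mono) auto
      \<comment> \<open>Young is applied once for each time at which w is taken. The weight P stays
        at time \<tau> in both, so \<alpha> occurs at \<tau> only and \<beta> at both times.\<close>
      also have "\<dots> \<le> 2 * L * \<alpha> (x, y, \<tau>) + L powr (1 - p) * (\<beta> (x, y, t) + \<beta> (x, y, \<tau>))"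
        using young[OF t(2,3) L1, of x y \<tau>] young[OF \<tau>(2,3) L1, of x y \<tau>] by (simp add: algebra_simps)
      finally have "ennreal (?W t \<tau> x y) \<le>
         ennreal (2 * L * \<alpha> (x, y, \<tau>) + L powr (1 - p) * (\<beta> (x, y, t) + \<beta> (x, y, \<tau>)))" by (rule ennreal_leI)
      also have "\<dots> = ?a * ennreal (\<alpha> (x, y, \<tau>)) + ?b * (ennreal (\<beta> (x, y, t)) + ennreal (\<beta> (x, y, \<tau>)))"
        using nonneg L1 by (simp add: ennreal_mult ennreal_plus del: ennreal_plus_if)
      finally show ?thesis using False by (auto intro: order_trans simp: add_increasing)
    qed
    have i1: "(NINT x. NINT y. I x * (I y * ennreal \<bar>w (x, t) - w (x, \<tau>)\<bar>)) \<le> ennreal (vol * e1)"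
    proof -
      have "(NINT x. NINT y. I x * (I y * ennreal \<bar>w (x, t) - w (x, \<tau>)\<bar>)) = (NINT x. I x * (ennreal vol * ennreal \<bar>w (x, t) - w (x, \<tau>)\<bar>))"
      proof (intro nn_integral_cong)
        fix x
        have "(NINT y. I y) = ennreal vol" unfolding I_def by (simp add: vol)
        then show "(NINT y. I x * (I y * ennreal \<bar>w (x, t) - w (x, \<tau>)\<bar>)) = I x * (ennreal vol * ennreal \<bar>w (x, t) - w (x, \<tau>)\<bar>)"
          by (simp add: nn_integral_cmult nn_integral_multc)
      qed
      also have "\<dots> \<le> (NINT x. ennreal vol * ennreal \<bar>w (x, t) - w (x, \<tau>)\<bar>)"
        by (intro nn_integral_mono) (auto simp: I_def indicator_def)
      also have "\<dots> = ennreal vol * (NINT x. ennreal \<bar>w (x, t) - w (x, \<tau>)\<bar>)" by (rule nn_integral_cmult) simp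
      also have "\<dots> \<le> ennreal vol * ennreal e1" using cd[OF t(1) \<tau>(1)] t \<tau> dist by (intro mult_left_mono) auto
      finally show ?thesis using vol e1 by (simp add: ennreal_mult)
    qed
    have i2: "(NINT x. NINT y. I x * (I y * ennreal \<bar>w (y, t) - w (y, \<tau>)\<bar>)) \<le> ennreal (vol * e1)"
    proof -
      have "(NINT x. NINT y. I x * (I y * ennreal \<bar>w (y, t) - w (y, \<tau>)\<bar>))
         = (NINT y. NINT x. I x * (I y * ennreal \<bar>w (y, t) - w (y, \<tau>)\<bar>))" by (intro lborel_pair.Fubini') simp
      also have "\<dots> = (NINT y. NINT x. I y * (I x * ennreal \<bar>w (y, t) - w (y, \<tau>)\<bar>))" by (simp add: mult.left_commute)
      finally show ?thesis using i1 by simp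
    qed
    have "(NINT x. NINT y. ennreal (?W t \<tau> x y))
      \<le> (NINT x. NINT y. ennreal (real n) * (I x * (I y * ennreal \<bar>w (x, t) - w (x, \<tau>)\<bar>)) + ennreal (real n) * (I x * (I y * ennreal \<bar>w (y, t) - w (y, \<tau>)\<bar>))
        + ?a * (ennreal (\<alpha> (x, y, \<tau>)) * (if norm x \<le> real n \<and> norm y \<le> real n \<and> P (x, y, \<tau>) \<le> real n then 0 else 1))
        + ?b * (ennreal (\<beta> (x, y, t)) + ennreal (\<beta> (x, y, \<tau>))))" by (intro nn_integral_mono pt)
    also have "\<dots> = ennreal (real n) * (NINT x. NINT y. I x * (I y * ennreal \<bar>w (x, t) - w (x, \<tau>)\<bar>))
        + ennreal (real n) * (NINT x. NINT y. I x * (I y * ennreal \<bar>w (y, t) - w (y, \<tau>)\<bar>))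
        + ?a * aa \<tau> + ?b * (bb t + bb \<tau>)" unfolding aa_def bb_def
      by (simp add: nn_integral_add nn_integral_cmult)
    also have "\<dots> \<le> ennreal (real n) * ennreal (vol * e1) + ennreal (real n) * ennreal (vol * e1)
        + ?a * aa \<tau> + ?b * (bb t + bb \<tau>)" by (intro add_mono mult_left_mono i1 i2 order_refl) auto
    also have "ennreal (real n) * ennreal (vol * e1) + ennreal (real n) * ennreal (vol * e1) = ennreal c"
      using vol e1 by (simp add: c_def ennreal_mult[symmetric] ennreal_plus[symmetric] del: ennreal_plus)
    finally show ?thesis .
  qed
  define h0 where "h0 = min d (t1 - a)"
  have h0: "0 < h0" using d assms by (simp add: h0_def)
  show ?thesis
  proof (intro exI[of _ h0] conjI allI impI h0)
    fix h assume h: "0 < h \<and> h < h0"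
    have "(NINT t. (NINT \<tau>. (NINT x. NINT y. ennreal (?W t \<tau> x y))
       * ?i h t \<tau>) * indicator {t1..t2} t)
      \<le> (NINT t. (NINT \<tau>. (ennreal c + ?a * aa \<tau> + ?b * (bb t + bb \<tau>))
       * ?i h t \<tau>) * indicator {t1..t2} t)"
    proof (rule nn_integral_mono_AE)
      show "AE t in lborel. (NINT \<tau>. (NINT x. NINT y. ennreal (?W t \<tau> x y))
         * ?i h t \<tau>) * indicator {t1..t2} t
        \<le> (NINT \<tau>. (ennreal c + ?a * aa \<tau> + ?b * (bb t + bb \<tau>))
         * ?i h t \<tau>) * indicator {t1..t2} t" using Th
      proof eventually_elim
        fix t assume "a < t \<and> t < b \<longrightarrow> t \<in> \<Theta>"
        then have t: "t \<in> {t1..t2} \<Longrightarrow> t \<in> \<Theta> \<and> a < t \<and> t < b" using assms by auto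
        show "(NINT \<tau>. (NINT x. NINT y. ennreal (?W t \<tau> x y))
         * ?i h t \<tau>) * indicator {t1..t2} t
        \<le> (NINT \<tau>. (ennreal c + ?a * aa \<tau> + ?b * (bb t + bb \<tau>))
         * ?i h t \<tau>) * indicator {t1..t2} t"
        proof (cases "t \<in> {t1..t2}")
          case True
          then have "t1 \<le> t" by simp
          have "AE \<tau> in lborel. (NINT x. NINT y. ennreal (?W t \<tau> x y))
             * ?i h t \<tau> \<le> (ennreal c + ?a * aa \<tau> + ?b * (bb t + bb \<tau>)) * ?i h t \<tau>"
            using Th
          proof eventually_elim
            fix \<tau> assume T: "a < \<tau> \<and> \<tau> < b \<longrightarrow> \<tau> \<in> \<Theta>"
            show "(NINT x. NINT y. ennreal (?W t \<tau> x y))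
             * ?i h t \<tau> \<le> (ennreal c + ?a * aa \<tau> + ?b * (bb t + bb \<tau>)) * ?i h t \<tau>"
            proof (cases "\<tau> \<in> {t - h..t}")
              case T2: True
              then have "a < \<tau>" "\<tau> < b" "\<bar>t - \<tau>\<bar> < d" using h \<open>t1 \<le> t\<close> t[OF True] unfolding h0_def by auto
              then show ?thesis using T t[OF True] T2 by (auto intro!: slice)
            qed simp
          qed
          then show ?thesis using True by (auto intro: nn_integral_mono_AE)
        qed simp
      qed
    qed
    \<comment> \<open>The contribution of \<beta> at time t does not involve \<tau>, so integrating
      it over the window only produces the factor h.\<close>
    also have "\<dots> \<le> (NINT t. (NINT \<tau>. (ennreal c + ?a * aa \<tau> + ?b * bb \<tau>)
       * ?i h t \<tau>) * indicator {t1..t2} t + ennreal h * (?b * (bb t * indicator {a..b} t)))"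
    proof (intro nn_integral_mono)
      fix t
      have "(NINT \<tau>. (ennreal c + ?a * aa \<tau> + ?b * (bb t + bb \<tau>)) * ?i h t \<tau>)
        = (NINT \<tau>. (ennreal c + ?a * aa \<tau> + ?b * bb \<tau>) * ?i h t \<tau>
            + (?b * bb t) * ?i h t \<tau>)"
        by (intro nn_integral_cong) (simp add: algebra_simps distrib_left distrib_right)
      also have "\<dots> = (NINT \<tau>. (ennreal c + ?a * aa \<tau> + ?b * bb \<tau>) * ?i h t \<tau>)
            + (?b * bb t) * ennreal h" using h by (subst nn_integral_add) (auto simp: nn_integral_cmult)
      finally show "(NINT \<tau>. (ennreal c + ?a * aa \<tau> + ?b * (bb t + bb \<tau>)) * ?i h t \<tau>) * indicator {t1..t2} t
        \<le> (NINT \<tau>. (ennreal c + ?a * aa \<tau> + ?b * bb \<tau>) * ?i h t \<tau>) * indicator {t1..t2} t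
          + ennreal h * (?b * (bb t * indicator {a..b} t))" using assms by (auto simp: indicator_def mult_ac)
    qed
    also have "\<dots> = (NINT t. (NINT \<tau>. (ennreal c + ?a * aa \<tau> + ?b * bb \<tau>)
       * ?i h t \<tau>) * indicator {t1..t2} t) + ennreal h * (?b * ennreal B)"
    proof -
      show ?thesis by (subst nn_integral_add; (measurable)?) (simp add: nn_integral_cmult B(1)[folded bb_def])
    qed
    also have "\<dots> \<le> (ennreal (c * (t2 - t1) * h) + ennreal h * (?a * ennreal (\<epsilon> / (6 * L)) + ?b * ennreal B)) + ennreal h * (?b * ennreal B)"
    proof (intro add_right_mono)
      have c0: "0 \<le> c" using vol e1 by (simp add: c_def)
      have "(NINT t. (NINT \<tau>. (ennreal c + ?a * aa \<tau> + ?b * bb \<tau>)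
         * ?i h t \<tau>) * indicator {t1..t2} t)
        \<le> (NINT t. ennreal (c * h) * indicator {t1..t2} t + (NINT \<tau>. (?a * aa \<tau> + ?b * bb \<tau>)
         * ?i h t \<tau>) * indicator {t1..t2} t)"
      proof (intro nn_integral_mono)
        fix t
        have "(NINT \<tau>. (ennreal c + ?a * aa \<tau> + ?b * bb \<tau>) * ?i h t \<tau>)
          = (NINT \<tau>. ennreal c * ?i h t \<tau> + (?a * aa \<tau> + ?b * bb \<tau>) * ?i h t \<tau>)"
          by (intro nn_integral_cong) (simp add: distrib_right add.assoc)
        also have "\<dots> = ennreal c * ennreal h + (NINT \<tau>. (?a * aa \<tau> + ?b * bb \<tau>) * ?i h t \<tau>)"
          using h by (subst nn_integral_add) (auto simp: nn_integral_cmult)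
        finally show "(NINT \<tau>. (ennreal c + ?a * aa \<tau> + ?b * bb \<tau>) * ?i h t \<tau>) * indicator {t1..t2} t
          \<le> ennreal (c * h) * indicator {t1..t2} t + (NINT \<tau>. (?a * aa \<tau> + ?b * bb \<tau>)
         * ?i h t \<tau>) * indicator {t1..t2} t" using c0 h by (simp add: distrib_right ennreal_mult)
      qed
      also have "\<dots> = ennreal (c * h) * ennreal (t2 - t1) + (NINT t. (NINT \<tau>. (?a * aa \<tau> + ?b * bb \<tau>)
         * ?i h t \<tau>) * indicator {t1..t2} t)"
      proof -
        show ?thesis using \<open>t1 < t2\<close> by (subst nn_integral_add; (measurable)?) (simp add: nn_integral_cmult)
      qed
      also have "\<dots> \<le> ennreal (c * h) * ennreal (t2 - t1) + ennreal h * (NINT \<tau>. (?a * aa \<tau> + ?b * bb \<tau>) * indicator {a..b} \<tau>)"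
        using h assms by (intro add_left_mono nn_integral_window) (auto simp: h0_def)
      also have "(NINT \<tau>. (?a * aa \<tau> + ?b * bb \<tau>) * indicator {a..b} \<tau>)
         = ?a * (NINT \<tau>. aa \<tau> * indicator {a..b} \<tau>) + ?b * (NINT \<tau>. bb \<tau> * indicator {a..b} \<tau>)"
        by (simp add: distrib_right mult.assoc nn_integral_add nn_integral_cmult)
      also have "(NINT \<tau>. bb \<tau> * indicator {a..b} \<tau>) = ennreal B" using B(1) by (simp add: bb_def)
      also have "ennreal (c * h) * ennreal (t2 - t1) + ennreal h * (?a * (NINT \<tau>. aa \<tau> * indicator {a..b} \<tau>) + ?b * ennreal B)
        \<le> ennreal (c * h) * ennreal (t2 - t1) + ennreal h * (?a * ennreal (\<epsilon> / (6 * L)) + ?b * ennreal B)"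
        using n unfolding aa_def by (intro add_left_mono mult_left_mono add_right_mono) auto
      also have "ennreal (c * h) * ennreal (t2 - t1) = ennreal (c * (t2 - t1) * h)"
        using c0 h \<open>t1 < t2\<close> by (simp add: ennreal_mult[symmetric] mult_ac)
      finally show "(NINT t. (NINT \<tau>. (ennreal c + ?a * aa \<tau> + ?b * bb \<tau>)
         * ?i h t \<tau>) * indicator {t1..t2} t) \<le> ennreal (c * (t2 - t1) * h) + ennreal h * (?a * ennreal (\<epsilon> / (6 * L)) + ?b * ennreal B)" .
    qed
    also have "\<dots> = ennreal (c * (t2 - t1) * h + h * (2 * L * (\<epsilon> / (6 * L)) + L powr (1 - p) * B) + h * (L powr (1 - p) * B))"
    proof -
      have "0 \<le> c * (t2 - t1) * h" "0 \<le> \<epsilon> / (6 * L)" "0 \<le> L powr (1 - p) * B" "0 \<le> h" "0 \<le> 2 * L"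
        using h L1 B \<open>0 < \<epsilon>\<close> vol e1 \<open>t1 < t2\<close> by (auto simp: c_def)
      then show ?thesis using B(2) by (simp only: ennreal_mult[symmetric] ennreal_plus[symmetric] mult_nonneg_nonneg add_nonneg_nonneg powr_ge_zero)
    qed
    also have "\<dots> \<le> ennreal (\<epsilon> * h)"
    proof (rule ennreal_leI)
      have "c * (t2 - t1) = real n * vol * (\<epsilon> / (6 * q))" using \<open>t1 < t2\<close> q(1) by (simp add: c_def e1_def field_simps)
      also have "\<dots> \<le> q * (\<epsilon> / (6 * q))" using q \<open>0 < \<epsilon>\<close> by (intro mult_right_mono) auto
      also have "\<dots> = \<epsilon> / 6" using q by simp
      finally have "c * (t2 - t1) \<le> \<epsilon> / 6" .
      moreover have "2 * L * (\<epsilon> / (6 * L)) = \<epsilon> / 3" using L1 by simp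
      ultimately have "c * (t2 - t1) + (2 * L * (\<epsilon> / (6 * L)) + L powr (1 - p) * B) + L powr (1 - p) * B \<le> \<epsilon>"
        using LB \<open>0 < \<epsilon>\<close> by linarith
      then have "(c * (t2 - t1) + (2 * L * (\<epsilon> / (6 * L)) + L powr (1 - p) * B) + L powr (1 - p) * B) * h \<le> \<epsilon> * h"
        using h by (intro mult_right_mono) auto
      then show "c * (t2 - t1) * h + h * (2 * L * (\<epsilon> / (6 * L)) + L powr (1 - p) * B) + h * (L powr (1 - p) * B) \<le> \<epsilon> * h"
        by (simp add: algebra_simps)
    qed
    finally show "(NINT t. (NINT \<tau>. (NINT x. NINT y. ennreal (?W t \<tau> x y))
       * ?i h t \<tau>) * indicator {t1..t2} t) \<le> ennreal (\<epsilon> * h)" .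
  qed
qed

section \<open>Energy balance for truncations\<close>

text \<open>The integral of \<Phi>(t) - \<Phi>(t - h) over [t1, t2] telescopes to an integral over
  the last window minus one over the window before t1. By continuity at the two end times this is h
  (\<Phi> t2 - \<Phi> t1) up to o(h), and a remainder of total size o(h) leaves no room for an
  increase.\<close>

lemma increment_le_of_window_average:
  fixes \<Phi> :: "real \<Rightarrow> real" and R :: "real \<Rightarrow> real \<Rightarrow> ennreal"
  assumes [measurable]: "\<Phi> \<in> borel_measurable borel"
    and bd: "\<And>t. a < t \<Longrightarrow> t < b \<Longrightarrow> \<bar>\<Phi> t\<bar> \<le> B"
    and Th: "AE t in lborel. a < t \<and> t < b \<longrightarrow> t \<in> \<Theta>"
    and t: "a < t1" "t1 < t2" "t2 < b"
    and c1: "\<And>\<epsilon>. 0 < \<epsilon> \<Longrightarrow> \<exists>d>0. \<forall>t\<in>\<Theta>. \<bar>t - t1\<bar> < d \<longrightarrow> \<bar>\<Phi> t - \<Phi> t1\<bar> \<le> \<epsilon>"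
    and c2: "\<And>\<epsilon>. 0 < \<epsilon> \<Longrightarrow> \<exists>d>0. \<forall>t\<in>\<Theta>. \<bar>t - t2\<bar> < d \<longrightarrow> \<bar>\<Phi> t - \<Phi> t2\<bar> \<le> \<epsilon>"
    and step: "\<And>h. 0 < h \<Longrightarrow> h < t1 - a \<Longrightarrow> AE t in lborel. t1 \<le> t \<and> t \<le> t2 \<longrightarrow> ennreal (\<Phi> t - \<Phi> (t - h)) \<le> R h t"
    and rem: "\<And>\<epsilon>. 0 < \<epsilon> \<Longrightarrow> \<exists>h0>0. \<forall>h. 0 < h \<and> h < h0 \<longrightarrow> (NINT t. R h t * indicator {t1..t2} t) \<le> ennreal (\<epsilon> * h)"
  shows "\<Phi> t2 \<le> \<Phi> t1"
proof (rule ccontr)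
  assume "\<not> \<Phi> t2 \<le> \<Phi> t1"
  \<comment> \<open>A quarter of the supposed increase: one \<epsilon> is lost at each end time, and
    the remaining 2 \<epsilon> still exceed the \<epsilon> allowed by the remainder.\<close>
  define \<epsilon> where "\<epsilon> = (\<Phi> t2 - \<Phi> t1) / 4"
  have e: "0 < \<epsilon>" "\<Phi> t2 = \<Phi> t1 + 4 * \<epsilon>" using \<open>\<not> \<Phi> t2 \<le> \<Phi> t1\<close> by (auto simp: \<epsilon>_def field_simps)
  obtain d1 where d1: "0 < d1" "\<And>t. t \<in> \<Theta> \<Longrightarrow> \<bar>t - t1\<bar> < d1 \<Longrightarrow> \<bar>\<Phi> t - \<Phi> t1\<bar> \<le> \<epsilon>" using c1[OF e(1)] by blast
  obtain d2 where d2: "0 < d2" "\<And>t. t \<in> \<Theta> \<Longrightarrow> \<bar>t - t2\<bar> < d2 \<Longrightarrow> \<bar>\<Phi> t - \<Phi> t2\<bar> \<le> \<epsilon>" using c2[OF e(1)] by blast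
  obtain h0 where h0: "0 < h0" "\<And>h. 0 < h \<Longrightarrow> h < h0 \<Longrightarrow> (NINT t. R h t * indicator {t1..t2} t) \<le> ennreal (\<epsilon> * h)"
    using rem[OF e(1)] by blast
  define h where "h = min (min d1 d2) (min h0 (min (t1 - a) (t2 - t1))) / 2"
  have h: "0 < h" "h < d1" "h < d2" "h < h0" "h < t1 - a" "h < t2 - t1" using d1(1) d2(1) h0(1) t by (auto simp: h_def min_def)
  have int: "integrable lborel (\<lambda>t. indicat_real {u<..v} t * \<Phi> t)" if "a < u" "v < b" for u v using that bd
    by (intro integrableI_bounded_set_indicator[where B = B, simplified] integrableI_bounded_set[where A = "{u<..v}" and B = B])
       (auto simp: indicator_def intro!: AE_I2 emeasure_bounded_finite[unfolded infinity_ennreal_def])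
  have shift: "(\<integral>t. indicat_real {t1<..t2} t * \<Phi> (t - h) \<partial>lborel) = (\<integral>t. indicat_real {t1 - h<..t2 - h} t * \<Phi> t \<partial>lborel)"
    and int2: "integrable lborel (\<lambda>t. indicat_real {t1<..t2} t * \<Phi> (t - h))"
  proof -
    have eq: "(\<lambda>t. indicat_real {t1<..t2} t * \<Phi> (t - h)) = (\<lambda>t. (\<lambda>u. indicat_real {t1 - h<..t2 - h} u * \<Phi> u) (- h + 1 * t))"
      by (auto simp: indicator_def fun_eq_iff)
    show "(\<integral>t. indicat_real {t1<..t2} t * \<Phi> (t - h) \<partial>lborel) = (\<integral>t. indicat_real {t1 - h<..t2 - h} t * \<Phi> t \<partial>lborel)"
      unfolding eq by (subst lborel_integral_real_affine[of 1 _ "- h"]) auto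
    show "integrable lborel (\<lambda>t. indicat_real {t1<..t2} t * \<Phi> (t - h))"
      unfolding eq using h t by (intro lborel_integrable_real_affine int) auto
  qed
  have "(\<integral>t. indicat_real {t1<..t2} t * (\<Phi> t - \<Phi> (t - h)) \<partial>lborel) =
      (\<integral>t. indicat_real {t1<..t2} t * \<Phi> t \<partial>lborel) - (\<integral>t. indicat_real {t1<..t2} t * \<Phi> (t - h) \<partial>lborel)"
    using int[of t1 t2] int2 t by (simp add: right_diff_distrib)
  also have "\<dots> = (\<integral>t. indicat_real {t1<..t2} t * \<Phi> t - indicat_real {t1 - h<..t2 - h} t * \<Phi> t \<partial>lborel)"
    unfolding shift using int[of t1 t2] int[of "t1 - h" "t2 - h"] t h by simp
  also have "\<dots> = (\<integral>t. indicat_real {t2 - h<..t2} t * \<Phi> t - indicat_real {t1 - h<..t1} t * \<Phi> t \<partial>lborel)"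
    using h by (intro Bochner_Integration.integral_cong) (auto simp: indicator_def)
  also have "\<dots> = (\<integral>t. indicat_real {t2 - h<..t2} t * \<Phi> t \<partial>lborel) - (\<integral>t. indicat_real {t1 - h<..t1} t * \<Phi> t \<partial>lborel)"
    using int[of "t2 - h" t2] int[of "t1 - h" t1] t h by simp
  finally have eq: "(\<integral>t. indicat_real {t1<..t2} t * (\<Phi> t - \<Phi> (t - h)) \<partial>lborel) =
      (\<integral>t. indicat_real {t2 - h<..t2} t * \<Phi> t \<partial>lborel) - (\<integral>t. indicat_real {t1 - h<..t1} t * \<Phi> t \<partial>lborel)" .
  have ci: "(\<integral>t. indicat_real {u - h<..u} t * c \<partial>lborel) = h * c" "integrable lborel (\<lambda>t. indicat_real {u - h<..u} t * c)" for u c :: real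
    using h by auto
  have "h * (\<Phi> t2 - \<epsilon>) = (\<integral>t. indicat_real {t2 - h<..t2} t * (\<Phi> t2 - \<epsilon>) \<partial>lborel)" by (rule ci(1)[symmetric])
  also have "\<dots> \<le> (\<integral>t. indicat_real {t2 - h<..t2} t * \<Phi> t \<partial>lborel)"
  proof (rule integral_mono_AE)
    show "AE t in lborel. indicat_real {t2 - h<..t2} t * (\<Phi> t2 - \<epsilon>) \<le> indicat_real {t2 - h<..t2} t * \<Phi> t" using Th
    proof eventually_elim
      fix t assume "a < t \<and> t < b \<longrightarrow> t \<in> \<Theta>"
      then show "indicat_real {t2 - h<..t2} t * (\<Phi> t2 - \<epsilon>) \<le> indicat_real {t2 - h<..t2} t * \<Phi> t"
        using d2(2)[of t] h t by (auto simp: indicator_def)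
    qed
  qed (use int[of "t2 - h" t2] t h ci in auto)
  finally have low: "h * (\<Phi> t2 - \<epsilon>) \<le> (\<integral>t. indicat_real {t2 - h<..t2} t * \<Phi> t \<partial>lborel)" .
  have "(\<integral>t. indicat_real {t1 - h<..t1} t * \<Phi> t \<partial>lborel) \<le> (\<integral>t. indicat_real {t1 - h<..t1} t * (\<Phi> t1 + \<epsilon>) \<partial>lborel)"
  proof (rule integral_mono_AE)
    show "AE t in lborel. indicat_real {t1 - h<..t1} t * \<Phi> t \<le> indicat_real {t1 - h<..t1} t * (\<Phi> t1 + \<epsilon>)" using Th
    proof eventually_elim
      fix t assume "a < t \<and> t < b \<longrightarrow> t \<in> \<Theta>"
      then show "indicat_real {t1 - h<..t1} t * \<Phi> t \<le> indicat_real {t1 - h<..t1} t * (\<Phi> t1 + \<epsilon>)"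
        using d1(2)[of t] h t by (auto simp: indicator_def)
    qed
  qed (use int[of "t1 - h" t1] t h ci in auto)
  also have "\<dots> = h * (\<Phi> t1 + \<epsilon>)" by (rule ci(1))
  finally have up: "(\<integral>t. indicat_real {t1 - h<..t1} t * \<Phi> t \<partial>lborel) \<le> h * (\<Phi> t1 + \<epsilon>)" .
  have "h * (2 * \<epsilon>) = h * (\<Phi> t2 - \<epsilon>) - h * (\<Phi> t1 + \<epsilon>)" using e by (simp add: algebra_simps)
  also have "\<dots> \<le> (\<integral>t. indicat_real {t1<..t2} t * (\<Phi> t - \<Phi> (t - h)) \<partial>lborel)"
    unfolding eq using low up by linarith
  finally have "ennreal (h * (2 * \<epsilon>)) \<le> ennreal (\<integral>t. indicat_real {t1<..t2} t * (\<Phi> t - \<Phi> (t - h)) \<partial>lborel)"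
    by (rule ennreal_leI)
  also have "\<dots> \<le> ennreal (\<integral>t. max 0 (indicat_real {t1<..t2} t * (\<Phi> t - \<Phi> (t - h))) \<partial>lborel)"
    using int[of t1 t2] int2 t by (intro ennreal_leI integral_mono) (auto simp: right_diff_distrib)
  also have "\<dots> = (NINT t. ennreal (max 0 (indicat_real {t1<..t2} t * (\<Phi> t - \<Phi> (t - h)))))"
    using int[of t1 t2] int2 t by (intro nn_integral_eq_integral[symmetric]) (auto simp: right_diff_distrib)
  also have "\<dots> \<le> (NINT t. R h t * indicator {t1..t2} t)"
  proof (rule nn_integral_mono_AE)
    show "AE t in lborel. ennreal (max 0 (indicat_real {t1<..t2} t * (\<Phi> t - \<Phi> (t - h)))) \<le> R h t * indicator {t1..t2} t"
      using step[OF h(1) h(5)] by eventually_elim (auto simp: indicator_def max_def ennreal_neg)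
  qed
  also have "\<dots> \<le> ennreal (\<epsilon> * h)" using h0(2) h by auto
  finally have "h * (2 * \<epsilon>) \<le> \<epsilon> * h" using e h by (subst (asm) ennreal_le_iff) auto
  then show False using e h by (simp add: mult.commute)
qed

text \<open>Continuity in time and the weak equation are required only at the times in \<Theta>, those at which the
  Borel representative V agrees with the solution almost everywhere.\<close>
locale slice_solution =
  fixes s p Co C1 :: real and K :: "'a::euclidean_space \<times> 'a \<times> real \<Rightarrow> real" and V :: "'a \<times> real \<Rightarrow> real"
    and T :: real and xo :: 'a and Rb :: real and \<Theta> :: "real set"
  assumes p: "1 < p" and s: "0 < s" "s < 1" and Co: "0 < Co" "Co \<le> C1"
    and K_meas [measurable]: "K \<in> borel_measurable borel3"
    and V_meas [measurable]: "V \<in> borel_measurable borel2"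
    and K_bounds: "AE t in lborel. 0 < t \<and> t < T \<longrightarrow> (AE x in lborel. AE y in lborel.
        between Co C1 (s * p) K x y t)"
    and \<Theta>_sub: "\<Theta> \<subseteq> {0<..<T}" and \<Theta>_AE: "AE t in lborel. 0 < t \<and> t < T \<longrightarrow> t \<in> \<Theta>"
    and V_gagliardo: "\<And>a b. 0 < a \<Longrightarrow> b < T \<Longrightarrow> (NINT t. (NINT x. NINT y. ennreal (fkernel (s * p) x y * \<bar>V (x, t) - V (y, t)\<bar> powr p) * indicator (ball xo Rb) x * indicator (ball xo Rb) y) * indicator {a..b} t) < \<infinity>"
    and V_far: "\<And>a b r. 0 < a \<Longrightarrow> b < T \<Longrightarrow> 0 < r \<Longrightarrow> r < Rb \<Longrightarrow> (NINT t. (NINT x. NINT y. ennreal (fkernel (s * p) x y * \<bar>V (x, t) - V (y, t)\<bar> powr (p - 1)) * indicator (ball xo r) x * indicator (- ball xo Rb) y) * indicator {a..b} t) < \<infinity>"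
    and V_cont: "\<And>a b \<epsilon>. 0 < a \<Longrightarrow> b < T \<Longrightarrow> 0 < \<epsilon> \<Longrightarrow> \<exists>d>0. \<forall>t\<in>\<Theta>. \<forall>\<tau>\<in>\<Theta>. a < t \<and> t < b \<and> a < \<tau> \<and> \<tau> < b \<and> \<bar>t - \<tau>\<bar> < d \<longrightarrow>
        (NINT x. ennreal \<bar>V (x, t) - V (x, \<tau>)\<bar> * indicator (ball xo Rb) x) \<le> ennreal \<epsilon>"
    and weak_eq: "\<And>t1 t2 g r H. t1 \<in> \<Theta> \<Longrightarrow> t2 \<in> \<Theta> \<Longrightarrow> t1 < t2 \<Longrightarrow> 0 < r \<Longrightarrow> r < Rb \<Longrightarrow> g \<in> borel_measurable borel \<Longrightarrow>
        (\<And>x. 0 \<le> g x) \<Longrightarrow> (\<And>x. g x \<le> H) \<Longrightarrow> (\<And>x. x \<notin> ball xo r \<Longrightarrow> g x = 0) \<Longrightarrow>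
        (NINT x. NINT y. ennreal (fkernel (s * p) x y * \<bar>g x - g y\<bar> powr p)) < \<infinity> \<Longrightarrow>
        integrable lborel (\<lambda>x. V (x, t1) * g x) \<and> integrable lborel (\<lambda>x. V (x, t2) * g x) \<and>
        integrable lborel3 (\<lambda>(x, y, t). indicat_real {t1<..t2} t * (K (x, y, t) * signed_powr p (V (x, t) - V (y, t)) * (g x - g y))) \<and>
        (\<integral>x. V (x, t2) * g x \<partial>lborel) - (\<integral>x. V (x, t1) * g x \<partial>lborel) +
        (\<integral>z. (case z of (x, y, t) \<Rightarrow> indicat_real {t1<..t2} t * (K (x, y, t) * signed_powr p (V (x, t) - V (y, t)) * (g x - g y))) \<partial>lborel3) = 0"
begin

text \<open>The nonlinearity is odd. This symmetry turns every upper bound into a lower bound, so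
  only superlevel sets are studied below.\<close>

lemma slice_solution_minus: "slice_solution s p Co C1 K (\<lambda>z. - V z) T xo Rb \<Theta>"
proof (unfold_locales, goal_cases)
  case (11 a b) then show ?case using V_gagliardo[of a b] by (simp add: abs_minus_commute)
next
  case (12 a b r) then show ?case using V_far[of a b r] by (simp add: abs_minus_commute)
next
  case (13 a b \<epsilon>) then show ?case using V_cont[of a b \<epsilon>] by (simp add: abs_minus_commute)
next
  case (14 t1 t2 g r H)
  have eq: "signed_powr p (- V (x, t) - - V (y, t)) = - signed_powr p (V (x, t) - V (y, t))" for x y t
    using signed_powr_minus[of p "V (x, t) - V (y, t)"] by simp
  have "(\<lambda>(x, y, t). indicat_real {t1<..t2} t * (K (x, y, t) * signed_powr p (- V (x, t) - - V (y, t)) * (g x - g y))) =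
     (\<lambda>z. - (case z of (x, y, t) \<Rightarrow> indicat_real {t1<..t2} t * (K (x, y, t) * signed_powr p (V (x, t) - V (y, t)) * (g x - g y))))"
    unfolding eq by (auto simp: fun_eq_iff)
  then show ?case using weak_eq[of t1 t2 r g H] 14 by simp
qed (use p s Co K_meas V_meas K_bounds \<Theta>_sub \<Theta>_AE in auto)


text \<open>Cutting at 0 and subtracting a function of x alone is 1-Lipschitz in V, so w inherits
  the L^1 modulus of continuity of V.\<close>

lemma truncation_time_continuous:
  assumes "0 < a" "b < T" "0 < \<epsilon>" "r \<le> Rb"
    and w: "w = (\<lambda>z. if fst z \<in> ball xo r then max 0 (V z - \<psi> (fst z)) else 0)"
  shows "\<exists>d>0. \<forall>t\<in>\<Theta>. \<forall>\<tau>\<in>\<Theta>. a < t \<and> t < b \<and> a < \<tau> \<and> \<tau> < b \<and> \<bar>t - \<tau>\<bar> < d \<longrightarrow>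
        (NINT x. ennreal \<bar>w (x, t) - w (x, \<tau>)\<bar>) \<le> ennreal \<epsilon>"
proof -
  obtain d where d: "d > 0" "\<And>t \<tau>. t \<in> \<Theta> \<Longrightarrow> \<tau> \<in> \<Theta> \<Longrightarrow> a < t \<and> t < b \<and> a < \<tau> \<and> \<tau> < b \<and> \<bar>t - \<tau>\<bar> < d \<Longrightarrow>
        (NINT x. ennreal \<bar>V (x, t) - V (x, \<tau>)\<bar> * indicator (ball xo Rb) x) \<le> ennreal \<epsilon>"
    using V_cont[OF assms(1-3)] by blast
  have "(NINT x. ennreal \<bar>w (x, t) - w (x, \<tau>)\<bar>) \<le> (NINT x. ennreal \<bar>V (x, t) - V (x, \<tau>)\<bar> * indicator (ball xo Rb) x)" for t \<tau>
  proof (intro nn_integral_mono)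
    fix x
    show "ennreal \<bar>w (x, t) - w (x, \<tau>)\<bar> \<le> ennreal \<bar>V (x, t) - V (x, \<tau>)\<bar> * indicator (ball xo Rb) x"
    proof (cases "x \<in> ball xo r")
      case True
      then have "x \<in> ball xo Rb" using \<open>r \<le> Rb\<close> by auto
      moreover have "\<bar>w (x, t) - w (x, \<tau>)\<bar> \<le> \<bar>V (x, t) - V (x, \<tau>)\<bar>" using True by (auto simp: w max_def)
      ultimately show ?thesis by (simp add: ennreal_leI)
    qed (simp add: w)
  qed
  note le = this
  show ?thesis
  proof (intro exI[of _ d] conjI ballI impI d(1))
    fix t \<tau> assume "t \<in> \<Theta>" "\<tau> \<in> \<Theta>" "a < t \<and> t < b \<and> a < \<tau> \<and> \<tau> < b \<and> \<bar>t - \<tau>\<bar> < d"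
    from d(2)[OF this] show "(NINT x. ennreal \<bar>w (x, t) - w (x, \<tau>)\<bar>) \<le> ennreal \<epsilon>" by (rule order_trans[OF le])
  qed
qed

lemma V_far_swap:
  assumes "0 < a" "b < T" "0 < r" "r < Rb"
  shows "(NINT t. (NINT x. NINT y. ennreal (fkernel (s * p) x y * \<bar>V (x, t) - V (y, t)\<bar> powr (p - 1)) * indicator (ball xo r) y * indicator (- ball xo Rb) x) * indicator {a..b} t) < \<infinity>"
proof -
  have [measurable]: "ball xo r \<in> sets borel" "ball xo Rb \<in> sets borel" by auto
  have "(NINT x. NINT y. ennreal (fkernel (s * p) x y * \<bar>V (x, t) - V (y, t)\<bar> powr (p - 1)) * indicator (ball xo r) y * indicator (- ball xo Rb) x)
     = (NINT x. NINT y. ennreal (fkernel (s * p) x y * \<bar>V (x, t) - V (y, t)\<bar> powr (p - 1)) * indicator (ball xo r) x * indicator (- ball xo Rb) y)" for t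
    by (subst lborel_pair.Fubini') (simp_all add: fkernel_commute[of _ _ x for x] abs_minus_commute)
  then show ?thesis using V_far[OF assms] by simp
qed

text \<open>For regular times t - h and t, the slice w(., t) is a bounded admissible test function,
  and (w(t)^2 - w(t-h)^2)/2 <= (V(t) - V(t-h)) w(t). Together with the weak equation on the window
  this bounds the increment of \<Phi>, half the squared L^2 norm plus the accumulated form, by the
  error of replacing w(\<tau>) with w(t). That error is o(h) on average, so \<Phi> does not increase
  from t1 to t2.\<close>

lemma energy_balance:
  assumes ab: "0 < a" "a < t1" "t1 < t2" "t2 < b" "b < T" and t\<Theta>: "t1 \<in> \<Theta>" "t2 \<in> \<Theta>" and r: "0 < r" "r < Rb" and H: "0 \<le> H"
    and [measurable]: "\<psi> \<in> borel_measurable borel"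
    and w: "w = (\<lambda>z. if fst z \<in> ball xo r then max 0 (V z - \<psi> (fst z)) else 0)"
    and bound: "\<And>x t. x \<in> ball xo r \<Longrightarrow> a < t \<Longrightarrow> t < b \<Longrightarrow> V (x, t) \<le> \<psi> x + H"
    and fin: "(NINT t. (NINT x. NINT y. ennreal (fkernel (s * p) x y * \<bar>w (x, t) - w (y, t)\<bar> powr p))
         * indicator {a..b} t) < \<infinity>"
  shows "integrable lborel3 (\<lambda>(x, y, t). indicat_real {t1<..t2} t * (K (x, y, t) * signed_powr p (V (x, t) - V (y, t)) * (w (x, t) - w (y, t))))" (is ?A)
    and "(\<integral>x. (w (x, t2))\<^sup>2 / 2 \<partial>lborel) - (\<integral>x. (w (x, t1))\<^sup>2 / 2 \<partial>lborel) +
      (\<integral>z. (case z of (x, y, t) \<Rightarrow> indicat_real {t1<..t2} t * (K (x, y, t) * signed_powr p (V (x, t) - V (y, t)) * (w (x, t) - w (y, t))))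
         \<partial>lborel3) \<le> 0" (is ?B)
proof -
  let ?M = "lborel3 :: ('a \<times> 'a \<times> real) measure"
  have [measurable]: "ball xo r \<in> sets borel" "ball xo Rb \<in> sets borel" by auto
  have [measurable]: "w \<in> borel_measurable borel2" unfolding w by measurable
  have w0: "0 \<le> w z" for z by (auto simp: w)
  have wH: "w (x, t) \<le> H" if "a < t" "t < b" for x t using bound[of x t] that H by (auto simp: w)
  have wout: "w (x, t) = 0" if "x \<notin> ball xo r" for x t using that by (simp add: w)
  \<comment> \<open>P dominates the flux \<open>Z\<close>. If both points are in the big ball,
    \<open>\<alpha>1\<close> and \<beta> come from Young's inequality with p-th powers. If one is
    outside, w vanishes there, so a nonzero increment forces the other point into
    \<open>ball xo r\<close>; then only the power p - 1 and the bound H enter, giving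
    \<open>\<alpha>2\<close> and \<open>\<alpha>3\<close>.\<close>
  define P where "P = (\<lambda>(x, y, t). C1 * (fkernel (s * p) x y * \<bar>V (x, t) - V (y, t)\<bar> powr (p - 1)))"
  define \<alpha>1 where "\<alpha>1 = (\<lambda>(x, y, t). fkernel (s * p) x y * \<bar>V (x, t) - V (y, t)\<bar> powr p * indicat_real (ball xo Rb) x * indicat_real (ball xo Rb) y)"
  define \<alpha>2 where "\<alpha>2 = (\<lambda>(x, y, t). fkernel (s * p) x y * \<bar>V (x, t) - V (y, t)\<bar> powr (p - 1) * indicat_real (ball xo r) x * indicat_real (- ball xo Rb) y)"
  define \<alpha>3 where "\<alpha>3 = (\<lambda>(x, y, t). fkernel (s * p) x y * \<bar>V (x, t) - V (y, t)\<bar> powr (p - 1) * indicat_real (ball xo r) y * indicat_real (- ball xo Rb) x)"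
  define \<alpha> where "\<alpha> z = C1 * \<alpha>1 z + C1 * H * (\<alpha>2 z + \<alpha>3 z)" for z
  define \<beta> where "\<beta> = (\<lambda>(x, y, t). C1 * (fkernel (s * p) x y * \<bar>w (x, t) - w (y, t)\<bar> powr p))"
  have [measurable]: "P \<in> borel_measurable borel3" "\<alpha>1 \<in> borel_measurable borel3"
    "\<alpha>2 \<in> borel_measurable borel3" "\<alpha>3 \<in> borel_measurable borel3"
    "\<beta> \<in> borel_measurable borel3" unfolding P_def \<alpha>1_def \<alpha>2_def \<alpha>3_def \<beta>_def by measurable
  have [measurable]: "\<alpha> \<in> borel_measurable borel3" unfolding \<alpha>_def[abs_def] by measurable
  have C1: "0 < C1" using Co by simp
  have nn: "0 \<le> P z" "0 \<le> \<alpha>1 z" "0 \<le> \<alpha>2 z" "0 \<le> \<alpha>3 z" "0 \<le> \<beta> z" for z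
    using C1 by (auto simp: P_def \<alpha>1_def \<alpha>2_def \<alpha>3_def \<beta>_def split: prod.splits)
  have nn\<alpha>: "0 \<le> \<alpha> z" for z using nn C1 H by (simp add: \<alpha>_def)
  have young: "P (x, y, \<tau>) * \<bar>w (x, t) - w (y, t)\<bar> \<le> L * \<alpha> (x, y, \<tau>) + L powr (1 - p) * \<beta> (x, y, t)"
    if t: "a < t" "t < b" and L: "1 \<le> L" for x y t \<tau> L
  proof (cases "x \<in> ball xo Rb \<and> y \<in> ball xo Rb")
    case True
    have "\<bar>V (x, \<tau>) - V (y, \<tau>)\<bar> powr (p - 1) * \<bar>w (x, t) - w (y, t)\<bar> \<le> L * \<bar>V (x, \<tau>) - V (y, \<tau>)\<bar> powr p + L powr (1 - p) * \<bar>w (x, t) - w (y, t)\<bar> powr p"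
      using p L by (intro powr_young) auto
    then have "C1 * fkernel (s * p) x y * (\<bar>V (x, \<tau>) - V (y, \<tau>)\<bar> powr (p - 1) * \<bar>w (x, t) - w (y, t)\<bar>) \<le>
       C1 * fkernel (s * p) x y * (L * \<bar>V (x, \<tau>) - V (y, \<tau>)\<bar> powr p + L powr (1 - p) * \<bar>w (x, t) - w (y, t)\<bar> powr p)"
      using C1 by (intro mult_left_mono) auto
    also have "\<dots> = L * (C1 * \<alpha>1 (x, y, \<tau>)) + L powr (1 - p) * \<beta> (x, y, t)"
      using True by (simp add: \<alpha>1_def \<beta>_def algebra_simps)
    also have "\<dots> \<le> L * \<alpha> (x, y, \<tau>) + L powr (1 - p) * \<beta> (x, y, t)"
      using L C1 H nn by (intro add_right_mono mult_left_mono) (auto simp: \<alpha>_def)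
    finally show ?thesis by (simp add: P_def mult_ac)
  next
    case False
    have main: "P (x, y, \<tau>) * \<bar>w (x, t) - w (y, t)\<bar> \<le> \<alpha> (x, y, \<tau>)"
    proof (cases "x \<in> ball xo r \<or> y \<in> ball xo r")
      case True
      have rR: "ball xo r \<subseteq> ball xo Rb" using r by auto
      have "P (x, y, \<tau>) * \<bar>w (x, t) - w (y, t)\<bar> \<le> P (x, y, \<tau>) * H"
        using wH[OF t, of x] wH[OF t, of y] w0[of "(x, t)"] w0[of "(y, t)"] nn by (intro mult_left_mono) auto
      also have "P (x, y, \<tau>) \<le> C1 * (\<alpha>2 (x, y, \<tau>) + \<alpha>3 (x, y, \<tau>))"
        using True False rR by (auto simp: P_def \<alpha>2_def \<alpha>3_def)
      then have "P (x, y, \<tau>) * H \<le> \<alpha> (x, y, \<tau>)"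
        using H C1 nn(2)[of "(x, y, \<tau>)"] mult_right_mono[of "P (x, y, \<tau>)" "C1 * (\<alpha>2 (x, y, \<tau>) + \<alpha>3 (x, y, \<tau>))" H]
        by (simp add: \<alpha>_def add_increasing mult_ac)
      finally show ?thesis .
    next
      case False then show ?thesis using wout nn\<alpha> by simp
    qed
    also have "\<dots> \<le> L * \<alpha> (x, y, \<tau>)" using L nn\<alpha>[of "(x, y, \<tau>)"] mult_right_mono[of 1 L "\<alpha> (x, y, \<tau>)"] by simp
    also have "\<dots> \<le> L * \<alpha> (x, y, \<tau>) + L powr (1 - p) * \<beta> (x, y, t)" using nn by simp
    finally show ?thesis .
  qed
  have f1: "(slab a b \<alpha>1) < \<infinity>"
    using V_gagliardo[OF ab(1,5)] by (simp add: \<alpha>1_def ennreal_mult ennreal_indicator)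
  have f2: "(slab a b \<alpha>2) < \<infinity>"
    using V_far[OF ab(1,5) r] by (simp add: \<alpha>2_def ennreal_mult ennreal_indicator)
  have f3: "(slab a b \<alpha>3) < \<infinity>"
    using V_far_swap[OF ab(1,5) r] by (simp add: \<alpha>3_def ennreal_mult ennreal_indicator)
  have fin\<alpha>: "(slab a b \<alpha>) < \<infinity>"
  proof -
    have e: "ennreal (\<alpha> z) = ennreal C1 * ennreal (\<alpha>1 z) + ennreal (C1 * H) * (ennreal (\<alpha>2 z) + ennreal (\<alpha>3 z))" for z
      unfolding \<alpha>_def using nn C1 H by (simp add: ennreal_mult[symmetric] ennreal_plus[symmetric] del: ennreal_plus)
    have "(slab a b \<alpha>) =
      ennreal C1 * (slab a b \<alpha>1) +
      ennreal (C1 * H) * ((slab a b \<alpha>2)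
        + (slab a b \<alpha>3))"
      unfolding e by (simp add: nn_integral_add nn_integral_cmult distrib_right mult.assoc)
    also have "\<dots> < \<infinity>" using f1 f2 f3 by (simp add: ennreal_mult_less_top ennreal_add_less_top)
    finally show ?thesis .
  qed
  have fin\<beta>: "(slab a b \<beta>) < \<infinity>"
  proof -
    have "(slab a b \<beta>) =
      ennreal C1 * (NINT t. (NINT x. NINT y. ennreal (fkernel (s * p) x y * \<bar>w (x, t) - w (y, t)\<bar> powr p)) * indicator {a..b} t)"
      using C1 by (simp add: \<beta>_def ennreal_mult[of C1] nn_integral_cmult mult.assoc)
    also have "\<dots> < \<infinity>" using fin by (simp add: ennreal_mult_less_top)
    finally show ?thesis .
  qed
  have Th: "AE t in lborel. a < t \<and> t < b \<longrightarrow> t \<in> \<Theta>" using \<Theta>_AE ab by (auto elim!: eventually_mono)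
  have contw: "\<And>\<epsilon>. 0 < \<epsilon> \<Longrightarrow> \<exists>d>0. \<forall>t\<in>\<Theta>. \<forall>\<tau>\<in>\<Theta>. a < t \<and> t < b \<and> a < \<tau> \<and> \<tau> < b \<and> \<bar>t - \<tau>\<bar> < d \<longrightarrow>
        (NINT x. ennreal \<bar>w (x, t) - w (x, \<tau>)\<bar>) \<le> ennreal \<epsilon>" using ab r w by (intro truncation_time_continuous) auto
  define Z where "Z = (\<lambda>(x, y, t). K (x, y, t) * signed_powr p (V (x, t) - V (y, t)))"
  have [measurable]: "Z \<in> borel_measurable borel3" unfolding Z_def by measurable
  have ZP: "AE t in lborel. a \<le> t \<and> t \<le> b \<longrightarrow> (AE x in lborel. AE y in lborel. \<bar>Z (x, y, t)\<bar> \<le> P (x, y, t))"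
    using K_bounds
  proof eventually_elim
    case (elim t)
    show ?case
    proof
      assume "a \<le> t \<and> t \<le> b"
      then have "AE x in lborel. AE y in lborel. between Co C1 (s * p) K x y t"
        using elim ab by auto
      then show "AE x in lborel. AE y in lborel. \<bar>Z (x, y, t)\<bar> \<le> P (x, y, t)"
      proof (rule eventually_mono, goal_cases)
        case (1 x) then show ?case
        proof (rule eventually_mono, goal_cases)
          case (1 y)
          have "0 \<le> Co * fkernel (s * p) x y" using Co by (intro mult_nonneg_nonneg) auto
          then have "0 \<le> K (x, y, t)" using 1 by linarith
          then show ?case using 1 by (simp add: Z_def P_def abs_mult abs_signed_powr mult_right_mono mult.assoc[symmetric])
        qed
      qed
    qed
  qed
  define D where "D = (\<lambda>(x, y, t). Z (x, y, t) * (w (x, t) - w (y, t)))"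
  have [measurable]: "D \<in> borel_measurable borel3" unfolding D_def by measurable
  let ?E = "\<lambda>u v z. indicat_real {u<..v} (snd (snd z)) * D z"
  have intD: "integrable ?M (\<lambda>z. ?E u v z)" if "a \<le> u" "v < b" for u v
  proof (rule integrableI_bounded)
    have "(\<integral>\<^sup>+ z. ennreal (norm (?E u v z)) \<partial>?M) =
       (NINT t. NINT x. NINT y. ennreal \<bar>D (x, y, t)\<bar> * indicator {u<..v} t)"
      by (subst nn_integral_triple) (auto simp: abs_mult ennreal_mult indicator_def intro!: nn_integral_cong)
    also have "\<dots> \<le> (NINT t. (NINT x. NINT y. ennreal (\<alpha> (x, y, t)) + ennreal (\<beta> (x, y, t))) * indicator {a..b} t)"
    proof (rule nn_integral_mono_AE)
      show "AE t in lborel. (NINT x. NINT y. ennreal \<bar>D (x, y, t)\<bar> * indicator {u<..v} t) \<le>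
         (NINT x. NINT y. ennreal (\<alpha> (x, y, t)) + ennreal (\<beta> (x, y, t))) * indicator {a..b} t" using ZP
      proof eventually_elim
        case (elim t)
        show ?case
        proof (cases "t \<in> {u<..v}")
          case True
          then have t: "a < t" "t < b" "t \<in> {a..b}" using that by auto
          have "AE x in lborel. AE y in lborel. \<bar>Z (x, y, t)\<bar> \<le> P (x, y, t)" using elim t by auto
          then have "AE x in lborel. (NINT y. ennreal \<bar>D (x, y, t)\<bar>) \<le> (NINT y. ennreal (\<alpha> (x, y, t)) + ennreal (\<beta> (x, y, t)))"
          proof (rule eventually_mono, intro nn_integral_mono_AE)
            fix x assume "AE y in lborel. \<bar>Z (x, y, t)\<bar> \<le> P (x, y, t)"
            then show "AE y in lborel. ennreal \<bar>D (x, y, t)\<bar> \<le> ennreal (\<alpha> (x, y, t)) + ennreal (\<beta> (x, y, t))"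
            proof (rule eventually_mono)
              fix y assume "\<bar>Z (x, y, t)\<bar> \<le> P (x, y, t)"
              then have "\<bar>D (x, y, t)\<bar> \<le> P (x, y, t) * \<bar>w (x, t) - w (y, t)\<bar>" by (simp add: D_def abs_mult mult_right_mono)
              also have "\<dots> \<le> \<alpha> (x, y, t) + \<beta> (x, y, t)" using young[OF t(1,2), of 1 x y t] by simp
              finally show "ennreal \<bar>D (x, y, t)\<bar> \<le> ennreal (\<alpha> (x, y, t)) + ennreal (\<beta> (x, y, t))"
                using nn nn\<alpha> by (simp add: ennreal_plus[symmetric] ennreal_leI del: ennreal_plus)
            qed
          qed
          then show ?thesis using True t by (auto intro!: nn_integral_mono_AE)
        qed simp
      qed
    qed
    also have "\<dots> = (slab a b \<alpha>) +
       (slab a b \<beta>)" by (simp add: nn_integral_add distrib_right)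
    also have "\<dots> < \<infinity>" using fin\<alpha> fin\<beta> by simp
    finally show "(\<integral>\<^sup>+ z. ennreal (norm (?E u v z)) \<partial>?M) < \<infinity>" .
  qed measurable
  have caseD: "(\<lambda>(x, y, t). indicat_real {u<..v} t * (K (x, y, t) * signed_powr p (V (x, t) - V (y, t)) * (w (x, t) - w (y, t)))) =
     (\<lambda>z. ?E u v z)" for u v by (auto simp: fun_eq_iff D_def Z_def)
  show ?A unfolding caseD using intD[of t1 t2] ab by auto
  \<comment> \<open>Integrability of the form is available for end times below b. Stopping the
    accumulated form J at \<open>b'\<close> makes it a bounded continuous function on the whole
    line.\<close>
  define b' where "b' = (t2 + b) / 2"
  have b': "t2 < b'" "b' < b" using ab by (auto simp: b'_def)
  define J where "J t = (\<integral>z. ?E a (min t b') z \<partial>?M)" for t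
  have J_diff: "J v - J u = (\<integral>z. ?E u v z \<partial>?M)" if "a \<le> u" "u \<le> v" "v \<le> b'" for u v
  proof -
    have "J v - J u = (\<integral>z. ?E a v z - ?E a u z \<partial>?M)"
      unfolding J_def using that intD[of a v] intD[of a u] b' by (simp add: min_absorb1)
    also have "\<dots> = (\<integral>z. ?E u v z \<partial>?M)"
      using that by (intro Bochner_Integration.integral_cong) (auto simp: indicator_def)
    finally show ?thesis .
  qed
  have J_cont: "isCont J t" for t
  proof (rule continuous_at_sequentiallyI)
    fix u :: "nat \<Rightarrow> real" assume u: "u \<longlonglongrightarrow> t"
    show "(\<lambda>n. J (u n)) \<longlonglongrightarrow> J t" unfolding J_def
    proof (rule integral_dominated_convergence[where w = "\<lambda>z. \<bar>?E a b' z\<bar>"])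
      show "integrable ?M (\<lambda>z. \<bar>?E a b' z\<bar>)" using intD[of a b'] b' by auto
      show "AE z in ?M. norm (?E a (min (u n) b') z) \<le> \<bar>?E a b' z\<bar>" for n
        by (auto simp: indicator_def)
      \<comment> \<open>The indicators can fail to converge only on the slice at time t, which is a
        null set.\<close>
      show "AE z in ?M. (\<lambda>n. ?E a (min (u n) b') z) \<longlonglongrightarrow> ?E a (min t b') z"
        using AE_time_neq_triple[of t]
      proof eventually_elim
        fix z :: "'a \<times> 'a \<times> real" assume z: "snd (snd z) \<noteq> t"
        have "\<forall>\<^sub>F n in sequentially. ?E a (min (u n) b') z = ?E a (min t b') z"
        proof (cases "snd (snd z) < t")
          case True
          show ?thesis using order_tendstoD(1)[OF u True] by eventually_elim (use True in \<open>auto simp: indicator_def\<close>)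
        next
          case False
          then have "t < snd (snd z)" using z by simp
          from order_tendstoD(2)[OF u this] show ?thesis by eventually_elim (use \<open>t < snd (snd z)\<close> in \<open>auto simp: indicator_def\<close>)
        qed
        then show "(\<lambda>n. ?E a (min (u n) b') z) \<longlonglongrightarrow> ?E a (min t b') z"
          by (rule tendsto_eventually)
      qed
    qed measurable
  qed
  define G where "G t = (\<integral>x. (w (x, t))\<^sup>2 / 2 \<partial>lborel)" for t
  have intG: "integrable lborel (\<lambda>x. (w (x, t))\<^sup>2 / 2)" if "a < t" "t < b" for t
  proof (rule integrableI_bounded_set[where A = "ball xo r" and B = "H\<^sup>2 / 2"])
    show "emeasure lborel (ball xo r) < \<infinity>" by (rule emeasure_lborel_ball_finite)
    show "AE x\<in>ball xo r in lborel. norm ((w (x, t))\<^sup>2 / 2) \<le> H\<^sup>2 / 2" using wH[OF that] w0 by (auto intro!: power_mono)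
  qed (auto simp: wout)
  have intw: "integrable lborel (\<lambda>x. w (x, t))" if "a < t" "t < b" for t using wH[OF that] w0 wout
    by (intro integrableI_bounded_set[where A = "ball xo r" and B = "H"]) (auto intro: emeasure_lborel_ball_finite[unfolded infinity_ennreal_def])
  define vol where "vol = measure lborel (ball xo r)"
  have Gb: "\<bar>G t\<bar> \<le> H\<^sup>2 / 2 * vol" if "a < t" "t < b" for t
  proof -
    have "0 \<le> G t" unfolding G_def by (intro integral_nonneg_AE) auto
    moreover have "G t \<le> (\<integral>x. indicat_real (ball xo r) x * (H\<^sup>2 / 2) \<partial>lborel)" unfolding G_def
    proof (rule integral_mono[OF intG[OF that]])
      show "integrable lborel (\<lambda>x. indicat_real (ball xo r) x * (H\<^sup>2 / 2))"
        by (intro integrable_mult_left integrable_real_indicator) (auto intro: emeasure_lborel_ball_finite[unfolded infinity_ennreal_def])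
      show "(w (x, t))\<^sup>2 / 2 \<le> indicat_real (ball xo r) x * (H\<^sup>2 / 2)" for x
        using wH[OF that, of x] w0[of "(x, t)"] wout[of x t] by (auto simp: indicator_def intro!: power_mono)
    qed
    ultimately show ?thesis by (simp add: vol_def mult.commute)
  qed
  have Gcont: "\<exists>d>0. \<forall>t\<in>\<Theta>. \<bar>t - c\<bar> < d \<longrightarrow> \<bar>G t - G c\<bar> \<le> \<epsilon>" if c: "c \<in> \<Theta>" "a < c" "c < b" and e: "0 < \<epsilon>" for c \<epsilon>
  proof -
    obtain d where d: "0 < d" "\<And>t. t \<in> \<Theta> \<Longrightarrow> a < t \<Longrightarrow> t < b \<Longrightarrow> \<bar>t - c\<bar> < d \<Longrightarrow>
        (NINT x. ennreal \<bar>w (x, t) - w (x, c)\<bar>) \<le> ennreal (\<epsilon> / (H + 1))"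
      using contw[of "\<epsilon> / (H + 1)"] e H c by (auto simp: divide_pos_pos)
    define d' where "d' = min d (min (c - a) (b - c))"
    have "0 < d'" using d c by (simp add: d'_def)
    moreover have "\<bar>G t - G c\<bar> \<le> \<epsilon>" if t: "t \<in> \<Theta>" "\<bar>t - c\<bar> < d'" for t
    proof -
      have tab: "a < t" "t < b" "\<bar>t - c\<bar> < d" using t by (auto simp: d'_def)
      have iw: "integrable lborel (\<lambda>x. \<bar>w (x, t) - w (x, c)\<bar>)" using intw[OF tab(1,2)] intw[OF c(2,3)] by simp
      have "ennreal (\<integral>x. \<bar>w (x, t) - w (x, c)\<bar> \<partial>lborel) \<le> ennreal (\<epsilon> / (H + 1))"
        using d(2)[OF t(1) tab] iw by (simp add: nn_integral_eq_integral)
      then have small: "(\<integral>x. \<bar>w (x, t) - w (x, c)\<bar> \<partial>lborel) \<le> \<epsilon> / (H + 1)" using e H by (subst (asm) ennreal_le_iff) auto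
      have "\<bar>G t - G c\<bar> = \<bar>\<integral>x. (w (x, t))\<^sup>2 / 2 - (w (x, c))\<^sup>2 / 2 \<partial>lborel\<bar>"
        unfolding G_def using intG[OF tab(1,2)] intG[OF c(2,3)] by simp
      also have "\<dots> \<le> (\<integral>x. H * \<bar>w (x, t) - w (x, c)\<bar> \<partial>lborel)"
      proof (rule integral_abs_bound[THEN order_trans], rule integral_mono)
        fix x
        have "(w (x, t))\<^sup>2 / 2 - (w (x, c))\<^sup>2 / 2 = (w (x, t) + w (x, c)) / 2 * (w (x, t) - w (x, c))"
          by (simp add: power2_eq_square field_simps)
        moreover have "(w (x, t) + w (x, c)) / 2 \<le> H" using wH[OF tab(1,2), of x] wH[OF c(2,3), of x] by simp
        ultimately show "\<bar>(w (x, t))\<^sup>2 / 2 - (w (x, c))\<^sup>2 / 2\<bar> \<le> H * \<bar>w (x, t) - w (x, c)\<bar>"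
          using w0[of "(x, t)"] w0[of "(x, c)"] by (simp only: abs_mult) (intro mult_right_mono, auto)
      qed (use intG[OF tab(1,2)] intG[OF c(2,3)] iw in auto)
      also have "\<dots> = H * (\<integral>x. \<bar>w (x, t) - w (x, c)\<bar> \<partial>lborel)" by simp
      also have "\<dots> \<le> H * (\<epsilon> / (H + 1))" using small H by (rule mult_left_mono)
      also have "\<dots> \<le> \<epsilon>" using H e by (simp add: field_simps)
      finally show ?thesis .
    qed
    ultimately show ?thesis by blast
  qed
  define \<Phi> where "\<Phi> t = G t + J t" for t
  define Rm where "Rm h t = (NINT \<tau>. (NINT x. NINT y. ennreal (P (x, y, \<tau>) * \<bar>(w (x, t) - w (y, t)) - (w (x, \<tau>) - w (y, \<tau>))\<bar>))
       * indicator {t - h..t} \<tau>)" for h t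
  have "\<Phi> t2 \<le> \<Phi> t1"
  proof (rule increment_le_of_window_average[where \<Phi> = \<Phi> and ?t1.0 = t1 and ?t2.0 = t2 and a = a and b = b' and \<Theta> = \<Theta> and R = Rm and B = "H\<^sup>2 / 2 * vol + (\<integral>z. \<bar>?E a b' z\<bar> \<partial>?M)"])
    have "continuous_on UNIV J" using J_cont by (simp add: continuous_on_eq_continuous_at)
    then have "J \<in> borel_measurable borel" by (rule borel_measurable_continuous_onI)
    moreover have "G \<in> borel_measurable borel" unfolding G_def[abs_def] by measurable
    ultimately show "\<Phi> \<in> borel_measurable borel" unfolding \<Phi>_def[abs_def] by measurable
    show "AE t in lborel. a < t \<and> t < b' \<longrightarrow> t \<in> \<Theta>" using Th b' by (auto elim!: eventually_mono)
    show "\<bar>\<Phi> t\<bar> \<le> H\<^sup>2 / 2 * vol + (\<integral>z. \<bar>?E a b' z\<bar> \<partial>?M)" if "a < t" "t < b'" for t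
    proof -
      have "\<bar>J t\<bar> \<le> (\<integral>z. \<bar>?E a b' z\<bar> \<partial>?M)"
        unfolding J_def using intD[of a t] intD[of a b'] that b'
        by (intro integral_abs_bound[THEN order_trans] integral_mono) (auto simp: indicator_def min_def)
      then show ?thesis using Gb[of t] that b' unfolding \<Phi>_def by linarith
    qed
    have "\<exists>d>0. \<forall>t\<in>\<Theta>. \<bar>t - c\<bar> < d \<longrightarrow> \<bar>\<Phi> t - \<Phi> c\<bar> \<le> \<epsilon>" if ce: "c \<in> \<Theta>" "a < c" "c < b" "0 < \<epsilon>" for c \<epsilon>
    proof -
      have e2: "0 < \<epsilon> / 2" using ce by simp
      obtain d1 where d1: "0 < d1" "\<And>t. t \<in> \<Theta> \<Longrightarrow> \<bar>t - c\<bar> < d1 \<Longrightarrow> \<bar>G t - G c\<bar> \<le> \<epsilon> / 2"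
        using Gcont[OF ce(1-3) e2] by blast
      obtain d2 where d2: "0 < d2" "\<And>t. \<bar>t - c\<bar> < d2 \<Longrightarrow> \<bar>J t - J c\<bar> < \<epsilon> / 2"
        using J_cont[of c, unfolded continuous_at_eps_delta dist_real_def] e2 by blast
      show ?thesis
      proof (intro exI[of _ "min d1 d2"] conjI ballI impI)
        fix t assume t: "t \<in> \<Theta>" "\<bar>t - c\<bar> < min d1 d2"
        from t have "\<bar>t - c\<bar> < d1" "\<bar>t - c\<bar> < d2" by simp_all
        from d1(2)[OF t(1) this(1)] d2(2)[OF this(2)]
        show "\<bar>\<Phi> t - \<Phi> c\<bar> \<le> \<epsilon>" unfolding \<Phi>_def by linarith
      qed (use d1 d2 in auto)
    qed
    from this[of t1] this[of t2]
    show "\<And>\<epsilon>. 0 < \<epsilon> \<Longrightarrow> \<exists>d>0. \<forall>t\<in>\<Theta>. \<bar>t - t1\<bar> < d \<longrightarrow> \<bar>\<Phi> t - \<Phi> t1\<bar> \<le> \<epsilon>"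
      "\<And>\<epsilon>. 0 < \<epsilon> \<Longrightarrow> \<exists>d>0. \<forall>t\<in>\<Theta>. \<bar>t - t2\<bar> < d \<longrightarrow> \<bar>\<Phi> t - \<Phi> t2\<bar> \<le> \<epsilon>"
      using t\<Theta> ab by auto
    show "\<exists>h0>0. \<forall>h. 0 < h \<and> h < h0 \<longrightarrow> (NINT t. Rm h t * indicator {t1..t2} t) \<le> ennreal (\<epsilon> * h)" if "0 < \<epsilon>" for \<epsilon>
      unfolding Rm_def
      by (rule time_shift_remainder[where \<alpha> = \<alpha> and \<beta> = \<beta> and p = p and a = a and b = b and \<Theta> = \<Theta>])
         (use nn nn\<alpha> p young fin\<alpha> fin\<beta> Th contw ab that in \<open>auto\<close>)
    show "AE t in lborel. t1 \<le> t \<and> t \<le> t2 \<longrightarrow> ennreal (\<Phi> t - \<Phi> (t - h)) \<le> Rm h t" if h: "0 < h" "h < t1 - a" for h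
    proof -
      \<comment> \<open>Both ends of the window have to be regular times; translates of null sets
        are null.\<close>
      have "AE t in lborel. t - h \<in> (\<Theta> \<union> - {a<..<b})"
      proof -
        have "AE t in lborel. t \<in> \<Theta> \<union> - {a<..<b}" using Th by eventually_elim auto
        then obtain N where N: "N \<in> null_sets lborel" "{t. t \<notin> \<Theta> \<union> - {a<..<b}} \<subseteq> N"
          by (auto simp: eventually_ae_filter)
        show ?thesis using N(2) by (intro AE_I'[OF null_sets_translation[OF N(1), of h]]) auto
      qed
      moreover have "AE t in lborel. (NINT x. NINT y. ennreal (fkernel (s * p) x y * \<bar>w (x, t) - w (y, t)\<bar> powr p)) * indicator {a..b} t \<noteq> \<infinity>"
        using fin by (intro nn_integral_PInf_AE) auto
      ultimately show ?thesis using Th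
      proof eventually_elim
        case (elim t)
        show ?case
        proof
          assume t: "t1 \<le> t \<and> t \<le> t2"
          have tt: "a < t" "t < b" "a < t - h" "t - h < b" "t - h < t" "t \<le> b'" using t h ab b' by auto
          have t\<Theta>: "t \<in> \<Theta>" "t - h \<in> \<Theta>" using elim tt by auto
          have gg: "(NINT x. NINT y. ennreal (fkernel (s * p) x y * \<bar>w (x, t) - w (y, t)\<bar> powr p)) < \<infinity>"
            using elim(2) tt by (auto simp: less_top)
          let ?I = "\<lambda>z. (case z of (x, y, \<tau>) \<Rightarrow> indicat_real {t - h<..t} \<tau> * (K (x, y, \<tau>) * signed_powr p (V (x, \<tau>) - V (y, \<tau>)) * (w (x, t) - w (y, t))))"
          have "(\<lambda>x. w (x, t)) \<in> borel_measurable borel" by measurable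
          from weak_eq[OF t\<Theta>(2,1) tt(5) r this, of H] gg w0 wH[OF tt(1,2)] wout
          have I1: "integrable lborel (\<lambda>x. V (x, t - h) * w (x, t))" and I2: "integrable lborel (\<lambda>x. V (x, t) * w (x, t))"
            and I3: "integrable ?M ?I"
            and eq: "(\<integral>x. V (x, t) * w (x, t) \<partial>lborel) - (\<integral>x. V (x, t - h) * w (x, t) \<partial>lborel) + (\<integral>z. ?I z \<partial>?M) = 0"
            by auto
          have "G t - G (t - h) = (\<integral>x. (w (x, t))\<^sup>2 / 2 - (w (x, t - h))\<^sup>2 / 2 \<partial>lborel)"
            unfolding G_def using intG tt by simp
          also have "\<dots> \<le> (\<integral>x. V (x, t) * w (x, t) - V (x, t - h) * w (x, t) \<partial>lborel)"
          proof (rule integral_mono)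
            fix x
            show "(w (x, t))\<^sup>2 / 2 - (w (x, t - h))\<^sup>2 / 2 \<le> V (x, t) * w (x, t) - V (x, t - h) * w (x, t)"
            proof (cases "0 < w (x, t)")
              case True
              then have x: "x \<in> ball xo r" using wout by force
              \<comment> \<open>At time t, V equals the level plus w, whereas at time t - h it is at
                most that. Hence V grows at least as much as w; the rest is 2 a b <= a^2 +
                b^2.\<close>
              have "V (x, t) = \<psi> x + w (x, t)" using True x by (auto simp: w)
              moreover have "V (x, t - h) \<le> \<psi> x + w (x, t - h)" using x by (auto simp: w)
              ultimately have "(w (x, t) - w (x, t - h)) * w (x, t) \<le> (V (x, t) - V (x, t - h)) * w (x, t)"
                using True by (intro mult_right_mono) auto
              moreover have "(w (x, t))\<^sup>2 / 2 - (w (x, t - h))\<^sup>2 / 2 \<le> (w (x, t) - w (x, t - h)) * w (x, t)"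
                using zero_le_power2[of "w (x, t) - w (x, t - h)"] by (simp add: power2_eq_square algebra_simps)
              ultimately show ?thesis by (simp add: algebra_simps)
            next
              case False then show ?thesis using w0[of "(x, t)"] by simp
            qed
          qed (use intG tt I1 I2 in auto)
          also have "\<dots> = - (\<integral>z. ?I z \<partial>?M)" using I1 I2 eq by simp
          finally have G1: "G t - G (t - h) \<le> - (\<integral>z. ?I z \<partial>?M)" .
          have ID: "integrable ?M (\<lambda>z. ?E (t - h) t z)" using intD tt by auto
          have "\<Phi> t - \<Phi> (t - h) \<le> (\<integral>z. ?E (t - h) t z \<partial>?M) - (\<integral>z. ?I z \<partial>?M)"
            using G1 J_diff[of "t - h" t] tt unfolding \<Phi>_def by linarith
          also have "\<dots> = (\<integral>z. ?E (t - h) t z - ?I z \<partial>?M)" using ID I3 by simp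
          also have "\<dots> \<le> norm (\<integral>z. ?E (t - h) t z - ?I z \<partial>?M)" by simp
          finally have "ennreal (\<Phi> t - \<Phi> (t - h)) \<le> ennreal (norm (\<integral>z. ?E (t - h) t z - ?I z \<partial>?M))"
            by (rule ennreal_leI)
          also have "\<dots> \<le> (\<integral>\<^sup>+ z. ennreal (norm (?E (t - h) t z - ?I z)) \<partial>?M)"
            using ID I3 by (intro integral_norm_bound_ennreal) simp
          also have "\<dots> = (NINT \<tau>. NINT x. NINT y. ennreal (norm (indicat_real {t - h<..t} \<tau> * D (x, y, \<tau>) - ?I (x, y, \<tau>))))"
            by (subst nn_integral_triple) auto
          also have "\<dots> \<le> Rm h t" unfolding Rm_def
          proof (rule nn_integral_mono_AE)
            show "AE \<tau> in lborel. (NINT x. NINT y. ennreal (norm (indicat_real {t - h<..t} \<tau> * D (x, y, \<tau>) - ?I (x, y, \<tau>))))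
               \<le> (NINT x. NINT y. ennreal (P (x, y, \<tau>) * \<bar>(w (x, t) - w (y, t)) - (w (x, \<tau>) - w (y, \<tau>))\<bar>)) * indicator {t - h..t} \<tau>"
              using ZP
            proof eventually_elim
              case (elim \<tau>)
              show ?case
              proof (cases "\<tau> \<in> {t - h<..t}")
                case True
                then have "AE x in lborel. AE y in lborel. \<bar>Z (x, y, \<tau>)\<bar> \<le> P (x, y, \<tau>)" using elim tt by auto
                then have "AE x in lborel. (NINT y. ennreal (norm (indicat_real {t - h<..t} \<tau> * D (x, y, \<tau>) - ?I (x, y, \<tau>))))
                  \<le> (NINT y. ennreal (P (x, y, \<tau>) * \<bar>(w (x, t) - w (y, t)) - (w (x, \<tau>) - w (y, \<tau>))\<bar>))"
                proof (rule eventually_mono, intro nn_integral_mono_AE)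
                  fix x assume "AE y in lborel. \<bar>Z (x, y, \<tau>)\<bar> \<le> P (x, y, \<tau>)"
                  then show "AE y in lborel. ennreal (norm (indicat_real {t - h<..t} \<tau> * D (x, y, \<tau>) - ?I (x, y, \<tau>))) \<le> ennreal (P (x, y, \<tau>) * \<bar>(w (x, t) - w (y, t)) - (w (x, \<tau>) - w (y, \<tau>))\<bar>)"
                  proof (rule eventually_mono, intro ennreal_leI)
                    fix y assume Z: "\<bar>Z (x, y, \<tau>)\<bar> \<le> P (x, y, \<tau>)"
                    have e: "indicat_real {t - h<..t} \<tau> * D (x, y, \<tau>) - ?I (x, y, \<tau>) = - (Z (x, y, \<tau>) * ((w (x, t) - w (y, t)) - (w (x, \<tau>) - w (y, \<tau>))))"
                      using True by (simp add: D_def Z_def algebra_simps)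
                    show "norm (indicat_real {t - h<..t} \<tau> * D (x, y, \<tau>) - ?I (x, y, \<tau>)) \<le> P (x, y, \<tau>) * \<bar>(w (x, t) - w (y, t)) - (w (x, \<tau>) - w (y, \<tau>))\<bar>"
                      unfolding e real_norm_def abs_minus_cancel abs_mult by (rule mult_right_mono[OF Z abs_ge_zero])
                  qed
                qed
                then show ?thesis using True by (auto intro!: nn_integral_mono_AE)
              next
                case False then show ?thesis by simp
              qed
            qed
          qed
          finally show "ennreal (\<Phi> t - \<Phi> (t - h)) \<le> Rm h t" .
        qed
      qed
    qed
  qed (use ab b' in auto)
  moreover have "J t2 - J t1 = (\<integral>z. ?E t1 t2 z \<partial>?M)" using ab b' by (intro J_diff) auto
  ultimately show ?B unfolding caseD \<Phi>_def G_def by linarith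
qed

end

section \<open>Level set estimates\<close>

definition slice_meas :: "('a::euclidean_space \<times> real \<Rightarrow> real) \<Rightarrow> 'a \<Rightarrow> real \<Rightarrow> real \<Rightarrow> real \<Rightarrow> real" where
  "slice_meas V xo \<kappa> \<rho> t = measure lborel {x \<in> ball xo \<rho>. \<kappa> < V (x, t)}"

definition cyl_meas :: "('a::euclidean_space \<times> real \<Rightarrow> real) \<Rightarrow> 'a \<Rightarrow> real \<Rightarrow> real \<Rightarrow> real \<Rightarrow> real \<Rightarrow> real" where
  "cyl_meas V xo \<kappa> \<rho> t1 t2 = measure lborel2 {z. fst z \<in> ball xo \<rho> \<and> t1 < snd z \<and> snd z \<le> t2 \<and> \<kappa> < V z}"

lemma emeasure_ball_less_top: "emeasure lborel (ball (x :: 'a::euclidean_space) r) < top"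
  using emeasure_lborel_ball_finite[of x r] by simp

lemma slice_set_measurable:
  fixes V :: "'a::euclidean_space \<times> real \<Rightarrow> real"
  assumes [measurable]: "V \<in> borel_measurable borel2"
  shows "{x \<in> ball xo \<rho>. \<kappa> < V (x, t)} \<in> sets borel"
proof -
  have [measurable]: "ball xo \<rho> \<in> sets borel" by simp
  have "Measurable.pred borel (\<lambda>x. x \<in> ball xo \<rho> \<and> \<kappa> < V (x, t))" by measurable
  then show ?thesis by (simp add: pred_def del: mem_ball)
qed

lemma emeasure_slice:
  assumes [measurable]: "V \<in> borel_measurable borel2"
  shows "emeasure lborel {x \<in> ball (xo :: 'a::euclidean_space) \<rho>. \<kappa> < V (x, t)} = ennreal (slice_meas V xo \<kappa> \<rho> t)"
proof -
  have "emeasure lborel {x \<in> ball xo \<rho>. \<kappa> < V (x, t)} \<le> emeasure lborel (ball xo \<rho>)" by (rule emeasure_mono) auto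
  also have "\<dots> < top" by (rule emeasure_ball_less_top)
  finally show ?thesis unfolding slice_meas_def by (intro emeasure_eq_ennreal_measure) simp
qed

lemma slice_meas_nonneg: "0 \<le> slice_meas V xo \<kappa> \<rho> t"
  by (simp add: slice_meas_def)

lemma cyl_meas_nonneg: "0 \<le> cyl_meas V xo \<kappa> \<rho> t1 t2"
  by (simp add: cyl_meas_def)

lemma cyl_set_measurable:
  fixes V :: "'a::euclidean_space \<times> real \<Rightarrow> real"
  assumes [measurable]: "V \<in> borel_measurable borel2"
  shows "{z. fst z \<in> ball xo \<rho> \<and> t1 < snd z \<and> snd z \<le> t2 \<and> \<kappa> < V z} \<in> sets borel2"
proof -
  have [measurable]: "ball xo \<rho> \<in> sets borel" by simp
  have "Measurable.pred borel2 (\<lambda>z. fst z \<in> ball xo \<rho> \<and> t1 < snd z \<and> snd z \<le> t2 \<and> \<kappa> < V z)" by measurable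
  then show ?thesis by (simp add: pred_def space_pair_measure del: mem_ball)
qed

lemma emeasure_cyl_nn_integral:
  assumes [measurable]: "V \<in> borel_measurable borel2"
  shows "emeasure lborel2 {z. fst z \<in> ball (xo :: 'a::euclidean_space) \<rho> \<and> t1 < snd z \<and> snd z \<le> t2 \<and> \<kappa> < V z}
     = (NINT t. ennreal (slice_meas V xo \<kappa> \<rho> t) * indicator {t1<..t2} t)"
proof -
  let ?S = "{z. fst z \<in> ball xo \<rho> \<and> t1 < snd z \<and> snd z \<le> t2 \<and> \<kappa> < V z}"
  have [measurable]: "?S \<in> sets borel2" by (rule cyl_set_measurable) simp
  have S2: "?S \<in> sets lborel2" by (simp del: mem_ball)
  have "emeasure lborel2 ?S = (\<integral>\<^sup>+ z. indicator ?S z \<partial>lborel2)" by (rule nn_integral_indicator[symmetric]) (rule S2)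
  also have "\<dots> = (NINT t. NINT x. indicator ?S (x, t))"
    by (rule lborel_pair.nn_integral_snd[symmetric, where f = "indicator ?S"]) (rule borel_measurable_indicator[OF S2])
  also have "\<dots> = (NINT t. (NINT x. indicator {x \<in> ball xo \<rho>. \<kappa> < V (x, t)} x * indicator {t1<..t2} t))"
    by (intro nn_integral_cong) (auto simp: indicator_def)
  also have "\<dots> = (NINT t. ennreal (slice_meas V xo \<kappa> \<rho> t) * indicator {t1<..t2} t)"
  proof (intro nn_integral_cong)
    fix t
    have [measurable]: "{x \<in> ball xo \<rho>. \<kappa> < V (x, t)} \<in> sets borel" by (rule slice_set_measurable) simp
    show "(NINT x. indicator {x \<in> ball xo \<rho>. \<kappa> < V (x, t)} x * indicator {t1<..t2} t) = ennreal (slice_meas V xo \<kappa> \<rho> t) * indicator {t1<..t2} t"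
      by (subst nn_integral_multc) (simp_all add: emeasure_slice del: mem_ball)
  qed
  finally show ?thesis .
qed

lemma slice_meas_le_ball:
  assumes "V \<in> borel_measurable borel2"
  shows "slice_meas V (xo :: 'a::euclidean_space) \<kappa> \<rho> t \<le> measure lborel (ball xo \<rho>)"
  unfolding slice_meas_def using emeasure_ball_less_top[of xo \<rho>]
  by (intro measure_mono_fmeasurable) (auto simp: fmeasurable_def slice_set_measurable[OF assms] simp del: mem_ball)

lemma emeasure_cyl:
  assumes [measurable]: "V \<in> borel_measurable borel2"
  shows "emeasure lborel2 {z. fst z \<in> ball (xo :: 'a::euclidean_space) \<rho> \<and> t1 < snd z \<and> snd z \<le> t2 \<and> \<kappa> < V z} = ennreal (cyl_meas V xo \<kappa> \<rho> t1 t2)"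
proof -
  have "(NINT t. ennreal (slice_meas V xo \<kappa> \<rho> t) * indicator {t1<..t2} t) \<le>
     (NINT t. ennreal (measure lborel (ball xo \<rho>)) * indicator {t1<..t2} t)"
    by (intro nn_integral_mono mult_right_mono ennreal_leI slice_meas_le_ball) auto
  also have "\<dots> = ennreal (measure lborel (ball xo \<rho>)) * emeasure lborel {t1<..t2}" by (subst nn_integral_cmult_indicator) auto
  also have "\<dots> < top" using emeasure_bounded_finite[of "{t1<..t2}"] by (auto simp: ennreal_mult_less_top)
  finally show ?thesis unfolding cyl_meas_def by (intro emeasure_eq_ennreal_measure) (simp add: emeasure_cyl_nn_integral del: mem_ball)
qed

lemma nn_integral_slice_meas:
  assumes "V \<in> borel_measurable borel2"
  shows "(NINT t. ennreal (slice_meas V (xo :: 'a::euclidean_space) \<kappa> \<rho> t) * indicator {t1<..t2} t) = ennreal (cyl_meas V xo \<kappa> \<rho> t1 t2)"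
  using emeasure_cyl_nn_integral[OF assms] emeasure_cyl[OF assms] by metis

lemma slice_meas_measurable [measurable]:
  assumes [measurable]: "V \<in> borel_measurable borel2"
  shows "slice_meas V (xo :: 'a::euclidean_space) \<kappa> \<rho> \<in> borel_measurable borel"
proof -
  have [measurable]: "ball xo \<rho> \<in> sets borel" by simp
  have eq: "slice_meas V xo \<kappa> \<rho> t = enn2real (NINT x. (if x \<in> ball xo \<rho> \<and> \<kappa> < V (x, t) then 1 else 0))" for t
  proof -
    have [measurable]: "{x \<in> ball xo \<rho>. \<kappa> < V (x, t)} \<in> sets borel" by (rule slice_set_measurable) simp
    have "(NINT x. (if x \<in> ball xo \<rho> \<and> \<kappa> < V (x, t) then 1 else 0)) = (NINT x. indicator {x \<in> ball xo \<rho>. \<kappa> < V (x, t)} x)"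
      by (intro nn_integral_cong) (auto simp: indicator_def)
    then show ?thesis by (simp add: emeasure_slice slice_meas_nonneg del: mem_ball)
  qed
  show ?thesis unfolding eq[abs_def] by measurable
qed

lemma cyl_meas_mono:
  assumes [measurable]: "V \<in> borel_measurable borel2"
    and "\<kappa>' \<le> \<kappa>" "\<rho> \<le> \<rho>'" "t1' \<le> t1" "t2 \<le> t2'"
  shows "cyl_meas V (xo :: 'a::euclidean_space) \<kappa> \<rho> t1 t2 \<le> cyl_meas V xo \<kappa>' \<rho>' t1' t2'"
proof -
  have "ennreal (cyl_meas V xo \<kappa> \<rho> t1 t2) \<le> ennreal (cyl_meas V xo \<kappa>' \<rho>' t1' t2')"
    unfolding emeasure_cyl[OF assms(1), symmetric]
    using assms(2-) cyl_set_measurable[OF assms(1)] by (intro emeasure_mono) (auto simp del: mem_ball intro: subsetD[OF subset_ball])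
  then show ?thesis by (simp add: cyl_meas_nonneg ennreal_le_iff)
qed

text \<open>The value is \<mu> - H on the inner ball and \<mu> outside the outer one. Where V <=
  \<mu>, the excess of V over this level vanishes outside the outer ball, so the level does the work
  of a cutoff function.\<close>

definition cone_level :: "'a::euclidean_space \<Rightarrow> real \<Rightarrow> real \<Rightarrow> real \<Rightarrow> real \<Rightarrow> 'a \<Rightarrow> real" where
  "cone_level xo \<mu> H r1 r2 x = \<mu> - H * max 0 (min 1 ((r2 - dist xo x) / (r2 - r1)))"

lemma clamp_diff_le:
  fixes A B :: real
  shows "\<bar>max 0 (min 1 A) - max 0 (min 1 B)\<bar> \<le> \<bar>A - B\<bar>" "\<bar>max 0 (min 1 A) - max 0 (min 1 B)\<bar> \<le> 1"
  by (auto simp: max_def min_def)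

lemma cone_level_props:
  assumes "0 \<le> H" "r1 < r2"
  shows "\<mu> - H \<le> cone_level xo \<mu> H r1 r2 x" "cone_level xo \<mu> H r1 r2 x \<le> \<mu>"
    "x \<in> ball xo r1 \<Longrightarrow> cone_level xo \<mu> H r1 r2 x = \<mu> - H"
    "x \<notin> ball xo r2 \<Longrightarrow> cone_level xo \<mu> H r1 r2 x = \<mu>"
    "\<bar>cone_level xo \<mu> H r1 r2 x - cone_level xo \<mu> H r1 r2 y\<bar> \<le> H / (r2 - r1) * dist x y"
    "\<bar>cone_level xo \<mu> H r1 r2 x - cone_level xo \<mu> H r1 r2 y\<bar> \<le> H"
proof -
  let ?c = "\<lambda>x. max 0 (min 1 ((r2 - dist xo x) / (r2 - r1)))"
  have c: "0 \<le> ?c x" "?c x \<le> 1" for x by auto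
  have "H * ?c x \<le> H * 1" using c[of x] assms by (intro mult_left_mono) auto
  then show "\<mu> - H \<le> cone_level xo \<mu> H r1 r2 x" by (simp add: cone_level_def)
  have "0 \<le> H * ?c x" using c[of x] assms by (intro mult_nonneg_nonneg) auto
  then show "cone_level xo \<mu> H r1 r2 x \<le> \<mu>" by (simp add: cone_level_def)
  show "cone_level xo \<mu> H r1 r2 x = \<mu> - H" if "x \<in> ball xo r1"
  proof -
    have "1 \<le> (r2 - dist xo x) / (r2 - r1)" using that assms by (simp add: field_simps)
    then have "?c x = 1" by linarith
    then show ?thesis unfolding cone_level_def by simp
  qed
  show "cone_level xo \<mu> H r1 r2 x = \<mu>" if "x \<notin> ball xo r2"
  proof -
    have "(r2 - dist xo x) / (r2 - r1) \<le> 0" using that assms by (simp add: divide_le_0_iff)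
    then have "?c x = 0" by linarith
    then show ?thesis unfolding cone_level_def by simp
  qed
  have diff: "\<bar>cone_level xo \<mu> H r1 r2 x - cone_level xo \<mu> H r1 r2 y\<bar> = H * \<bar>?c x - ?c y\<bar>"
  proof -
    have "cone_level xo \<mu> H r1 r2 x - cone_level xo \<mu> H r1 r2 y = H * (?c y - ?c x)" unfolding cone_level_def right_diff_distrib by simp
    then show ?thesis using assms by (simp add: abs_mult abs_minus_commute)
  qed
  have "\<bar>?c x - ?c y\<bar> \<le> \<bar>(r2 - dist xo x) / (r2 - r1) - (r2 - dist xo y) / (r2 - r1)\<bar>" by (rule clamp_diff_le)
  also have "\<dots> = \<bar>dist xo y - dist xo x\<bar> / (r2 - r1)" using assms by (simp add: diff_divide_distrib[symmetric])
  also have "\<dots> \<le> dist x y / (r2 - r1)"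
  proof (rule divide_right_mono)
    show "\<bar>dist xo y - dist xo x\<bar> \<le> dist x y"
      using abs_dist_diff_le[of y xo x] by (simp only: dist_commute[of y xo] dist_commute[of y x])
  qed (use assms in simp)
  finally have "H * \<bar>?c x - ?c y\<bar> \<le> H * (dist x y / (r2 - r1))" using assms by (intro mult_left_mono)
  then show "\<bar>cone_level xo \<mu> H r1 r2 x - cone_level xo \<mu> H r1 r2 y\<bar> \<le> H / (r2 - r1) * dist x y" unfolding diff by simp
  have "\<bar>?c x - ?c y\<bar> \<le> 1" by (rule clamp_diff_le)
  then have "H * \<bar>?c x - ?c y\<bar> \<le> H * 1" using assms by (intro mult_left_mono)
  then show "\<bar>cone_level xo \<mu> H r1 r2 x - cone_level xo \<mu> H r1 r2 y\<bar> \<le> H" unfolding diff by simp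
qed

lemma cone_level_measurable [measurable]: "cone_level xo \<mu> H r1 r2 \<in> borel_measurable borel"
  unfolding cone_level_def[abs_def] by measurable

text \<open>The two sets are at distance at least R - r, so for each x the integral is a tail
  integral from x, and x ranges over a ball of finite measure.\<close>

lemma kernel_separated_finite:
  fixes xo :: "'a::euclidean_space"
  assumes r: "r < R" and \<sigma>: "0 < \<sigma>"
  shows "(NINT x. NINT y. ennreal (fkernel \<sigma> x y) * (indicator (ball xo r) x * indicator (- ball xo R) y)) < \<infinity>"
proof -
  let ?c = "ennreal (tail_const TYPE('a) \<sigma> * (R - r) powr - \<sigma>)"
  have "(NINT x. NINT y. ennreal (fkernel \<sigma> x y) * (indicator (ball xo r) x * indicator (- ball xo R) y)) \<le> (NINT x. ?c * indicator (ball xo r) x)"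
  proof (intro nn_integral_mono)
    fix x
    show "(NINT y. ennreal (fkernel \<sigma> x y) * (indicator (ball xo r) x * indicator (- ball xo R) y)) \<le> ?c * indicator (ball xo r) x"
    proof (cases "x \<in> ball xo r")
      case True
      have "(NINT y. ennreal (fkernel \<sigma> x y) * (indicator (ball xo r) x * indicator (- ball xo R) y)) \<le> (NINT y. ennreal (fkernel \<sigma> x y) * indicator (- ball x (R - r)) y)"
      proof (intro nn_integral_mono mult_left_mono)
        fix y
        have "y \<in> - ball x (R - r)" if "y \<in> - ball xo R" using that True dist_triangle[of xo y x] by auto
        then show "indicator (ball xo r) x * indicator (- ball xo R) y \<le> (indicator (- ball x (R - r)) y :: ennreal)" by (auto simp: indicator_def)
      qed simp
      also have "\<dots> \<le> ?c" using r \<sigma> by (intro nn_integral_kernel_far) auto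
      finally show ?thesis using True by simp
    qed simp
  qed
  also have "\<dots> = ?c * emeasure lborel (ball xo r)" by (rule nn_integral_cmult_indicator) simp
  also have "\<dots> < \<infinity>" using emeasure_ball_less_top[of xo r] by (simp add: ennreal_mult_less_top)
  finally show ?thesis .
qed

context slice_solution begin

abbreviation "\<sigma> \<equiv> s * p"
abbreviation (input) "exc \<kappa> t x \<equiv> far \<sigma> xo Rb (\<lambda>y. max 0 (V (y, t) - \<kappa>) powr (p - 1)) x"
abbreviation (input) "mS \<equiv> slice_meas V xo"
abbreviation (input) "mQ \<equiv> cyl_meas V xo"

definition cone_const :: real where
  "cone_const = near_const TYPE('a) \<sigma> p + tail_const TYPE('a) \<sigma>"

lemma \<sigma>: "0 < \<sigma>" "\<sigma> < p"
  using s p by auto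

lemma cone_const_pos: "0 < cone_const"
  unfolding cone_const_def using near_const_nonneg[OF \<sigma>(2), where 'a='a] tail_const_nonneg[OF \<sigma>(1), where 'a='a] by simp

lemma cone_energy:
  assumes "0 \<le> H" "r1 < r2"
  shows "(NINT y. ennreal (fkernel \<sigma> x y * \<bar>cone_level xo \<mu> H r1 r2 x - cone_level xo \<mu> H r1 r2 y\<bar> powr p))
     \<le> ennreal (cone_const * H powr p * (r2 - r1) powr - \<sigma>)"
proof -
  have "(NINT y. ennreal (\<bar>cone_level xo \<mu> H r1 r2 x - cone_level xo \<mu> H r1 r2 y\<bar> powr p * fkernel \<sigma> x y))
     \<le> ennreal ((near_const TYPE('a) \<sigma> p + tail_const TYPE('a) \<sigma>) * H powr p * (r2 - r1) powr - \<sigma>)"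
    using assms \<sigma> by (intro nn_integral_kernel_lipschitz cone_level_measurable cone_level_props) auto
  then show ?thesis unfolding cone_const_def by (simp only: mult.commute[of "fkernel \<sigma> x _"])
qed

text \<open>In the big ball w is V minus the cone, cut at 0, so its increments are controlled by
  those of V and of the cone. A pair with one point outside contributes only if the other is in
  \<open>ball xo r2\<close>, at positive distance from the exterior, where w <= H suffices.\<close>

lemma truncation_gagliardo:
  assumes ab: "0 < a" "a < b" "b < T" and r: "r1 < r2" "0 < r2" "r2 < Rb" and H: "0 \<le> H"
    and w: "w = (\<lambda>z. if fst z \<in> ball xo r2 then max 0 (V z - cone_level xo \<mu> H r1 r2 (fst z)) else 0)"
    and bound: "\<And>x t. x \<in> ball xo Rb \<Longrightarrow> a < t \<Longrightarrow> t < b \<Longrightarrow> V (x, t) \<le> \<mu>"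
  shows "(NINT t. (NINT x. NINT y. ennreal (fkernel \<sigma> x y * \<bar>w (x, t) - w (y, t)\<bar> powr p))
         * indicator {a..b} t) < \<infinity>"
proof -
  let ?\<psi> = "cone_level xo \<mu> H r1 r2"
  note \<psi> = cone_level_props[OF H r(1)]
  have [measurable]: "ball xo r2 \<in> sets borel" "ball xo Rb \<in> sets borel" by auto
  have [measurable]: "w \<in> borel_measurable borel2" unfolding w by measurable
  define f1 where "f1 = (\<lambda>(t, x, y). ennreal (fkernel \<sigma> x y * \<bar>V (x, t) - V (y, t)\<bar> powr p) * indicator (ball xo Rb) x * indicator (ball xo Rb) y)"
  define f2 where "f2 = (\<lambda>(x, y). ennreal (fkernel \<sigma> x y * \<bar>?\<psi> x - ?\<psi> y\<bar> powr p) * indicator (ball xo Rb) x)"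
  define f3 where "f3 = (\<lambda>(x, y). ennreal (fkernel \<sigma> x y) * (indicator (ball xo r2) x * indicator (- ball xo Rb) y))"
  have [measurable]: "f1 \<in> borel_measurable borel3"
    "f2 \<in> borel_measurable borel2" "f3 \<in> borel_measurable borel2" unfolding f1_def f2_def f3_def by measurable
  have wH: "0 \<le> w (x, t)" "w (x, t) \<le> H" if "a < t" "t < b" for x t using bound[of x t] that \<psi>(1)[of \<mu> xo x] H r(3) by (auto simp: w)
  have pt: "ennreal (fkernel \<sigma> x y * \<bar>w (x, t) - w (y, t)\<bar> powr p) \<le>
      ennreal (2 powr p) * f1 (t, x, y) + ennreal (2 powr p) * f2 (x, y) + ennreal (H powr p) * (f3 (x, y) + f3 (y, x))" if t: "a < t" "t < b" for x y t
  proof (cases "x \<in> ball xo Rb \<and> y \<in> ball xo Rb")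
    case True
    have wi: "w (z, t) = max 0 (V (z, t) - ?\<psi> z)" if "z \<in> ball xo Rb" for z using bound[OF that t] \<psi>(4)[of z xo \<mu>] by (auto simp: w)
    have "\<bar>w (x, t) - w (y, t)\<bar> \<le> \<bar>V (x, t) - V (y, t)\<bar> + \<bar>?\<psi> x - ?\<psi> y\<bar>"
      unfolding wi[OF conjunct1[OF True]] wi[OF conjunct2[OF True]] by linarith
    then have "\<bar>w (x, t) - w (y, t)\<bar> powr p \<le> (\<bar>V (x, t) - V (y, t)\<bar> + \<bar>?\<psi> x - ?\<psi> y\<bar>) powr p"
      using p by (intro powr_mono2) auto
    also have "\<dots> \<le> 2 powr p * (\<bar>V (x, t) - V (y, t)\<bar> powr p + \<bar>?\<psi> x - ?\<psi> y\<bar> powr p)"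
      using p by (intro powr_add_le) auto
    finally have "fkernel \<sigma> x y * \<bar>w (x, t) - w (y, t)\<bar> powr p \<le> fkernel \<sigma> x y * (2 powr p * (\<bar>V (x, t) - V (y, t)\<bar> powr p + \<bar>?\<psi> x - ?\<psi> y\<bar> powr p))"
      by (intro mult_left_mono) auto
    also have "\<dots> = 2 powr p * (fkernel \<sigma> x y * \<bar>V (x, t) - V (y, t)\<bar> powr p) + 2 powr p * (fkernel \<sigma> x y * \<bar>?\<psi> x - ?\<psi> y\<bar> powr p)"
      by (simp add: algebra_simps)
    finally have "ennreal (fkernel \<sigma> x y * \<bar>w (x, t) - w (y, t)\<bar> powr p) \<le> ennreal (2 powr p * (fkernel \<sigma> x y * \<bar>V (x, t) - V (y, t)\<bar> powr p) + 2 powr p * (fkernel \<sigma> x y * \<bar>?\<psi> x - ?\<psi> y\<bar> powr p))"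
      by (rule ennreal_leI)
    also have "\<dots> = ennreal (2 powr p) * f1 (t, x, y) + ennreal (2 powr p) * f2 (x, y)" using True by (simp add: f1_def f2_def ennreal_mult)
    finally show ?thesis by (rule order_trans) simp
  next
    case False
    show ?thesis
    proof (cases "x \<in> ball xo r2 \<or> y \<in> ball xo r2")
      case True
      have sub: "z \<in> ball xo Rb" if "z \<in> ball xo r2" for z using that r by auto
      have "\<bar>w (x, t) - w (y, t)\<bar> powr p \<le> H powr p" using wH[OF t, of x] wH[OF t, of y] p by (intro powr_mono2) auto
      then have "fkernel \<sigma> x y * \<bar>w (x, t) - w (y, t)\<bar> powr p \<le> H powr p * fkernel \<sigma> x y"
        by (subst mult.commute) (intro mult_right_mono, auto)
      then have "ennreal (fkernel \<sigma> x y * \<bar>w (x, t) - w (y, t)\<bar> powr p) \<le> ennreal (H powr p) * ennreal (fkernel \<sigma> x y)"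
        by (simp add: ennreal_mult[symmetric] ennreal_leI)
      also have "\<dots> \<le> ennreal (H powr p) * (f3 (x, y) + f3 (y, x))"
        using True False sub by (intro mult_left_mono) (auto simp: f3_def fkernel_commute[of _ y x])
      finally show ?thesis by (rule order_trans) simp
    qed (auto simp: w)
  qed
  have "(NINT t. (NINT x. NINT y. ennreal (fkernel \<sigma> x y * \<bar>w (x, t) - w (y, t)\<bar> powr p)) * indicator {a..b} t)
    \<le> (NINT t. (NINT x. NINT y. ennreal (2 powr p) * f1 (t, x, y) + ennreal (2 powr p) * f2 (x, y) + ennreal (H powr p) * (f3 (x, y) + f3 (y, x))) * indicator {a..b} t)"
  proof (rule nn_integral_mono_AE)
    have "AE t in lborel. t \<noteq> a \<and> t \<noteq> b" using AE_lborel_singleton[of a] AE_lborel_singleton[of b] by eventually_elim auto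
    then show "AE t in lborel. (NINT x. NINT y. ennreal (fkernel \<sigma> x y * \<bar>w (x, t) - w (y, t)\<bar> powr p)) * indicator {a..b} t
      \<le> (NINT x. NINT y. ennreal (2 powr p) * f1 (t, x, y) + ennreal (2 powr p) * f2 (x, y) + ennreal (H powr p) * (f3 (x, y) + f3 (y, x))) * indicator {a..b} t"
    proof eventually_elim
      case (elim t)
      show ?case
      proof (cases "t \<in> {a..b}")
        case True
        then have "a < t" "t < b" using elim by auto
        then show ?thesis using True by (auto intro!: nn_integral_mono pt)
      qed simp
    qed
  qed
  also have "\<dots> = ennreal (2 powr p) * (NINT t. (NINT x. NINT y. f1 (t, x, y)) * indicator {a..b} t)
     + ennreal (2 powr p) * ((NINT x. NINT y. f2 (x, y)) * ennreal (b - a))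
     + ennreal (H powr p) * (((NINT x. NINT y. f3 (x, y)) + (NINT x. NINT y. f3 (y, x))) * ennreal (b - a))"
  proof -
    define B where "B = (NINT x. NINT y. f2 (x, y))"
    define C where "C = (NINT x. NINT y. f3 (x, y)) + (NINT x. NINT y. f3 (y, x))"
    define A where "A t = (NINT x. NINT y. f1 (t, x, y))" for t
    have [measurable]: "A \<in> borel_measurable borel" unfolding A_def[abs_def] by measurable
    have inner: "(NINT x. NINT y. ennreal (2 powr p) * f1 (t, x, y) + ennreal (2 powr p) * f2 (x, y) + ennreal (H powr p) * (f3 (x, y) + f3 (y, x)))
       = ennreal (2 powr p) * A t + ennreal (2 powr p) * B + ennreal (H powr p) * C" for t
      unfolding A_def B_def C_def by (simp add: nn_integral_add nn_integral_cmult)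
    have "(NINT t. (ennreal (2 powr p) * A t + ennreal (2 powr p) * B + ennreal (H powr p) * C) * indicator {a..b} t) =
      (NINT t. ennreal (2 powr p) * (A t * indicator {a..b} t) + (ennreal (2 powr p) * B + ennreal (H powr p) * C) * indicator {a..b} t)"
      by (intro nn_integral_cong) (simp add: distrib_right mult.assoc add.assoc)
    also have "\<dots> = ennreal (2 powr p) * (NINT t. A t * indicator {a..b} t) + (ennreal (2 powr p) * B + ennreal (H powr p) * C) * ennreal (b - a)"
      using ab by (simp add: nn_integral_add nn_integral_cmult nn_integral_cmult_indicator)
    finally show ?thesis unfolding inner unfolding A_def B_def C_def by (simp add: distrib_right mult.assoc add.assoc)
  qed
  also have "(NINT x. NINT y. f3 (y, x)) = (NINT x. NINT y. f3 (x, y))" by (rule lborel_pair.Fubini') simp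
  also have "ennreal (2 powr p) * (NINT t. (NINT x. NINT y. f1 (t, x, y)) * indicator {a..b} t)
     + ennreal (2 powr p) * ((NINT x. NINT y. f2 (x, y)) * ennreal (b - a))
     + ennreal (H powr p) * (((NINT x. NINT y. f3 (x, y)) + (NINT x. NINT y. f3 (x, y))) * ennreal (b - a)) < \<infinity>"
  proof -
    have 1: "(NINT t. (NINT x. NINT y. f1 (t, x, y)) * indicator {a..b} t) < \<infinity>"
      using V_gagliardo[OF ab(1,3)] by (simp only: f1_def prod.case)
    have "(NINT x. NINT y. f2 (x, y)) \<le> (NINT x. ennreal (cone_const * H powr p * (r2 - r1) powr - \<sigma>) * indicator (ball xo Rb) x)"
      by (intro nn_integral_mono) (auto simp: f2_def nn_integral_multc simp del: mem_ball intro!: mult_right_mono cone_energy H r)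
    also have "\<dots> = ennreal (cone_const * H powr p * (r2 - r1) powr - \<sigma>) * emeasure lborel (ball xo Rb)"
      by (rule nn_integral_cmult_indicator) simp
    also have "\<dots> < \<infinity>" using emeasure_ball_less_top[of xo Rb] by (simp add: ennreal_mult_less_top)
    finally have 2: "(NINT x. NINT y. f2 (x, y)) < \<infinity>" .
    have 3: "(NINT x. NINT y. f3 (x, y)) < \<infinity>" using kernel_separated_finite[OF r(3) \<sigma>(1), of xo] by (simp only: f3_def prod.case)
    show ?thesis using 1 2 3 by (simp add: ennreal_mult_less_top)
  qed
  finally show ?thesis .
qed

end

lemma nn_integral_mono_AE2:
  assumes "AE x in M. AE y in N. P x y" and "\<And>x y. P x y \<Longrightarrow> f x y \<le> g x y"
  shows "(\<integral>\<^sup>+ x. \<integral>\<^sup>+ y. f x y \<partial>N \<partial>M) \<le> (\<integral>\<^sup>+ x. \<integral>\<^sup>+ y. g x y \<partial>N \<partial>M)"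
proof (rule nn_integral_mono_AE)
  show "AE x in M. (\<integral>\<^sup>+ y. f x y \<partial>N) \<le> (\<integral>\<^sup>+ y. g x y \<partial>N)" using assms(1)
  proof (rule eventually_mono)
    fix x assume "AE y in N. P x y"
    then have "AE y in N. f x y \<le> g x y"
    proof eventually_elim
      case (elim y) then show ?case by (rule assms(2))
    qed
    then show "(\<integral>\<^sup>+ y. f x y \<partial>N) \<le> (\<integral>\<^sup>+ y. g x y \<partial>N)" by (rule nn_integral_mono_AE)
  qed
qed

context slice_solution begin

text \<open>A Caccioppoli inequality that keeps the nonlocal gain from pairs with x above and y
  below the cone. The gain is left abstract in \<open>good\<close>: its exponent q will be 1 when
  the sublevel set is known to be large and deep, and p when only the superlevel set is known to be
  small. In the error, 6 is twice the coercivity constant 3, as each pair may be charged to x and to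
  y, and \<open>Tl\<close> stands for the exterior, where V may exceed \<mu>.\<close>

lemma level_estimate:
  assumes ab: "0 < a" "a < t1" "t1 < t2" "t2 < b" "b < T" and t\<Theta>: "t1 \<in> \<Theta>" "t2 \<in> \<Theta>"
    and r: "r1 < r2" "0 < r1" "r2 < Rb" and H: "0 < H" and l: "0 \<le> l" "l \<le> H" and c: "0 \<le> c" and q: "1 \<le> q" and Tl: "0 \<le> Tl"
    and bound: "\<And>x t. x \<in> ball xo Rb \<Longrightarrow> a < t \<Longrightarrow> t < b \<Longrightarrow> V (x, t) \<le> \<mu>"
    and tail: "AE t in lborel. a < t \<and> t < b \<longrightarrow> (\<forall>x\<in>ball xo r2.
       exc (\<mu> - H) t x \<le> ennreal Tl)"
    and good: "AE t in lborel. t1 < t \<and> t \<le> t2 \<longrightarrow> (\<forall>x\<in>ball xo r2. cone_level xo \<mu> H r1 r2 x < V (x, t) \<longrightarrow>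
       ennreal (c * (V (x, t) - cone_level xo \<mu> H r1 r2 x) powr (q - 1)) \<le>
       (NINT y. ennreal (fkernel \<sigma> x y * (V (x, t) - cone_level xo \<mu> H r1 r2 x + (cone_level xo \<mu> H r1 r2 y - V (y, t))) powr (p - 1))
          * indicator {y \<in> ball xo Rb. V (y, t) \<le> cone_level xo \<mu> H r1 r2 y} y))"
  shows "l\<^sup>2 / 2 * mS (\<mu> - H + l) r1 t2 + Co * 2 powr (1 - p) * c * l powr q * mQ (\<mu> - H + l) r1 t1 t2
     \<le> H\<^sup>2 / 2 * mS (\<mu> - H) r2 t1 +
       (6 * C1 * cone_const * H powr p * (r2 - r1) powr - \<sigma> + 2 * C1 * H * Tl) * mQ (\<mu> - H) r2 t1 t2"
proof -
  let ?M = "lborel3 :: ('a \<times> 'a \<times> real) measure"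
  define \<psi> where "\<psi> = cone_level xo \<mu> H r1 r2"
  have H0: "0 \<le> H" using H by simp
  note \<psi> = cone_level_props[OF H0 r(1), where \<mu> = \<mu> and xo = xo, folded \<psi>_def]
  have [measurable]: "\<psi> \<in> borel_measurable borel" unfolding \<psi>_def by measurable
  have [measurable]: "ball xo r1 \<in> sets borel" "ball xo r2 \<in> sets borel" "ball xo Rb \<in> sets borel" by auto
  define w where "w = (\<lambda>z. if fst z \<in> ball xo r2 then max 0 (V z - \<psi> (fst z)) else 0)"
  have [measurable]: "w \<in> borel_measurable borel2" unfolding w_def by measurable
  have r2: "0 < r2" using r by simp
  have sub: "x \<in> ball xo Rb" if "x \<in> ball xo r2" for x using that r by auto
  have C1: "0 < C1" using Co by simp
  have wbound: "V (x, t) \<le> \<psi> x + H" if "x \<in> ball xo r2" "a < t" "t < b" for x t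
    using bound[OF sub[OF that(1)] that(2,3)] \<psi>(1)[of x] by linarith
  have wH: "0 \<le> w (x, t)" "w (x, t) \<le> H" if "a < t" "t < b" for x t using wbound[of x t] that H by (auto simp: w_def)
  have wi: "w (z, t) = max 0 (V (z, t) - \<psi> z)" if "z \<in> ball xo Rb" "a < t" "t < b" for z t
    using bound[OF that] \<psi>(4)[of z] by (auto simp: w_def)
  have wpos: "x \<in> ball xo r2 \<and> w (x, t) = V (x, t) - \<psi> x \<and> \<psi> x < V (x, t) \<and> \<mu> - H < V (x, t)" if "0 < w (x, t)" for x t
    using that \<psi>(1)[of x] by (auto simp: w_def split: if_splits)
  have fin: "(NINT t. (NINT x. NINT y. ennreal (fkernel \<sigma> x y * \<bar>w (x, t) - w (y, t)\<bar> powr p))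
         * indicator {a..b} t) < \<infinity>"
    by (rule truncation_gagliardo[where \<mu> = \<mu> and ?r1.0 = r1 and ?r2.0 = r2 and H = H]) (use ab r r2 H bound in \<open>auto simp: w_def \<psi>_def\<close>)
  define D where "D = (\<lambda>(x, y, t). indicat_real {t1<..t2} t * (K (x, y, t) * signed_powr p (V (x, t) - V (y, t)) * (w (x, t) - w (y, t))))"
  have intD: "integrable ?M D" and bal: "(\<integral>x. (w (x, t2))\<^sup>2 / 2 \<partial>lborel) - (\<integral>x. (w (x, t1))\<^sup>2 / 2 \<partial>lborel) + (\<integral>z. D z \<partial>?M) \<le> 0"
    unfolding D_def using energy_balance[OF ab t\<Theta> r2 r(3) H0, of \<psi> w] w_def wbound fin by auto
  have [measurable]: "D \<in> borel_measurable borel3" unfolding D_def by measurable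
  \<comment> \<open>The error charged to a point x with w > 0: the slope of the cone, and the values
    of V above \<mu> - H in the exterior.\<close>
  define b1 where "b1 = (\<lambda>(x, y, t). if 0 < w (x, t) then 3 * C1 * (fkernel \<sigma> x y * \<bar>\<psi> x - \<psi> y\<bar> powr p)
      + C1 * H * (fkernel \<sigma> x y * max 0 (V (y, t) - (\<mu> - H)) powr (p - 1) * indicat_real (- ball xo Rb) y) else 0)"
  have [measurable]: "b1 \<in> borel_measurable borel3" unfolding b1_def by measurable
  have b1: "0 \<le> b1 z" for z using C1 H by (auto simp: b1_def split: prod.splits)
  define Bd where "Bd = (\<lambda>(x, y, t). indicat_real {t1<..t2} t * (b1 (x, y, t) + b1 (y, x, t)))"
  have [measurable]: "Bd \<in> borel_measurable borel3" unfolding Bd_def by measurable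
  define g where "g = (\<lambda>(x, y, t). if 0 < w (x, t) \<and> y \<in> ball xo Rb \<and> V (y, t) \<le> \<psi> y
      then fkernel \<sigma> x y * (w (x, t) * (w (x, t) + (\<psi> y - V (y, t))) powr (p - 1)) else 0)"
  have [measurable]: "g \<in> borel_measurable borel3" unfolding g_def by measurable
  define Cg where "Cg = Co * 2 powr (1 - p)"
  have Cg: "0 < Cg" using Co by (simp add: Cg_def)
  have pt: "Cg * g (x, y, t) \<le> K (x, y, t) * signed_powr p (V (x, t) - V (y, t)) * (w (x, t) - w (y, t)) + (b1 (x, y, t) + b1 (y, x, t))"
    if t: "a < t" "t < b" and Kb: "Co * fkernel \<sigma> x y \<le> K (x, y, t)" "K (x, y, t) \<le> C1 * fkernel \<sigma> x y" for x y t
  proof -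
    have K0: "0 \<le> K (x, y, t)" using Kb(1) Co by (intro order_trans[OF _ Kb(1)]) simp
    \<comment> \<open>Here v is in the exterior, so w vanishes at v. Where w(u) > 0, V(u) is above
      \<mu> - H, and a negative flux is at most the excess of V(v) over \<mu> - H to the power p -
      1.\<close>
    have far: "- b1 (u, v, t) \<le> K (x, y, t) * (signed_powr p (V (u, t) - V (v, t)) * w (u, t))"
      if uv: "v \<notin> ball xo Rb" "fkernel \<sigma> u v = fkernel \<sigma> x y" for u v
    proof (cases "0 < w (u, t)")
      case True
      have "- (max 0 (V (v, t) - (\<mu> - H)) powr (p - 1)) \<le> signed_powr p (V (u, t) - V (v, t))"
      proof (cases "V (v, t) \<le> V (u, t)")
        case True then show ?thesis by (simp add: signed_powr_pos order_trans[of _ 0])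
      next
        case False
        have "V (v, t) - V (u, t) \<le> max 0 (V (v, t) - (\<mu> - H))" using wpos[OF True] by auto
        then show ?thesis using False p by (simp add: signed_powr_neg powr_mono2)
      qed
      then have "- (max 0 (V (v, t) - (\<mu> - H)) powr (p - 1)) * w (u, t) \<le> signed_powr p (V (u, t) - V (v, t)) * w (u, t)"
        using True by (intro mult_right_mono) auto
      moreover have "max 0 (V (v, t) - (\<mu> - H)) powr (p - 1) * w (u, t) \<le> max 0 (V (v, t) - (\<mu> - H)) powr (p - 1) * H"
        using wH[OF t] by (intro mult_left_mono) auto
      ultimately have "- (max 0 (V (v, t) - (\<mu> - H)) powr (p - 1) * H) \<le> signed_powr p (V (u, t) - V (v, t)) * w (u, t)" by linarith
      then have "K (x, y, t) * - (max 0 (V (v, t) - (\<mu> - H)) powr (p - 1) * H) \<le> K (x, y, t) * (signed_powr p (V (u, t) - V (v, t)) * w (u, t))"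
        using K0 by (intro mult_left_mono)
      moreover have "K (x, y, t) * (max 0 (V (v, t) - (\<mu> - H)) powr (p - 1) * H) \<le> C1 * fkernel \<sigma> x y * (max 0 (V (v, t) - (\<mu> - H)) powr (p - 1) * H)"
        using Kb(2) H by (intro mult_right_mono) auto
      moreover have "C1 * fkernel \<sigma> x y * (max 0 (V (v, t) - (\<mu> - H)) powr (p - 1) * H) \<le> b1 (u, v, t)"
        using True uv C1 by (simp add: b1_def mult_ac)
      ultimately show ?thesis by linarith
    next
      case False
      then have "w (u, t) = 0" using wH(1)[OF t, of u] by simp
      then show ?thesis using b1[of "(u, v, t)"] by simp
    qed
    have wo: "w (z, t) = 0" if "z \<notin> ball xo Rb" for z using that sub by (auto simp: w_def)
    show ?thesis
    proof (cases "x \<in> ball xo Rb")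
      case x: True
      show ?thesis
      proof (cases "y \<in> ball xo Rb")
        case y: True
        let ?gd = "if 0 < w (x, t) \<and> w (y, t) = 0 then w (x, t) * (w (x, t) + (\<psi> y - V (y, t))) powr (p - 1) else 0"
        let ?i = "(if 0 < w (x, t) then 1 else 0) + (if 0 < w (y, t) then 1 else 0) :: real"
        have "2 powr (1 - p) * ?gd - 3 * \<bar>\<psi> x - \<psi> y\<bar> powr p * ?i \<le> signed_powr p (V (x, t) - V (y, t)) * (w (x, t) - w (y, t))"
          unfolding wi[OF x t] wi[OF y t] by (rule truncation_coercive[OF p(1)])
        then have 1: "K (x, y, t) * (2 powr (1 - p) * ?gd - 3 * \<bar>\<psi> x - \<psi> y\<bar> powr p * ?i) \<le> K (x, y, t) * (signed_powr p (V (x, t) - V (y, t)) * (w (x, t) - w (y, t)))"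
          using K0 by (intro mult_left_mono)
        have 2: "Co * fkernel \<sigma> x y * (2 powr (1 - p) * ?gd) \<le> K (x, y, t) * (2 powr (1 - p) * ?gd)"
          using Kb(1) by (intro mult_right_mono) auto
        have 3: "K (x, y, t) * (3 * \<bar>\<psi> x - \<psi> y\<bar> powr p * ?i) \<le> C1 * fkernel \<sigma> x y * (3 * \<bar>\<psi> x - \<psi> y\<bar> powr p * ?i)"
          using Kb(2) by (intro mult_right_mono) auto
        have 4: "Co * fkernel \<sigma> x y * (2 powr (1 - p) * ?gd) = Cg * g (x, y, t)" using y wi[OF y t] by (auto simp: g_def Cg_def max_def)
        have 5: "C1 * fkernel \<sigma> x y * (3 * \<bar>\<psi> x - \<psi> y\<bar> powr p * ?i) = b1 (x, y, t) + b1 (y, x, t)"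
          using x y by (simp add: b1_def abs_minus_commute fkernel_commute[of _ y x])
        show ?thesis using 1[unfolded right_diff_distrib[of "K (x, y, t)" "2 powr (1 - p) * _"]] 2[unfolded 4] 3[unfolded 5]
          unfolding mult.assoc[of "K (x, y, t)"] by linarith
      next
        case y: False
        have "g (x, y, t) = 0" using y by (simp add: g_def)
        moreover have "- b1 (x, y, t) \<le> K (x, y, t) * (signed_powr p (V (x, t) - V (y, t)) * w (x, t))" by (rule far) (use y in auto)
        ultimately show ?thesis using wo[OF y] b1[of "(y, x, t)"] by (simp add: mult.assoc)
      qed
    next
      case x: False
      have gx: "g (x, y, t) = 0" using wo[OF x] by (simp add: g_def)
      have "- b1 (y, x, t) \<le> K (x, y, t) * (signed_powr p (V (y, t) - V (x, t)) * w (y, t))" by (rule far) (use x fkernel_commute in auto)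
      moreover have "signed_powr p (V (y, t) - V (x, t)) = - signed_powr p (V (x, t) - V (y, t))"
        using signed_powr_minus[of p "V (x, t) - V (y, t)"] by simp
      ultimately show ?thesis using wo[OF x] b1[of "(x, y, t)"] gx by (simp add: mult.assoc)
    qed
  qed
  define S where "S = mQ (\<mu> - H) r2 t1 t2"
  define \<Gamma> where "\<Gamma> = 6 * C1 * cone_const * H powr p * (r2 - r1) powr - \<sigma> + 2 * C1 * H * Tl"
  have \<Gamma>0: "0 \<le> \<Gamma>" unfolding \<Gamma>_def using C1 cone_const_pos H Tl by (intro add_nonneg_nonneg mult_nonneg_nonneg) auto
  have inner: "(NINT y. ennreal (b1 (x, y, t))) \<le> ennreal (\<Gamma> / 2) * indicator {x \<in> ball xo r2. \<mu> - H < V (x, t)} x"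
    if tl: "\<forall>x\<in>ball xo r2. exc (\<mu> - H) t x \<le> ennreal Tl" for x t
  proof (cases "0 < w (x, t)")
    case True
    note W = wpos[OF True]
    have "(NINT y. ennreal (b1 (x, y, t))) = (NINT y. ennreal (3 * C1) * ennreal (fkernel \<sigma> x y * \<bar>\<psi> x - \<psi> y\<bar> powr p)
      + ennreal (C1 * H) * (ennreal (fkernel \<sigma> x y * max 0 (V (y, t) - (\<mu> - H)) powr (p - 1)) * indicator (- ball xo Rb) y))"
      using True C1 H by (intro nn_integral_cong) (auto simp: b1_def ennreal_mult[symmetric] ennreal_plus[symmetric] indicator_def simp del: ennreal_plus)
    also have "\<dots> = ennreal (3 * C1) * (NINT y. ennreal (fkernel \<sigma> x y * \<bar>\<psi> x - \<psi> y\<bar> powr p))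
      + ennreal (C1 * H) * exc (\<mu> - H) t x"
      by (simp add: nn_integral_add nn_integral_cmult)
    also have "\<dots> \<le> ennreal (3 * C1) * ennreal (cone_const * H powr p * (r2 - r1) powr - \<sigma>) + ennreal (C1 * H) * ennreal Tl"
      using W tl unfolding \<psi>_def by (intro add_mono mult_left_mono cone_energy H0 r(1)) auto
    also have "\<dots> = ennreal (3 * C1 * (cone_const * H powr p * (r2 - r1) powr - \<sigma>) + C1 * H * Tl)"
      using C1 H Tl cone_const_pos by (subst ennreal_plus) (auto simp: ennreal_mult[symmetric] mult.assoc)
    also have "3 * C1 * (cone_const * H powr p * (r2 - r1) powr - \<sigma>) + C1 * H * Tl = \<Gamma> / 2" by (simp add: \<Gamma>_def)
    finally show ?thesis using W by simp
  next
    case False then show ?thesis by (simp add: b1_def)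
  qed
  have Th: "AE t in lborel. t1 < t \<and> t \<le> t2 \<longrightarrow> (NINT x. NINT y. ennreal (b1 (x, y, t))) \<le> ennreal (\<Gamma> / 2) * ennreal (mS (\<mu> - H) r2 t)"
    using tail
  proof eventually_elim
    case (elim t)
    show ?case
    proof
      assume "t1 < t \<and> t \<le> t2"
      then have "a < t \<and> t < b" using ab by auto
      then have "(NINT x. NINT y. ennreal (b1 (x, y, t))) \<le> (NINT x. ennreal (\<Gamma> / 2) * indicator {x \<in> ball xo r2. \<mu> - H < V (x, t)} x)"
        using elim by (intro nn_integral_mono inner) auto
      also have "\<dots> = ennreal (\<Gamma> / 2) * ennreal (mS (\<mu> - H) r2 t)"
        using slice_set_measurable[OF V_meas, of xo r2 "\<mu> - H" t] by (subst nn_integral_cmult_indicator) (simp_all add: emeasure_slice del: mem_ball)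
      finally show "(NINT x. NINT y. ennreal (b1 (x, y, t))) \<le> ennreal (\<Gamma> / 2) * ennreal (mS (\<mu> - H) r2 t)" .
    qed
  qed
  have swap: "(NINT x. NINT y. ennreal (b1 (y, x, t))) = (NINT x. NINT y. ennreal (b1 (x, y, t)))" for t by (rule lborel_pair.Fubini') simp
  have nnB: "(\<integral>\<^sup>+ z. ennreal (Bd z) \<partial>?M) \<le> ennreal (\<Gamma> * S)"
  proof -
    have "(\<integral>\<^sup>+ z. ennreal (Bd z) \<partial>?M) = (NINT t. NINT x. NINT y. ennreal (Bd (x, y, t)))" by (rule nn_integral_triple) simp
    also have "\<dots> = (NINT t. (NINT x. NINT y. ennreal (b1 (x, y, t)) + ennreal (b1 (y, x, t))) * indicator {t1<..t2} t)"
      using b1 by (intro nn_integral_cong) (auto simp: Bd_def indicator_def)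
    also have "\<dots> = (NINT t. (2 * (NINT x. NINT y. ennreal (b1 (x, y, t)))) * indicator {t1<..t2} t)" by (simp add: nn_integral_add swap mult_2)
    also have "\<dots> \<le> (NINT t. ennreal \<Gamma> * (ennreal (mS (\<mu> - H) r2 t) * indicator {t1<..t2} t))"
    proof (rule nn_integral_mono_AE)
      show "AE t in lborel. (2 * (NINT x. NINT y. ennreal (b1 (x, y, t)))) * indicator {t1<..t2} t \<le> ennreal \<Gamma> * (ennreal (mS (\<mu> - H) r2 t) * indicator {t1<..t2} t)"
        using Th
      proof eventually_elim
        case (elim t)
        have e: "ennreal \<Gamma> = 2 * ennreal (\<Gamma> / 2)" using \<Gamma>0 ennreal_mult[of 2 "\<Gamma> / 2"] by simp
        show ?case using elim by (auto simp: indicator_def e mult.assoc intro!: mult_left_mono)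
      qed
    qed
    also have "\<dots> = ennreal \<Gamma> * ennreal S" unfolding S_def by (subst nn_integral_cmult) (auto simp: nn_integral_slice_meas)
    finally show ?thesis unfolding S_def by (simp only: ennreal_mult[OF \<Gamma>0 cyl_meas_nonneg])
  qed
  have Bd0: "0 \<le> Bd z" for z using b1 by (auto simp: Bd_def split: prod.splits)
  have intB: "integrable ?M Bd" using Bd0 nnB by (intro integrableI_bounded) (auto simp: order_le_less_trans[OF _ ennreal_less_top])
  have IB: "(\<integral>z. Bd z \<partial>?M) \<le> \<Gamma> * S" using nnB \<Gamma>0 cyl_meas_nonneg[of V xo "\<mu> - H" r2 t1 t2] Bd0
    by (subst (asm) nn_integral_eq_integral[OF intB]) (auto simp: ennreal_le_iff S_def)
  define Y where "Y = mQ (\<mu> - H + l) r1 t1 t2"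
  have gt: "AE t in lborel. t1 < t \<and> t \<le> t2 \<longrightarrow> ennreal (c * l powr q) * ennreal (mS (\<mu> - H + l) r1 t) \<le> (NINT x. NINT y. ennreal (g (x, y, t)))"
    using good
  proof eventually_elim
    case (elim t)
    show ?case
    proof
      assume t: "t1 < t \<and> t \<le> t2"
      have "ennreal (c * l powr q) * ennreal (mS (\<mu> - H + l) r1 t) = (NINT x. ennreal (c * l powr q) * indicator {x \<in> ball xo r1. \<mu> - H + l < V (x, t)} x)"
        using slice_set_measurable[OF V_meas, of xo r1 "\<mu> - H + l" t] by (subst nn_integral_cmult_indicator) (simp_all add: emeasure_slice del: mem_ball)
      also have "\<dots> \<le> (NINT x. NINT y. ennreal (g (x, y, t)))"
      proof (rule nn_integral_mono)
        fix x
        show "ennreal (c * l powr q) * indicator {x \<in> ball xo r1. \<mu> - H + l < V (x, t)} x \<le> (NINT y. ennreal (g (x, y, t)))"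
        proof (cases "x \<in> ball xo r1 \<and> \<mu> - H + l < V (x, t)")
          case True
          have x2: "x \<in> ball xo r2" using True r by auto
          have \<psi>x: "\<psi> x = \<mu> - H" using True \<psi>(3) by simp
          have lw: "l < V (x, t) - \<psi> x" and Vx: "\<psi> x < V (x, t)" using True \<psi>x l by auto
          have wx: "w (x, t) = V (x, t) - \<psi> x" using x2 Vx by (simp add: w_def)
          have [measurable]: "{y \<in> ball xo Rb. V (y, t) \<le> \<psi> y} \<in> sets borel"
          proof -
            have "Measurable.pred borel (\<lambda>y. y \<in> ball xo Rb \<and> V (y, t) \<le> \<psi> y)" by measurable
            then show ?thesis by (simp add: pred_def del: mem_ball)
          qed
          have "c * l powr q \<le> c * (V (x, t) - \<psi> x) powr q" using c l lw q by (intro mult_left_mono powr_mono2) auto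
          also have "\<dots> = (V (x, t) - \<psi> x) * (c * (V (x, t) - \<psi> x) powr (q - 1))" using lw l by (simp add: powr_diff)
          finally have "ennreal (c * l powr q) \<le> ennreal (V (x, t) - \<psi> x) * ennreal (c * (V (x, t) - \<psi> x) powr (q - 1))"
            using Vx c by (simp add: ennreal_mult[symmetric] ennreal_leI)
          also have "\<dots> \<le> ennreal (V (x, t) - \<psi> x) * (NINT y. ennreal (fkernel \<sigma> x y * (V (x, t) - \<psi> x + (\<psi> y - V (y, t))) powr (p - 1)) * indicator {y \<in> ball xo Rb. V (y, t) \<le> \<psi> y} y)"
            using elim t x2 Vx unfolding \<psi>_def by (intro mult_left_mono) auto
          also have "\<dots> = (NINT y. ennreal (V (x, t) - \<psi> x) * (ennreal (fkernel \<sigma> x y * (V (x, t) - \<psi> x + (\<psi> y - V (y, t))) powr (p - 1)) * indicator {y \<in> ball xo Rb. V (y, t) \<le> \<psi> y} y))"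
            by (rule nn_integral_cmult[symmetric]) measurable
          also have "\<dots> \<le> (NINT y. ennreal (g (x, y, t)))"
            using Vx wx by (intro nn_integral_mono) (auto simp: g_def indicator_def ennreal_mult[symmetric] mult_ac)
          finally show ?thesis using True by simp
        qed auto
      qed
      finally show "ennreal (c * l powr q) * ennreal (mS (\<mu> - H + l) r1 t) \<le> (NINT x. NINT y. ennreal (g (x, y, t)))" .
    qed
  qed
  have AEnn: "AE z in ?M. 0 \<le> D z + Bd z"
  proof (rule AE_tripleI)
    show "AE t in lborel. AE x in lborel. AE y in lborel. 0 \<le> D (x, y, t) + Bd (x, y, t)" using K_bounds
    proof eventually_elim
      case (elim t)
      show ?case
      proof (cases "t \<in> {t1<..t2}")
        case True
        then have t: "a < t" "t < b" using ab by auto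
        then have "AE x in lborel. AE y in lborel. between Co C1 \<sigma> K x y t"
          using elim ab by auto
        then show ?thesis
        proof eventually_elim
          case (elim x)
          then show ?case
          proof eventually_elim
            case (elim y)
            moreover have "0 \<le> Cg * g (x, y, t)" using Cg by (simp add: g_def)
            ultimately show ?case using pt[OF t, of x y] True by (simp add: D_def Bd_def)
          qed
        qed
      qed (simp add: D_def Bd_def)
    qed
  qed measurable
  have "ennreal (Cg * (c * l powr q) * Y) \<le> ennreal ((\<integral>z. D z \<partial>?M) + (\<integral>z. Bd z \<partial>?M))"
  proof -
    have "ennreal (Cg * (c * l powr q) * Y) = ennreal Cg * (ennreal (c * l powr q) * ennreal Y)"
    proof -
      have n: "0 \<le> Cg" "0 \<le> c * l powr q" "0 \<le> Y" using Cg c by (auto simp: Y_def cyl_meas_nonneg)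
      show ?thesis unfolding mult.assoc[of Cg "c * l powr q" Y] ennreal_mult[OF n(1) mult_nonneg_nonneg[OF n(2,3)]] ennreal_mult[OF n(2,3)] ..
    qed
    also have "\<dots> = ennreal Cg * (NINT t. ennreal (c * l powr q) * (ennreal (mS (\<mu> - H + l) r1 t) * indicator {t1<..t2} t))"
      unfolding Y_def by (subst nn_integral_cmult) (auto simp: nn_integral_slice_meas)
    also have "\<dots> \<le> ennreal Cg * (NINT t. (NINT x. NINT y. ennreal (g (x, y, t))) * indicator {t1<..t2} t)"
    proof (intro mult_left_mono nn_integral_mono_AE)
      show "AE t in lborel. ennreal (c * l powr q) * (ennreal (mS (\<mu> - H + l) r1 t) * indicator {t1<..t2} t) \<le> (NINT x. NINT y. ennreal (g (x, y, t))) * indicator {t1<..t2} t"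
        using gt by eventually_elim (auto simp: indicator_def)
    qed simp
    also have "\<dots> = (NINT t. (NINT x. NINT y. ennreal (Cg * g (x, y, t))) * indicator {t1<..t2} t)"
      using Cg by (simp add: ennreal_mult'[of Cg] nn_integral_cmult mult.assoc)
    also have "\<dots> \<le> (NINT t. NINT x. NINT y. ennreal (D (x, y, t) + Bd (x, y, t)))"
    proof (rule nn_integral_mono_AE)
      show "AE t in lborel. (NINT x. NINT y. ennreal (Cg * g (x, y, t))) * indicator {t1<..t2} t \<le> (NINT x. NINT y. ennreal (D (x, y, t) + Bd (x, y, t)))"
        using K_bounds
      proof eventually_elim
        case (elim t)
        show ?case
        proof (cases "t \<in> {t1<..t2}")
          case True
          then have t: "a < t" "t < b" using ab by auto
          then have "AE x in lborel. AE y in lborel. between Co C1 \<sigma> K x y t"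
            using elim ab by auto
          then have "(NINT x. NINT y. ennreal (Cg * g (x, y, t))) \<le> (NINT x. NINT y. ennreal (D (x, y, t) + Bd (x, y, t)))"
          proof (rule nn_integral_mono_AE2)
            fix x y assume "between Co C1 \<sigma> K x y t"
            then show "ennreal (Cg * g (x, y, t)) \<le> ennreal (D (x, y, t) + Bd (x, y, t))"
              using pt[OF t, of x y] True by (intro ennreal_leI) (simp add: D_def Bd_def)
          qed
          then show ?thesis using True by simp
        qed simp
      qed
    qed
    also have "\<dots> = (\<integral>\<^sup>+ z. ennreal (D z + Bd z) \<partial>?M)" by (rule nn_integral_triple[symmetric]) simp
    also have "\<dots> = ennreal (\<integral>z. D z + Bd z \<partial>?M)"
    proof (rule nn_integral_eq_integral)
      show "integrable ?M (\<lambda>z. D z + Bd z)" using intD intB by simp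
      show "AE z in ?M. 0 \<le> D z + Bd z" by (rule AEnn)
    qed
    also have "(\<integral>z. D z + Bd z \<partial>?M) = (\<integral>z. D z \<partial>?M) + (\<integral>z. Bd z \<partial>?M)" using intD intB by simp
    finally show ?thesis .
  qed
  moreover have "0 \<le> (\<integral>z. D z \<partial>?M) + (\<integral>z. Bd z \<partial>?M)" using integral_nonneg_AE[OF AEnn] intD intB by simp
  ultimately have "Cg * (c * l powr q) * Y \<le> (\<integral>z. D z \<partial>?M) + (\<integral>z. Bd z \<partial>?M)" by (simp add: ennreal_le_iff)
  then have main: "Cg * (c * l powr q) * Y \<le> (\<integral>z. D z \<partial>?M) + \<Gamma> * S" using IB by linarith
  have intw: "integrable lborel (\<lambda>x. (w (x, t))\<^sup>2 / 2)" if "a < t" "t < b" for t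
  proof (rule integrableI_bounded_set[where A = "ball xo r2" and B = "H\<^sup>2 / 2"])
    show "AE x\<in>ball xo r2 in lborel. norm ((w (x, t))\<^sup>2 / 2) \<le> H\<^sup>2 / 2" using wH[OF that] by (auto intro!: power_mono)
    show "emeasure lborel (ball xo r2) < \<infinity>" by (rule emeasure_lborel_ball_finite)
    show "AE x in lborel. x \<notin> ball xo r2 \<longrightarrow> (w (x, t))\<^sup>2 / 2 = 0" by (simp add: w_def)
  qed simp_all
  have indi: "integrable lborel (\<lambda>x. indicat_real {x \<in> ball xo \<rho>. \<kappa> < V (x, t)} x * e)"
      "(\<integral>x. indicat_real {x \<in> ball xo \<rho>. \<kappa> < V (x, t)} x * e \<partial>lborel) = e * mS \<kappa> \<rho> t" for \<kappa> \<rho> t e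
    using slice_set_measurable[OF V_meas, of xo \<rho> \<kappa> t] emeasure_slice[OF V_meas, of xo \<rho> \<kappa> t]
    by (auto simp: slice_meas_def mult.commute simp del: mem_ball intro!: integrable_mult_left integrable_real_indicator)
  have G2: "l\<^sup>2 / 2 * mS (\<mu> - H + l) r1 t2 \<le> (\<integral>x. (w (x, t2))\<^sup>2 / 2 \<partial>lborel)"
  proof -
    have "(\<integral>x. indicat_real {x \<in> ball xo r1. \<mu> - H + l < V (x, t2)} x * (l\<^sup>2 / 2) \<partial>lborel) \<le> (\<integral>x. (w (x, t2))\<^sup>2 / 2 \<partial>lborel)"
    proof (rule integral_mono[OF indi(1) intw])
      fix x
      show "indicat_real {x \<in> ball xo r1. \<mu> - H + l < V (x, t2)} x * (l\<^sup>2 / 2) \<le> (w (x, t2))\<^sup>2 / 2"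
      proof (cases "x \<in> ball xo r1 \<and> \<mu> - H + l < V (x, t2)")
        case True
        then have "x \<in> ball xo r2" "\<psi> x = \<mu> - H" using r \<psi>(3) by auto
        then have "l \<le> w (x, t2)" using True by (simp add: w_def max_def)
        then have "l\<^sup>2 \<le> (w (x, t2))\<^sup>2" using l by (intro power_mono) auto
        then show ?thesis using True by (simp add: indicator_def)
      qed auto
    qed (use ab in auto)
    then show ?thesis by (simp only: indi(2))
  qed
  have G1: "(\<integral>x. (w (x, t1))\<^sup>2 / 2 \<partial>lborel) \<le> H\<^sup>2 / 2 * mS (\<mu> - H) r2 t1"
  proof -
    have "(\<integral>x. (w (x, t1))\<^sup>2 / 2 \<partial>lborel) \<le> (\<integral>x. indicat_real {x \<in> ball xo r2. \<mu> - H < V (x, t1)} x * (H\<^sup>2 / 2) \<partial>lborel)"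
    proof (rule integral_mono[OF intw indi(1)])
      fix x
      have t: "a < t1" "t1 < b" using ab by auto
      show "(w (x, t1))\<^sup>2 / 2 \<le> indicat_real {x \<in> ball xo r2. \<mu> - H < V (x, t1)} x * (H\<^sup>2 / 2)"
      proof (cases "0 < w (x, t1)")
        case True
        have "(w (x, t1))\<^sup>2 \<le> H\<^sup>2" using wH[OF t, of x] by (intro power_mono) auto
        then show ?thesis using wpos[OF True] by (simp add: indicator_def)
      next
        case False then have "w (x, t1) = 0" using wH(1)[OF t, of x] by simp
        then show ?thesis by (simp add: indicator_def)
      qed
    qed (use ab in auto)
    then show ?thesis by (simp only: indi(2))
  qed
  have "l\<^sup>2 / 2 * mS (\<mu> - H + l) r1 t2 + Cg * (c * l powr q) * Y \<le> H\<^sup>2 / 2 * mS (\<mu> - H) r2 t1 + \<Gamma> * S"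
    using main bal G1 G2 by linarith
  then show ?thesis by (simp only: Cg_def \<Gamma>_def S_def Y_def mult.assoc)
qed

end

section \<open>Estimates inside a fixed oscillation window\<close>

definition slope_const :: "'a::euclidean_space itself \<Rightarrow> real \<Rightarrow> real \<Rightarrow> real \<Rightarrow> real" where
  "slope_const _ s p C1 = 6 * C1 * (near_const TYPE('a) (s * p) p + tail_const TYPE('a) (s * p))
     + 2 * C1 * (2 powr (p - 1) * (1 + tail_const TYPE('a) (s * p)))"

text \<open>The product of the bounds in \<open>good_term_from_slices\<close>: the kernel at
  distance 4 r, a gap e/2 to the power p - 1, and a quarter of the volume of the ball.\<close>

definition spread_const :: "'a::euclidean_space itself \<Rightarrow> real \<Rightarrow> real \<Rightarrow> real" where
  "spread_const _ s p = 4 powr - (real DIM('a) + s * p) * 2 powr (1 - p) * unit_ball_vol (real DIM('a)) / 4"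

lemma spread_const_pos: "0 < spread_const TYPE('a::euclidean_space) s p"
  by (simp add: spread_const_def)

lemma slope_const_pos:
  assumes "0 < s" "s < 1" "1 < p" "0 < C1"
  shows "0 < slope_const TYPE('a::euclidean_space) s p C1"
proof -
  have "0 < near_const TYPE('a) (s * p) p" "0 < tail_const TYPE('a) (s * p)" using assms by (auto intro!: near_const_nonneg tail_const_nonneg)
  then show ?thesis unfolding slope_const_def using assms by (intro add_pos_pos mult_pos_pos) auto
qed

lemma measure_ball_powr:
  fixes x :: "'a::euclidean_space"
  assumes "0 < r"
  shows "measure lborel (ball x r) = unit_ball_vol (real DIM('a)) * r powr real DIM('a)"
  using emeasure_ball_powr[OF assms, of x] by (simp add: measure_def)

text \<open>If every time in \<Theta> had a slice above the mean c0, the nonnegative function f, the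
  excess over c0, would have integral 0 and yet be positive almost everywhere.\<close>

lemma exists_time_below_average:
  fixes V :: "'a::euclidean_space \<times> real \<Rightarrow> real"
  assumes V: "V \<in> borel_measurable borel2" and t: "t' < t''"
    and Th: "AE t in lborel. t' < t \<and> t < t'' \<longrightarrow> t \<in> \<Theta>"
  shows "\<exists>t1\<in>\<Theta>. t' < t1 \<and> t1 < t'' \<and> slice_meas V xo \<kappa> \<rho> t1 \<le> cyl_meas V xo \<kappa> \<rho> t' t'' / (t'' - t')"
proof (rule ccontr)
  assume neg: "\<not> ?thesis"
  note [measurable] = V
  define c0 where "c0 = cyl_meas V xo \<kappa> \<rho> t' t'' / (t'' - t')"
  have c0: "0 \<le> c0" using t by (simp add: c0_def cyl_meas_nonneg)
  have big: "AE t in lborel. t' < t \<and> t < t'' \<longrightarrow> c0 < slice_meas V xo \<kappa> \<rho> t"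
    using Th by eventually_elim (use neg in \<open>auto simp: c0_def not_le\<close>)
  define f where "f t = ennreal (slice_meas V xo \<kappa> \<rho> t - c0) * indicator {t'<..t''} t" for t
  have fm [measurable]: "f \<in> borel_measurable borel" unfolding f_def[abs_def] by measurable
  have "ennreal (cyl_meas V xo \<kappa> \<rho> t' t'') = (NINT t. ennreal (slice_meas V xo \<kappa> \<rho> t) * indicator {t'<..t''} t)"
    by (rule nn_integral_slice_meas[symmetric]) (rule V)
  also have "\<dots> = (NINT t. ennreal c0 * indicator {t'<..t''} t + f t)"
  proof (rule nn_integral_cong_AE)
    show "AE t in lborel. ennreal (slice_meas V xo \<kappa> \<rho> t) * indicator {t'<..t''} t = ennreal c0 * indicator {t'<..t''} t + f t"
      using big AE_lborel_singleton[of t'']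
    proof eventually_elim
      case (elim t)
      show ?case
      proof (cases "t \<in> {t'<..t''}")
        case True
        then have "c0 < slice_meas V xo \<kappa> \<rho> t" using elim by auto
        then have "ennreal (slice_meas V xo \<kappa> \<rho> t) = ennreal c0 + ennreal (slice_meas V xo \<kappa> \<rho> t - c0)"
          using c0 by (simp add: ennreal_plus[symmetric] del: ennreal_plus)
        then show ?thesis using True by (simp add: f_def)
      qed (simp add: f_def)
    qed
  qed
  also have "\<dots> = ennreal c0 * ennreal (t'' - t') + (NINT t. f t)" using t by (subst nn_integral_add) (auto simp: nn_integral_cmult_indicator)
  also have "ennreal c0 * ennreal (t'' - t') = ennreal (cyl_meas V xo \<kappa> \<rho> t' t'')"
    using t c0 by (simp add: ennreal_mult[symmetric] c0_def)
  finally have "(NINT t. f t) = 0" using ennreal_add_left_cancel[of "ennreal (cyl_meas V xo \<kappa> \<rho> t' t'')" 0 "NINT t. f t"] by simp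
  then have "AE t in lborel. f t = 0" by (subst (asm) nn_integral_0_iff_AE) simp_all
  then have "AE t in lborel. t \<notin> {t'<..<t''}" using big by eventually_elim (auto simp: f_def ennreal_eq_0_iff)
  then have "emeasure lborel {t'<..<t''} = 0" by (subst (asm) AE_iff_measurable[where N = "{t'<..<t''}"]) auto
  then show False using t by simp
qed

context slice_solution begin

abbreviation "cG \<equiv> Co * 2 powr (1 - p)"

lemma slope_pos: "0 < slope_const TYPE('a) s p C1"
  using s p Co by (intro slope_const_pos) auto

lemma cG_pos: "0 < cG"
  using Co by simp

lemma ball_vol_pos: "0 < unit_ball_vol (real DIM('a))"
  by simp

text \<open>The bound on V is required at every point, which is later arranged by clipping the
  representative. The number h0 measures the tail above \<mu>: truncations of height H >= h0 absorb
  it. The factor 8 keeps points of \<open>ball xo (2 * r)\<close> at distance at least 6 r from the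
  exterior.\<close>

definition osc_window :: "real \<Rightarrow> real \<Rightarrow> real \<Rightarrow> real \<Rightarrow> real \<Rightarrow> bool" where
  "osc_window r \<mu> h0 a b \<longleftrightarrow> 0 < r \<and> 8 * r \<le> Rb \<and> 0 < a \<and> a < b \<and> b \<le> T \<and> 0 < h0 \<and>
     (\<forall>x\<in>ball xo Rb. \<forall>t. a < t \<longrightarrow> t < b \<longrightarrow> V (x, t) \<le> \<mu>) \<and>
     (AE t in lborel. a < t \<and> t < b \<longrightarrow> (\<forall>x\<in>ball xo (2 * r).
       exc \<mu> t x
         \<le> ennreal (h0 powr (p - 1) * r powr - \<sigma>)))"

lemma osc_windowD:
  assumes "osc_window r \<mu> h0 a b"
  shows "0 < r" "8 * r \<le> Rb" "0 < a" "a < b" "b \<le> T" "0 < h0"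
    "\<And>x t. x \<in> ball xo Rb \<Longrightarrow> a < t \<Longrightarrow> t < b \<Longrightarrow> V (x, t) \<le> \<mu>"
    "AE t in lborel. a < t \<and> t < b \<longrightarrow> (\<forall>x\<in>ball xo (2 * r).
       exc \<mu> t x
         \<le> ennreal (h0 powr (p - 1) * r powr - \<sigma>))"
    "AE t in lborel. a < t \<and> t < b \<longrightarrow> t \<in> \<Theta>"
  using assms \<Theta>_AE by (auto simp: osc_window_def elim!: eventually_mono)

text \<open>Lowering the level by H adds at most H in the exterior, which is integrated against the
  kernel over distances at least 6 r. With h0 <= H the original tail and the added part are both of
  order H^(p-1) r^(-\<sigma>).\<close>

lemma tail_of_shifted_level:
  assumes win: "osc_window r \<mu> h0 a b" and H: "h0 \<le> H"
  shows "AE t in lborel. a < t \<and> t < b \<longrightarrow> (\<forall>x\<in>ball xo (2 * r).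
       exc (\<mu> - H) t x
         \<le> ennreal (2 powr (p - 1) * (1 + tail_const TYPE('a) \<sigma>) * H powr (p - 1) * r powr - \<sigma>))" using osc_windowD(8)[OF win]
proof eventually_elim
  case (elim t)
  note S = osc_windowD[OF win]
  have H0: "0 < H" using S H by simp
  have [measurable]: "ball xo Rb \<in> sets borel" by simp
  show ?case
  proof (intro impI ballI)
    fix x assume t: "a < t \<and> t < b" and x: "x \<in> ball xo (2 * r)"
    have "exc (\<mu> - H) t x
      \<le> (NINT y. ennreal (2 powr (p - 1)) * (ennreal (fkernel \<sigma> x y * max 0 (V (y, t) - \<mu>) powr (p - 1)) * indicator (- ball xo Rb) y)
          + ennreal (2 powr (p - 1) * H powr (p - 1)) * (ennreal (fkernel \<sigma> x y) * indicator (- ball x (6 * r)) y))"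
    proof (rule nn_integral_mono)
      fix y
      show "ennreal (fkernel \<sigma> x y * max 0 (V (y, t) - (\<mu> - H)) powr (p - 1)) * indicator (- ball xo Rb) y \<le>
        ennreal (2 powr (p - 1)) * (ennreal (fkernel \<sigma> x y * max 0 (V (y, t) - \<mu>) powr (p - 1)) * indicator (- ball xo Rb) y)
          + ennreal (2 powr (p - 1) * H powr (p - 1)) * (ennreal (fkernel \<sigma> x y) * indicator (- ball x (6 * r)) y)"
      proof (cases "y \<in> ball xo Rb")
        case False
        then have y6: "y \<notin> ball x (6 * r)" using x S dist_triangle[of xo y x] by auto
        have "max 0 (V (y, t) - (\<mu> - H)) powr (p - 1) \<le> (max 0 (V (y, t) - \<mu>) + H) powr (p - 1)" using p H0 by (intro powr_mono2) auto
        also have "\<dots> \<le> 2 powr (p - 1) * (max 0 (V (y, t) - \<mu>) powr (p - 1) + H powr (p - 1))" using p H0 by (intro powr_add_le) auto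
        finally have "fkernel \<sigma> x y * max 0 (V (y, t) - (\<mu> - H)) powr (p - 1) \<le>
            fkernel \<sigma> x y * (2 powr (p - 1) * (max 0 (V (y, t) - \<mu>) powr (p - 1) + H powr (p - 1)))" by (intro mult_left_mono) auto
        also have "\<dots> = 2 powr (p - 1) * (fkernel \<sigma> x y * max 0 (V (y, t) - \<mu>) powr (p - 1)) + 2 powr (p - 1) * H powr (p - 1) * fkernel \<sigma> x y"
          by (simp add: algebra_simps)
        finally show ?thesis using False y6 by (simp add: ennreal_mult[symmetric] ennreal_plus[symmetric] ennreal_leI del: ennreal_plus)
      qed simp
    qed
    also have "\<dots> = ennreal (2 powr (p - 1)) * (exc \<mu> t x)
          + ennreal (2 powr (p - 1) * H powr (p - 1)) * (NINT y. ennreal (fkernel \<sigma> x y) * indicator (- ball x (6 * r)) y)"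
    proof -
      have [measurable]: "ball x (6 * r) \<in> sets borel" by simp
      show ?thesis by (simp add: nn_integral_add nn_integral_cmult)
    qed
    also have "\<dots> \<le> ennreal (2 powr (p - 1)) * ennreal (H powr (p - 1) * r powr - \<sigma>)
          + ennreal (2 powr (p - 1) * H powr (p - 1)) * ennreal (tail_const TYPE('a) \<sigma> * r powr - \<sigma>)"
    proof (intro add_mono mult_left_mono)
      have "exc \<mu> t x \<le> ennreal (h0 powr (p - 1) * r powr - \<sigma>)"
        using elim t x by blast
      also have "\<dots> \<le> ennreal (H powr (p - 1) * r powr - \<sigma>)" using S H p by (intro ennreal_leI mult_right_mono powr_mono2) auto
      finally show "exc \<mu> t x \<le> ennreal (H powr (p - 1) * r powr - \<sigma>)" .
      have "(NINT y. ennreal (fkernel \<sigma> x y) * indicator (- ball x (6 * r)) y) \<le> ennreal (tail_const TYPE('a) \<sigma> * (6 * r) powr - \<sigma>)"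
        using S \<sigma> by (intro nn_integral_kernel_far) auto
      also have "\<dots> \<le> ennreal (tail_const TYPE('a) \<sigma> * r powr - \<sigma>)"
        using S \<sigma> tail_const_nonneg[OF \<sigma>(1), where 'a='a] by (intro ennreal_leI mult_left_mono powr_mono2') auto
      finally show "(NINT y. ennreal (fkernel \<sigma> x y) * indicator (- ball x (6 * r)) y) \<le> ennreal (tail_const TYPE('a) \<sigma> * r powr - \<sigma>)" .
    qed auto
    also have "\<dots> = ennreal (2 powr (p - 1) * (H powr (p - 1) * r powr - \<sigma>) + 2 powr (p - 1) * H powr (p - 1) * (tail_const TYPE('a) \<sigma> * r powr - \<sigma>))"
      using tail_const_nonneg[OF \<sigma>(1), where 'a='a] by (subst ennreal_plus) (auto simp: ennreal_mult)
    also have "2 powr (p - 1) * (H powr (p - 1) * r powr - \<sigma>) + 2 powr (p - 1) * H powr (p - 1) * (tail_const TYPE('a) \<sigma> * r powr - \<sigma>)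
       = 2 powr (p - 1) * (1 + tail_const TYPE('a) \<sigma>) * H powr (p - 1) * r powr - \<sigma>" by (simp add: algebra_simps)
    finally show "exc (\<mu> - H) t x
         \<le> ennreal (2 powr (p - 1) * (1 + tail_const TYPE('a) \<sigma>) * H powr (p - 1) * r powr - \<sigma>)" .
  qed
qed

text \<open>For H >= h0 the tail error H \<open>Tl\<close> scales like H^p r^(-\<sigma>), and r2 -
  r1 <= r bounds it by the scaling of the slope error. \<open>slope_const\<close> is the sum of the
  two coefficients.\<close>

lemma basic_estimate:
  assumes win: "osc_window r \<mu> h0 a b" and t: "t1 \<in> \<Theta>" "t2 \<in> \<Theta>" "a < t1" "t1 < t2" "t2 < b"
    and r: "0 < r1" "r1 < r2" "r2 \<le> 2 * r" "r2 - r1 \<le> r" and H: "h0 \<le> H" and l: "0 \<le> l" "l \<le> H" and c: "0 \<le> c" and q: "1 \<le> q"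
    and good: "AE t in lborel. t1 < t \<and> t \<le> t2 \<longrightarrow> (\<forall>x\<in>ball xo r2. cone_level xo \<mu> H r1 r2 x < V (x, t) \<longrightarrow>
       ennreal (c * (V (x, t) - cone_level xo \<mu> H r1 r2 x) powr (q - 1)) \<le>
       (NINT y. ennreal (fkernel \<sigma> x y * (V (x, t) - cone_level xo \<mu> H r1 r2 x + (cone_level xo \<mu> H r1 r2 y - V (y, t))) powr (p - 1))
          * indicator {y \<in> ball xo Rb. V (y, t) \<le> cone_level xo \<mu> H r1 r2 y} y))"
  shows "l\<^sup>2 / 2 * mS (\<mu> - H + l) r1 t2 + cG * c * l powr q * mQ (\<mu> - H + l) r1 t1 t2
     \<le> H\<^sup>2 / 2 * mS (\<mu> - H) r2 t1 + slope_const TYPE('a) s p C1 * H powr p * (r2 - r1) powr - \<sigma> * mQ (\<mu> - H) r2 t1 t2"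
proof -
  note S = osc_windowD[OF win]
  have H0: "0 < H" using S H by simp
  \<comment> \<open>The window may end at T, whereas \<open>level_estimate\<close> works on an
    interval ending strictly before T.\<close>
  define b' where "b' = (t2 + b) / 2"
  have b': "t2 < b'" "b' < b" "b' < T" using t S by (auto simp: b'_def)
  define Tl where "Tl = 2 powr (p - 1) * (1 + tail_const TYPE('a) \<sigma>) * H powr (p - 1) * r powr - \<sigma>"
  have tc: "0 < tail_const TYPE('a) \<sigma>" by (rule tail_const_nonneg[OF \<sigma>(1)])
  have Tl: "0 \<le> Tl" unfolding Tl_def using tc by simp
  have main: "l\<^sup>2 / 2 * mS (\<mu> - H + l) r1 t2 + cG * c * l powr q * mQ (\<mu> - H + l) r1 t1 t2
     \<le> H\<^sup>2 / 2 * mS (\<mu> - H) r2 t1 + (6 * C1 * cone_const * H powr p * (r2 - r1) powr - \<sigma> + 2 * C1 * H * Tl) * mQ (\<mu> - H) r2 t1 t2"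
  proof (rule level_estimate[where a = a and b = b'])
    show "\<And>x t. x \<in> ball xo Rb \<Longrightarrow> a < t \<Longrightarrow> t < b' \<Longrightarrow> V (x, t) \<le> \<mu>" using S(7) b' by auto
    show "AE t in lborel. a < t \<and> t < b' \<longrightarrow> (\<forall>x\<in>ball xo r2.
       exc (\<mu> - H) t x \<le> ennreal Tl)"
      using tail_of_shifted_level[OF win H] unfolding Tl_def
    proof eventually_elim
      case (elim t)
      show ?case
      proof (intro impI ballI)
        fix x assume "a < t \<and> t < b'" "x \<in> ball xo r2"
        then have "a < t \<and> t < b" "x \<in> ball xo (2 * r)" using b' r by auto
        then show "exc (\<mu> - H) t x
         \<le> ennreal (2 powr (p - 1) * (1 + tail_const TYPE('a) \<sigma>) * H powr (p - 1) * r powr - \<sigma>)" using elim by blast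
      qed
    qed
  qed (use t S r H0 l c q Tl b' good in auto)
  have "2 * C1 * H * Tl = 2 * C1 * (2 powr (p - 1) * (1 + tail_const TYPE('a) \<sigma>)) * (H * H powr (p - 1)) * r powr - \<sigma>"
    by (simp add: Tl_def mult_ac)
  also have "H * H powr (p - 1) = H powr p" using H0 by (simp add: powr_diff)
  also have "2 * C1 * (2 powr (p - 1) * (1 + tail_const TYPE('a) \<sigma>)) * H powr p * r powr - \<sigma> \<le> 2 * C1 * (2 powr (p - 1) * (1 + tail_const TYPE('a) \<sigma>)) * H powr p * (r2 - r1) powr - \<sigma>"
    using Co tc r S \<sigma> by (intro mult_left_mono powr_mono2') auto
  finally have "6 * C1 * cone_const * H powr p * (r2 - r1) powr - \<sigma> + 2 * C1 * H * Tl \<le> slope_const TYPE('a) s p C1 * H powr p * (r2 - r1) powr - \<sigma>"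
    by (simp add: slope_const_def cone_const_def distrib_right)
  then have "(6 * C1 * cone_const * H powr p * (r2 - r1) powr - \<sigma> + 2 * C1 * H * Tl) * mQ (\<mu> - H) r2 t1 t2
    \<le> slope_const TYPE('a) s p C1 * H powr p * (r2 - r1) powr - \<sigma> * mQ (\<mu> - H) r2 t1 t2"
    by (intro mult_right_mono cyl_meas_nonneg)
  then show ?thesis using main by linarith
qed

text \<open>The slice at the initial time is replaced by a mean: t1 is taken in (t', t'') where the
  slice is at most its average. The price is the factor 1/(t'' - t') and a gain counted only after
  t''.\<close>

lemma averaged_estimate:
  assumes win: "osc_window r \<mu> h0 a b" and t: "t2 \<in> \<Theta>" "a \<le> t'" "t' < t''" "t'' < t2" "t2 < b"
    and r: "0 < r1" "r1 < r2" "r2 \<le> 2 * r" "r2 - r1 \<le> r" and H: "h0 \<le> H" and l: "0 \<le> l" "l \<le> H" and c: "0 \<le> c" and q: "1 \<le> q"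
    and good: "AE t in lborel. t' < t \<and> t \<le> t2 \<longrightarrow> (\<forall>x\<in>ball xo r2. cone_level xo \<mu> H r1 r2 x < V (x, t) \<longrightarrow>
       ennreal (c * (V (x, t) - cone_level xo \<mu> H r1 r2 x) powr (q - 1)) \<le>
       (NINT y. ennreal (fkernel \<sigma> x y * (V (x, t) - cone_level xo \<mu> H r1 r2 x + (cone_level xo \<mu> H r1 r2 y - V (y, t))) powr (p - 1))
          * indicator {y \<in> ball xo Rb. V (y, t) \<le> cone_level xo \<mu> H r1 r2 y} y))"
  shows "l\<^sup>2 / 2 * mS (\<mu> - H + l) r1 t2 + cG * c * l powr q * mQ (\<mu> - H + l) r1 t'' t2
     \<le> (H\<^sup>2 / (2 * (t'' - t')) + slope_const TYPE('a) s p C1 * H powr p * (r2 - r1) powr - \<sigma>) * mQ (\<mu> - H) r2 t' t2"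
proof -
  note S = osc_windowD[OF win]
  have H0: "0 < H" using S H by simp
  have "AE t in lborel. t' < t \<and> t < t'' \<longrightarrow> t \<in> \<Theta>" using S(9) by eventually_elim (use t in auto)
  then obtain t1 where t1: "t1 \<in> \<Theta>" "t' < t1" "t1 < t''"
    and m: "mS (\<mu> - H) r2 t1 \<le> mQ (\<mu> - H) r2 t' t'' / (t'' - t')"
    using exists_time_below_average[OF V_meas t(3), of \<Theta> xo "\<mu> - H" r2] by blast
  have "l\<^sup>2 / 2 * mS (\<mu> - H + l) r1 t2 + cG * c * l powr q * mQ (\<mu> - H + l) r1 t1 t2
     \<le> H\<^sup>2 / 2 * mS (\<mu> - H) r2 t1 + slope_const TYPE('a) s p C1 * H powr p * (r2 - r1) powr - \<sigma> * mQ (\<mu> - H) r2 t1 t2"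
  proof (rule basic_estimate[OF win t1(1) t(1)])
    show "AE t in lborel. t1 < t \<and> t \<le> t2 \<longrightarrow> (\<forall>x\<in>ball xo r2. cone_level xo \<mu> H r1 r2 x < V (x, t) \<longrightarrow>
       ennreal (c * (V (x, t) - cone_level xo \<mu> H r1 r2 x) powr (q - 1)) \<le>
       (NINT y. ennreal (fkernel \<sigma> x y * (V (x, t) - cone_level xo \<mu> H r1 r2 x + (cone_level xo \<mu> H r1 r2 y - V (y, t))) powr (p - 1))
          * indicator {y \<in> ball xo Rb. V (y, t) \<le> cone_level xo \<mu> H r1 r2 y} y))" using good by eventually_elim (use t1 in auto)
  qed (use t t1 r H l c q in auto)
  moreover have "cG * c * l powr q * mQ (\<mu> - H + l) r1 t'' t2 \<le> cG * c * l powr q * mQ (\<mu> - H + l) r1 t1 t2"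
    using t1 c cG_pos by (intro mult_left_mono cyl_meas_mono V_meas) auto
  moreover have "slope_const TYPE('a) s p C1 * H powr p * (r2 - r1) powr - \<sigma> * mQ (\<mu> - H) r2 t1 t2 \<le> slope_const TYPE('a) s p C1 * H powr p * (r2 - r1) powr - \<sigma> * mQ (\<mu> - H) r2 t' t2"
    using t1 slope_pos by (intro mult_left_mono cyl_meas_mono V_meas) auto
  moreover have "H\<^sup>2 / 2 * mS (\<mu> - H) r2 t1 \<le> H\<^sup>2 / 2 * (mQ (\<mu> - H) r2 t' t2 / (t'' - t'))"
  proof (intro mult_left_mono order_trans[OF m] divide_right_mono cyl_meas_mono V_meas)
  qed (use t in auto)
  moreover have "H\<^sup>2 / 2 * (mQ (\<mu> - H) r2 t' t2 / (t'' - t')) = H\<^sup>2 / (2 * (t'' - t')) * mQ (\<mu> - H) r2 t' t2"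
    by simp
  ultimately show ?thesis unfolding distrib_right by linarith
qed

lemma sublevel_measurable:
  assumes [measurable]: "\<psi> \<in> borel_measurable borel"
  shows "{y \<in> ball z \<rho>. V (y, t) \<le> \<psi> y} \<in> sets borel"
proof -
  have [measurable]: "ball z \<rho> \<in> sets borel" by simp
  have "Measurable.pred borel (\<lambda>y. y \<in> ball z \<rho> \<and> V (y, t) \<le> \<psi> y)" by measurable
  then show ?thesis by (simp add: pred_def del: mem_ball)
qed

text \<open>At least a quarter of \<open>ball xo r\<close> lies below \<mu> - e. Against such y, any
  x above the cone has a gap of at least e/2, since H <= e/2, however small its own excess is. The
  gain is therefore a constant, which is the case q = 1.\<close>

lemma good_term_from_slices:
  assumes r: "0 < r" "8 * r \<le> Rb" "r1 < r2" "r2 \<le> 2 * r" and H: "0 < H" "H \<le> e / 2"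
    and m: "mS (\<mu> - e) r t \<le> 3 / 4 * unit_ball_vol (real DIM('a)) * r powr real DIM('a)"
    and x: "x \<in> ball xo r2" "cone_level xo \<mu> H r1 r2 x < V (x, t)"
  shows "ennreal (spread_const TYPE('a) s p * e powr (p - 1) * r powr - \<sigma>) \<le>
       (NINT y. ennreal (fkernel \<sigma> x y * (V (x, t) - cone_level xo \<mu> H r1 r2 x + (cone_level xo \<mu> H r1 r2 y - V (y, t))) powr (p - 1))
          * indicator {y \<in> ball xo Rb. V (y, t) \<le> cone_level xo \<mu> H r1 r2 y} y)"
proof -
  let ?\<psi> = "cone_level xo \<mu> H r1 r2"
  have H0: "0 \<le> H" using H by simp
  note \<psi> = cone_level_props[OF H0 r(3), where \<mu> = \<mu> and xo = xo]
  define Sy where "Sy = {y \<in> ball xo r. V (y, t) \<le> \<mu> - e}"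
  have Sm [measurable]: "Sy \<in> sets borel" unfolding Sy_def by (rule sublevel_measurable) simp
  have fin: "Sy \<in> fmeasurable lborel"
    by (rule fmeasurableI2[of "ball xo r"]) (auto simp: Sy_def fmeasurable_def emeasure_ball_less_top Sm[unfolded Sy_def])
  have "measure lborel (ball xo r) = measure lborel ({x \<in> ball xo r. \<mu> - e < V (x, t)} \<union> Sy)"
    by (rule arg_cong[where f = "measure lborel"]) (auto simp: Sy_def)
  also have "\<dots> \<le> measure lborel {x \<in> ball xo r. \<mu> - e < V (x, t)} + measure lborel Sy"
    by (rule measure_Un_le) (use slice_set_measurable[OF V_meas] Sm in auto)
  finally have mS: "unit_ball_vol (real DIM('a)) * r powr real DIM('a) / 4 \<le> measure lborel Sy"
    using m r(1) by (simp add: measure_ball_powr slice_meas_def)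
  define c where "c = (4 * r) powr - (real DIM('a) + \<sigma>) * (e / 2) powr (p - 1)"
  have "ennreal (spread_const TYPE('a) s p * e powr (p - 1) * r powr - \<sigma>) = ennreal (c * (unit_ball_vol (real DIM('a)) * r powr real DIM('a) / 4))"
  proof -
    have "r powr - (real DIM('a) + \<sigma>) * r powr real DIM('a) = r powr - \<sigma>" using r by (simp flip: powr_add)
    then have "c * (unit_ball_vol (real DIM('a)) * r powr real DIM('a) / 4) = 4 powr - (real DIM('a) + \<sigma>) * (e / 2) powr (p - 1) * unit_ball_vol (real DIM('a)) / 4 * r powr - \<sigma>"
      unfolding c_def powr_mult by (simp add: mult_ac)
    also have "(e / 2) powr (p - 1) = 2 powr (1 - p) * e powr (p - 1)" unfolding powr_divide using powr_minus_divide[of 2 "p - 1"] by simp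
    finally have eq: "c * (unit_ball_vol (real DIM('a)) * r powr real DIM('a) / 4) =
      4 powr - (real DIM('a) + \<sigma>) * (2 powr (1 - p) * e powr (p - 1)) * unit_ball_vol (real DIM('a)) / 4 * r powr - \<sigma>" .
    show ?thesis unfolding eq spread_const_def by (simp add: mult_ac)
  qed
  also have "\<dots> \<le> ennreal (c * measure lborel Sy)" using mS by (intro ennreal_leI mult_left_mono) (auto simp: c_def)
  also have "\<dots> = ennreal c * emeasure lborel Sy" using fin by (simp add: c_def ennreal_mult emeasure_eq_measure2)
  also have "\<dots> = (NINT y. ennreal c * indicator Sy y)" by (rule nn_integral_cmult_indicator[symmetric]) simp
  also have "\<dots> \<le> (NINT y. ennreal (fkernel \<sigma> x y * (V (x, t) - ?\<psi> x + (?\<psi> y - V (y, t))) powr (p - 1)) * indicator {y \<in> ball xo Rb. V (y, t) \<le> ?\<psi> y} y)"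
  proof (rule nn_integral_mono)
    fix y
    show "ennreal c * indicator Sy y \<le> ennreal (fkernel \<sigma> x y * (V (x, t) - ?\<psi> x + (?\<psi> y - V (y, t))) powr (p - 1)) * indicator {y \<in> ball xo Rb. V (y, t) \<le> ?\<psi> y} y"
    proof (cases "y \<in> Sy")
      case True
      then have yb: "y \<in> ball xo r" and Vy: "V (y, t) \<le> \<mu> - e" by (auto simp: Sy_def)
      have y\<psi>: "V (y, t) \<le> ?\<psi> y" using Vy \<psi>(1)[of y] H by linarith
      \<comment> \<open>The kernel is 0 on the diagonal, so its lower bound needs distinct points: x
        is above the cone and y is not.\<close>
      have "x \<noteq> y" using y\<psi> x(2) by auto
      moreover have "dist x y \<le> 4 * r" using x(1) yb r dist_triangle[of x y xo] by (auto simp: dist_commute)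
      ultimately have k: "(4 * r) powr - (real DIM('a) + \<sigma>) \<le> fkernel \<sigma> x y" using \<sigma> by (intro fkernel_ge) auto
      have "e / 2 \<le> V (x, t) - ?\<psi> x + (?\<psi> y - V (y, t))" using x(2) Vy \<psi>(1)[of y] H by linarith
      then have "(e / 2) powr (p - 1) \<le> (V (x, t) - ?\<psi> x + (?\<psi> y - V (y, t))) powr (p - 1)" using p H by (intro powr_mono2) auto
      then have "c \<le> fkernel \<sigma> x y * (V (x, t) - ?\<psi> x + (?\<psi> y - V (y, t))) powr (p - 1)"
        unfolding c_def using k by (intro mult_mono) auto
      moreover have "y \<in> ball xo Rb" using yb r by auto
      ultimately show ?thesis using True y\<psi> by (simp add: ennreal_leI)
    qed simp
  qed
  finally show ?thesis .
qed

text \<open>The superlevel set fills at most half of the volume of a \<rho>-ball, so half of the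
  \<rho>-ball about x is below the cone, and the kernel there is at least \<rho>^(-N-\<sigma>). The
  smaller the superlevel set, the smaller \<rho> may be and the larger the gain \<rho>^(-\<sigma>);
  this is the source of the superlinear recursion.\<close>

lemma good_term_from_smallness:
  assumes r: "r1 < r2" "r2 + \<rho> \<le> Rb" "0 < \<rho>" and H: "0 < H"
    and bound: "\<And>x. x \<in> ball xo Rb \<Longrightarrow> V (x, t) \<le> \<mu>"
    and m: "mS (\<mu> - H) r2 t \<le> unit_ball_vol (real DIM('a)) * \<rho> powr real DIM('a) / 2"
    and x: "x \<in> ball xo r2" "cone_level xo \<mu> H r1 r2 x < V (x, t)"
  shows "ennreal (unit_ball_vol (real DIM('a)) / 2 * \<rho> powr - \<sigma> * (V (x, t) - cone_level xo \<mu> H r1 r2 x) powr (p - 1)) \<le>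
       (NINT y. ennreal (fkernel \<sigma> x y * (V (x, t) - cone_level xo \<mu> H r1 r2 x + (cone_level xo \<mu> H r1 r2 y - V (y, t))) powr (p - 1))
          * indicator {y \<in> ball xo Rb. V (y, t) \<le> cone_level xo \<mu> H r1 r2 y} y)"
proof -
  let ?\<psi> = "cone_level xo \<mu> H r1 r2"
  have H0: "0 \<le> H" using H by simp
  note \<psi> = cone_level_props[OF H0 r(1), where \<mu> = \<mu> and xo = xo]
  define Sy where "Sy = {y \<in> ball x \<rho>. V (y, t) \<le> ?\<psi> y}"
  have Sm [measurable]: "Sy \<in> sets borel" unfolding Sy_def by (rule sublevel_measurable) simp
  have fin: "Sy \<in> fmeasurable lborel"
    by (rule fmeasurableI2[of "ball x \<rho>"]) (auto simp: Sy_def fmeasurable_def emeasure_ball_less_top Sm[unfolded Sy_def])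
  have inB: "y \<in> ball xo Rb" if "y \<in> ball x \<rho>" for y using that x(1) r dist_triangle[of xo y x] by auto
  \<comment> \<open>A point above the cone lies in \<open>ball xo r2\<close>, since outside it the
    level is \<mu>; and it exceeds \<mu> - H, the lowest value of the cone.\<close>
  have sub: "ball x \<rho> \<subseteq> {x \<in> ball xo r2. \<mu> - H < V (x, t)} \<union> Sy"
  proof
    fix y assume y: "y \<in> ball x \<rho>"
    show "y \<in> {x \<in> ball xo r2. \<mu> - H < V (x, t)} \<union> Sy"
    proof (cases "V (y, t) \<le> ?\<psi> y")
      case True then show ?thesis using y by (simp add: Sy_def)
    next
      case False
      have "y \<in> ball xo r2" using False \<psi>(4)[of y] bound[OF inB[OF y]] by (cases "y \<in> ball xo r2") auto
      then show ?thesis using False \<psi>(1)[of y] by auto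
    qed
  qed
  have fs: "{x \<in> ball xo r2. \<mu> - H < V (x, t)} \<in> fmeasurable lborel"
    using emeasure_slice[OF V_meas, of xo r2 "\<mu> - H" t] slice_set_measurable[OF V_meas, of xo r2 "\<mu> - H" t]
    by (simp add: fmeasurable_def del: mem_ball)
  have "measure lborel (ball x \<rho>) \<le> measure lborel ({x \<in> ball xo r2. \<mu> - H < V (x, t)} \<union> Sy)"
    using fs fin sub by (intro measure_mono_fmeasurable) (auto simp del: mem_ball)
  also have "\<dots> \<le> measure lborel {x \<in> ball xo r2. \<mu> - H < V (x, t)} + measure lborel Sy"
    by (rule measure_Un_le) (use slice_set_measurable[OF V_meas] Sm in auto)
  finally have mS: "unit_ball_vol (real DIM('a)) * \<rho> powr real DIM('a) / 2 \<le> measure lborel Sy"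
    using m r by (simp add: measure_ball_powr slice_meas_def)
  define c where "c = \<rho> powr - (real DIM('a) + \<sigma>) * (V (x, t) - ?\<psi> x) powr (p - 1)"
  have "ennreal (unit_ball_vol (real DIM('a)) / 2 * \<rho> powr - \<sigma> * (V (x, t) - ?\<psi> x) powr (p - 1)) = ennreal (c * (unit_ball_vol (real DIM('a)) * \<rho> powr real DIM('a) / 2))"
  proof -
    have "\<rho> powr - (real DIM('a) + \<sigma>) * \<rho> powr real DIM('a) = \<rho> powr - \<sigma>" using r by (simp flip: powr_add)
    then have "c * (unit_ball_vol (real DIM('a)) * \<rho> powr real DIM('a) / 2) = unit_ball_vol (real DIM('a)) / 2 * \<rho> powr - \<sigma> * (V (x, t) - ?\<psi> x) powr (p - 1)"
      unfolding c_def by (simp add: mult_ac)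
    then show ?thesis by (simp only:)
  qed
  also have "\<dots> \<le> ennreal (c * measure lborel Sy)" using mS by (intro ennreal_leI mult_left_mono) (auto simp: c_def)
  also have "\<dots> = ennreal c * emeasure lborel Sy" using fin by (simp add: c_def ennreal_mult emeasure_eq_measure2)
  also have "\<dots> = (NINT y. ennreal c * indicator Sy y)" by (rule nn_integral_cmult_indicator[symmetric]) simp
  also have "\<dots> \<le> (NINT y. ennreal (fkernel \<sigma> x y * (V (x, t) - ?\<psi> x + (?\<psi> y - V (y, t))) powr (p - 1)) * indicator {y \<in> ball xo Rb. V (y, t) \<le> ?\<psi> y} y)"
  proof (rule nn_integral_mono)
    fix y
    show "ennreal c * indicator Sy y \<le> ennreal (fkernel \<sigma> x y * (V (x, t) - ?\<psi> x + (?\<psi> y - V (y, t))) powr (p - 1)) * indicator {y \<in> ball xo Rb. V (y, t) \<le> ?\<psi> y} y"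
    proof (cases "y \<in> Sy")
      case True
      then have yb: "y \<in> ball x \<rho>" and y\<psi>: "V (y, t) \<le> ?\<psi> y" by (auto simp: Sy_def)
      have "x \<noteq> y" using y\<psi> x(2) by auto
      then have k: "\<rho> powr - (real DIM('a) + \<sigma>) \<le> fkernel \<sigma> x y" using \<sigma> yb by (intro fkernel_ge) auto
      have "(V (x, t) - ?\<psi> x) powr (p - 1) \<le> (V (x, t) - ?\<psi> x + (?\<psi> y - V (y, t))) powr (p - 1)"
        using p x(2) y\<psi> by (intro powr_mono2) auto
      then have "c \<le> fkernel \<sigma> x y * (V (x, t) - ?\<psi> x + (?\<psi> y - V (y, t))) powr (p - 1)"
        unfolding c_def using k by (intro mult_mono) auto
      then show ?thesis using True y\<psi> inB[OF yb] by (simp add: ennreal_leI)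
    qed simp
  qed
  finally show ?thesis .
qed

end

section \<open>Propagation in time and shrinking of superlevel sets\<close>

definition dwell_const :: "'a::euclidean_space itself \<Rightarrow> real \<Rightarrow> real \<Rightarrow> real \<Rightarrow> real" where
  "dwell_const _ s p C1 = (1 / (16 * real DIM('a))) powr (s * p) / (64 * slope_const TYPE('a) s p C1)"

text \<open>The ratio q satisfies q^\<kappa> = 1/B. In the induction the factor q^i inside Z i
  cancels the growth B^i, and the threshold on Z 0 says exactly that C (Z 0)^\<kappa> <= q, which
  supplies one more factor q.\<close>

lemma fast_geometric_decay:
  fixes Z :: "nat \<Rightarrow> real"
  assumes Z: "\<And>i. 0 \<le> Z i" and step: "\<And>i. Z (Suc i) \<le> C * B ^ i * Z i powr (1 + \<kappa>)"
    and C: "0 < C" and B: "1 < B" and \<kappa>: "0 < \<kappa>" and Z0: "Z 0 \<le> C powr (- 1 / \<kappa>) * B powr (- 1 / \<kappa>\<^sup>2)"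
  shows "Z \<longlonglongrightarrow> 0"
proof -
  define q where "q = B powr (- 1 / \<kappa>)"
  have q: "0 < q" "q < 1" using B \<kappa> by (auto simp: q_def powr_less_one)
  have "q powr \<kappa> = B powr (- 1)" using \<kappa> by (simp only: q_def powr_powr) simp
  then have qk: "q powr \<kappa> = 1 / B" using B by (simp add: powr_minus_divide)
  have Z0k: "C * Z 0 powr \<kappa> \<le> q"
  proof -
    have "Z 0 powr \<kappa> \<le> (C powr (- 1 / \<kappa>) * B powr (- 1 / \<kappa>\<^sup>2)) powr \<kappa>"
      using Z Z0 \<kappa> by (intro powr_mono2) auto
    also have "\<dots> = C powr (- 1) * B powr (- 1 / \<kappa>)" using \<kappa> unfolding powr_mult powr_powr by (simp add: power2_eq_square)
    finally have "C * Z 0 powr \<kappa> \<le> C * (C powr (- 1) * B powr (- 1 / \<kappa>))" using C by (intro mult_left_mono) auto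
    also have "\<dots> = q" using C by (simp add: q_def powr_minus_divide)
    finally show ?thesis .
  qed
  have bd: "Z i \<le> Z 0 * q ^ i" for i
  proof (induction i)
    case (Suc i)
    have "Z (Suc i) \<le> C * B ^ i * (Z i powr \<kappa> * Z i)"
      using step[of i] Z[of i] by (simp add: powr_add mult.commute[of "Z i" "Z i powr \<kappa>"])
    also have "\<dots> \<le> C * B ^ i * ((Z 0 * q ^ i) powr \<kappa> * (Z 0 * q ^ i))"
      using Suc Z C B \<kappa> by (intro mult_left_mono mult_mono powr_mono2) auto
    also have "(Z 0 * q ^ i) powr \<kappa> = Z 0 powr \<kappa> * (1 / B) ^ i"
      unfolding powr_mult qk[symmetric] using q by (simp add: powr_realpow[symmetric] powr_powr mult.commute)
    also have "C * B ^ i * (Z 0 powr \<kappa> * (1 / B) ^ i * (Z 0 * q ^ i)) = (C * Z 0 powr \<kappa>) * (Z 0 * q ^ i)"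
      using B by (simp add: power_one_over mult_ac)
    also have "\<dots> \<le> q * (Z 0 * q ^ i)" using Z0k Z q by (intro mult_right_mono) auto
    finally show ?case by (simp add: mult_ac)
  qed simp
  have "(\<lambda>i. Z 0 * q ^ i) \<longlonglongrightarrow> Z 0 * 0" using q by (intro tendsto_mult_left LIMSEQ_power_zero) auto
  then have lim: "(\<lambda>i. Z 0 * q ^ i) \<longlonglongrightarrow> 0" by simp
  show ?thesis by (rule tendsto_sandwich[OF _ _ tendsto_const lim]) (use Z bd in auto)
qed

lemma cyl_meas_le:
  fixes V :: "'a::euclidean_space \<times> real \<Rightarrow> real"
  assumes V: "V \<in> borel_measurable borel2" and "t1 \<le> t2" "0 < \<rho>"
  shows "cyl_meas V xo \<kappa> \<rho> t1 t2 \<le> (t2 - t1) * (unit_ball_vol (real DIM('a)) * \<rho> powr real DIM('a))"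
proof -
  note [measurable] = V
  have "ennreal (cyl_meas V xo \<kappa> \<rho> t1 t2) = (NINT t. ennreal (slice_meas V xo \<kappa> \<rho> t) * indicator {t1<..t2} t)"
    by (rule nn_integral_slice_meas[symmetric]) (rule V)
  also have "\<dots> \<le> (NINT t. ennreal (measure lborel (ball xo \<rho>)) * indicator {t1<..t2} t)"
    by (intro nn_integral_mono mult_right_mono ennreal_leI slice_meas_le_ball V) auto
  also have "\<dots> = ennreal (measure lborel (ball xo \<rho>)) * ennreal (t2 - t1)" using assms by (subst nn_integral_cmult_indicator) auto
  also have "\<dots> = ennreal ((t2 - t1) * measure lborel (ball xo \<rho>))" using assms by (simp add: ennreal_mult[symmetric] mult.commute)
  finally have "cyl_meas V xo \<kappa> \<rho> t1 t2 \<le> (t2 - t1) * measure lborel (ball xo \<rho>)"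
    using assms by (subst (asm) ennreal_le_iff) auto
  then show ?thesis using measure_ball_powr[OF \<open>0 < \<rho>\<close>, of xo] by simp
qed

text \<open>The constant accumulated by the halvings in \<open>shrink_iterate\<close>. The step from
  n to n + 1 has time gap 2^(-n-2) and radius gap 2^(-n-1), up to the factors b - t0 and r; the
  factor \<open>2 powr (real n * m)\<close> arises because the induction hypothesis is used at
  height 2 H.\<close>

primrec shrink_const :: "real \<Rightarrow> real \<Rightarrow> real \<Rightarrow> real \<Rightarrow> real \<Rightarrow> real \<Rightarrow> real \<Rightarrow> real \<Rightarrow> nat \<Rightarrow> real" where
  "shrink_const A0 c0 G d p \<sigma> m dd 0 = A0"
| "shrink_const A0 c0 G d p \<sigma> m dd (Suc n) =
     16 powr (p - 1) / c0 * (2 ^ (n + 4) / d + G * 2 powr (p + (real n + 1) * \<sigma>)) * 2 powr (real n * m) * shrink_const A0 c0 G d p \<sigma> m dd n"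

context slice_solution begin

lemma dwell_const_pos: "0 < dwell_const TYPE('a) s p C1"
  using slope_pos by (simp add: dwell_const_def)

text \<open>The basic estimate without gain, from t0 to t. In units of M^2 times the volume of the
  ball, the right-hand side is at most 1/4 from the slice at t0 plus 1/64 from the slope; the value
  of \<open>dwell_const\<close> is made for the latter. Division by (15/16)^2/2 leaves less than
  0.61 of the ball, and the omitted shell adds 1/16, in total below 3/4.\<close>

lemma propagation:
  assumes win: "osc_window r \<mu> h0 a b" and t0: "t0 \<in> \<Theta>" "a < t0" and M: "h0 \<le> M"
    and half: "mS (\<mu> - M) r t0 \<le> unit_ball_vol (real DIM('a)) * r powr real DIM('a) / 2"
    and short: "b - t0 \<le> dwell_const TYPE('a) s p C1 * M powr (2 - p) * r powr \<sigma>"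
    and t: "t \<in> \<Theta>" "t0 < t" "t < b"
  shows "mS (\<mu> - M / 16) r t \<le> 3 / 4 * unit_ball_vol (real DIM('a)) * r powr real DIM('a)"
proof -
  note S = osc_windowD[OF win]
  have M0: "0 < M" using S M by simp
  define \<beta> where "\<beta> = unit_ball_vol (real DIM('a))"
  define P where "P = \<beta> * r powr real DIM('a)"
  have P: "0 < P" using S ball_vol_pos by (simp add: P_def \<beta>_def)
  \<comment> \<open>By Bernoulli's inequality a shell of relative thickness 1/(16 N) takes at most
    1/16 of the volume.\<close>
  define \<delta> where "\<delta> = 1 / (16 * real DIM('a))"
  have N1: "1 \<le> real DIM('a)" using DIM_positive[where 'a='a] by linarith
  have \<delta>: "0 < \<delta>" "\<delta> < 1" unfolding \<delta>_def using N1 by (simp, subst divide_less_eq_1_pos) linarith+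
  define r1 where "r1 = (1 - \<delta>) * r"
  have r1: "0 < r1" "r1 < r" "r - r1 = \<delta> * r" using \<delta> S by (auto simp: r1_def algebra_simps)
  define l where "l = 15 / 16 * M"
  let ?G = "slope_const TYPE('a) s p C1"
  have "l\<^sup>2 / 2 * mS (\<mu> - M + l) r1 t + cG * 0 * l powr 1 * mQ (\<mu> - M + l) r1 t0 t
     \<le> M\<^sup>2 / 2 * mS (\<mu> - M) r t0 + ?G * M powr p * (r - r1) powr - \<sigma> * mQ (\<mu> - M) r t0 t"
    by (rule basic_estimate[OF win]) (use t0 t r1 S M M0 \<delta> in \<open>auto simp: l_def\<close>)
  moreover have "\<mu> - M + l = \<mu> - M / 16" by (simp add: l_def)
  ultimately have main: "l\<^sup>2 / 2 * mS (\<mu> - M / 16) r1 t \<le> M\<^sup>2 / 2 * mS (\<mu> - M) r t0 + ?G * M powr p * (r - r1) powr - \<sigma> * mQ (\<mu> - M) r t0 t"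
    by simp
  have "?G * M powr p * (r - r1) powr - \<sigma> * mQ (\<mu> - M) r t0 t \<le> ?G * M powr p * (r - r1) powr - \<sigma> * ((b - t0) * P)"
  proof (rule mult_left_mono)
    have "mQ (\<mu> - M) r t0 t \<le> (t - t0) * P"
      using cyl_meas_le[OF V_meas, of t0 t r xo "\<mu> - M"] t S by (simp add: P_def \<beta>_def)
    also have "\<dots> \<le> (b - t0) * P" using t P by (intro mult_right_mono) auto
    finally show "mQ (\<mu> - M) r t0 t \<le> (b - t0) * P" .
  qed (use slope_pos in simp)
  also have "\<dots> \<le> ?G * M powr p * (r - r1) powr - \<sigma> * ((dwell_const TYPE('a) s p C1 * M powr (2 - p) * r powr \<sigma>) * P)"
    using short P slope_pos by (intro mult_left_mono mult_right_mono) auto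
  also have "\<dots> = ?G * dwell_const TYPE('a) s p C1 * \<delta> powr - \<sigma> * (M powr p * M powr (2 - p)) * (r powr - \<sigma> * r powr \<sigma>) * P"
    unfolding r1(3) powr_mult by (simp add: mult_ac)
  also have "M powr p * M powr (2 - p) = M\<^sup>2" using M0 by (simp flip: powr_add add: powr_numeral)
  also have "r powr - \<sigma> * r powr \<sigma> = 1" using S by (simp flip: powr_add)
  also have "?G * dwell_const TYPE('a) s p C1 * \<delta> powr - \<sigma> = 1 / 64"
  proof -
    have "\<delta> powr \<sigma> * \<delta> powr - \<sigma> = 1" using \<delta> by (simp flip: powr_add)
    then show ?thesis using slope_pos unfolding dwell_const_def \<delta>_def by simp
  qed
  finally have e1: "?G * M powr p * (r - r1) powr - \<sigma> * mQ (\<mu> - M) r t0 t \<le> M\<^sup>2 * (P / 64)" by simp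
  have "M\<^sup>2 / 2 * mS (\<mu> - M) r t0 \<le> M\<^sup>2 / 2 * (P / 2)"
    using half by (intro mult_left_mono) (auto simp: P_def \<beta>_def)
  then have "l\<^sup>2 / 2 * mS (\<mu> - M / 16) r1 t \<le> M\<^sup>2 * (P * (17 / 64))" using main e1 by (simp add: algebra_simps)
  moreover have "l\<^sup>2 / 2 = M\<^sup>2 * (225 / 512)" by (simp add: l_def power2_eq_square)
  ultimately have "M\<^sup>2 * (225 / 512 * mS (\<mu> - M / 16) r1 t) \<le> M\<^sup>2 * (P * (17 / 64))" by (simp add: mult.assoc)
  then have m1: "mS (\<mu> - M / 16) r1 t \<le> P * (17 / 64) * (512 / 225)" using M0 by (subst (asm) mult_le_cancel_left_pos) auto
  have "1 + real DIM('a) * (- \<delta>) \<le> (1 + (- \<delta>)) ^ DIM('a)" using \<delta> by (intro Bernoulli_inequality) auto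
  then have bern: "15 / 16 \<le> (1 - \<delta>) ^ DIM('a)" using N1 by (simp add: \<delta>_def)
  have P1: "measure lborel (ball xo r1) = P * (1 - \<delta>) ^ DIM('a)"
    using r1 \<delta> S by (simp add: measure_ball_powr P_def \<beta>_def r1_def powr_realpow power_mult_distrib)
  have fmb: "ball xo \<rho> \<in> fmeasurable lborel" for \<rho> using emeasure_ball_less_top[of xo \<rho>] by (simp add: fmeasurable_def)
  have "mS (\<mu> - M / 16) r t \<le> measure lborel ({x \<in> ball xo r1. \<mu> - M / 16 < V (x, t)} \<union> (ball xo r - ball xo r1))"
    unfolding slice_meas_def
  proof (rule measure_mono_fmeasurable)
    show "{x \<in> ball xo r1. \<mu> - M / 16 < V (x, t)} \<union> (ball xo r - ball xo r1) \<in> fmeasurable lborel"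
    proof (intro fmeasurable.Un fmeasurable.Diff fmb)
      show "{x \<in> ball xo r1. \<mu> - M / 16 < V (x, t)} \<in> fmeasurable lborel"
        by (rule fmeasurableI2[OF fmb[of r1]]) (use slice_set_measurable[OF V_meas] in auto)
    qed
    show "{x \<in> ball xo r. \<mu> - M / 16 < V (x, t)} \<in> sets lborel" using slice_set_measurable[OF V_meas] by simp
  qed auto
  also have "\<dots> \<le> mS (\<mu> - M / 16) r1 t + measure lborel (ball xo r - ball xo r1)"
    unfolding slice_meas_def using slice_set_measurable[OF V_meas, of xo r1 "\<mu> - M / 16" t] by (intro measure_Un_le) auto
  also have "measure lborel (ball xo r - ball xo r1) = P - P * (1 - \<delta>) ^ DIM('a)"
  proof (subst measure_Diff)
    show "emeasure lborel (ball xo r) \<noteq> \<infinity>" using emeasure_ball_less_top[of xo r] by auto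
    show "ball xo r1 \<subseteq> ball xo r" using r1 by auto
    show "measure lborel (ball xo r) - measure lborel (ball xo r1) = P - P * (1 - \<delta>) ^ DIM('a)"
      unfolding P1 using S by (simp add: measure_ball_powr P_def \<beta>_def)
  qed auto
  also have "P - P * (1 - \<delta>) ^ DIM('a) \<le> P / 16" using mult_left_mono[OF bern, of P] P by simp
  finally have "mS (\<mu> - M / 16) r t \<le> P * (17 / 64) * (512 / 225) + P / 16" using m1 by linarith
  also have "\<dots> \<le> 3 / 4 * P" using P by simp
  finally show ?thesis by (simp add: P_def \<beta>_def)
qed

text \<open>One halving of the height, with the constant gain of
  \<open>good_term_from_slices\<close> and q = 1. The slice at the end time is nonnegative and
  dropped.\<close>

lemma shrink_step:
  assumes win: "osc_window r \<mu> h0 a b" and t0: "a < t0"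
    and slices: "\<And>t. t \<in> \<Theta> \<Longrightarrow> t0 < t \<Longrightarrow> t < b \<Longrightarrow> mS (\<mu> - e) r t \<le> 3 / 4 * unit_ball_vol (real DIM('a)) * r powr real DIM('a)"
    and te: "te \<in> \<Theta>" "t0 \<le> t'" "t' < t''" "t'' < te" "te < b"
    and r: "r \<le> r1" "r1 < r2" "r2 \<le> 2 * r" and H: "h0 \<le> H" "H \<le> e / 2"
  shows "cG * (spread_const TYPE('a) s p * e powr (p - 1) * r powr - \<sigma>) * (H / 2) * mQ (\<mu> - H / 2) r1 t'' te
     \<le> (H\<^sup>2 / (2 * (t'' - t')) + slope_const TYPE('a) s p C1 * H powr p * (r2 - r1) powr - \<sigma>) * mQ (\<mu> - H) r2 t' te"
proof -
  note S = osc_windowD[OF win]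
  have H0: "0 < H" using S H by simp
  define c where "c = spread_const TYPE('a) s p * e powr (p - 1) * r powr - \<sigma>"
  have c: "0 \<le> c" using spread_const_pos[of s p, where 'a='a] by (simp add: c_def)
  have A: "(H / 2)\<^sup>2 / 2 * mS (\<mu> - H + H / 2) r1 te + cG * c * (H / 2) powr 1 * mQ (\<mu> - H + H / 2) r1 t'' te
     \<le> (H\<^sup>2 / (2 * (t'' - t')) + slope_const TYPE('a) s p C1 * H powr p * (r2 - r1) powr - \<sigma>) * mQ (\<mu> - H) r2 t' te"
  proof (rule averaged_estimate[OF win te(1)])
    show "AE t in lborel. t' < t \<and> t \<le> te \<longrightarrow> (\<forall>x\<in>ball xo r2. cone_level xo \<mu> H r1 r2 x < V (x, t) \<longrightarrow>
       ennreal (c * (V (x, t) - cone_level xo \<mu> H r1 r2 x) powr (1 - 1)) \<le>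
       (NINT y. ennreal (fkernel \<sigma> x y * (V (x, t) - cone_level xo \<mu> H r1 r2 x + (cone_level xo \<mu> H r1 r2 y - V (y, t))) powr (p - 1))
          * indicator {y \<in> ball xo Rb. V (y, t) \<le> cone_level xo \<mu> H r1 r2 y} y))" using S(9)
    proof eventually_elim
      case (elim t)
      show ?case
      proof (intro impI ballI)
        fix x assume t: "t' < t \<and> t \<le> te" and x: "x \<in> ball xo r2" "cone_level xo \<mu> H r1 r2 x < V (x, t)"
        have "t \<in> \<Theta>" "t0 < t" "t < b" using elim t te t0 by auto
        then have "mS (\<mu> - e) r t \<le> 3 / 4 * unit_ball_vol (real DIM('a)) * r powr real DIM('a)" by (rule slices)
        from good_term_from_slices[OF S(1,2) r(2,3) H0 H(2) this x]
        show "ennreal (c * (V (x, t) - cone_level xo \<mu> H r1 r2 x) powr (1 - 1)) \<le>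
       (NINT y. ennreal (fkernel \<sigma> x y * (V (x, t) - cone_level xo \<mu> H r1 r2 x + (cone_level xo \<mu> H r1 r2 y - V (y, t))) powr (p - 1))
          * indicator {y \<in> ball xo Rb. V (y, t) \<le> cone_level xo \<mu> H r1 r2 y} y)" using x by (simp add: c_def)
      qed
    qed
  qed (use te t0 S r H H0 c in auto)
  have eq: "(H / 2) powr 1 = H / 2" "\<mu> - H + H / 2 = \<mu> - H / 2" using H0 by auto
  have "0 \<le> (H / 2)\<^sup>2 / 2 * mS (\<mu> - H / 2) r1 te" by (simp add: slice_meas_nonneg)
  with A have "cG * c * (H / 2) * mQ (\<mu> - H / 2) r1 t'' te
     \<le> (H\<^sup>2 / (2 * (t'' - t')) + slope_const TYPE('a) s p C1 * H powr p * (r2 - r1) powr - \<sigma>) * mQ (\<mu> - H) r2 t' te"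
    unfolding eq by linarith
  then show ?thesis by (simp only: c_def)
qed

text \<open>Each halving wins a factor (H/M)^m. Divided by the gain, of order M^(p-1) r^(-\<sigma>)
  H, the time error leaves H/M, because the window has intrinsic length, and the slope error leaves
  (H/M)^(p-1); an m below both 1 and p - 1 serves for either. Going backwards through the induction
  the height doubles, so 2^n H <= M/32 keeps it below half the depth M/16 known for the
  slices.\<close>

lemma shrink_iterate:
  assumes win: "osc_window r \<mu> h0 a b" and t0: "a < t0" "t0 < b" and M: "0 < M"
    and slices: "\<And>t. t \<in> \<Theta> \<Longrightarrow> t0 < t \<Longrightarrow> t < b \<Longrightarrow> mS (\<mu> - M / 16) r t \<le> 3 / 4 * unit_ball_vol (real DIM('a)) * r powr real DIM('a)"
    and te: "te \<in> \<Theta>" "t0 + (b - t0) / 2 < te" "te < b"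
    and d: "0 < d" "d * M powr (2 - p) * r powr \<sigma> \<le> 2 * (b - t0)"
    and m: "0 < m" "m \<le> 1" "m \<le> p - 1"
    and H: "h0 \<le> H" "2 ^ n * H \<le> M / 32"
  shows "mQ (\<mu> - H) ((1 + 1 / 2 ^ n) * r) (t0 + (b - t0) * (1 / 2 - 1 / 2 ^ (n + 1))) te
     \<le> shrink_const (unit_ball_vol (real DIM('a)) * 2 powr real DIM('a)) (cG * spread_const TYPE('a) s p) (slope_const TYPE('a) s p C1) d p \<sigma> m 0 n
        * (H / M) powr (real n * m) * ((b - t0) * r powr real DIM('a))" using H
proof (induction n arbitrary: H)
  case 0
  note S = osc_windowD[OF win]
  have "mQ (\<mu> - H) (2 * r) t0 te \<le> (te - t0) * (unit_ball_vol (real DIM('a)) * (2 * r) powr real DIM('a))"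
  proof (rule cyl_meas_le[OF V_meas])
    have "0 < (b - t0) / 2" using t0(2) by simp
    then show "t0 \<le> te" using te(2) by linarith
  qed (use S in simp)
  also have "\<dots> \<le> (b - t0) * (unit_ball_vol (real DIM('a)) * (2 * r) powr real DIM('a))" using te by (intro mult_right_mono) auto
  finally show ?case using S M 0 by (simp add: powr_mult mult_ac)
next
  case (Suc n)
  note S = osc_windowD[OF win]
  define \<tau> where "\<tau> = b - t0"
  have \<tau>: "0 < \<tau>" using t0 by (simp add: \<tau>_def)
  define A where "A = shrink_const (unit_ball_vol (real DIM('a)) * 2 powr real DIM('a)) (cG * spread_const TYPE('a) s p) (slope_const TYPE('a) s p C1) d p \<sigma> m 0 n"
  have H0: "0 < H" using S Suc by simp
  have pw: "(1::real) \<le> 2 ^ n" by simp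
  have H2: "h0 \<le> 2 * H" "2 ^ n * (2 * H) \<le> M / 32" using Suc.prems H0 by auto
  have "2 * H \<le> 2 ^ n * (2 * H)" using pw H0 mult_right_mono[of 1 "2 ^ n" "2 * H"] by simp
  then have HM: "2 * H \<le> M / 16 / 2" using H2 by simp
  then have hM: "H / M \<le> 1" "0 < H / M" using H0 M by (auto simp: field_simps)
  define t' where "t' = t0 + \<tau> * (1 / 2 - 1 / 2 ^ (n + 1))"
  define t'' where "t'' = t0 + \<tau> * (1 / 2 - 1 / 2 ^ (n + 2))"
  define r1 where "r1 = (1 + 1 / 2 ^ (n + 1)) * r"
  define r2 where "r2 = (1 + 1 / 2 ^ n) * r"
  have tt: "t'' - t' = \<tau> / 2 ^ (n + 2)" by (simp add: t'_def t''_def field_simps)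
  have rr: "r2 - r1 = r / 2 ^ (n + 1)" by (simp add: r1_def r2_def field_simps)
  have IH: "mQ (\<mu> - 2 * H) r2 t' te \<le> A * (2 * H / M) powr (real n * m) * (\<tau> * r powr real DIM('a))"
    using Suc.IH[OF H2] by (simp add: A_def r2_def t'_def \<tau>_def)
  have "(1::real) / 2 ^ (n + 1) \<le> 1 / 2" by (simp add: field_simps)
  then have t'0: "t0 \<le> t'" using \<tau> by (simp add: t'_def)
  have t''e: "t'' < te"
  proof -
    have "t'' \<le> t0 + \<tau> * (1 / 2)" unfolding t''_def using \<tau> by (intro add_left_mono mult_left_mono) auto
    then show ?thesis using te by (simp add: \<tau>_def)
  qed
  have "(1::real) / 2 ^ n \<le> 1" by simp
  then have "(1 + 1 / 2 ^ n) * r \<le> 2 * r" using S by (intro mult_right_mono) auto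
  then have r22: "r2 \<le> 2 * r" by (simp add: r2_def)
  define Y where "Y = mQ (\<mu> - H) r1 t'' te"
  define Y0 where "Y0 = mQ (\<mu> - 2 * H) r2 t' te"
  have Y0: "0 \<le> Y0" by (simp add: Y0_def cyl_meas_nonneg)
  define c0 where "c0 = cG * spread_const TYPE('a) s p"
  have c0: "0 < c0" using cG_pos spread_const_pos[of s p, where 'a='a] by (simp add: c0_def)
  let ?G = "slope_const TYPE('a) s p C1"
  have G: "0 < ?G" by (rule slope_pos)
  have "cG * (spread_const TYPE('a) s p * (M / 16) powr (p - 1) * r powr - \<sigma>) * (2 * H / 2) * mQ (\<mu> - 2 * H / 2) r1 t'' te
     \<le> ((2 * H)\<^sup>2 / (2 * (t'' - t')) + ?G * (2 * H) powr p * (r2 - r1) powr - \<sigma>) * mQ (\<mu> - 2 * H) r2 t' te"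
  proof (rule shrink_step[OF win t0(1) slices te(1) t'0])
    have "0 < \<tau> / 2 ^ (n + 2)" "0 < r / 2 ^ (n + 1)" using \<tau> S by auto
    then show "t' < t''" "r1 < r2" using tt rr by linarith+
    show "r \<le> r1" using S by (simp add: r1_def)
  qed (use t''e te r22 H2 HM in auto)
  then have st: "c0 * (M / 16) powr (p - 1) * r powr - \<sigma> * H * Y \<le> ((2 * H)\<^sup>2 / (2 * (\<tau> / 2 ^ (n + 2))) + ?G * (2 * H) powr p * (r / 2 ^ (n + 1)) powr - \<sigma>) * Y0"
    by (simp add: Y_def Y0_def tt rr c0_def mult_ac)
  define D where "D = c0 * (M / 16) powr (p - 1) * r powr - \<sigma> * H"
  have D: "0 < D" using c0 M S H0 by (simp add: D_def)
  define F where "F = 16 powr (p - 1) / c0 * (2 ^ (n + 4) / d + ?G * 2 powr (p + (real n + 1) * \<sigma>))"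
  have F0: "0 \<le> F" using c0 d G by (simp add: F_def)
  \<comment> \<open>Since H <= M, the smaller exponent gives the larger power.\<close>
  have hm: "H / M \<le> (H / M) powr m" "(H / M) powr (p - 1) \<le> (H / M) powr m"
    using powr_mono'[of m 1 "H / M"] powr_mono'[of m "p - 1" "H / M"] hM m H0 M by auto
  have "(2 * H)\<^sup>2 / (2 * (\<tau> / 2 ^ (n + 2))) + ?G * (2 * H) powr p * (r / 2 ^ (n + 1)) powr - \<sigma> \<le> D * (F * (H / M) powr m)"
  proof -
    have DE: "D * (16 powr (p - 1) / c0) = M powr (p - 1) * r powr - \<sigma> * H" using c0 by (simp add: D_def powr_divide)
    have "M powr (2 - p) * r powr \<sigma> * (M powr (p - 1) * r powr - \<sigma>) = M"
    proof -
      have "M powr (2 - p) * M powr (p - 1) = M" using M by (simp flip: powr_add)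
      moreover have "r powr \<sigma> * r powr - \<sigma> = 1" using S by (simp flip: powr_add)
      ultimately show ?thesis by (simp add: mult.assoc mult.left_commute[of "r powr \<sigma>"])
    qed
    \<comment> \<open>The lower bound on the length of the window, cleared of M^(2-p) r^\<sigma>. In
      the time error it trades 1/\<tau> for a multiple of M^(p-2) r^(-\<sigma>).\<close>
    then have dM: "d * M \<le> 2 * \<tau> * (M powr (p - 1) * r powr - \<sigma>)"
      using mult_right_mono[OF d(2), of "M powr (p - 1) * r powr - \<sigma>"] by (simp add: \<tau>_def mult.assoc)
    define E where "E = (2::real) ^ (n + 2)"
    have E: "0 < E" "2 ^ (n + 3) = 2 * E" "2 ^ (n + 4) = 4 * E" by (auto simp: E_def power_add)
    have "(2 * H)\<^sup>2 / (2 * (\<tau> / 2 ^ (n + 2))) = 2 ^ (n + 3) * H\<^sup>2 / \<tau>"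
      unfolding E E_def[symmetric] using \<tau> by (simp add: power2_eq_square field_simps)
    also have "\<dots> \<le> 2 ^ (n + 4) / d * (M powr (p - 1) * r powr - \<sigma> * H) * (H / M)"
    proof -
      have "2 ^ (n + 3) * H\<^sup>2 * (d * M) \<le> 2 ^ (n + 3) * H\<^sup>2 * (2 * \<tau> * (M powr (p - 1) * r powr - \<sigma>))"
        using dM by (intro mult_left_mono) auto
      then show ?thesis unfolding E using \<tau> d M E(1) by (simp add: field_simps power2_eq_square)
    qed
    also have "\<dots> \<le> 2 ^ (n + 4) / d * (M powr (p - 1) * r powr - \<sigma> * H) * (H / M) powr m"
      using hm d M H0 by (intro mult_left_mono) auto
    finally have 1: "(2 * H)\<^sup>2 / (2 * (\<tau> / 2 ^ (n + 2))) \<le> 2 ^ (n + 4) / d * (M powr (p - 1) * r powr - \<sigma> * H) * (H / M) powr m" .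
    have "(r / 2 ^ (n + 1)) powr - \<sigma> = r powr - \<sigma> * 2 powr ((real n + 1) * \<sigma>)"
    proof -
      have "(2 ^ (n + 1)) powr - \<sigma> = (2::real) powr - ((real n + 1) * \<sigma>)"
        by (simp add: powr_realpow[symmetric] powr_powr del: power_Suc) (simp add: algebra_simps)
      then show ?thesis unfolding powr_divide by (simp add: powr_minus_divide)
    qed
    then have "?G * (2 * H) powr p * (r / 2 ^ (n + 1)) powr - \<sigma> = ?G * 2 powr (p + (real n + 1) * \<sigma>) * (H powr p * r powr - \<sigma>)"
      unfolding powr_mult powr_add by (simp add: mult_ac)
    also have "H powr p = M powr (p - 1) * H * (H / M) powr (p - 1)" using H0 M by (simp add: powr_divide powr_diff)
    also have "?G * 2 powr (p + (real n + 1) * \<sigma>) * (M powr (p - 1) * H * (H / M) powr (p - 1) * r powr - \<sigma>) =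
        ?G * 2 powr (p + (real n + 1) * \<sigma>) * (M powr (p - 1) * r powr - \<sigma> * H) * (H / M) powr (p - 1)" by (simp add: mult_ac)
    also have "\<dots> \<le> ?G * 2 powr (p + (real n + 1) * \<sigma>) * (M powr (p - 1) * r powr - \<sigma> * H) * (H / M) powr m"
      using hm G H0 by (intro mult_left_mono) auto
    finally have 2: "?G * (2 * H) powr p * (r / 2 ^ (n + 1)) powr - \<sigma> \<le> ?G * 2 powr (p + (real n + 1) * \<sigma>) * (M powr (p - 1) * r powr - \<sigma> * H) * (H / M) powr m" .
    have "D * (F * (H / M) powr m) = D * (16 powr (p - 1) / c0) * (2 ^ (n + 4) / d + ?G * 2 powr (p + (real n + 1) * \<sigma>)) * (H / M) powr m"
      by (simp add: F_def)
    also have "\<dots> = 2 ^ (n + 4) / d * (M powr (p - 1) * r powr - \<sigma> * H) * (H / M) powr m + ?G * 2 powr (p + (real n + 1) * \<sigma>) * (M powr (p - 1) * r powr - \<sigma> * H) * (H / M) powr m"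
      unfolding DE by (simp add: algebra_simps)
    finally show ?thesis using 1 2 by linarith
  qed
  then have "D * Y \<le> D * (F * (H / M) powr m) * Y0" using st Y0 by (smt (verit, best) D_def mult_right_mono)
  then have "Y \<le> F * (H / M) powr m * Y0" using D by (simp add: mult.assoc)
  also have "\<dots> \<le> F * (H / M) powr m * (A * (2 * H / M) powr (real n * m) * (\<tau> * r powr real DIM('a)))"
    using IH F0 by (intro mult_left_mono) (auto simp: Y0_def)
  also have "(2 * H / M) powr (real n * m) = 2 powr (real n * m) * (H / M) powr (real n * m)" using powr_mult[of 2 "H / M" "real n * m"] by simp
  also have "F * (H / M) powr m * (A * (2 powr (real n * m) * (H / M) powr (real n * m)) * (\<tau> * r powr real DIM('a))) =
     F * 2 powr (real n * m) * A * ((H / M) powr m * (H / M) powr (real n * m)) * (\<tau> * r powr real DIM('a))" by (simp add: mult_ac)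
  also have "(H / M) powr m * (H / M) powr (real n * m) = (H / M) powr (real (Suc n) * m)" by (simp flip: powr_add add: algebra_simps)
  also have "F * 2 powr (real n * m) * A = shrink_const (unit_ball_vol (real DIM('a)) * 2 powr real DIM('a)) c0 ?G d p \<sigma> m 0 (Suc n)"
    by (simp add: F_def A_def c0_def)
  finally show ?case by (simp add: Y_def r1_def t''_def \<tau>_def c0_def del: shrink_const.simps)
qed

end

section \<open>De Giorgi iteration\<close>

text \<open>The growth per index of the recursion in \<open>degiorgi_step\<close>. The factors come,
  in this order, from the slice bound to the power \<sigma>/N, from the height gap to the power -p,
  and from the error coefficient of the second estimate. \<open>decay_const\<close> collects what
  does not depend on the index.\<close>

definition decay_base :: "'a::euclidean_space itself \<Rightarrow> real \<Rightarrow> real \<Rightarrow> real" where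
  "decay_base _ s p = (4 * 2 powr (1 + s * p)) powr (s * p / real DIM('a)) * 2 powr p * 2 powr (1 + s * p)"

definition decay_const :: "'a::euclidean_space itself \<Rightarrow> real \<Rightarrow> real \<Rightarrow> real \<Rightarrow> real \<Rightarrow> real" where
  "decay_const _ s p Co d = 2 / (Co * 2 powr (1 - p) * unit_ball_vol (real DIM('a)))
     * (128 * (2 powr (1 + s * p))\<^sup>2 / unit_ball_vol (real DIM('a))) powr (s * p / real DIM('a))
     * 8 powr p * (2 * (2 powr (1 + s * p)) ^ 3) * (2 / d)"

lemma decay_base_gt_1:
  assumes "0 < s" "1 < p"
  shows "1 < decay_base TYPE('a::euclidean_space) s p"
proof -
  have sp: "0 < s * p" using assms by simp
  have "1 \<le> (4 * 2 powr (1 + s * p)) powr (s * p / real DIM('a))"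
  proof (rule ge_one_powr_ge_zero)
    have "1 \<le> (2::real) powr (1 + s * p)" using sp by (intro ge_one_powr_ge_zero) auto
    then show "1 \<le> 4 * (2::real) powr (1 + s * p)" by simp
  qed (use sp in simp)
  moreover have "1 \<le> (2::real) powr p" using assms by (intro ge_one_powr_ge_zero) auto
  moreover have "1 < (2::real) powr (1 + s * p)" using sp by simp
  ultimately have "1 * 1 * 1 < (4 * 2 powr (1 + s * p)) powr (s * p / real DIM('a)) * 2 powr p * 2 powr (1 + s * p)"
    by (intro mult_le_less_imp_less mult_mono) auto
  then show ?thesis by (simp add: decay_base_def)
qed

lemma power_powr_swap:
  fixes x :: real
  assumes "0 < x"
  shows "(x ^ j) powr a = (x powr a) ^ j" using assms by (simp add: powr_realpow[symmetric] powr_powr mult.commute)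

context slice_solution begin

text \<open>On a window of length \<tau> <= d M^(2-p) r^\<sigma> with d small against
  \<open>slope_const\<close>, the slope coefficient M^p r^(-\<sigma>) is dominated by the time
  coefficient M^2/\<tau>. Both gaps cost at most powers of 2^(1+\<sigma>).\<close>

lemma degiorgi_coefficient:
  assumes H: "0 \<le> H" "H \<le> M" and M: "0 < M" and r: "0 < r" and \<tau>: "0 < \<tau>" and d: "\<tau> \<le> d * M powr (2 - p) * r powr \<sigma>"
    and Gd: "slope_const TYPE('a) s p C1 * d \<le> 1"
  shows "H\<^sup>2 / (2 * (\<tau> / 2 ^ (j + 3))) + slope_const TYPE('a) s p C1 * H powr p * (r / 2 ^ (j + 2)) powr - \<sigma>
     \<le> M\<^sup>2 / \<tau> * 2 * (2 powr (1 + \<sigma>)) ^ (j + 2)"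
proof -
  let ?G = "slope_const TYPE('a) s p C1"
  let ?D = "2 powr (1 + \<sigma>) :: real"
  have "1 \<le> (2::real) powr \<sigma>" using \<sigma> by (intro ge_one_powr_ge_zero) auto
  then have D: "2 \<le> ?D" "2 powr \<sigma> \<le> ?D" by (auto simp: powr_add)
  have HM: "H\<^sup>2 \<le> M\<^sup>2" "H powr p \<le> M powr p" using H p by (auto intro!: power_mono powr_mono2)
  have "H\<^sup>2 / (2 * (\<tau> / 2 ^ (j + 3))) = H\<^sup>2 / \<tau> * 2 ^ (j + 2)" using \<tau> by (simp add: power_add field_simps)
  also have "\<dots> \<le> M\<^sup>2 / \<tau> * ?D ^ (j + 2)" using HM H \<tau> D by (intro mult_mono divide_right_mono power_mono) auto
  finally have 1: "H\<^sup>2 / (2 * (\<tau> / 2 ^ (j + 3))) \<le> M\<^sup>2 / \<tau> * ?D ^ (j + 2)" .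
  have rp: "(r / 2 ^ (j + 2)) powr - \<sigma> = r powr - \<sigma> * (2 powr \<sigma>) ^ (j + 2)"
  proof -
    have "(2 ^ (j + 2)) powr \<sigma> = ((2::real) powr \<sigma>) ^ (j + 2)" using powr_nat_shift[of 1 "j + 2" \<sigma>] by simp
    then show ?thesis unfolding powr_divide by (simp add: powr_minus_divide)
  qed
  have "?G * M powr p * r powr - \<sigma> \<le> M\<^sup>2 / \<tau>"
  proof -
    have "\<tau> * (?G * M powr p * r powr - \<sigma>) \<le> (d * M powr (2 - p) * r powr \<sigma>) * (?G * M powr p * r powr - \<sigma>)"
      using d slope_pos by (intro mult_right_mono) auto
    also have "\<dots> = (?G * d) * (M powr (2 - p) * M powr p) * (r powr \<sigma> * r powr - \<sigma>)" by (simp add: mult_ac)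
    also have "M powr (2 - p) * M powr p = M\<^sup>2" using M by (simp flip: powr_add add: powr_numeral)
    also have "r powr \<sigma> * r powr - \<sigma> = 1" using r by (simp flip: powr_add)
    also have "?G * d * M\<^sup>2 * 1 \<le> 1 * M\<^sup>2" using mult_right_mono[OF Gd, of "M\<^sup>2"] by simp
    finally show ?thesis using \<tau> by (simp add: field_simps)
  qed
  then have "?G * M powr p * r powr - \<sigma> * (2 powr \<sigma>) ^ (j + 2) \<le> M\<^sup>2 / \<tau> * ?D ^ (j + 2)"
    using D \<tau> by (intro mult_mono power_mono) auto
  moreover have "?G * H powr p * (r / 2 ^ (j + 2)) powr - \<sigma> \<le> ?G * M powr p * r powr - \<sigma> * (2 powr \<sigma>) ^ (j + 2)"
    unfolding rp mult.assoc[symmetric] using HM slope_pos by (intro mult_right_mono mult_left_mono) auto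
  ultimately show ?thesis using 1 by linarith
qed

text \<open>Two levels are spent per step. The first, without gain, bounds every time slice at level
  j + 1 by a multiple of y j, and hence fixes a radius \<rho> with \<rho>^N of that order. The
  second uses the gain \<rho>^(-\<sigma>), that is (y j)^(-\<sigma>/N), so y (j + 2) is controlled
  by y j to the power 1 + \<sigma>/N.\<close>

lemma degiorgi_step:
  assumes win: "osc_window r \<mu> h0 a b" and t0: "a < t0" "t0 < b" and M: "0 < M" and h: "0 < h" "h \<le> 1" "h0 \<le> h * M / 2"
    and d: "0 < d" "d * M powr (2 - p) * r powr \<sigma> \<le> 2 * (b - t0)" "b - t0 \<le> d * M powr (2 - p) * r powr \<sigma>"
    and Gd: "slope_const TYPE('a) s p C1 * d \<le> 1"
    and te: "te \<in> \<Theta>" "t0 + (b - t0) * (3 / 4) < te" "te < b"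
    and y: "y = (\<lambda>j. mQ (\<mu> - h * M * (1 / 2 + 1 / 2 ^ (j + 1))) (r * (1 / 2 + 1 / 2 ^ (j + 1))) (t0 + (b - t0) * (3 / 4 - 1 / 2 ^ (j + 2))) te)"
  shows "y (j + 2) \<le> decay_const TYPE('a) s p Co d * decay_base TYPE('a) s p ^ j * h powr - (p + 2 * (\<sigma> / real DIM('a)))
     * ((b - t0) * r powr real DIM('a)) powr - (\<sigma> / real DIM('a)) * y j powr (1 + \<sigma> / real DIM('a))"
proof -
  note S = osc_windowD[OF win]
  let ?G = "slope_const TYPE('a) s p C1"
  define \<tau> where "\<tau> = b - t0"
  have \<tau>: "0 < \<tau>" using t0 by (simp add: \<tau>_def)
  define \<kappa> where "\<kappa> = \<sigma> / real DIM('a)"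
  have N0: "0 < real DIM('a)" using DIM_positive[where 'a='a] by linarith
  have \<kappa>: "0 < \<kappa>" "\<kappa> * real DIM('a) = \<sigma>" using \<sigma> N0 by (auto simp: \<kappa>_def)
  define \<beta> where "\<beta> = unit_ball_vol (real DIM('a))"
  have \<beta>: "0 < \<beta>" by (simp add: \<beta>_def)
  define D where "D = (2::real) powr (1 + \<sigma>)"
  have D: "0 < D" by (simp add: D_def)
  define Hj where "Hj i = h * M * (1 / 2 + 1 / 2 ^ (i + 1))" for i :: nat
  define rj where "rj i = r * (1 / 2 + 1 / 2 ^ (i + 1))" for i :: nat
  define Tj where "Tj i = t0 + \<tau> * (3 / 4 - 1 / 2 ^ (i + 2))" for i :: nat
  have ydef: "y i = mQ (\<mu> - Hj i) (rj i) (Tj i) te" for i by (simp add: y Hj_def rj_def Tj_def \<tau>_def)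
  have y0: "0 \<le> y i" for i by (simp add: ydef cyl_meas_nonneg)
  have half: "(1::real) / 2 ^ (i + 1) \<le> 1 / 2" "(0::real) < 1 / 2 ^ (i + 1)" for i by (auto simp: field_simps)
  have half1: "1 / 2 + 1 / 2 ^ (i + 1) \<le> (1::real)" for i :: nat using half(1)[of i] by linarith
  have Hj: "0 < Hj i" "Hj i \<le> M" "h0 \<le> Hj i" for i
  proof -
    show "0 < Hj i" using h M half(2)[of i] by (simp add: Hj_def add_pos_pos)
    have "h * M * (1 / 2 + 1 / 2 ^ (i + 1)) \<le> h * M * 1" using h M by (intro mult_left_mono half1) auto
    also have "\<dots> \<le> 1 * M" using h M by simp
    finally show "Hj i \<le> M" by (simp add: Hj_def)
    have "h * M * (1 / 2) \<le> Hj i" unfolding Hj_def using h M by (intro mult_left_mono) auto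
    then show "h0 \<le> Hj i" using h by simp
  qed
  have rj: "0 < rj i" "rj i \<le> r" for i
  proof -
    show "0 < rj i" using S half(2)[of i] by (simp add: rj_def add_pos_pos)
    have "rj i \<le> r * 1" unfolding rj_def using S by (intro mult_left_mono half1) auto
    then show "rj i \<le> r" by simp
  qed
  have dH: "Hj i - Hj (Suc i) = h * M / 2 ^ (i + 2)" for i by (simp add: Hj_def field_simps)
  have dr: "rj i - rj (Suc i) = r / 2 ^ (i + 2)" for i by (simp add: rj_def field_simps)
  have dT: "Tj (Suc i) - Tj i = \<tau> / 2 ^ (i + 3)" for i by (simp add: Tj_def power_add field_simps)
  have rlt: "rj (Suc i) < rj i" for i
  proof -
    have "0 < r / 2 ^ (i + 2)" using S by simp
    then show ?thesis using dr[of i] by linarith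
  qed
  have rdl: "rj i - rj (Suc i) \<le> r" for i using rj(2)[of i] rj(1)[of "Suc i"] by linarith
  have Tlt: "Tj i < Tj (Suc i)" for i
  proof -
    have "0 < \<tau> / 2 ^ (i + 3)" using \<tau> by simp
    then show ?thesis using dT[of i] by linarith
  qed
  have T0: "t0 \<le> Tj i" for i
  proof -
    have "(1::real) / 2 ^ (i + 2) \<le> 3 / 4" by (rule order_trans[of _ "1 / 4"]) (auto simp: power_add field_simps)
    then show ?thesis using \<tau> by (simp add: Tj_def)
  qed
  have Te: "Tj i < te" for i
  proof -
    have "Tj i \<le> t0 + \<tau> * (3 / 4)" unfolding Tj_def using \<tau> by (intro add_left_mono mult_left_mono) auto
    then show ?thesis using te by (simp add: \<tau>_def)
  qed
  have ymono: "y (Suc i) \<le> y i" for i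
  proof -
    have "0 < h * M / 2 ^ (i + 2)" using h M by simp
    then have "Hj (Suc i) \<le> Hj i" using dH[of i] by linarith
    then show ?thesis unfolding ydef using rlt[of i] Tlt[of i] by (intro cyl_meas_mono V_meas) auto
  qed
  have coef: "(Hj i)\<^sup>2 / (2 * (Tj (Suc i) - Tj i)) + ?G * Hj i powr p * (rj i - rj (Suc i)) powr - \<sigma> \<le> M\<^sup>2 / \<tau> * 2 * D ^ (i + 2)" for i
    unfolding dT dr D_def using Hj[of i] M S \<tau> d Gd by (intro degiorgi_coefficient[where d = d]) (auto simp: \<tau>_def)
  show ?thesis
  \<comment> \<open>The radius \<rho> is built from y j and must be positive, so the degenerate case
    is settled separately by monotonicity of y.\<close>
  proof (cases "y j = 0")
    case True
    then have "y (j + 2) \<le> 0" using ymono[of j] ymono[of "Suc j"] by simp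
    then show ?thesis using True by simp
  next
    case False
    then have yj: "0 < y j" using y0[of j] by simp
    define l where "l = h * M / 2 ^ (j + 2)"
    have l: "0 < l" using h M by (simp add: l_def)
    define l' where "l' = h * M / 2 ^ (j + 3)"
    have l': "0 < l'" using h M by (simp add: l'_def)
    have lH: "l \<le> Hj j" "\<mu> - Hj j + l = \<mu> - Hj (Suc j)" using dH[of j] Hj(1)[of "Suc j"] by (auto simp: l_def)
    have lH': "l' \<le> Hj (Suc j)" "\<mu> - Hj (Suc j) + l' = \<mu> - Hj (j + 2)" using dH[of "Suc j"] Hj(1)[of "Suc (Suc j)"] by (auto simp: l'_def numeral_eq_Suc)
    define Q where "Q = M\<^sup>2 / \<tau> * 2 * D ^ (j + 2)"
    define Q' where "Q' = M\<^sup>2 / \<tau> * 2 * D ^ (j + 3)"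
    have Q: "0 < Q" "0 < Q'" using M \<tau> D by (auto simp: Q_def Q'_def)
    define bnd where "bnd = 2 / l\<^sup>2 * (Q * y j)"
    have bnd: "0 < bnd" using l Q yj by (simp add: bnd_def)
    \<comment> \<open>The second entry of the minimum ensures \<rho> <= 2 r, so that the \<rho>-ball
      about x remains inside the big ball.\<close>
    define A where "A = min bnd (\<beta> * r powr real DIM('a))"
    have A: "0 < A" "A \<le> bnd" "A \<le> \<beta> * r powr real DIM('a)" using bnd \<beta> S by (auto simp: A_def)
    have mA: "mS (\<mu> - Hj (Suc j)) (rj (Suc j)) t \<le> A" if t: "t \<in> \<Theta>" "Tj (Suc j) < t" "t \<le> te" for t
    proof -
      have "l\<^sup>2 / 2 * mS (\<mu> - Hj j + l) (rj (Suc j)) t + cG * 0 * l powr 1 * mQ (\<mu> - Hj j + l) (rj (Suc j)) (Tj (Suc j)) t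
        \<le> ((Hj j)\<^sup>2 / (2 * (Tj (Suc j) - Tj j)) + ?G * Hj j powr p * (rj j - rj (Suc j)) powr - \<sigma>) * mQ (\<mu> - Hj j) (rj j) (Tj j) t"
        by (rule averaged_estimate[OF win t(1)]) (use t te t0 T0[of j] Tlt[of j] rj rlt rdl Hj l lH S in \<open>auto intro: order_trans[OF rj(2)]\<close>)
      also have "\<dots> \<le> Q * y j"
        unfolding ydef using coef[of j] Q t by (intro mult_mono cyl_meas_mono V_meas cyl_meas_nonneg) (auto simp: Q_def)
      finally have "l\<^sup>2 / 2 * mS (\<mu> - Hj (Suc j)) (rj (Suc j)) t \<le> Q * y j" by (simp add: lH)
      then have "mS (\<mu> - Hj (Suc j)) (rj (Suc j)) t \<le> bnd" using l by (simp add: bnd_def field_simps)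
      moreover have "mS (\<mu> - Hj (Suc j)) (rj (Suc j)) t \<le> \<beta> * r powr real DIM('a)"
      proof -
        have "mS (\<mu> - Hj (Suc j)) (rj (Suc j)) t \<le> \<beta> * rj (Suc j) powr real DIM('a)"
          using slice_meas_le_ball[OF V_meas, of xo "\<mu> - Hj (Suc j)" "rj (Suc j)" t] rj(1)[of "Suc j"] by (simp add: measure_ball_powr \<beta>_def)
        also have "\<dots> \<le> \<beta> * r powr real DIM('a)" using rj[of "Suc j"] \<beta> by (intro mult_left_mono powr_mono2) auto
        finally show ?thesis .
      qed
      ultimately show ?thesis by (simp add: A_def)
    qed
    define \<rho> where "\<rho> = (2 * A / \<beta>) powr (1 / real DIM('a))"
    have \<rho>: "0 < \<rho>" using A \<beta> by (simp add: \<rho>_def)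
    have \<rho>N: "\<rho> powr real DIM('a) = 2 * A / \<beta>" using A \<beta> N0 by (simp add: \<rho>_def powr_powr)
    have \<rho>\<sigma>: "\<rho> powr \<sigma> = (2 * A / \<beta>) powr \<kappa>" by (simp add: \<rho>_def powr_powr \<kappa>_def)
    have \<rho>r: "\<rho> \<le> 2 * r"
    proof -
      have "2 * A / \<beta> \<le> 2 * r powr real DIM('a)" using A \<beta> by (simp add: field_simps)
      also have "\<dots> \<le> 2 powr real DIM('a) * r powr real DIM('a)"
        using powr_mono[of 1 "real DIM('a)" 2] DIM_positive[where 'a='a] by (intro mult_right_mono) (auto simp: Suc_le_eq)
      also have "\<dots> = (2 * r) powr real DIM('a)" by (rule powr_mult[symmetric])
      finally have "\<rho> \<le> ((2 * r) powr real DIM('a)) powr (1 / real DIM('a))"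
        unfolding \<rho>_def using A \<beta> N0 by (intro powr_mono2) auto
      also have "\<dots> = 2 * r" using S N0 by (simp add: powr_powr)
      finally show ?thesis .
    qed
    define c where "c = \<beta> / 2 * \<rho> powr - \<sigma>"
    have c: "0 < c" using \<beta> \<rho> by (simp add: c_def)
    have "l'\<^sup>2 / 2 * mS (\<mu> - Hj (Suc j) + l') (rj (Suc (Suc j))) te + cG * c * l' powr p * mQ (\<mu> - Hj (Suc j) + l') (rj (Suc (Suc j))) (Tj (Suc (Suc j))) te
        \<le> ((Hj (Suc j))\<^sup>2 / (2 * (Tj (Suc (Suc j)) - Tj (Suc j))) + ?G * Hj (Suc j) powr p * (rj (Suc j) - rj (Suc (Suc j))) powr - \<sigma>) * mQ (\<mu> - Hj (Suc j)) (rj (Suc j)) (Tj (Suc j)) te"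
    proof (rule averaged_estimate[OF win te(1)])
      let ?\<psi> = "cone_level xo \<mu> (Hj (Suc j)) (rj (Suc (Suc j))) (rj (Suc j))"
      show "AE t in lborel. Tj (Suc j) < t \<and> t \<le> te \<longrightarrow> (\<forall>x\<in>ball xo (rj (Suc j)). ?\<psi> x < V (x, t) \<longrightarrow>
         ennreal (c * (V (x, t) - ?\<psi> x) powr (p - 1)) \<le>
         (NINT y. ennreal (fkernel \<sigma> x y * (V (x, t) - ?\<psi> x
             + (?\<psi> y - V (y, t))) powr (p - 1))
            * indicator {y \<in> ball xo Rb. V (y, t) \<le> ?\<psi> y} y))" using S(9)
      proof eventually_elim
        case (elim t)
        show ?case
        proof (intro impI ballI)
          fix x assume t: "Tj (Suc j) < t \<and> t \<le> te" and x: "x \<in> ball xo (rj (Suc j))" "?\<psi> x < V (x, t)"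
          have ab: "a < t" "t < b" using t te t0 T0[of "Suc j"] by auto
          then have "t \<in> \<Theta>" using elim by auto
          then have "mS (\<mu> - Hj (Suc j)) (rj (Suc j)) t \<le> \<beta> * \<rho> powr real DIM('a) / 2"
            using mA[of t] t \<beta> by (simp add: \<rho>N)
          then show "ennreal (c * (V (x, t) - ?\<psi> x) powr (p - 1)) \<le>
         (NINT y. ennreal (fkernel \<sigma> x y * (V (x, t) - ?\<psi> x
             + (?\<psi> y - V (y, t))) powr (p - 1))
            * indicator {y \<in> ball xo Rb. V (y, t) \<le> ?\<psi> y} y)"
            unfolding c_def \<beta>_def
            by (intro good_term_from_smallness) (use rlt \<rho> \<rho>r rj(2)[of "Suc j"] S ab Hj x in \<open>auto\<close>)
        qed
      qed
    qed (use te t0 T0[of "Suc j"] Tlt[of "Suc j"] Te rj rlt rdl Hj l' lH' c p S in \<open>auto intro: order_trans[OF rj(2)]\<close>)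
    moreover have "0 \<le> l'\<^sup>2 / 2 * mS (\<mu> - Hj (Suc j) + l') (rj (Suc (Suc j))) te" by (simp add: slice_meas_nonneg)
    moreover have "((Hj (Suc j))\<^sup>2 / (2 * (Tj (Suc (Suc j)) - Tj (Suc j))) + ?G * Hj (Suc j) powr p * (rj (Suc j) - rj (Suc (Suc j))) powr - \<sigma>) * y (Suc j) \<le> Q' * y j"
    proof (rule mult_mono)
      have "Suc j + 2 = j + 3" by simp
      from coef[of "Suc j", unfolded this]
      show "(Hj (Suc j))\<^sup>2 / (2 * (Tj (Suc (Suc j)) - Tj (Suc j))) + ?G * Hj (Suc j) powr p * (rj (Suc j) - rj (Suc (Suc j))) powr - \<sigma> \<le> Q'"
        by (simp only: Q'_def)
    qed (use Q y0 ymono[of j] in auto)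
    ultimately have main: "cG * c * l' powr p * y (j + 2) \<le> Q' * y j" by (simp add: lH' ydef numeral_eq_Suc)
    have "y (j + 2) \<le> Q' * y j / (cG * c * l' powr p)"
    proof -
      have "0 < cG * c * l' powr p" using cG_pos c l' by simp
      then show ?thesis using main by (simp add: pos_le_divide_eq mult.commute)
    qed
    also have "\<dots> = 2 / (cG * \<beta>) * \<rho> powr \<sigma> * l' powr - p * Q' * y j"
      using \<beta> \<rho> by (simp add: c_def powr_minus_divide)
    also have "\<dots> \<le> 2 / (cG * \<beta>) * (2 * bnd / \<beta>) powr \<kappa> * l' powr - p * Q' * y j"
      unfolding \<rho>\<sigma> using A \<beta> \<kappa> cG_pos Q yj by (intro mult_right_mono mult_left_mono powr_mono2 divide_right_mono) auto
    also have "2 * bnd / \<beta> = (128 * D\<^sup>2 / \<beta>) * (4 * D) ^ j * h powr - 2 * \<tau> powr - 1 * y j"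
    proof -
      have e: "(2::real) ^ (j + 2) * 2 ^ (j + 2) = 16 * 4 ^ j" by (simp add: power_add power_mult_distrib[symmetric])
      have "2 * bnd / \<beta> = 2 * (2 / (h * M)\<^sup>2 * (2 ^ (j + 2) * 2 ^ (j + 2)) * (M\<^sup>2 / \<tau> * 2 * D ^ (j + 2) * y j)) / \<beta>"
        by (simp add: bnd_def Q_def l_def power2_eq_square)
      also have "\<dots> = (128 * D\<^sup>2 / \<beta>) * (4 * D) ^ j * (1 / h\<^sup>2) * (1 / \<tau>) * y j"
        unfolding e using M by (simp add: power_add power_mult_distrib power2_eq_square mult_ac)
      also have "1 / h\<^sup>2 = h powr - 2" using h by (simp add: powr_minus_divide powr_numeral)
      also have "1 / \<tau> = \<tau> powr - 1" using \<tau> by (simp add: powr_minus_divide)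
      finally show ?thesis .
    qed
    also have "((128 * D\<^sup>2 / \<beta>) * (4 * D) ^ j * h powr - 2 * \<tau> powr - 1 * y j) powr \<kappa> =
        (128 * D\<^sup>2 / \<beta>) powr \<kappa> * ((4 * D) powr \<kappa>) ^ j * h powr - (2 * \<kappa>) * \<tau> powr - \<kappa> * y j powr \<kappa>"
    proof -
      have "((4 * D) ^ j) powr \<kappa> = ((4 * D) powr \<kappa>) ^ j" using D by (intro power_powr_swap) simp
      then show ?thesis unfolding powr_mult[of _ _ \<kappa>] by (simp only: powr_powr) simp
    qed
    also have "l' powr - p = h powr - p * M powr - p * 8 powr p * (2 powr p) ^ j"
    proof -
      have "(2 ^ (j + 3)) powr p = 8 powr p * ((2::real) powr p) ^ j" using powr_nat_shift[of 8 j p] by (simp add: power_add mult.commute)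
      then show ?thesis unfolding l'_def powr_divide powr_mult by (simp add: powr_minus_divide)
    qed
    also have "Q' = M\<^sup>2 / \<tau> * (2 * D ^ 3) * D ^ j" by (simp add: Q'_def power_add mult_ac)
    also have "2 / (cG * \<beta>) * ((128 * D\<^sup>2 / \<beta>) powr \<kappa> * ((4 * D) powr \<kappa>) ^ j * h powr - (2 * \<kappa>) * \<tau> powr - \<kappa> * y j powr \<kappa>)
         * (h powr - p * M powr - p * 8 powr p * (2 powr p) ^ j) * (M\<^sup>2 / \<tau> * (2 * D ^ 3) * D ^ j) * y j
       = (2 / (cG * \<beta>) * (128 * D\<^sup>2 / \<beta>) powr \<kappa> * 8 powr p * (2 * D ^ 3)) * (((4 * D) powr \<kappa>) ^ j * (2 powr p) ^ j * D ^ j)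
         * (h powr - (2 * \<kappa>) * h powr - p) * \<tau> powr - \<kappa> * (y j powr \<kappa> * y j) * (M powr - p * M\<^sup>2 / \<tau>)"
      by (simp add: mult_ac)
    also have "\<dots> \<le> (2 / (cG * \<beta>) * (128 * D\<^sup>2 / \<beta>) powr \<kappa> * 8 powr p * (2 * D ^ 3)) * (((4 * D) powr \<kappa>) ^ j * (2 powr p) ^ j * D ^ j)
         * (h powr - (2 * \<kappa>) * h powr - p) * \<tau> powr - \<kappa> * (y j powr \<kappa> * y j) * (2 / d * r powr - \<sigma>)"
    proof (rule mult_left_mono)
      \<comment> \<open>The lower bound on the window length removes M: M^(2-p)/\<tau> is at most a
        multiple of r^(-\<sigma>), which joins \<tau>^(-\<sigma>/N) to a power of the measure scale
        \<tau> r^N.\<close>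
      have "M powr - p * M\<^sup>2 = M powr (2 - p)" using M powr_add[of M "- p" 2] by (simp add: powr_numeral algebra_simps)
      moreover have "M powr (2 - p) \<le> 2 * \<tau> / d * r powr - \<sigma>"
      proof -
        have "d * M powr (2 - p) * r powr \<sigma> * r powr - \<sigma> \<le> 2 * \<tau> * r powr - \<sigma>"
          using d by (intro mult_right_mono) (auto simp: \<tau>_def)
        moreover have rr: "r powr \<sigma> * r powr - \<sigma> = 1" using S by (simp flip: powr_add)
        ultimately have "d * M powr (2 - p) \<le> 2 * \<tau> * r powr - \<sigma>" by (simp only: mult.assoc rr mult_1_right)
        then show ?thesis using d(1) by (simp add: pos_le_divide_eq mult.commute)
      qed
      ultimately show "M powr - p * M\<^sup>2 / \<tau> \<le> 2 / d * r powr - \<sigma>" using \<tau> d by (simp add: field_simps)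
      show "0 \<le> (2 / (cG * \<beta>) * (128 * D\<^sup>2 / \<beta>) powr \<kappa> * 8 powr p * (2 * D ^ 3)) * (((4 * D) powr \<kappa>) ^ j * (2 powr p) ^ j * D ^ j)
         * (h powr - (2 * \<kappa>) * h powr - p) * \<tau> powr - \<kappa> * (y j powr \<kappa> * y j)" using \<beta> D cG_pos yj by simp
    qed
    also have "\<dots> = (2 / (cG * \<beta>) * (128 * D\<^sup>2 / \<beta>) powr \<kappa> * 8 powr p * (2 * D ^ 3) * (2 / d)) * (((4 * D) powr \<kappa>) ^ j * (2 powr p) ^ j * D ^ j)
         * (h powr - (2 * \<kappa>) * h powr - p) * (\<tau> powr - \<kappa> * r powr - \<sigma>) * (y j powr \<kappa> * y j)" by (simp add: mult_ac)
    also have "2 / (cG * \<beta>) * (128 * D\<^sup>2 / \<beta>) powr \<kappa> * 8 powr p * (2 * D ^ 3) * (2 / d) = decay_const TYPE('a) s p Co d"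
      by (simp add: decay_const_def D_def \<beta>_def \<kappa>_def)
    also have "((4 * D) powr \<kappa>) ^ j * (2 powr p) ^ j * D ^ j = decay_base TYPE('a) s p ^ j"
      by (simp add: decay_base_def D_def \<kappa>_def power_mult_distrib)
    also have "h powr - (2 * \<kappa>) * h powr - p = h powr - (p + 2 * \<kappa>)" by (simp flip: powr_add add: algebra_simps)
    also have "\<tau> powr - \<kappa> * r powr - \<sigma> = (\<tau> * r powr real DIM('a)) powr - \<kappa>"
      unfolding powr_mult powr_powr using \<kappa>(2) by (simp add: mult.commute)
    also have "y j powr \<kappa> * y j = y j powr (1 + \<kappa>)" using yj by (simp add: powr_add)
    finally show ?thesis by (simp add: \<tau>_def \<kappa>_def)
  qed
qed

text \<open>The recursion advances by two indices, so fast decay is applied to the even terms,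
  normalised by the measure scale W. The set in the conclusion is contained in all sets of the
  sequence.\<close>

lemma degiorgi:
  assumes win: "osc_window r \<mu> h0 a b" and t0: "a < t0" "t0 < b" and M: "0 < M" and h: "0 < h" "h \<le> 1" "h0 \<le> h * M / 2"
    and d: "0 < d" "d * M powr (2 - p) * r powr \<sigma> \<le> 2 * (b - t0)" "b - t0 \<le> d * M powr (2 - p) * r powr \<sigma>"
    and Gd: "slope_const TYPE('a) s p C1 * d \<le> 1"
    and te: "te \<in> \<Theta>" "t0 + (b - t0) * (3 / 4) < te" "te < b"
    and small: "mQ (\<mu> - h * M) r (t0 + (b - t0) / 2) te \<le>
       (decay_const TYPE('a) s p Co d * h powr - (p + 2 * (\<sigma> / real DIM('a)))) powr (- 1 / (\<sigma> / real DIM('a)))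
        * ((decay_base TYPE('a) s p)\<^sup>2) powr (- 1 / (\<sigma> / real DIM('a))\<^sup>2) * ((b - t0) * r powr real DIM('a))"
  shows "mQ (\<mu> - h * M / 2) (r / 2) (t0 + (b - t0) * (3 / 4)) te = 0"
proof -
  note S = osc_windowD[OF win]
  define \<kappa> where "\<kappa> = \<sigma> / real DIM('a)"
  have N0: "0 < real DIM('a)" using DIM_positive[where 'a='a] by linarith
  have \<kappa>: "0 < \<kappa>" using \<sigma> N0 by (auto simp: \<kappa>_def)
  define W where "W = (b - t0) * r powr real DIM('a)"
  have W: "0 < W" using t0 S by (simp add: W_def)
  define C where "C = decay_const TYPE('a) s p Co d * h powr - (p + 2 * \<kappa>)"
  have C: "0 < C"
    unfolding C_def decay_const_def using Co d(1) h(1) less_imp_neq[OF ball_vol_pos, symmetric] by (intro mult_pos_pos divide_pos_pos) auto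
  define B where "B = decay_base TYPE('a) s p"
  have B: "1 < B" unfolding B_def using s p by (intro decay_base_gt_1) auto
  define y where "y = (\<lambda>j. mQ (\<mu> - h * M * (1 / 2 + 1 / 2 ^ (j + 1))) (r * (1 / 2 + 1 / 2 ^ (j + 1))) (t0 + (b - t0) * (3 / 4 - 1 / 2 ^ (j + 2))) te)"
  have y0: "0 \<le> y i" for i by (simp add: y_def cyl_meas_nonneg)
  define Z where "Z i = y (2 * i) / W" for i
  have Z0: "0 \<le> Z i" for i using y0 W by (simp add: Z_def)
  have "Z \<longlonglongrightarrow> 0"
  proof (rule fast_geometric_decay[OF Z0 _ C _ \<kappa>])
    show "1 < B\<^sup>2" using B by (simp add: one_less_power)
    show "Z (Suc i) \<le> C * (B\<^sup>2) ^ i * Z i powr (1 + \<kappa>)" for i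
    proof -
      have "y (2 * i + 2) \<le> decay_const TYPE('a) s p Co d * B ^ (2 * i) * h powr - (p + 2 * \<kappa>) * W powr - \<kappa> * y (2 * i) powr (1 + \<kappa>)"
        using degiorgi_step[OF win t0 M h d Gd te y_def, of "2 * i"] by (simp add: B_def W_def \<kappa>_def)
      also have "\<dots> = C * (B\<^sup>2) ^ i * W powr - \<kappa> * y (2 * i) powr (1 + \<kappa>)" by (simp only: C_def power_mult[symmetric] mult_ac)
      finally have "y (2 * i + 2) / W \<le> C * (B\<^sup>2) ^ i * W powr - \<kappa> * y (2 * i) powr (1 + \<kappa>) / W"
        using W by (intro divide_right_mono) auto
      also have "\<dots> = C * (B\<^sup>2) ^ i * (y (2 * i) powr (1 + \<kappa>) / W powr (1 + \<kappa>))"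
      proof -
        have "W powr - \<kappa> / W = 1 / W powr (1 + \<kappa>)" using W by (simp add: powr_add powr_minus_divide)
        moreover have "C * (B\<^sup>2) ^ i * W powr - \<kappa> * y (2 * i) powr (1 + \<kappa>) / W = C * (B\<^sup>2) ^ i * (y (2 * i) powr (1 + \<kappa>) * (W powr - \<kappa> / W))"
          by (simp add: mult_ac)
        ultimately show ?thesis by simp
      qed
      finally show ?thesis by (simp add: Z_def powr_divide)
    qed
    have "y 0 = mQ (\<mu> - h * M) r (t0 + (b - t0) / 2) te" by (simp add: y_def)
    then have "y 0 \<le> C powr (- 1 / \<kappa>) * (B\<^sup>2) powr (- 1 / \<kappa>\<^sup>2) * W"
      using small by (simp only: C_def B_def W_def \<kappa>_def)
    then show "Z 0 \<le> C powr (- 1 / \<kappa>) * (B\<^sup>2) powr (- 1 / \<kappa>\<^sup>2)" using W by (simp add: Z_def pos_divide_le_eq)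
  qed
  moreover have "mQ (\<mu> - h * M / 2) (r / 2) (t0 + (b - t0) * (3 / 4)) te / W \<le> Z i" for i
  proof -
    have "mQ (\<mu> - h * M / 2) (r / 2) (t0 + (b - t0) * (3 / 4)) te \<le> y (2 * i)" unfolding y_def
    proof (intro cyl_meas_mono V_meas)
      have e: "1 / 2 \<le> (1 / 2 + 1 / 2 ^ (2 * i + 1) :: real)" by simp
      have "h * M * (1 / 2) \<le> h * M * (1 / 2 + 1 / 2 ^ (2 * i + 1))" using h M by (intro mult_left_mono e) auto
      from diff_left_mono[OF this, of \<mu>]
      show "\<mu> - h * M * (1 / 2 + 1 / 2 ^ (2 * i + 1)) \<le> \<mu> - h * M / 2" by (simp only: times_divide_eq_right mult_1_right)
      have "r * (1 / 2) \<le> r * (1 / 2 + 1 / 2 ^ (2 * i + 1))" using S by (intro mult_left_mono e) auto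
      then show "r / 2 \<le> r * (1 / 2 + 1 / 2 ^ (2 * i + 1))" by (simp only: times_divide_eq_right mult_1_right)
      show "t0 + (b - t0) * (3 / 4 - 1 / 2 ^ (2 * i + 2)) \<le> t0 + (b - t0) * (3 / 4)" using t0 by (intro add_left_mono mult_left_mono) auto
    qed simp
    then show ?thesis unfolding Z_def using W by (intro divide_right_mono) auto
  qed
  ultimately have "mQ (\<mu> - h * M / 2) (r / 2) (t0 + (b - t0) * (3 / 4)) te / W \<le> 0" by (intro LIMSEQ_le_const) auto
  then show ?thesis using W cyl_meas_nonneg[of V xo "\<mu> - h * M / 2" "r / 2" "t0 + (b - t0) * (3 / 4)" te] by (simp add: divide_le_0_iff)
qed

end

section \<open>Choice of the reduction factor and reduction of the oscillation\<close>

definition osc_factor :: "'a::euclidean_space itself \<Rightarrow> real \<Rightarrow> real \<Rightarrow> real \<Rightarrow> real \<Rightarrow> real \<Rightarrow> bool" where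
  "osc_factor _ s p Co C1 h \<longleftrightarrow> 0 < h \<and> h < 1 \<and> (\<exists>n. 2 ^ n * h \<le> 1 / 32 \<and>
     shrink_const (unit_ball_vol (real DIM('a)) * 2 powr real DIM('a)) (Co * 2 powr (1 - p) * spread_const TYPE('a) s p)
        (slope_const TYPE('a) s p C1) (dwell_const TYPE('a) s p C1) p (s * p) (min 1 (p - 1)) 0 n * h powr (real n * min 1 (p - 1)) \<le>
     (decay_const TYPE('a) s p Co (dwell_const TYPE('a) s p C1) * h powr - (p + 2 * (s * p / real DIM('a)))) powr (- 1 / (s * p / real DIM('a)))
        * ((decay_base TYPE('a) s p)\<^sup>2) powr (- 1 / (s * p / real DIM('a))\<^sup>2))"

lemma shrink_const_nonneg:
  assumes "0 \<le> A0" "0 < c0" "0 \<le> G" "0 < d"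
  shows "0 \<le> shrink_const A0 c0 G d p \<sigma> m e n" using assms by (induction n) auto

text \<open>The threshold of \<open>degiorgi\<close> is \<open>C8\<close> times h^q with q = (p + 2
  \<kappa>)/\<kappa>, while n halvings give a constant A times h^(n m). First n is fixed with n m >=
  q + 1, which fixes A; the spare factor h is then chosen so small that A h <=
  \<open>C8\<close>.\<close>

lemma osc_factor_exists:
  assumes p: "1 < p" and s: "0 < s" "s < 1" and Co: "0 < Co" "Co \<le> C1"
  shows "\<exists>h. osc_factor TYPE('a::euclidean_space) s p Co C1 h"
proof -
  define m where "m = min 1 (p - 1)"
  have m: "0 < m" using p by (simp add: m_def)
  have N0: "0 < real DIM('a)" using DIM_positive[where 'a='a] by linarith
  define \<kappa> where "\<kappa> = s * p / real DIM('a)"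
  have \<kappa>: "0 < \<kappa>" using s p N0 by (simp add: \<kappa>_def)
  define q where "q = (p + 2 * \<kappa>) / \<kappa>"
  have G: "0 < slope_const TYPE('a) s p C1" using slope_const_pos[of s p C1, where 'a='a] assms by simp
  define d where "d = dwell_const TYPE('a) s p C1"
  have d: "0 < d" using G by (simp add: d_def dwell_const_def)
  define C where "C = decay_const TYPE('a) s p Co d"
  have vol: "0 < unit_ball_vol (real DIM('a))" by simp
  have C: "0 < C" unfolding C_def decay_const_def using Co d less_imp_neq[OF vol, symmetric] by (intro mult_pos_pos divide_pos_pos) auto
  define B where "B = decay_base TYPE('a) s p"
  have B: "1 < B" unfolding B_def using s p by (intro decay_base_gt_1) auto
  define C8 where "C8 = C powr (- 1 / \<kappa>) * (B\<^sup>2) powr (- 1 / \<kappa>\<^sup>2)"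
  have C8: "0 < C8" using C B by (simp add: C8_def)
  obtain n :: nat where "(q + 1) / m \<le> real n" using real_arch_simple by blast
  then have n: "q + 1 \<le> real n * m" using m by (simp add: pos_divide_le_eq)
  define A where "A = shrink_const (unit_ball_vol (real DIM('a)) * 2 powr real DIM('a)) (Co * 2 powr (1 - p) * spread_const TYPE('a) s p)
        (slope_const TYPE('a) s p C1) d p (s * p) m 0 n"
  have A: "0 \<le> A" unfolding A_def using Co G d spread_const_pos[of s p, where 'a='a] by (intro shrink_const_nonneg) auto
  define h where "h = min (1 / (32 * 2 ^ n)) (C8 / (A + 1))"
  have "(0::real) < 1 / (32 * 2 ^ n)" by simp
  moreover have "0 < C8 / (A + 1)" using C8 A by simp
  ultimately have h: "0 < h" by (simp add: h_def)
  have h32: "2 ^ n * h \<le> 1 / 32"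
  proof -
    have "2 ^ n * h \<le> 2 ^ n * (1 / (32 * 2 ^ n))" by (intro mult_left_mono) (auto simp: h_def)
    then show ?thesis by simp
  qed
  have "1 * h \<le> 2 ^ n * h" using h by (intro mult_right_mono) auto
  then have h1: "h < 1" using h32 by simp
  have "A * h \<le> (A + 1) * h" using h by simp
  also have "\<dots> \<le> (A + 1) * (C8 / (A + 1))" using A by (intro mult_left_mono) (auto simp: h_def)
  also have "\<dots> = C8" using A by simp
  finally have Ah: "A * h \<le> C8" .
  have "A * h powr (real n * m) \<le> A * h powr (q + 1)" using A h h1 n by (intro mult_left_mono powr_mono') auto
  also have "\<dots> = A * h * h powr q" using h by (simp add: powr_add)
  also have "\<dots> \<le> C8 * h powr q" using Ah by (intro mult_right_mono) auto
  also have "\<dots> = (C * h powr - (p + 2 * \<kappa>)) powr (- 1 / \<kappa>) * (B\<^sup>2) powr (- 1 / \<kappa>\<^sup>2)"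
  proof -
    have "- (p + 2 * \<kappa>) * (- 1 / \<kappa>) = q" using \<kappa> by (simp add: q_def field_simps)
    then show ?thesis unfolding powr_mult powr_powr C8_def by (simp only: mult_ac)
  qed
  finally show ?thesis using h h1 h32 unfolding osc_factor_def A_def C_def B_def d_def m_def \<kappa>_def by blast
qed

context slice_solution begin

text \<open>Propagation provides the slices for the halvings, these make the set at height h M small
  on the second half of the window, and the iteration empties it at height h M/2. The tail size is h
  M/2 because the heights in the iteration decrease to that value.\<close>

lemma oscillation_reduction:
  assumes h: "osc_factor TYPE('a) s p Co C1 h" and win: "osc_window r \<mu> (h * M / 2) a b" and t0: "t0 \<in> \<Theta>" "a < t0" "t0 < b" and M: "0 < M"
    and half: "mS (\<mu> - M) r t0 \<le> unit_ball_vol (real DIM('a)) * r powr real DIM('a) / 2"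
    and d: "dwell_const TYPE('a) s p C1 * M powr (2 - p) * r powr \<sigma> \<le> 2 * (b - t0)" "b - t0 \<le> dwell_const TYPE('a) s p C1 * M powr (2 - p) * r powr \<sigma>"
  shows "AE z in lborel2. fst z \<in> ball xo (r / 2) \<and> t0 + (b - t0) * (3 / 4) < snd z \<and> snd z < b \<longrightarrow> V z \<le> \<mu> - h * M / 2"
proof -
  note S = osc_windowD[OF win]
  let ?q = "t0 + (b - t0) * (3 / 4)"
  define m where "m = min 1 (p - 1)"
  have m: "0 < m" "m \<le> 1" "m \<le> p - 1" using p by (auto simp: m_def)
  define dd where "dd = dwell_const TYPE('a) s p C1"
  have dd: "0 < dd" unfolding dd_def by (rule dwell_const_pos)
  have N1: "1 \<le> real DIM('a)" using DIM_positive[where 'a='a] by linarith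
  have Gd: "slope_const TYPE('a) s p C1 * dd \<le> 1"
  proof -
    have "1 / (16 * real DIM('a)) \<le> 1" using N1 by (subst divide_le_eq_1_pos) linarith+
    then have "(1 / (16 * real DIM('a))) powr \<sigma> \<le> 1" using \<sigma> by (intro powr_le1) auto
    then show ?thesis using slope_pos by (simp add: dd_def dwell_const_def)
  qed
  obtain n where h01: "0 < h" "h < 1" and hn: "2 ^ n * h \<le> 1 / 32"
    and small: "shrink_const (unit_ball_vol (real DIM('a)) * 2 powr real DIM('a)) (cG * spread_const TYPE('a) s p)
        (slope_const TYPE('a) s p C1) dd p \<sigma> m 0 n * h powr (real n * m) \<le>
     (decay_const TYPE('a) s p Co dd * h powr - (p + 2 * (\<sigma> / real DIM('a)))) powr (- 1 / (\<sigma> / real DIM('a)))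
        * ((decay_base TYPE('a) s p)\<^sup>2) powr (- 1 / (\<sigma> / real DIM('a))\<^sup>2)" using h unfolding osc_factor_def dd_def m_def by blast
  have hM: "h * M / 2 \<le> M" "h * M / 2 \<le> h * M" using h01 M by (auto intro: mult_right_mono order_trans[of _ "1 * M"])
  have zero: "mQ (\<mu> - h * M / 2) (r / 2) (?q) te = 0"
    if te: "te \<in> \<Theta>" "?q < te" "te < b" for te
  proof (rule degiorgi[OF win t0(2,3) M h01(1) _ _ dd _ _ Gd te])
    have te2: "t0 + (b - t0) / 2 < te"
    proof -
      have "(b - t0) / 2 \<le> (b - t0) * (3 / 4)" using t0 by simp
      then show ?thesis using te by linarith
    qed
    have "mQ (\<mu> - h * M) r (t0 + (b - t0) / 2) te \<le> mQ (\<mu> - h * M) ((1 + 1 / 2 ^ n) * r) (t0 + (b - t0) * (1 / 2 - 1 / 2 ^ (n + 1))) te"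
    proof (intro cyl_meas_mono V_meas)
      show "r \<le> (1 + 1 / 2 ^ n) * r" using S by (simp add: algebra_simps)
      have "(b - t0) * (1 / 2 - 1 / 2 ^ (n + 1)) \<le> (b - t0) * (1 / 2)" using t0 by (intro mult_left_mono) auto
      from add_left_mono[OF this, of t0]
      show "t0 + (b - t0) * (1 / 2 - 1 / 2 ^ (n + 1)) \<le> t0 + (b - t0) / 2" by (simp only: times_divide_eq_right mult_1_right)
    qed auto
    also have "\<dots> \<le> shrink_const (unit_ball_vol (real DIM('a)) * 2 powr real DIM('a)) (cG * spread_const TYPE('a) s p) (slope_const TYPE('a) s p C1) dd p \<sigma> m 0 n
        * (h * M / M) powr (real n * m) * ((b - t0) * r powr real DIM('a))"
    proof (rule shrink_iterate[OF win t0(2,3) M])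
      show "mS (\<mu> - M / 16) r t \<le> 3 / 4 * unit_ball_vol (real DIM('a)) * r powr real DIM('a)" if "t \<in> \<Theta>" "t0 < t" "t < b" for t
        using propagation[OF win t0(1,2) hM(1) half d(2) that] .
      show "2 ^ n * (h * M) \<le> M / 32" using mult_right_mono[OF hn, of M] M by simp
    qed (use te te2 dd d m hM in \<open>auto simp: dd_def\<close>)
    also have "h * M / M = h" using M by simp
    finally have "mQ (\<mu> - h * M) r (t0 + (b - t0) / 2) te \<le>
        shrink_const (unit_ball_vol (real DIM('a)) * 2 powr real DIM('a)) (cG * spread_const TYPE('a) s p) (slope_const TYPE('a) s p C1) dd p \<sigma> m 0 n
        * h powr (real n * m) * ((b - t0) * r powr real DIM('a))" .
    also have "\<dots> \<le> (decay_const TYPE('a) s p Co dd * h powr - (p + 2 * (\<sigma> / real DIM('a)))) powr (- 1 / (\<sigma> / real DIM('a)))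
        * ((decay_base TYPE('a) s p)\<^sup>2) powr (- 1 / (\<sigma> / real DIM('a))\<^sup>2) * ((b - t0) * r powr real DIM('a))"
      using t0 by (intro mult_right_mono[OF small]) auto
    finally show "mQ (\<mu> - h * M) r (t0 + (b - t0) / 2) te \<le>
       (decay_const TYPE('a) s p Co dd * h powr - (p + 2 * (\<sigma> / real DIM('a)))) powr (- 1 / (\<sigma> / real DIM('a)))
        * ((decay_base TYPE('a) s p)\<^sup>2) powr (- 1 / (\<sigma> / real DIM('a))\<^sup>2) * ((b - t0) * r powr real DIM('a))" .
  qed (use h01 d in \<open>auto simp: dd_def\<close>)
  \<comment> \<open>The iteration ends at a regular time strictly before b; regular times tending to
    b exhaust the cylinder by countably many null sets.\<close>
  have ex: "\<exists>te\<in>\<Theta>. max (?q) (b - 1 / real (Suc k)) < te \<and> te < b" for k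
  proof (rule ccontr)
    define c where "c = max (?q) (b - 1 / real (Suc k))"
    assume neg: "\<not> ?thesis"
    have "(b - t0) * (3 / 4) < (b - t0) * 1" using t0 by (intro mult_strict_left_mono) auto
    then have "?q < t0 + (b - t0) * 1" by (rule add_strict_left_mono)
    then have "?q < b" by (simp only: mult_1_right add_diff_eq add_diff_cancel_left')
    then have cb: "c < b" unfolding c_def by (intro max_less_iff_conj[THEN iffD2] conjI) auto
    have tc: "t0 \<le> c" using t0 unfolding c_def by (simp add: le_max_iff_disj)
    have "AE t in lborel. t \<notin> {c<..<b}" using S(9)
    proof eventually_elim
      case (elim t)
      show ?case
      proof
        assume t: "t \<in> {c<..<b}"
        then have "t \<in> \<Theta>" using elim tc t0 by auto
        then show False using neg t unfolding c_def by auto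
      qed
    qed
    then have "emeasure lborel {c<..<b} = 0" by (subst (asm) AE_iff_measurable[where N = "{c<..<b}"]) auto
    then show False using cb by simp
  qed
  then obtain T' where T': "\<And>k. T' k \<in> \<Theta>" "\<And>k. max (?q) (b - 1 / real (Suc k)) < T' k" "\<And>k. T' k < b"
    by metis
  have "AE z in lborel2. \<not> (fst z \<in> ball xo (r / 2) \<and> ?q < snd z \<and> snd z \<le> T' k \<and> \<mu> - h * M / 2 < V z)" for k
  proof (rule AE_I')
    show "{z. fst z \<in> ball xo (r / 2) \<and> ?q < snd z \<and> snd z \<le> T' k \<and> \<mu> - h * M / 2 < V z} \<in> null_sets lborel2"
    proof (rule null_setsI)
      show "emeasure lborel2 {z. fst z \<in> ball xo (r / 2) \<and> ?q < snd z \<and> snd z \<le> T' k \<and> \<mu> - h * M / 2 < V z} = 0"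
        unfolding emeasure_cyl[OF V_meas] using zero[OF T'(1) _ T'(3)] T'(2) by simp
      show "{z. fst z \<in> ball xo (r / 2) \<and> ?q < snd z \<and> snd z \<le> T' k \<and> \<mu> - h * M / 2 < V z} \<in> sets lborel2"
        using cyl_set_measurable[OF V_meas] by (simp del: mem_ball)
    qed
  qed auto
  then have "AE z in lborel2. \<forall>k. \<not> (fst z \<in> ball xo (r / 2) \<and> ?q < snd z \<and> snd z \<le> T' k \<and> \<mu> - h * M / 2 < V z)"
    unfolding AE_all_countable by blast
  then show ?thesis
  proof eventually_elim
    case (elim z)
    show ?case
    proof (intro impI)
      assume z: "fst z \<in> ball xo (r / 2) \<and> ?q < snd z \<and> snd z < b"
      obtain k where "1 / (b - snd z) < real (Suc k)" using reals_Archimedean2[of "1 / (b - snd z)"] less_trans by (metis lessI of_nat_less_iff)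
      then have "1 / real (Suc k) < b - snd z" using z by (simp add: field_simps)
      then have "snd z \<le> T' k" using T'(2)[of k] by simp
      then show "V z \<le> \<mu> - h * M / 2" using elim z by (meson not_le)
    qed
  qed
qed

end

lemma AE_triple_slices:
  fixes P :: "'a::euclidean_space \<times> 'a \<times> real \<Rightarrow> bool"
  assumes "AE z in lborel3. P z"
  shows "AE t in lborel. AE x in lborel. AE y in lborel. P (x, y, t)"
proof -
  let ?M = "lborel3 :: ('a \<times> 'a \<times> real) measure"
  obtain N where N: "{z \<in> space ?M. \<not> P z} \<subseteq> N" "emeasure ?M N = 0" "N \<in> sets ?M" by (rule AE_E[OF assms]) (blast intro: that)
  have ind: "(\<lambda>z. indicator N z :: ennreal) \<in> borel_measurable ?M" using N(3) by (rule borel_measurable_indicator)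
  have m [measurable]: "(\<lambda>z. indicator N z :: ennreal) \<in> borel_measurable borel3" using ind by (simp cong: measurable_cong_sets)
  have "(NINT t. NINT x. NINT y. indicator N (x, y, t)) = (\<integral>\<^sup>+ z. indicator N z \<partial>?M)"
    by (rule nn_integral_triple[OF m, symmetric])
  also have "\<dots> = 0" using N by simp
  finally have "AE t in lborel. (NINT x. NINT y. indicator N (x, y, t)) = 0" by (subst (asm) nn_integral_0_iff_AE) simp_all
  then show ?thesis
  proof eventually_elim
    case (elim t)
    then have "AE x in lborel. (NINT y. indicator N (x, y, t)) = 0" by (subst (asm) nn_integral_0_iff_AE) simp_all
    then show ?case
    proof eventually_elim
      case (elim x)
      then have "AE y in lborel. indicator N (x, y, t) = (0::ennreal)" by (subst (asm) nn_integral_0_iff_AE) simp_all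
      then show ?case
      proof eventually_elim
        case (elim y)
        then have "(x, y, t) \<notin> N" by (auto simp: indicator_def split: if_splits)
        then show ?case using N(1) by (auto simp: space_pair_measure)
      qed
    qed
  qed
qed

section \<open>From weak solutions to time slices\<close>

text \<open>The function \<open>- cone_level xo 0 1 r r'\<close> is the standard cutoff: 1 on
  \<open>ball xo r\<close>, 0 outside \<open>ball xo r'\<close> and Lipschitz in between.\<close>

lemma bump_gagliardo:
  fixes xo :: "'a::euclidean_space"
  assumes r: "0 < r" "r < r'" and p: "1 < p" and s: "0 < s" "s < 1"
  shows "(NINT x. NINT y. ennreal (fkernel (s * p) x y * \<bar>(- cone_level xo 0 1 r r' x) - (- cone_level xo 0 1 r r' y)\<bar> powr p)) < \<infinity>"
proof -
  let ?g = "cone_level xo 0 1 r r'"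
  let ?\<sigma> = "s * p"
  let ?c = "ennreal ((near_const TYPE('a) ?\<sigma> p + tail_const TYPE('a) ?\<sigma>) * 1 powr p * (r' - r) powr - ?\<sigma>)"
  note \<psi> = cone_level_props[of 1 r r', OF zero_le_one r(2), where \<mu> = 0 and xo = xo]
  have \<sigma>: "0 < ?\<sigma>" "?\<sigma> < p" using s p by auto
  define R where "R = r' + 1"
  have [measurable]: "ball xo r' \<in> sets borel" "ball xo R \<in> sets borel" by auto
  define f where "f = (\<lambda>(x, y). ennreal (fkernel ?\<sigma> x y * \<bar>(- ?g x) - (- ?g y)\<bar> powr p))"
  define f3 where "f3 = (\<lambda>(x, y). ennreal (fkernel ?\<sigma> x y) * (indicator (ball xo r') x * indicator (- ball xo R) y))"
  have [measurable]: "f \<in> borel_measurable borel2" "f3 \<in> borel_measurable borel2" unfolding f_def f3_def by measurable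
  have pt: "f (x, y) \<le> f (x, y) * indicator (ball xo R) x + f3 (y, x)" for x y
  proof (cases "x \<in> ball xo R")
    case False
    then have gx: "?g x = 0" using \<psi>(4)[of x] by (auto simp: R_def)
    show ?thesis
    proof (cases "y \<in> ball xo r'")
      case True
      have "\<bar>?g y\<bar> \<le> 1" using \<psi>(1)[of y] \<psi>(2)[of y] by simp
      then have "\<bar>?g y\<bar> powr p \<le> 1" using p by (intro powr_le1) auto
      then have "fkernel ?\<sigma> x y * \<bar>?g y\<bar> powr p \<le> fkernel ?\<sigma> y x"
        using mult_left_mono[of "\<bar>?g y\<bar> powr p" 1 "fkernel ?\<sigma> x y"] by (simp add: fkernel_commute[of _ x y])
      then show ?thesis using True False gx by (simp add: f_def f3_def ennreal_leI)
    next
      case False then show ?thesis using gx \<psi>(4)[of y] by (simp add: f_def)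
    qed
  qed simp
  have i1: "(NINT y. f (x, y)) \<le> ?c" for x
  proof -
    have "(NINT y. ennreal (\<bar>?g x - ?g y\<bar> powr p * fkernel ?\<sigma> x y))
     \<le> ?c"
      using r \<sigma> \<psi> by (intro nn_integral_kernel_lipschitz cone_level_measurable) auto
    moreover have "f (x, y) = ennreal (\<bar>?g x - ?g y\<bar> powr p * fkernel ?\<sigma> x y)" for y
      by (simp add: f_def mult.commute abs_minus_commute)
    ultimately show ?thesis by simp
  qed
  have "(NINT x. NINT y. f (x, y)) \<le> (NINT x. NINT y. f (x, y) * indicator (ball xo R) x + f3 (y, x))" by (intro nn_integral_mono pt)
  also have "\<dots> = (NINT x. (NINT y. f (x, y)) * indicator (ball xo R) x) + (NINT x. NINT y. f3 (y, x))"
    by (simp add: nn_integral_add nn_integral_multc)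
  also have "(NINT x. NINT y. f3 (y, x)) = (NINT x. NINT y. f3 (x, y))" by (rule lborel_pair.Fubini') simp
  also have "(NINT x. (NINT y. f (x, y)) * indicator (ball xo R) x) \<le> (NINT x. ?c * indicator (ball xo R) x)"
    by (intro nn_integral_mono mult_right_mono i1) auto
  also have "\<dots> = ?c * emeasure lborel (ball xo R)"
    by (rule nn_integral_cmult_indicator) simp
  finally have le: "(NINT x. NINT y. f (x, y)) \<le> ?c * emeasure lborel (ball xo R) + (NINT x. NINT y. f3 (x, y))"
    by (simp add: add_right_mono)
  have "(NINT x. NINT y. f3 (x, y)) < \<infinity>" using kernel_separated_finite[of r' R ?\<sigma> xo] \<sigma> by (simp only: f3_def prod.case) (simp add: R_def)
  moreover have "?c * emeasure lborel (ball xo R) < \<infinity>"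
    using emeasure_ball_less_top[of xo R] by (simp add: ennreal_mult_less_top)
  ultimately have "(NINT x. NINT y. f (x, y)) < \<infinity>" using le by (simp add: ennreal_add_less_top order_le_less_trans)
  then show ?thesis by (simp only: f_def prod.case)
qed

lemma integral_deriv_vanishing:
  fixes \<eta> \<eta>' :: "real \<Rightarrow> real"
  assumes "\<And>t. (\<eta> has_real_derivative \<eta>' t) (at t)" "continuous_on UNIV \<eta>'" "t1 < a" "b < t2" "\<And>t. t \<notin> {a..b} \<Longrightarrow> \<eta> t = 0" "t1 < t2"
  shows "(\<integral>t. \<eta>' t * indicator {t1..t2} t \<partial>lborel) = 0"
proof -
  have "(\<integral>t. \<eta>' t * indicator {t1..t2} t \<partial>lborel) = \<eta> t2 - \<eta> t1"
    using assms by (intro integral_FTC_Icc_real) (auto simp: continuous_on_eq_continuous_at)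
  also have "\<dots> = 0" using assms(3-5) by simp
  finally show ?thesis .
qed

lemma borel_measurable_lebesgue_prod:
  fixes f :: "'a::euclidean_space \<times> 'b::euclidean_space \<Rightarrow> 'c::topological_space"
  assumes "f \<in> measurable borel2 M"
  shows "f \<in> measurable lebesgue M" using assms by (intro measurable_completion) (simp add: borel_prod)

text \<open>For a function constant in time, the weak derivative identity with derivative 0 reduces
  to the vanishing of the integral of \<eta>', as \<eta> is 0 near t1 and t2. The remaining
  conditions hold because g is bounded with bounded support.\<close>

lemma test_fun_constant:
  fixes g :: "'a::euclidean_space \<Rightarrow> real"
  assumes g [measurable]: "g \<in> borel_measurable borel" and g0: "\<And>x. 0 \<le> g x" and gH: "\<And>x. g x \<le> H" and out: "\<And>x. x \<notin> ball xo r \<Longrightarrow> g x = 0"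
    and fin: "(NINT x. NINT y. ennreal (fkernel (s * p) x y * \<bar>g x - g y\<bar> powr p)) < \<infinity>"
    and t: "t1 < t2" and p: "1 < p"
  shows "test_fun s p (cball xo r) t1 t2 (\<lambda>x t. g x) (\<lambda>x t. 0)"
proof -
  have H: "0 \<le> H" using g0[of 0] gH[of 0] by simp
  have cb: "cball xo r \<in> sets lebesgue" by simp
  have gl: "g \<in> borel_measurable lebesgue" by (intro measurable_completion) simp
  have pw: "(NINT x. ennreal (h (g x))) < \<infinity>" if "\<And>x. h (g x) \<le> B" "h 0 = 0" "\<And>x. 0 \<le> h (g x)" for h :: "real \<Rightarrow> real" and B
  proof -
    have "(NINT x. ennreal (h (g x))) \<le> (NINT x. ennreal B * indicator (ball xo r) x)"
      using that out by (intro nn_integral_mono) (auto simp: indicator_def ennreal_leI)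
    also have "\<dots> = ennreal B * emeasure lborel (ball xo r)" by (rule nn_integral_cmult_indicator) simp
    also have "\<dots> < \<infinity>" using emeasure_ball_less_top[of xo r] by (simp add: ennreal_mult_less_top)
    finally show ?thesis .
  qed
  have sq: "(NINT x. ennreal ((g x)\<^sup>2)) < \<infinity>"
    by (rule pw[where h = "\<lambda>z. z\<^sup>2" and B = "H\<^sup>2"]) (use g0 gH in \<open>auto intro!: power_mono\<close>)
  have lp: "(NINT x. ennreal (\<bar>g x\<bar> powr p)) < \<infinity>"
    by (rule pw[where h = "\<lambda>z. \<bar>z\<bar> powr p" and B = "H powr p"]) (use g0 gH p in \<open>auto intro!: powr_mono2\<close>)
  have Lp: "Lp_pow p UNIV g < \<infinity>" using lp by (simp add: Lp_pow_def nn_integral_completion)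
  have gag: "gagliardo s p UNIV g < \<infinity>" using fin by (simp add: gagliardo_def nn_integral_completion fkernel_def mult.commute)
  have weak: "(LINT z:cball xo r \<times> {t1..t2}|lebesgue. g (fst z) * g2 (fst z) * \<eta>' (snd z)) = 0"
    if \<eta>: "\<forall>t. (\<eta> has_real_derivative \<eta>' t) (at t)" "continuous_on UNIV \<eta>'" "\<exists>a b. t1 < a \<and> b < t2 \<and> (\<forall>t. t \<notin> {a..b} \<longrightarrow> \<eta> t = 0)"
      and g2: "g2 \<in> borel_measurable lebesgue" for \<eta> \<eta>' :: "real \<Rightarrow> real" and g2 :: "'a \<Rightarrow> real"
  proof -
    \<comment> \<open>The function g2 is only Lebesgue measurable; a Borel representative is
      substituted before Fubini's theorem is used on the product.\<close>
    obtain g3 where g3 [measurable]: "g3 \<in> borel_measurable lborel" and eq: "AE x in lborel. g2 x = g3 x"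
      using completion_ex_borel_measurable_real[OF g2] by blast
    have [measurable]: "\<eta>' \<in> borel_measurable borel" using \<eta>(2) by (rule borel_measurable_continuous_onI)
    have g3b [measurable]: "g3 \<in> borel_measurable borel" using g3 by simp
    define F where "F = (\<lambda>z :: 'a \<times> real. indicat_real (cball xo r) (fst z) * (g (fst z) * g3 (fst z)) * (\<eta>' (snd z) * indicat_real {t1..t2} (snd z)))"
    have cm [measurable]: "cball xo r \<in> sets borel" by simp
    have Fm [measurable]: "F \<in> borel_measurable borel2" unfolding F_def by measurable
    have "AE z in lborel2. g2 (fst (z :: 'a \<times> real)) = g3 (fst z)"
    proof -
      obtain N where N: "N \<in> null_sets lborel" "{x. g2 x \<noteq> g3 x} \<subseteq> N" using eq by (auto simp: eventually_ae_filter)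
      have "emeasure lborel2 (N \<times> (UNIV :: real set)) = emeasure lborel N * emeasure lborel (UNIV :: real set)"
        using N by (intro lborel.emeasure_pair_measure_Times) auto
      then have "N \<times> UNIV \<in> null_sets (lborel2 :: ('a \<times> real) measure)" using N by (intro null_setsI) (auto simp: null_sets_def)
      then show ?thesis by (rule AE_I') (use N(2) in auto)
    qed
    then have aeq: "AE z in lebesgue. indicat_real (cball xo r \<times> {t1..t2}) z * (g (fst z) * g2 (fst z) * \<eta>' (snd z)) = F z"
      unfolding AE_completion_iff lborel_prod by eventually_elim (auto simp: F_def indicator_def)
    have Fl: "F \<in> borel_measurable lebesgue" by (rule borel_measurable_lebesgue_prod[OF Fm])
    have m1: "(\<lambda>z. indicat_real (cball xo r \<times> {t1..t2}) z * (g (fst z) * g2 (fst z) * \<eta>' (snd z))) \<in> borel_measurable lebesgue"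
    proof -
      have "AE z in lebesgue. F z = indicat_real (cball xo r \<times> {t1..t2}) z * (g (fst z) * g2 (fst z) * \<eta>' (snd z))"
        using aeq by eventually_elim simp
      then show ?thesis by (rule borel_measurable_AE[OF Fl])
    qed
    have "(LINT z:cball xo r \<times> {t1..t2}|lebesgue. g (fst z) * g2 (fst z) * \<eta>' (snd z)) = (\<integral>z. F z \<partial>lebesgue)"
      unfolding set_lebesgue_integral_def real_scaleR_def by (rule integral_cong_AE[OF m1 Fl aeq])
    also have "\<dots> = (\<integral>z. F z \<partial>lborel2)" unfolding lborel_prod by (rule integral_completion) (simp add: borel_prod[symmetric])
    also have "\<dots> = 0"
    \<comment> \<open>A function that is not integrable has Bochner integral 0 by convention, so the
      identity also holds in that case.\<close>
    proof (cases "integrable lborel2 F")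
      case True
      have "(\<integral>z. F z \<partial>lborel2) = (\<integral>x. \<integral>t. F (x, t) \<partial>lborel \<partial>lborel)"
        by (rule lborel_pair.integral_fst'[OF True, symmetric])
      also have "\<dots> = (\<integral>x. 0 \<partial>(lborel :: 'a measure))"
      proof (rule Bochner_Integration.integral_cong)
        fix x
        have "(\<integral>t. F (x, t) \<partial>lborel) = indicat_real (cball xo r) x * (g x * g3 x) * (\<integral>t. \<eta>' t * indicator {t1..t2} t \<partial>lborel)"
          unfolding F_def by simp
        also have "\<dots> = 0" using \<eta> t integral_deriv_vanishing[of \<eta> \<eta>' t1 _ _ t2] by auto
        finally show "(\<integral>t. F (x, t) \<partial>lborel) = 0" .
      qed simp
      finally show ?thesis by simp
    qed (rule not_integrable_integral_eq)
    finally show ?thesis .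
  qed
  show ?thesis unfolding test_fun_def
  proof (intro conjI allI impI ballI)
    show "(\<lambda>z. g (fst z)) \<in> borel_measurable (lebesgue :: ('a \<times> real) measure)" by (rule borel_measurable_lebesgue_prod) measurable
    show "time_cont_L2 (cball xo r) {t1..t2} (\<lambda>x t. g x)" unfolding time_cont_L2_def
    proof (intro conjI ballI)
      show "set_borel_measurable lebesgue (cball xo r) g"
        unfolding set_borel_measurable_def using gl cb by (intro borel_measurable_scaleR borel_measurable_indicator)
      have "(\<integral>\<^sup>+ x \<in> cball xo r. ennreal ((g x)\<^sup>2) \<partial>lebesgue) \<le> (NINT x. ennreal ((g x)\<^sup>2))"
        unfolding nn_integral_completion by (intro nn_integral_mono) (auto simp: indicator_def)
      then show "(\<integral>\<^sup>+ x \<in> cball xo r. ennreal ((g x)\<^sup>2) \<partial>lebesgue) < \<infinity>" using sq by (rule order_le_less_trans)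
    qed simp
    show "AE x in lebesgue. x \<notin> cball xo r \<longrightarrow> g x = 0" using out by (intro AE_I2) auto
    have "(\<integral>\<^sup>+ t\<in>{t1..t2}. Lp_pow p UNIV g + gagliardo s p UNIV g \<partial>lebesgue) = (Lp_pow p UNIV g + gagliardo s p UNIV g) * ennreal (t2 - t1)"
      using t unfolding nn_integral_completion by (subst nn_integral_cmult_indicator) auto
    also have "\<dots> < \<infinity>" using Lp gag by (simp add: ennreal_mult_less_top)
    finally show "(\<integral>\<^sup>+ t\<in>{t1..t2}. Lp_pow p UNIV g + gagliardo s p UNIV g \<partial>lebesgue) < \<infinity>" .
  next
    fix \<eta> \<eta>' and g2 :: "'a \<Rightarrow> real"
    assume "(\<forall>t. (\<eta> has_real_derivative \<eta>' t) (at t)) \<and> continuous_on UNIV \<eta>' \<and>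
          (\<exists>a b. t1 < a \<and> b < t2 \<and> (\<forall>t. t \<notin> {a..b} \<longrightarrow> \<eta> t = 0)) \<and>
          g2 \<in> borel_measurable lebesgue \<and> (\<integral>\<^sup>+ x \<in> cball xo r. ennreal ((g2 x)\<^sup>2) \<partial>lebesgue) < \<infinity>"
    then have "(LINT z:cball xo r \<times> {t1..t2}|lebesgue. g (fst z) * g2 (fst z) * \<eta>' (snd z)) = 0" by (intro weak) blast+
    then show "(LINT z:cball xo r \<times> {t1..t2}|lebesgue. g (fst z) * g2 (fst z) * \<eta>' (snd z)) =
      - (LINT z:cball xo r \<times> {t1..t2}|lebesgue. 0 * g2 (fst z) * \<eta> (snd z))" by (simp add: set_lebesgue_integral_def)
  qed (use g0 in auto)
qed

lemma lebesgue_integral_borel_representative: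
  fixes f F :: "'b::euclidean_space \<Rightarrow> real"
  assumes f: "integrable lebesgue f" and F: "F \<in> borel_measurable borel" and eq: "AE z in lborel. f z = F z"
  shows "integrable lborel F" "(\<integral>z. f z \<partial>lebesgue) = (\<integral>z. F z \<partial>lborel)"
proof -
  have Fb: "F \<in> borel_measurable lborel" using F by simp
  have Fl: "F \<in> borel_measurable lebesgue" by (rule measurable_completion[OF Fb])
  have eql: "AE z in lebesgue. f z = F z" using eq by (simp add: AE_completion_iff)
  have "integrable lebesgue F" by (rule integrable_cong_AE_imp[OF f Fl eql])
  then show "integrable lborel F" using integrable_completion[OF Fb] by simp
  have "(\<integral>z. f z \<partial>lebesgue) = (\<integral>z. F z \<partial>lebesgue)" using f by (intro integral_cong_AE Fl eql) simp
  then show "(\<integral>z. f z \<partial>lebesgue) = (\<integral>z. F z \<partial>lborel)" using integral_completion[OF Fb] by simp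
qed

definition regular_times :: "real \<Rightarrow> ('a::euclidean_space \<Rightarrow> real \<Rightarrow> real) \<Rightarrow> ('a \<times> real \<Rightarrow> real) \<Rightarrow> real set" where
  "regular_times T u V = {t \<in> {0<..<T}. AE x in lborel. u x t = V (x, t)}"

lemma regular_times_AE:
  assumes "AE z in lborel2. snd z \<in> {0<..T} \<longrightarrow> u (fst z) (snd z) = V z"
  shows "AE t in lborel. 0 < t \<and> t < T \<longrightarrow> t \<in> regular_times T u V"
  using AE_pair_swap_slices[OF assms] by eventually_elim (auto simp: regular_times_def)

lemma AE_exists_between:
  fixes a b :: real
  assumes "AE t in lborel. P t" "a < b"
  shows "\<exists>t. a < t \<and> t < b \<and> P t"
proof (rule ccontr)
  assume "\<not> ?thesis"
  then have "AE t in lborel. t \<notin> {a<..<b}" using assms(1) by (auto elim!: eventually_mono)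
  then have "{a<..<b} \<in> null_sets lborel" by (subst AE_iff_null_sets) auto
  then show False using assms(2) by (auto simp: null_sets_def)
qed

text \<open>From |z| <= \<eta> + z^2/\<eta>, applied to both differences from c. It takes the place
  of Hoelder's inequality in passing from L^2 to L^1 continuity on a set of finite measure.\<close>

lemma abs_diff_le_quadratic:
  fixes a b c \<eta> :: real
  assumes "0 < \<eta>"
  shows "\<bar>a - b\<bar> \<le> 2 * \<eta> + (1 / \<eta>) * (a - c)\<^sup>2 + (1 / \<eta>) * (b - c)\<^sup>2"
proof -
  have q: "\<bar>z\<bar> \<le> \<eta> + (1 / \<eta>) * z\<^sup>2" for z
  proof -
    have "\<eta> * \<bar>z\<bar> \<le> \<eta> * \<eta> + z\<^sup>2"
    proof -
      have "2 * \<eta> * \<bar>z\<bar> \<le> \<eta> * \<eta> + z\<^sup>2" using sum_squares_bound[of \<eta> "\<bar>z\<bar>"] by (simp add: power2_eq_square)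
      moreover have "0 \<le> \<eta> * \<bar>z\<bar>" using assms by simp
      ultimately show ?thesis by linarith
    qed
    then show ?thesis using assms by (simp add: field_simps)
  qed
  show ?thesis using q[of "a - c"] q[of "b - c"] by linarith
qed

text \<open>Continuity is given at each time separately; a Lebesgue number of the resulting cover of
  [a, b] makes it uniform. The constants satisfy 2 \<eta> m <= \<epsilon>/2 and 2 \<delta>/\<eta> =
  \<epsilon>/2, where m is the measure of the ball.\<close>

lemma time_cont_L2_uniform:
  fixes u :: "'a::euclidean_space \<Rightarrow> real \<Rightarrow> real"
  assumes c: "time_cont_L2 (cball xo r) {0<..<T} u" and ab: "0 < a" "b < T" "0 < \<epsilon>"
  shows "\<exists>d>0. \<forall>t\<in>{a<..<b}. \<forall>\<tau>\<in>{a<..<b}. \<bar>t - \<tau>\<bar> < d \<longrightarrow>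
    (NINT x. ennreal \<bar>u x t - u x \<tau>\<bar> * indicator (cball xo r) x) \<le> ennreal \<epsilon>"
proof -
  let ?C = "cball xo r"
  let ?N = "\<lambda>t t0. \<integral>\<^sup>+ x \<in> ?C. ennreal ((u x t - u x t0)\<^sup>2) \<partial>lebesgue"
  define m where "m = measure lborel ?C"
  have m: "0 \<le> m" "emeasure lborel ?C = ennreal m"
    using emeasure_eq_ennreal_measure[of lborel ?C] emeasure_lborel_cball_finite[of xo r] by (auto simp: m_def)
  define \<eta> where "\<eta> = \<epsilon> / (4 * (m + 1))"
  define \<delta> where "\<delta> = \<epsilon> * \<eta> / 4"
  have pos: "0 < \<eta>" "0 < \<delta>" using m ab by (auto simp: \<eta>_def \<delta>_def)
  have \<eta>m: "2 * \<eta> * m \<le> \<epsilon> / 2" using m ab by (simp add: \<eta>_def field_simps)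
  have ex: "\<exists>d>0. \<forall>t\<in>{0<..<T}. dist t t0 < d \<longrightarrow> ?N t t0 \<le> ennreal \<delta>" if "t0 \<in> {a..b}" for t0
  proof -
    have t0: "t0 \<in> {0<..<T}" using that ab by auto
    have "((\<lambda>t. \<integral>\<^sup>+ x \<in> ?C. ennreal ((u x t - u x t0)\<^sup>2) \<partial>lebesgue) \<longlongrightarrow> 0) (at t0 within {0<..<T})"
      using c t0 unfolding time_cont_L2_def by blast
    from order_tendstoD(2)[OF this, of "ennreal \<delta>"] pos
    obtain d where d: "0 < d" "\<And>t. t \<in> {0<..<T} \<Longrightarrow> t \<noteq> t0 \<Longrightarrow> dist t t0 < d \<Longrightarrow> ?N t t0 < ennreal \<delta>"
      by (auto simp: eventually_at)
    have "?N t t0 \<le> ennreal \<delta>" if "t \<in> {0<..<T}" "dist t t0 < d" for t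
      using d(2)[OF that(1) _ that(2)] by (cases "t = t0") (auto intro: less_imp_le)
    then show ?thesis using d(1) by blast
  qed
  obtain D where "\<forall>t0\<in>{a..b}. 0 < D t0 \<and> (\<forall>t\<in>{0<..<T}. dist t t0 < D t0 \<longrightarrow> ?N t t0 \<le> ennreal \<delta>)"
    using bchoice[of "{a..b}" "\<lambda>t0 d. 0 < d \<and> (\<forall>t\<in>{0<..<T}. dist t t0 < d \<longrightarrow> ?N t t0 \<le> ennreal \<delta>)"] ex by blast
  then have D: "\<And>t0. t0 \<in> {a..b} \<Longrightarrow> 0 < D t0"
    "\<And>t0 t. t0 \<in> {a..b} \<Longrightarrow> t \<in> {0<..<T} \<Longrightarrow> dist t t0 < D t0 \<Longrightarrow> ?N t t0 \<le> ennreal \<delta>"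
    by blast+
  have "\<exists>e>0. \<forall>x\<in>{a..b}. \<exists>G\<in>(\<lambda>t0. ball t0 (D t0)) ` {a..b}. ball x e \<subseteq> G"
  proof (rule Heine_Borel_lemma[of "{a..b}"])
    show "{a..b} \<subseteq> \<Union> ((\<lambda>t0. ball t0 (D t0)) ` {a..b})"
    proof
      fix t assume "t \<in> {a..b}"
      then show "t \<in> \<Union> ((\<lambda>t0. ball t0 (D t0)) ` {a..b})" using D(1)[of t] by (intro UN_I[of t]) auto
    qed
  qed auto
  then obtain d where d: "0 < d" "\<And>t. t \<in> {a..b} \<Longrightarrow> \<exists>t0\<in>{a..b}. ball t d \<subseteq> ball t0 (D t0)" by auto
  have "(NINT x. ennreal \<bar>u x t - u x \<tau>\<bar> * indicator ?C x) \<le> ennreal \<epsilon>" if t: "t \<in> {a<..<b}" "\<tau> \<in> {a<..<b}" "\<bar>t - \<tau>\<bar> < d" for t \<tau>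
  proof -
    obtain t0 where t0: "t0 \<in> {a..b}" "ball t d \<subseteq> ball t0 (D t0)" using d(2)[of t] t by auto
    have "t \<in> ball t0 (D t0)" "\<tau> \<in> ball t0 (D t0)" using t0(2) t(3) d(1) by (auto simp: dist_real_def subset_iff)
    then have sq: "?N t t0 \<le> ennreal \<delta>" "?N \<tau> t0 \<le> ennreal \<delta>"
      using D(2)[OF t0(1)] t ab by (auto simp: dist_commute)
    have um: "(\<lambda>x. indicator ?C x * u x \<theta>) \<in> borel_measurable lebesgue" if "\<theta> \<in> {0<..<T}" for \<theta>
      using c that unfolding time_cont_L2_def set_borel_measurable_def by simp
    have sm: "(\<lambda>x. ennreal ((u x \<theta> - u x t0)\<^sup>2) * indicator ?C x) \<in> borel_measurable lebesgue" if "\<theta> \<in> {0<..<T}" for \<theta>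
    proof -
      have [measurable]: "(\<lambda>x. indicator ?C x * u x \<theta>) \<in> borel_measurable lebesgue" "(\<lambda>x. indicator ?C x * u x t0) \<in> borel_measurable lebesgue"
        using um that t0(1) ab by auto
      have "(\<lambda>x. ennreal ((indicator ?C x * u x \<theta> - indicator ?C x * u x t0)\<^sup>2)) \<in> borel_measurable lebesgue" by measurable
      moreover have "(\<lambda>x. ennreal ((u x \<theta> - u x t0)\<^sup>2) * indicator ?C x) = (\<lambda>x. ennreal ((indicator ?C x * u x \<theta> - indicator ?C x * u x t0)\<^sup>2))"
        by (auto simp: fun_eq_iff indicator_def)
      ultimately show ?thesis by simp
    qed
    have tT: "t \<in> {0<..<T}" "\<tau> \<in> {0<..<T}" using t ab by auto
    note sm1 = sm[OF tT(1)] and sm2 = sm[OF tT(2)]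
    have "(\<integral>\<^sup>+ x. ennreal \<bar>u x t - u x \<tau>\<bar> * indicator ?C x \<partial>lebesgue) \<le>
      (\<integral>\<^sup>+ x. ennreal (2 * \<eta>) * indicator ?C x + (ennreal (1 / \<eta>) * (ennreal ((u x t - u x t0)\<^sup>2) * indicator ?C x) + ennreal (1 / \<eta>) * (ennreal ((u x \<tau> - u x t0)\<^sup>2) * indicator ?C x)) \<partial>lebesgue)"
    proof (intro nn_integral_mono)
      fix x
      have "ennreal \<bar>u x t - u x \<tau>\<bar> \<le> ennreal (2 * \<eta> + (1 / \<eta>) * (u x t - u x t0)\<^sup>2 + (1 / \<eta>) * (u x \<tau> - u x t0)\<^sup>2)"
        using pos by (intro ennreal_leI abs_diff_le_quadratic)
      also have "\<dots> = ennreal (2 * \<eta>) + (ennreal (1 / \<eta>) * ennreal ((u x t - u x t0)\<^sup>2) + ennreal (1 / \<eta>) * ennreal ((u x \<tau> - u x t0)\<^sup>2))"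
        using pos by (simp add: ennreal_mult[symmetric] ennreal_plus[symmetric] add.assoc del: ennreal_plus)
      finally show "ennreal \<bar>u x t - u x \<tau>\<bar> * indicator ?C x \<le> ennreal (2 * \<eta>) * indicator ?C x + (ennreal (1 / \<eta>) * (ennreal ((u x t - u x t0)\<^sup>2) * indicator ?C x) + ennreal (1 / \<eta>) * (ennreal ((u x \<tau> - u x t0)\<^sup>2) * indicator ?C x))"
        by (cases "x \<in> ?C") auto
    qed
    also have "\<dots> = ennreal (2 * \<eta>) * emeasure lebesgue ?C + (ennreal (1 / \<eta>) * ?N t t0 + ennreal (1 / \<eta>) * ?N \<tau> t0)"
    proof -
      have i: "(\<integral>\<^sup>+ x. ennreal (2 * \<eta>) * indicator ?C x \<partial>lebesgue) = ennreal (2 * \<eta>) * emeasure lebesgue ?C"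
        by (rule nn_integral_cmult_indicator) simp
      have mi: "(\<lambda>x. ennreal (2 * \<eta>) * indicator ?C x) \<in> borel_measurable lebesgue"
        by (intro borel_measurable_times_ennreal borel_measurable_const borel_measurable_indicator) simp
      have m1: "(\<lambda>x. ennreal (1 / \<eta>) * (ennreal ((u x t - u x t0)\<^sup>2) * indicator ?C x)) \<in> borel_measurable lebesgue"
        and m2: "(\<lambda>x. ennreal (1 / \<eta>) * (ennreal ((u x \<tau> - u x t0)\<^sup>2) * indicator ?C x)) \<in> borel_measurable lebesgue"
        by (intro borel_measurable_times_ennreal borel_measurable_const sm1 sm2)+
      show ?thesis
        by (simp only: nn_integral_add[OF mi borel_measurable_add[OF m1 m2]] nn_integral_add[OF m1 m2] i nn_integral_cmult[OF sm1] nn_integral_cmult[OF sm2])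
    qed
    also have "\<dots> \<le> ennreal (2 * \<eta>) * ennreal m + (ennreal (1 / \<eta>) * ennreal \<delta> + ennreal (1 / \<eta>) * ennreal \<delta>)"
      using m by (intro add_mono mult_left_mono sq) auto
    also have "\<dots> = ennreal (2 * \<eta> * m + 2 * (\<delta> / \<eta>))"
      using pos m by (simp add: ennreal_mult[symmetric] ennreal_plus[symmetric] del: ennreal_plus)
    also have "\<dots> \<le> ennreal \<epsilon>" using \<eta>m pos by (intro ennreal_leI) (simp add: \<delta>_def)
    finally show ?thesis by (simp add: nn_integral_completion)
  qed
  then show ?thesis using d(1) by blast
qed

lemma AE_lborel_pair:
  fixes P :: "'a::euclidean_space \<times> 'b::euclidean_space \<Rightarrow> bool"
  assumes "AE z in lborel2. P z"
  shows "AE x in lborel. AE y in lborel. P (x, y)" using lborel_pair.AE_pair[OF assms] .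

text \<open>The kernel and the solution are only Lebesgue measurable in space-time, so single slices
  carry no measurability by themselves. Borel representatives, equal to them almost everywhere,
  permit iterated integrals; slices may be exchanged at almost every time.\<close>

locale solution_representative =
  fixes s p Co C1 T :: real and E :: "'a::euclidean_space set" and K u and K' :: "'a \<times> 'a \<times> real \<Rightarrow> real" and V :: "'a \<times> real \<Rightarrow> real"
  assumes p: "1 < p" and s: "0 < s" "s < 1" and Co: "0 < Co" "Co \<le> C1"
    and adm: "admissible_kernel s p Co C1 T K" and sol: "weak_solution s p E T K u"
    and K'_meas [measurable]: "K' \<in> borel_measurable borel3"
    and V_meas [measurable]: "V \<in> borel_measurable borel2"
    and K'_eq: "AE z in lborel3. snd (snd z) \<in> {0<..T} \<longrightarrow> K (fst z) (fst (snd z)) (snd (snd z)) = K' z"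
    and V_eq: "AE z in lborel2. snd z \<in> {0<..T} \<longrightarrow> u (fst z) (snd z) = V z"
begin

abbreviation "\<Theta> \<equiv> regular_times T u V"

lemma times_AE: "AE t in lborel. 0 < t \<and> t < T \<longrightarrow> t \<in> \<Theta>"
  using V_eq by (rule regular_times_AE)

lemma timesD: "t \<in> \<Theta> \<Longrightarrow> 0 < t" "t \<in> \<Theta> \<Longrightarrow> t < T" "t \<in> \<Theta> \<Longrightarrow> AE x in lborel. u x t = V (x, t)"
  by (auto simp: regular_times_def)

lemma kernel_bounds: "AE t in lborel. 0 < t \<and> t < T \<longrightarrow> (AE x in lborel. AE y in lborel.
        between Co C1 (s * p) K' x y t)" using AE_triple_slices[OF K'_eq]
proof eventually_elim
  case (elim t)
  show ?case
  proof
    assume t: "0 < t \<and> t < T"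
    have "AE z in lebesgue. Co / norm (fst z - snd z) powr (real DIM('a) + s * p) \<le> K (fst z) (snd z) t \<and>
        K (fst z) (snd z) t \<le> C1 / norm (fst z - snd z) powr (real DIM('a) + s * p)" using adm t by (simp add: admissible_kernel_def)
    then have "AE z in lborel2. Co / norm (fst z - snd z) powr (real DIM('a) + s * p) \<le> K (fst z) (snd z) t \<and>
        K (fst z) (snd z) t \<le> C1 / norm (fst z - snd z) powr (real DIM('a) + s * p)" unfolding AE_completion_iff lborel_prod .
    from AE_lborel_pair[OF this] elim
    show "AE x in lborel. AE y in lborel. between Co C1 (s * p) K' x y t"
    proof eventually_elim
      case x: (elim x)
      show ?case using x by eventually_elim (use t in \<open>simp add: fkernel_def\<close>)
    qed
  qed
qed

lemma regular: "weak_regular s p E T u"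
  using sol by (simp add: weak_solution_def weak_subsolution_def)

lemma gagliardo_finite:
  assumes E: "cball xo Rb \<subseteq> E" and ab: "0 < a" "b < T"
  shows "(NINT t. (NINT x. NINT y. ennreal (fkernel (s * p) x y * \<bar>V (x, t) - V (y, t)\<bar> powr p) * indicator (ball xo Rb) x * indicator (ball xo Rb) y) * indicator {a..b} t) < \<infinity>"
proof (cases "a \<le> b")
  case True
  let ?F = "\<lambda>t x y. ennreal (fkernel (s * p) x y * \<bar>V (x, t) - V (y, t)\<bar> powr p) * indicator (ball xo Rb) x * indicator (ball xo Rb) y"
  have fin: "(\<integral>\<^sup>+ t \<in> {a..b}. Lp_pow p (cball xo Rb) (\<lambda>x. u x t) + gagliardo s p (cball xo Rb) (\<lambda>x. u x t) \<partial>lebesgue) < \<infinity>"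
    using regular E ab True unfolding weak_regular_def by (elim conjE) (auto simp del: infinity_ennreal_def)
  have "(NINT t. (NINT x. NINT y. ?F t x y) * indicator {a..b} t) \<le>
    (NINT t. (Lp_pow p (cball xo Rb) (\<lambda>x. u x t) + gagliardo s p (cball xo Rb) (\<lambda>x. u x t)) * indicator {a..b} t)"
  proof (rule nn_integral_mono_AE)
    show "AE t in lborel. (NINT x. NINT y. ?F t x y) * indicator {a..b} t \<le> (Lp_pow p (cball xo Rb) (\<lambda>x. u x t) + gagliardo s p (cball xo Rb) (\<lambda>x. u x t)) * indicator {a..b} t"
      using times_AE
    proof eventually_elim
      case (elim t)
      show ?case
      proof (cases "t \<in> {a..b}")
        case True
        then have "t \<in> \<Theta>" using elim ab by auto
        note eq = timesD(3)[OF this]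
        have "(NINT x. NINT y. ?F t x y)
          \<le> (NINT x. (NINT y. ennreal (\<bar>u x t - u y t\<bar> powr p / norm (x - y) powr (real DIM('a) + s * p)) * indicator (cball xo Rb) y) * indicator (cball xo Rb) x)"
        proof (rule nn_integral_mono_AE)
          show "AE x in lborel. (NINT y. ?F t x y)
            \<le> (NINT y. ennreal (\<bar>u x t - u y t\<bar> powr p / norm (x - y) powr (real DIM('a) + s * p)) * indicator (cball xo Rb) y) * indicator (cball xo Rb) x"
            using eq
          proof eventually_elim
            case x: (elim x)
            show ?case
            proof (cases "x \<in> ball xo Rb")
              case True
              have "(NINT y. ?F t x y)
                \<le> (NINT y. ennreal (\<bar>u x t - u y t\<bar> powr p / norm (x - y) powr (real DIM('a) + s * p)) * indicator (cball xo Rb) y)"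
              proof (rule nn_integral_mono_AE)
                show "AE y in lborel. ?F t x y
                  \<le> ennreal (\<bar>u x t - u y t\<bar> powr p / norm (x - y) powr (real DIM('a) + s * p)) * indicator (cball xo Rb) y"
                  using eq by eventually_elim (use x in \<open>auto simp: fkernel_def indicator_def\<close>)
              qed
              then show ?thesis using True by simp
            qed simp
          qed
        qed
        also have "\<dots> = gagliardo s p (cball xo Rb) (\<lambda>x. u x t)" by (simp add: gagliardo_def nn_integral_completion)
        finally show ?thesis using True by (simp add: add_increasing)
      qed simp
    qed
  qed
  also have "\<dots> < \<infinity>" using fin by (simp add: nn_integral_completion)
  finally show ?thesis .
qed simp

lemma time_continuity:
  assumes E: "cball xo Rb \<subseteq> E" and ab: "0 < a" "b < T" "0 < \<epsilon>"
  shows "\<exists>d>0. \<forall>t\<in>\<Theta>. \<forall>\<tau>\<in>\<Theta>. a < t \<and> t < b \<and> a < \<tau> \<and> \<tau> < b \<and> \<bar>t - \<tau>\<bar> < d \<longrightarrow>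
        (NINT x. ennreal \<bar>V (x, t) - V (x, \<tau>)\<bar> * indicator (ball xo Rb) x) \<le> ennreal \<epsilon>"
proof -
  have "time_cont_L2 (cball xo Rb) {0<..<T} u" using regular E unfolding weak_regular_def by (elim conjE) auto
  from time_cont_L2_uniform[OF this ab] obtain d where d: "0 < d"
    "\<And>t \<tau>. t \<in> {a<..<b} \<Longrightarrow> \<tau> \<in> {a<..<b} \<Longrightarrow> \<bar>t - \<tau>\<bar> < d \<Longrightarrow> (NINT x. ennreal \<bar>u x t - u x \<tau>\<bar> * indicator (cball xo Rb) x) \<le> ennreal \<epsilon>"
    by blast
  have "(NINT x. ennreal \<bar>V (x, t) - V (x, \<tau>)\<bar> * indicator (ball xo Rb) x) \<le> ennreal \<epsilon>"
    if "t \<in> \<Theta>" "\<tau> \<in> \<Theta>" "a < t" "t < b" "a < \<tau>" "\<tau> < b" "\<bar>t - \<tau>\<bar> < d" for t \<tau>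
  proof -
    have "(NINT x. ennreal \<bar>V (x, t) - V (x, \<tau>)\<bar> * indicator (ball xo Rb) x) \<le> (NINT x. ennreal \<bar>u x t - u x \<tau>\<bar> * indicator (cball xo Rb) x)"
    proof (rule nn_integral_mono_AE)
      show "AE x in lborel. ennreal \<bar>V (x, t) - V (x, \<tau>)\<bar> * indicator (ball xo Rb) x \<le> ennreal \<bar>u x t - u x \<tau>\<bar> * indicator (cball xo Rb) x"
        using timesD(3)[OF that(1)] timesD(3)[OF that(2)] by eventually_elim (auto simp: indicator_def)
    qed
    also have "\<dots> \<le> ennreal \<epsilon>" using that by (intro d(2)) auto
    finally show ?thesis .
  qed
  then show ?thesis using d(1) by blast
qed

text \<open>With a test function constant in time the term containing its time derivative is 0. The
  inequalities for sub- and supersolutions combine to an equation, which is then moved to the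
  representatives.\<close>

lemma weak_equation:
  assumes E: "cball xo r \<subseteq> E" and t: "t1 \<in> \<Theta>" "t2 \<in> \<Theta>" "t1 < t2"
    and g [measurable]: "g \<in> borel_measurable borel" and g0: "\<And>x. 0 \<le> g x" and gH: "\<And>x. g x \<le> H" and out: "\<And>x. x \<notin> ball xo r \<Longrightarrow> g x = 0"
    and fin: "(NINT x. NINT y. ennreal (fkernel (s * p) x y * \<bar>g x - g y\<bar> powr p)) < \<infinity>"
  shows "integrable lborel (\<lambda>x. V (x, t1) * g x) \<and> integrable lborel (\<lambda>x. V (x, t2) * g x) \<and>
        integrable lborel3 (\<lambda>(x, y, t). indicat_real {t1<..t2} t * (K' (x, y, t) * signed_powr p (V (x, t) - V (y, t)) * (g x - g y))) \<and>
        (\<integral>x. V (x, t2) * g x \<partial>lborel) - (\<integral>x. V (x, t1) * g x \<partial>lborel) +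
        (\<integral>z. (case z of (x, y, t) \<Rightarrow> indicat_real {t1<..t2} t * (K' (x, y, t) * signed_powr p (V (x, t) - V (y, t)) * (g x - g y))) \<partial>lborel3) = 0"
proof -
  let ?C = "cball xo r" and ?\<phi> = "\<lambda>(x::'a) (t::real). g x" and ?d = "\<lambda>(x::'a) (t::real). 0 :: real"
  have tT: "0 < t1" "t2 < T" using timesD(1,2) t by auto
  have tf: "test_fun s p ?C t1 t2 ?\<phi> ?d" by (rule test_fun_constant[OF g g0 gH out fin t(3) p])
  have int: "weak_integrable p K u ?C t1 t2 ?\<phi> ?d" and le: "weak_lhs p K u ?C t1 t2 ?\<phi> ?d \<le> 0"
    using sol E t(3) tT tf unfolding weak_solution_def weak_subsolution_def by (auto 0 3)
  have ge: "weak_lhs p K u ?C t1 t2 ?\<phi> ?d \<ge> 0" using sol E t(3) tT tf unfolding weak_solution_def weak_supersolution_def by (auto 0 3)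
  define F where "F = (\<lambda>(x, y, t). indicat_real {t1<..t2} t * (K' (x, y, t) * signed_powr p (V (x, t) - V (y, t)) * (g x - g y)))"
  have Fm: "F \<in> borel_measurable borel3" unfolding F_def by measurable
  have L3: "lborel3 = (lborel :: ('a \<times> 'a \<times> real) measure)" by (simp add: lborel_prod)
  have sl: "integrable lborel (\<lambda>x. V (x, t) * g x) \<and> (LINT x:?C|lebesgue. u x t * g x) = (\<integral>x. V (x, t) * g x \<partial>lborel)"
    if "t \<in> \<Theta>" "set_integrable lebesgue ?C (\<lambda>x. u x t * g x)" for t
  proof -
    have a: "AE x in lborel. indicat_real ?C x *\<^sub>R (u x t * g x) = V (x, t) * g x"
      using timesD(3)[OF that(1)] by eventually_elim (use out in \<open>auto simp: indicator_def\<close>)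
    have m: "(\<lambda>x. V (x, t) * g x) \<in> borel_measurable borel" by measurable
    show ?thesis using lebesgue_integral_borel_representative[OF that(2)[unfolded set_integrable_def] m a] by (simp add: set_lebesgue_integral_def)
  qed
  have i1: "set_integrable lebesgue ?C (\<lambda>x. u x t1 * g x)" and i2: "set_integrable lebesgue ?C (\<lambda>x. u x t2 * g x)"
    and i3: "set_integrable lebesgue (UNIV \<times> UNIV \<times> {t1..t2}) (energy_integrand p K u ?\<phi>)"
    using int by (auto simp: weak_integrable_def)
  \<comment> \<open>The closed time interval of the weak formulation and the half-open one used here
    differ by the slice at t1, a null set.\<close>
  have "AE z in lborel3. indicat_real (UNIV \<times> UNIV \<times> {t1..t2}) z *\<^sub>R energy_integrand p K u ?\<phi> z = F z"
    using K'_eq AE_triple_of_pair[OF V_eq] AE_time_neq_triple[where 'a = 'a and c = t1]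
  proof eventually_elim
    case (elim z)
    obtain x y t where z: "z = (x, y, t)" by (cases z rule: prod_cases3) auto
    show ?case using elim tT unfolding z by (auto simp: F_def energy_integrand_def signed_powr_def indicator_def)
  qed
  then have ae: "AE z in lborel. indicat_real (UNIV \<times> UNIV \<times> {t1..t2}) z *\<^sub>R energy_integrand p K u ?\<phi> z = F z"
    unfolding L3 .
  have Fb: "F \<in> borel_measurable borel" using Fm by (simp add: borel_prod)
  note e3 = lebesgue_integral_borel_representative[OF i3[unfolded set_integrable_def] Fb ae]
  have "weak_lhs p K u ?C t1 t2 ?\<phi> ?d = (\<integral>x. V (x, t2) * g x \<partial>lborel) - (\<integral>x. V (x, t1) * g x \<partial>lborel) + (\<integral>z. F z \<partial>lborel)"
    using sl[OF t(1) i1] sl[OF t(2) i2] e3(2) by (simp add: weak_lhs_def set_lebesgue_integral_def)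
  then have "(\<integral>x. V (x, t2) * g x \<partial>lborel) - (\<integral>x. V (x, t1) * g x \<partial>lborel) + (\<integral>z. F z \<partial>lborel) = 0"
    using le ge by linarith
  then show ?thesis using sl[OF t(1) i1] sl[OF t(2) i2] e3(1) unfolding L3[symmetric] F_def by blast
qed

text \<open>The integrability is read off the weak formulation: for a cutoff g the form is
  integrable, and for x in the inner ball and y outside the big ball g x - g y = 1, so the integrand
  there is the kernel times |V(x) - V(y)|^(p-1). Dividing by the lower kernel bound gives the
  claim.\<close>

lemma far_finite:
  assumes E: "cball xo Rb \<subseteq> E" and ab: "0 < a" "b < T" and r: "0 < r" "r < Rb"
  shows "(NINT t. (NINT x. NINT y. ennreal (fkernel (s * p) x y * \<bar>V (x, t) - V (y, t)\<bar> powr (p - 1)) * indicator (ball xo r) x * indicator (- ball xo Rb) y) * indicator {a..b} t) < \<infinity>"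
proof (cases "a \<le> b")
  case True
  let ?F = "\<lambda>t x y. ennreal (fkernel (s * p) x y * \<bar>V (x, t) - V (y, t)\<bar> powr (p - 1)) * indicator (ball xo r) x * indicator (- ball xo Rb) y"
  obtain t1 where "0 < t1 \<and> t1 < a \<and> (0 < t1 \<and> t1 < T \<longrightarrow> t1 \<in> \<Theta>)"
    using AE_exists_between[OF times_AE, of 0 a] ab by blast
  then have t1: "t1 \<in> \<Theta>" "t1 < a" using True ab by auto
  obtain t2 where "b < t2 \<and> t2 < T \<and> (0 < t2 \<and> t2 < T \<longrightarrow> t2 \<in> \<Theta>)"
    using AE_exists_between[OF times_AE, of b T] ab by blast
  then have t2: "t2 \<in> \<Theta>" "b < t2" using True ab by auto
  define r' where "r' = (r + Rb) / 2"
  have r': "r < r'" "r' < Rb" using r by (auto simp: r'_def)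
  define g where "g = (\<lambda>x. - cone_level xo 0 1 r r' x)"
  note c = cone_level_props[of 1 r r', OF zero_le_one r'(1), where \<mu> = 0 and xo = xo]
  have g0: "0 \<le> g x" and g1: "g x \<le> 1" for x using c(1)[of x] c(2)[of x] by (auto simp: g_def)
  have gin: "x \<in> ball xo r \<Longrightarrow> g x = 1" and gout: "x \<notin> ball xo r' \<Longrightarrow> g x = 0" for x using c(3)[of x] c(4)[of x] by (auto simp: g_def)
  have gm [measurable]: "g \<in> borel_measurable borel" unfolding g_def by measurable
  have fin: "(NINT x. NINT y. ennreal (fkernel (s * p) x y * \<bar>g x - g y\<bar> powr p)) < \<infinity>"
    unfolding g_def by (rule bump_gagliardo[OF r(1) r'(1) p s])
  define F where "F = (\<lambda>(x, y, t). indicat_real {t1<..t2} t * (K' (x, y, t) * signed_powr p (V (x, t) - V (y, t)) * (g x - g y)))"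
  have Fm [measurable]: "F \<in> borel_measurable borel3" unfolding F_def by measurable
  have E': "cball xo r' \<subseteq> E" using E r' by (auto simp: subset_iff)
  have tt: "t1 < t2" using t1 t2 True by auto
  have "integrable lborel3 F" unfolding F_def using weak_equation[OF E' t1(1) t2(1) tt gm g0 g1 gout fin] by blast
  then have "(\<integral>\<^sup>+ z. ennreal (norm (F z)) \<partial>lborel3) < \<infinity>" by (simp add: integrable_iff_bounded)
  also have "(\<integral>\<^sup>+ z. ennreal (norm (F z)) \<partial>lborel3) = (NINT t. NINT x. NINT y. ennreal (norm (F (x, y, t))))"
    by (rule nn_integral_triple) measurable
  finally have Ffin: "(NINT t. NINT x. NINT y. ennreal (norm (F (x, y, t)))) < \<infinity>" .
  have "(NINT t. (NINT x. NINT y. ?F t x y) * indicator {a..b} t) \<le> (NINT t. ennreal (1 / Co) * (NINT x. NINT y. ennreal (norm (F (x, y, t)))))"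
  proof (rule nn_integral_mono_AE)
    show "AE t in lborel. (NINT x. NINT y. ?F t x y) * indicator {a..b} t \<le> ennreal (1 / Co) * (NINT x. NINT y. ennreal (norm (F (x, y, t))))"
      using kernel_bounds
    proof eventually_elim
      case (elim t)
      show ?case
      proof (cases "t \<in> {a..b}")
        case t: True
        then have tt: "0 < t \<and> t < T" "t1 < t" "t \<le> t2" using ab t1 t2 by auto
        have "(NINT x. NINT y. ?F t x y)
          \<le> (NINT x. NINT y. ennreal (1 / Co) * ennreal (norm (F (x, y, t))))"
        proof (rule nn_integral_mono_AE2[OF elim[rule_format, OF tt(1)]])
          fix x y assume K: "between Co C1 (s * p) K' x y t"
          show "?F t x y \<le> ennreal (1 / Co) * ennreal (norm (F (x, y, t)))"
          proof (cases "x \<in> ball xo r \<and> y \<notin> ball xo Rb")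
            case True
            then have "y \<notin> ball xo r'" using r' by auto
            then have gg: "g x - g y = 1" using True gin gout by simp
            have "0 \<le> Co * fkernel (s * p) x y" using Co by simp
            then have nn: "0 \<le> K' (x, y, t)" using K by linarith
            have "norm (F (x, y, t)) = K' (x, y, t) * \<bar>V (x, t) - V (y, t)\<bar> powr (p - 1)"
              using tt nn by (simp add: F_def gg abs_mult abs_signed_powr)
            moreover have "Co * fkernel (s * p) x y * \<bar>V (x, t) - V (y, t)\<bar> powr (p - 1) \<le> K' (x, y, t) * \<bar>V (x, t) - V (y, t)\<bar> powr (p - 1)"
              using K by (intro mult_right_mono) auto
            ultimately have "fkernel (s * p) x y * \<bar>V (x, t) - V (y, t)\<bar> powr (p - 1) \<le> 1 / Co * norm (F (x, y, t))"
              using Co by (simp add: field_simps)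
            then have "ennreal (fkernel (s * p) x y * \<bar>V (x, t) - V (y, t)\<bar> powr (p - 1)) \<le> ennreal (1 / Co) * ennreal (norm (F (x, y, t)))"
              using Co by (subst ennreal_mult[symmetric]) (auto intro: ennreal_leI)
            then show ?thesis using True by simp
          qed (auto simp: indicator_def)
        qed
        also have "\<dots> = ennreal (1 / Co) * (NINT x. NINT y. ennreal (norm (F (x, y, t))))" by (simp add: nn_integral_cmult)
        finally show ?thesis using t by simp
      qed simp
    qed
  qed
  also have "\<dots> = ennreal (1 / Co) * (NINT t. NINT x. NINT y. ennreal (norm (F (x, y, t))))" by (rule nn_integral_cmult) measurable
  also have "\<dots> < \<infinity>" using Ffin by (simp add: ennreal_mult_less_top)
  finally show ?thesis .
qed simp

lemma slice_solution:
  assumes E: "cball xo Rb \<subseteq> E"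
  shows "slice_solution s p Co C1 K' V T xo Rb \<Theta>"
proof
  show "\<Theta> \<subseteq> {0<..<T}" by (auto simp: regular_times_def)
  fix t1 t2 g r H assume h: "t1 \<in> \<Theta>" "t2 \<in> \<Theta>" "t1 < t2" "0 < r" "r < Rb" "g \<in> borel_measurable borel"
        "\<And>x. 0 \<le> g x" "\<And>x. g x \<le> H" "\<And>x. x \<notin> ball xo r \<Longrightarrow> g x = 0"
        "(NINT x. NINT y. ennreal (fkernel (s * p) x y * \<bar>g x - g y\<bar> powr p)) < \<infinity>"
  have "cball xo r \<subseteq> E" using E h(5) by (auto simp: subset_iff)
  then show "integrable lborel (\<lambda>x. V (x, t1) * g x) \<and> integrable lborel (\<lambda>x. V (x, t2) * g x) \<and>
        integrable lborel3 (\<lambda>(x, y, t). indicat_real {t1<..t2} t * (K' (x, y, t) * signed_powr p (V (x, t) - V (y, t)) * (g x - g y))) \<and>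
        (\<integral>x. V (x, t2) * g x \<partial>lborel) - (\<integral>x. V (x, t1) * g x \<partial>lborel) +
        (\<integral>z. (case z of (x, y, t) \<Rightarrow> indicat_real {t1<..t2} t * (K' (x, y, t) * signed_powr p (V (x, t) - V (y, t)) * (g x - g y))) \<partial>lborel3) = 0"
    by (rule weak_equation) (use h in blast)+
qed (fact p s Co K'_meas V_meas kernel_bounds times_AE gagliardo_finite[OF E] time_continuity[OF E] far_finite[OF E])+

end

section \<open>Decay of the oscillation\<close>

text \<open>For x in the quarter ball and y outside the ball, |xo - y| <= 2 |x - y|, so moving the
  pole of the kernel costs only 2^(N+\<sigma>).\<close>

lemma nn_integral_tail_recenter:
  fixes xo :: "'a::euclidean_space" and f :: "'a \<Rightarrow> real"
  assumes x: "x \<in> ball xo (R / 4)" and \<sigma>: "0 < \<sigma>" and [measurable]: "f \<in> borel_measurable borel" and f0: "\<And>y. 0 \<le> f y"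
  shows "far \<sigma> xo R (\<lambda>y. f y) x \<le>
    ennreal (2 powr (real DIM('a) + \<sigma>)) * far \<sigma> xo R (\<lambda>y. f y) xo"
proof -
  have [measurable]: "ball xo R \<in> sets borel" by simp
  have R: "0 < R" using x by (auto simp: dist_norm) (smt (verit) norm_ge_zero)
  have k: "fkernel \<sigma> x y \<le> 2 powr (real DIM('a) + \<sigma>) * fkernel \<sigma> xo y" if "y \<notin> ball xo R" for y
  proof -
    have d: "R \<le> dist xo y" "dist xo x < R / 4" using that x by (auto simp: not_less)
    have "dist xo y \<le> dist xo x + dist x y" by (rule dist_triangle)
    then have "dist xo y / 2 \<le> dist x y" using d R by linarith
    then have "fkernel \<sigma> x y \<le> (dist xo y / 2) powr - (real DIM('a) + \<sigma>)" using d R \<sigma> by (intro fkernel_le) auto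
    also have "\<dots> = 2 powr (real DIM('a) + \<sigma>) * fkernel \<sigma> xo y"
    proof -
      define q where "q = real DIM('a) + \<sigma>"
      have "(dist xo y / 2) powr - q = 2 powr q * (1 / norm (xo - y) powr q)" using d R by (simp add: powr_divide powr_minus dist_norm divide_simps)
      then show ?thesis by (simp add: fkernel_def q_def)
    qed
    finally show ?thesis .
  qed
  have "far \<sigma> xo R (\<lambda>y. f y) x \<le>
    (NINT y. ennreal (2 powr (real DIM('a) + \<sigma>)) * (ennreal (fkernel \<sigma> xo y * f y) * indicator (- ball xo R) y))"
  proof (intro nn_integral_mono)
    fix y
    show "ennreal (fkernel \<sigma> x y * f y) * indicator (- ball xo R) y \<le> ennreal (2 powr (real DIM('a) + \<sigma>)) * (ennreal (fkernel \<sigma> xo y * f y) * indicator (- ball xo R) y)"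
    proof (cases "y \<in> ball xo R")
      case False
      have "fkernel \<sigma> x y * f y \<le> 2 powr (real DIM('a) + \<sigma>) * (fkernel \<sigma> xo y * f y)"
        using mult_right_mono[OF k[OF False] f0[of y]] by (simp add: mult.assoc)
      then have "ennreal (fkernel \<sigma> x y * f y) \<le> ennreal (2 powr (real DIM('a) + \<sigma>)) * ennreal (fkernel \<sigma> xo y * f y)"
        using f0[of y] by (subst ennreal_mult[symmetric]) (auto intro: ennreal_leI)
      then show ?thesis using False by (auto simp: indicator_def)
    qed simp
  qed
  also have "\<dots> = ennreal (2 powr (real DIM('a) + \<sigma>)) * far \<sigma> xo R (\<lambda>y. f y) xo"
    by (rule nn_integral_cmult) measurable
  finally show ?thesis .
qed

context slice_solution begin

text \<open>With M = w/2 and r = \<theta> Rb, every t0 in the first half of the window has \<tau>/2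
  < b - t0 < \<tau>, which is the two-sided length condition of
  \<open>oscillation_reduction\<close>. The last quarter of (t0, b) then contains the last eighth of
  the window.\<close>

lemma half_oscillation_aux:
  assumes h: "osc_factor TYPE('a) s p Co C1 h" and Rb: "0 < Rb" and w: "0 < w" and \<theta>: "0 < \<theta>" "8 * \<theta> \<le> 1" and b: "b \<le> T"
    and \<tau>: "\<tau> = dwell_const TYPE('a) s p C1 * (w / 2) powr (2 - p) * (\<theta> * Rb) powr \<sigma>" and a: "0 < b - \<tau>"
    and bnd: "\<And>x t. x \<in> ball xo Rb \<Longrightarrow> b - \<tau> < t \<Longrightarrow> t < b \<Longrightarrow> V (x, t) \<le> \<mu>"
    and tl: "AE t in lborel. b - \<tau> < t \<and> t < b \<longrightarrow> exc \<mu> t xo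
       \<le> ennreal ((h * (w / 2) / 2) powr (p - 1) * (\<theta> * Rb) powr - \<sigma> / 2 powr (real DIM('a) + \<sigma>))"
    and t0: "t0 \<in> \<Theta>" "b - \<tau> < t0" "t0 < b - \<tau> / 2"
    and half: "mS (\<mu> - w / 2) (\<theta> * Rb) t0 \<le> unit_ball_vol (real DIM('a)) * (\<theta> * Rb) powr real DIM('a) / 2"
  shows "AE z in lborel2. fst z \<in> ball xo (\<theta> * Rb / 2) \<and> b - \<tau> / 8 < snd z \<and> snd z < b \<longrightarrow> V z \<le> \<mu> - h / 4 * w"
proof -
  have h0: "0 < h" using h by (simp add: osc_factor_def)
  have \<tau>0: "0 < \<tau>" unfolding \<tau> using dwell_const_pos Rb w \<theta> by simp
  have win: "osc_window (\<theta> * Rb) \<mu> (h * (w / 2) / 2) (b - \<tau>) b" unfolding osc_window_def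
  proof (intro conjI ballI allI impI)
    show "8 * (\<theta> * Rb) \<le> Rb" using mult_right_mono[OF \<theta>(2), of Rb] Rb by simp
    show "AE t in lborel. b - \<tau> < t \<and> t < b \<longrightarrow> (\<forall>x\<in>ball xo (2 * (\<theta> * Rb)).
       exc \<mu> t x
         \<le> ennreal ((h * (w / 2) / 2) powr (p - 1) * (\<theta> * Rb) powr - \<sigma>))" using tl
    proof eventually_elim
      case (elim t)
      show ?case
      proof (intro impI ballI)
        fix x assume t: "b - \<tau> < t \<and> t < b" and x: "x \<in> ball xo (2 * (\<theta> * Rb))"
        have "2 * (\<theta> * Rb) \<le> Rb / 4" using mult_right_mono[OF \<theta>(2), of Rb] Rb by simp
        then have "x \<in> ball xo (Rb / 4)" using x by auto
        then have "exc \<mu> t x \<le>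
          ennreal (2 powr (real DIM('a) + \<sigma>)) * exc \<mu> t xo"
          using p s by (intro nn_integral_tail_recenter) auto
        also have "\<dots> \<le> ennreal (2 powr (real DIM('a) + \<sigma>)) * ennreal ((h * (w / 2) / 2) powr (p - 1) * (\<theta> * Rb) powr - \<sigma> / 2 powr (real DIM('a) + \<sigma>))"
          using elim t by (intro mult_left_mono) auto
        also have "\<dots> = ennreal ((h * (w / 2) / 2) powr (p - 1) * (\<theta> * Rb) powr - \<sigma>)" by (subst ennreal_mult[symmetric]) auto
        finally show "exc \<mu> t x
         \<le> ennreal ((h * (w / 2) / 2) powr (p - 1) * (\<theta> * Rb) powr - \<sigma>)" .
      qed
    qed
  qed (use Rb w \<theta> h0 \<tau>0 a b bnd in auto)
  have "AE z in lborel2. fst z \<in> ball xo (\<theta> * Rb / 2) \<and> t0 + (b - t0) * (3 / 4) < snd z \<and> snd z < b \<longrightarrow> V z \<le> \<mu> - h * (w / 2) / 2"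
    using t0 \<tau>0 w half \<tau> by (intro oscillation_reduction[OF h win]) auto
  then show ?thesis
  proof eventually_elim
    case (elim z)
    have "t0 + (b - t0) * (3 / 4) = b - (b - t0) / 4" by (simp add: field_simps)
    moreover have "\<tau> / 8 \<le> (b - t0) / 4" using t0(3) by simp
    ultimately have "t0 + (b - t0) * (3 / 4) \<le> b - \<tau> / 8" by linarith
    then show ?case using elim by auto
  qed
qed

text \<open>The sets where V is above and below the middle value \<mu> + w/2 are disjoint, so at t0
  one of them fills at most half of the ball. In the second case the first is applied to -V, and the
  lower end of the interval moves up by h w/4.\<close>

lemma half_oscillation:
  assumes h: "osc_factor TYPE('a) s p Co C1 h" and Rb: "0 < Rb" and w: "0 < w" and \<theta>: "0 < \<theta>" "8 * \<theta> \<le> 1" and b: "b \<le> T"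
    and \<tau>: "\<tau> = dwell_const TYPE('a) s p C1 * (w / 2) powr (2 - p) * (\<theta> * Rb) powr \<sigma>" and a: "0 < b - \<tau>"
    and bnd: "\<And>x t. x \<in> ball xo Rb \<Longrightarrow> b - \<tau> < t \<Longrightarrow> t < b \<Longrightarrow> \<mu> \<le> V (x, t) \<and> V (x, t) \<le> \<mu> + w"
    and tl: "AE t in lborel. b - \<tau> < t \<and> t < b \<longrightarrow> far \<sigma> xo Rb (\<lambda>y. \<bar>V (y, t) - \<mu>\<bar> powr (p - 1)) xo
       \<le> ennreal ((h * (w / 2) / 2) powr (p - 1) * (\<theta> * Rb) powr - \<sigma> / 2 powr (real DIM('a) + \<sigma>))"
  shows "\<exists>\<mu>'. \<mu> \<le> \<mu>' \<and> \<mu>' \<le> \<mu> + h / 4 * w \<and>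
    (AE z in lborel2. fst z \<in> ball xo (\<theta> * Rb / 2) \<and> b - \<tau> / 8 < snd z \<and> snd z < b \<longrightarrow> \<mu>' \<le> V z \<and> V z \<le> \<mu>' + (1 - h / 4) * w)"
proof -
  let ?Q = "\<lambda>z. fst z \<in> ball xo (\<theta> * Rb / 2) \<and> b - \<tau> / 8 < snd z \<and> snd z < b"
  have h0: "0 < h" using h by (simp add: osc_factor_def)
  have \<tau>0: "0 < \<tau>" unfolding \<tau> using dwell_const_pos Rb w \<theta> by simp
  let ?r = "\<theta> * Rb"
  have r: "0 < ?r" "?r \<le> Rb" using Rb \<theta> mult_right_mono[of \<theta> 1 Rb] by auto
  obtain t0 where "b - \<tau> < t0 \<and> t0 < b - \<tau> / 2 \<and> (0 < t0 \<and> t0 < T \<longrightarrow> t0 \<in> \<Theta>)"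
    using AE_exists_between[OF \<Theta>_AE, of "b - \<tau>" "b - \<tau> / 2"] \<tau>0 by auto
  then have t0: "t0 \<in> \<Theta>" "b - \<tau> < t0" "t0 < b - \<tau> / 2" using a b \<tau>0 by auto
  let ?A = "{x \<in> ball xo ?r. \<mu> + w - w / 2 < V (x, t0)}" and ?B = "{x \<in> ball xo ?r. - \<mu> - w / 2 < - V (x, t0)}"
  have mV: "(\<lambda>z. - V z) \<in> borel_measurable borel2" by measurable
  have sA: "?A \<in> sets borel" by (rule slice_set_measurable[OF V_meas])
  have sB: "?B \<in> sets borel" by (rule slice_set_measurable[OF mV])
  have fB: "ball xo ?r \<in> fmeasurable lborel" using emeasure_ball_less_top[of xo ?r] by (simp add: fmeasurable_def)
  have fA: "?A \<in> fmeasurable lborel" and fB': "?B \<in> fmeasurable lborel"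
    using fB sA sB by (auto intro!: fmeasurableI2[OF fB] simp del: mem_ball)
  have "measure lborel ?A + measure lborel ?B = measure lborel (?A \<union> ?B)" using fA fB' by (intro measure_Un_AE[symmetric] AE_I2) auto
  also have "\<dots> \<le> measure lborel (ball xo ?r)" by (rule measure_mono_fmeasurable) (use fB sA sB in auto)
  also have "\<dots> = unit_ball_vol (real DIM('a)) * ?r powr real DIM('a)" by (rule measure_ball_powr[OF r(1)])
  finally have sum: "mS (\<mu> + w - w / 2) ?r t0 + slice_meas (\<lambda>z. - V z) xo (- \<mu> - w / 2) ?r t0 \<le> unit_ball_vol (real DIM('a)) * ?r powr real DIM('a)"
    by (simp add: slice_meas_def)
  have in_ball: "x \<in> ball xo Rb" if "x \<in> ball xo (?r / 2)" for x using that r by auto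
  have mono: "far \<sigma> xo Rb (\<lambda>y. f y powr (p - 1)) xo \<le> far \<sigma> xo Rb (\<lambda>y. \<bar>V (y, t) - \<mu>\<bar> powr (p - 1)) xo"
    if "\<And>y. 0 \<le> f y" "\<And>y. f y \<le> \<bar>V (y, t) - \<mu>\<bar>" for f t
    using that p by (intro nn_integral_mono mult_right_mono ennreal_leI mult_left_mono powr_mono2) auto
  consider "mS (\<mu> + w - w / 2) ?r t0 \<le> unit_ball_vol (real DIM('a)) * ?r powr real DIM('a) / 2"
    | "slice_meas (\<lambda>z. - V z) xo (- \<mu> - w / 2) ?r t0 \<le> unit_ball_vol (real DIM('a)) * ?r powr real DIM('a) / 2" using sum by linarith
  then show ?thesis
  proof cases
    case 1
    have "AE z in lborel2. ?Q z \<longrightarrow> V z \<le> \<mu> + w - h / 4 * w"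
    proof (rule half_oscillation_aux[OF h Rb w \<theta> b \<tau> a _ _ t0 1])
      show "AE t in lborel. b - \<tau> < t \<and> t < b \<longrightarrow> exc (\<mu> + w) t xo
       \<le> ennreal ((h * (w / 2) / 2) powr (p - 1) * ?r powr - \<sigma> / 2 powr (real DIM('a) + \<sigma>))" using tl
      proof eventually_elim
        case (elim t)
        have "V (y, t) - (\<mu> + w) \<le> \<bar>V (y, t) - \<mu>\<bar>" for y using w by linarith
        then have "exc (\<mu> + w) t xo \<le> far \<sigma> xo Rb (\<lambda>y. \<bar>V (y, t) - \<mu>\<bar> powr (p - 1)) xo"
          by (intro mono) auto
        then show ?case using elim by (blast intro: order_trans)
      qed
    qed (use bnd in auto)
    then have "AE z in lborel2. ?Q z \<longrightarrow> \<mu> \<le> V z \<and> V z \<le> \<mu> + (1 - h / 4) * w"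
    proof eventually_elim
      case (elim z)
      show ?case
      proof
        assume z: "?Q z"
        have "b - \<tau> < snd z" using z \<tau>0 by linarith
        then show "\<mu> \<le> V z \<and> V z \<le> \<mu> + (1 - h / 4) * w"
          using bnd[of "fst z" "snd z"] in_ball[of "fst z"] z elim by (simp add: left_diff_distrib)
      qed
    qed
    then show ?thesis using h0 w by (intro exI[of _ \<mu>]) auto
  next
    case 2
    interpret m: slice_solution s p Co C1 K "\<lambda>z. - V z" T xo Rb \<Theta> by (rule slice_solution_minus)
    have "AE z in lborel2. ?Q z \<longrightarrow> - V z \<le> - \<mu> - h / 4 * w"
    proof (rule m.half_oscillation_aux[OF h Rb w \<theta> b \<tau> a _ _ t0 2])
      show "AE t in lborel. b - \<tau> < t \<and> t < b \<longrightarrow> far \<sigma> xo Rb (\<lambda>y. max 0 (- V (y, t) - - \<mu>) powr (p - 1)) xo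
       \<le> ennreal ((h * (w / 2) / 2) powr (p - 1) * ?r powr - \<sigma> / 2 powr (real DIM('a) + \<sigma>))" using tl
      proof eventually_elim
        case (elim t)
        have "- V (y, t) - - \<mu> \<le> \<bar>V (y, t) - \<mu>\<bar>" for y by linarith
        then have "far \<sigma> xo Rb (\<lambda>y. max 0 (- V (y, t) - - \<mu>) powr (p - 1)) xo \<le> far \<sigma> xo Rb (\<lambda>y. \<bar>V (y, t) - \<mu>\<bar> powr (p - 1)) xo"
          by (intro mono) auto
        then show ?case using elim by (blast intro: order_trans)
      qed
    qed (use bnd in auto)
    then have "AE z in lborel2. ?Q z \<longrightarrow> \<mu> + h / 4 * w \<le> V z \<and> V z \<le> \<mu> + h / 4 * w + (1 - h / 4) * w"
    proof eventually_elim
      case (elim z)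
      show ?case
      proof
        assume z: "?Q z"
        have "b - \<tau> < snd z" using z \<tau>0 by linarith
        then show "\<mu> + h / 4 * w \<le> V z \<and> V z \<le> \<mu> + h / 4 * w + (1 - h / 4) * w"
          using bnd[of "fst z" "snd z"] in_ball[of "fst z"] z elim by (simp add: left_diff_distrib)
      qed
    qed
    then show ?thesis using h0 w by (intro exI[of _ "\<mu> + h / 4 * w"]) auto
  qed
qed

end

text \<open>Outside the r-ball the change of base value from \<mu> to \<mu>' costs the factor 2^q
  and a kernel tail of size w^q. In the annulus between \<rho> and r the values are confined, so it
  contributes w^q times the kernel tail at radius \<rho>.\<close>

lemma nn_integral_tail_shift:
  fixes xo :: "'a::euclidean_space" and f :: "'a \<Rightarrow> real"
  assumes [measurable]: "f \<in> borel_measurable borel" and q: "0 < q" and \<sigma>: "0 < \<sigma>" and \<rho>: "0 < \<rho>" "\<rho> \<le> r" and X: "0 \<le> X"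
    and tl: "far \<sigma> xo r (\<lambda>y. \<bar>f y - \<mu>\<bar> powr q) xo \<le> ennreal X"
    and \<mu>: "\<bar>\<mu>' - \<mu>\<bar> \<le> w" and bnd: "AE y in lborel. y \<in> ball xo r \<longrightarrow> \<bar>f y - \<mu>'\<bar> \<le> w"
  shows "far \<sigma> xo \<rho> (\<lambda>y. \<bar>f y - \<mu>'\<bar> powr q) xo
    \<le> ennreal (2 powr q * (X + tail_const TYPE('a) \<sigma> * w powr q * r powr - \<sigma>) + tail_const TYPE('a) \<sigma> * w powr q * \<rho> powr - \<sigma>)"
proof -
  let ?c = "tail_const TYPE('a) \<sigma>" and ?k = "fkernel \<sigma> xo"
  have c: "0 < ?c" using \<sigma> by (rule tail_const_nonneg)
  have r: "0 < r" using \<rho> by simp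
  have [measurable]: "ball xo r \<in> sets borel" "ball xo \<rho> \<in> sets borel" by auto
  define A where "A = (\<lambda>y. ennreal (?k y * \<bar>f y - \<mu>\<bar> powr q) * indicator (- ball xo r) y)"
  define B where "B = (\<lambda>R y. ennreal (?k y) * indicator (- ball xo R) y)"
  have [measurable]: "A \<in> borel_measurable borel" "B r \<in> borel_measurable borel" "B \<rho> \<in> borel_measurable borel"
    unfolding A_def B_def by measurable
  have iB: "(NINT y. B R y) \<le> ennreal (?c * R powr - \<sigma>)" if "0 < R" for R
    unfolding B_def by (rule nn_integral_kernel_far[OF that \<sigma>])
  have "(NINT y. ennreal (?k y * \<bar>f y - \<mu>'\<bar> powr q) * indicator (- ball xo \<rho>) y)
    \<le> (NINT y. ennreal (2 powr q) * A y + (ennreal (2 powr q * w powr q) * B r y + ennreal (w powr q) * B \<rho> y))"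
  proof (rule nn_integral_mono_AE)
    show "AE y in lborel. ennreal (?k y * \<bar>f y - \<mu>'\<bar> powr q) * indicator (- ball xo \<rho>) y \<le> ennreal (2 powr q) * A y + (ennreal (2 powr q * w powr q) * B r y + ennreal (w powr q) * B \<rho> y)"
      using bnd
    proof eventually_elim
      case (elim y)
      consider "y \<in> ball xo \<rho>" | "y \<notin> ball xo \<rho>" "y \<in> ball xo r" | "y \<notin> ball xo \<rho>" "y \<notin> ball xo r" by blast
      then show ?case
      proof cases
        case 2
        have "?k y * \<bar>f y - \<mu>'\<bar> powr q \<le> w powr q * ?k y"
          using elim 2 q by (subst mult.commute, intro mult_right_mono powr_mono2) auto
        then have "ennreal (?k y * \<bar>f y - \<mu>'\<bar> powr q) \<le> ennreal (w powr q) * ennreal (?k y)"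
          by (subst ennreal_mult[symmetric]) (auto intro: ennreal_leI)
        then show ?thesis using 2 by (simp add: A_def B_def)
      next
        case 3
        have "\<bar>f y - \<mu>'\<bar> powr q \<le> (\<bar>f y - \<mu>\<bar> + w) powr q" using \<mu> q by (intro powr_mono2) auto
        also have "\<dots> \<le> 2 powr q * (\<bar>f y - \<mu>\<bar> powr q + w powr q)" using \<mu> q by (intro powr_add_le) auto
        finally have "?k y * \<bar>f y - \<mu>'\<bar> powr q \<le> ?k y * (2 powr q * (\<bar>f y - \<mu>\<bar> powr q + w powr q))" by (rule mult_left_mono) simp
        also have "\<dots> = 2 powr q * (?k y * \<bar>f y - \<mu>\<bar> powr q) + 2 powr q * w powr q * ?k y" by (simp add: algebra_simps)
        finally have "ennreal (?k y * \<bar>f y - \<mu>'\<bar> powr q) \<le> ennreal (2 powr q) * ennreal (?k y * \<bar>f y - \<mu>\<bar> powr q) + ennreal (2 powr q * w powr q) * ennreal (?k y)"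
          by (subst (1 2) ennreal_mult[symmetric], simp_all, subst ennreal_plus[symmetric]) (auto intro: ennreal_leI simp del: ennreal_plus)
        then show ?thesis using 3 by (simp add: A_def B_def add_increasing2 add.assoc[symmetric])
      qed simp
    qed
  qed
  also have "\<dots> = ennreal (2 powr q) * (NINT y. A y) + (ennreal (2 powr q * w powr q) * (NINT y. B r y) + ennreal (w powr q) * (NINT y. B \<rho> y))"
    by (simp add: nn_integral_add nn_integral_cmult)
  also have "\<dots> \<le> ennreal (2 powr q) * ennreal X + (ennreal (2 powr q * w powr q) * ennreal (?c * r powr - \<sigma>) + ennreal (w powr q) * ennreal (?c * \<rho> powr - \<sigma>))"
    using tl iB[OF r] iB[OF \<rho>(1)] by (intro add_mono mult_left_mono) (auto simp: A_def)
  also have "\<dots> = ennreal (2 powr q * X + (2 powr q * w powr q * (?c * r powr - \<sigma>) + w powr q * (?c * \<rho> powr - \<sigma>)))"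
    using X c by (simp add: ennreal_mult[symmetric] ennreal_plus[symmetric] del: ennreal_plus)
  also have "2 powr q * X + (2 powr q * w powr q * (?c * r powr - \<sigma>) + w powr q * (?c * \<rho> powr - \<sigma>)) =
    2 powr q * (X + ?c * w powr q * r powr - \<sigma>) + ?c * w powr q * \<rho> powr - \<sigma>" by (simp add: algebra_simps)
  finally show ?thesis .
qed

text \<open>The inequalities after \<kappa> <= \<theta>/2 say in turn: the induction can start; the
  window fits into the current cylinder; the next cylinder fits into the last eighth of the window;
  the tail is small enough at scale \<theta> r for the reduction by h; the tail bound with constant
  \<Lambda> reproduces itself at radius \<kappa> r.\<close>

definition contraction_params :: "'a::euclidean_space itself \<Rightarrow> real \<Rightarrow> real \<Rightarrow> real \<Rightarrow> real \<Rightarrow> real \<Rightarrow> real \<Rightarrow> real \<Rightarrow> real \<Rightarrow> bool" where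
  "contraction_params _ s p Co C1 h \<theta> \<kappa> \<Lambda> \<longleftrightarrow> osc_factor TYPE('a) s p Co C1 h \<and> 0 < \<theta> \<and> 8 * \<theta> \<le> 1 \<and> 0 < \<kappa> \<and> \<kappa> \<le> \<theta> / 2 \<and>
     2 powr (p - 1) * (1 + tail_const TYPE('a) (s * p)) + tail_const TYPE('a) (s * p) \<le> \<Lambda> \<and>
     dwell_const TYPE('a) s p C1 * (1 / 2) powr (2 - p) * \<theta> powr (s * p) < 1 \<and>
     (1 - h / 4) powr (2 - p) * \<kappa> powr (s * p) \<le> dwell_const TYPE('a) s p C1 * (1 / 2) powr (2 - p) * \<theta> powr (s * p) / 8 \<and>
     2 powr (real DIM('a) + s * p) * \<Lambda> * \<theta> powr (s * p) \<le> (h / 4) powr (p - 1) \<and>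
     \<kappa> powr (s * p) * (2 powr (p - 1) * (\<Lambda> + tail_const TYPE('a) (s * p))) + tail_const TYPE('a) (s * p) \<le> \<Lambda> * (1 - h / 4) powr (p - 1)"

lemma exists_small_powr:
  fixes b c q :: real
  assumes "0 < b" "0 < c" "0 < q"
  shows "\<exists>x>0. x \<le> b \<and> x powr q \<le> c"
proof (intro exI conjI)
  let ?x = "min b (c powr (1 / q))"
  show "0 < ?x" "?x \<le> b" using assms by auto
  have "?x powr q \<le> (c powr (1 / q)) powr q" using assms by (intro powr_mono2) auto
  then show "?x powr q \<le> c" using assms by (simp add: powr_powr)
qed

text \<open>The order of choice is h, \<Lambda>, \<theta>, \<kappa>. In the last condition the
  annulus term does not become small with \<kappa>; the summand 2 c/q in \<Lambda> makes it at most
  half of \<Lambda> q. As \<Lambda> depends on h but not on \<theta>, \<theta> can still be made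
  small against it, and \<kappa> against all others.\<close>

lemma contraction_params_exist:
  assumes p: "1 < p" and s: "0 < s" "s < 1" and Co: "0 < Co" "Co \<le> C1"
  shows "\<exists>h \<theta> \<kappa> \<Lambda>. contraction_params TYPE('a::euclidean_space) s p Co C1 h \<theta> \<kappa> \<Lambda>"
proof -
  let ?c = "tail_const TYPE('a) (s * p)"
  have \<sigma>: "0 < s * p" using p s by simp
  have c: "0 < ?c" using \<sigma> by (rule tail_const_nonneg)
  obtain h where h: "osc_factor TYPE('a) s p Co C1 h" using osc_factor_exists[OF p s Co] by blast
  then have h01: "0 < h" "h < 1" by (auto simp: osc_factor_def)
  define q where "q = (1 - h / 4) powr (p - 1)"
  have q: "0 < q" using h01 by (simp add: q_def)
  define q2 where "q2 = (1 - h / 4) powr (2 - p)"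
  have q2: "0 < q2" using h01 by (simp add: q2_def)
  define \<delta> where "\<delta> = dwell_const TYPE('a) s p C1 * (1 / 2) powr (2 - p)"
  have "0 < slope_const TYPE('a) s p C1" using p s Co by (intro slope_const_pos) auto
  then have \<delta>: "0 < \<delta>" by (simp add: \<delta>_def dwell_const_def)
  define \<Lambda> where "\<Lambda> = 2 powr (p - 1) * (1 + ?c) + ?c + 2 * ?c / q"
  have \<Lambda>: "2 powr (p - 1) * (1 + ?c) + ?c \<le> \<Lambda>" using c q by (simp add: \<Lambda>_def)
  have "0 < 2 powr (p - 1) * (1 + ?c) + ?c" using c by (intro add_pos_pos mult_pos_pos) auto
  then have \<Lambda>0: "0 < \<Lambda>" using \<Lambda> by linarith
  have \<Lambda>q: "2 * ?c \<le> \<Lambda> * q"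
  proof -
    have "2 * ?c / q \<le> \<Lambda>" unfolding \<Lambda>_def using \<open>0 < 2 powr (p - 1) * (1 + ?c) + ?c\<close> by simp
    then show ?thesis using q by (simp add: pos_divide_le_eq)
  qed
  obtain \<theta> where \<theta>: "0 < \<theta>" "\<theta> \<le> 1 / 8" "\<theta> powr (s * p) \<le> min (1 / (2 * \<delta>)) ((h / 4) powr (p - 1) / (2 powr (real DIM('a) + s * p) * \<Lambda>))"
    using exists_small_powr[of "1 / 8" "min (1 / (2 * \<delta>)) ((h / 4) powr (p - 1) / (2 powr (real DIM('a) + s * p) * \<Lambda>))" "s * p"] \<sigma> \<delta> \<Lambda>0 h01 by auto
  have t1: "\<delta> * \<theta> powr (s * p) < 1"
  proof -
    have "\<theta> powr (s * p) \<le> 1 / (2 * \<delta>)" using \<theta>(3) by simp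
    then have "\<theta> powr (s * p) * (2 * \<delta>) \<le> 1" using \<delta> by (subst (asm) pos_le_divide_eq) auto
    then have "2 * (\<delta> * \<theta> powr (s * p)) \<le> 1" by (simp add: mult_ac)
    then show ?thesis by linarith
  qed
  have t2: "2 powr (real DIM('a) + s * p) * \<Lambda> * \<theta> powr (s * p) \<le> (h / 4) powr (p - 1)"
  proof -
    have "\<theta> powr (s * p) \<le> (h / 4) powr (p - 1) / (2 powr (real DIM('a) + s * p) * \<Lambda>)" using \<theta>(3) by simp
    then show ?thesis using \<Lambda>0 by (subst (asm) pos_le_divide_eq) (auto simp: mult.commute)
  qed
  define Y where "Y = min (\<delta> * \<theta> powr (s * p) / 8 / q2) (\<Lambda> * q / 2 / (2 powr (p - 1) * (\<Lambda> + ?c)))"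
  have "0 < Y" unfolding Y_def using \<delta> \<theta> q q2 \<Lambda>0 c by simp
  then obtain \<kappa> where \<kappa>: "0 < \<kappa>" "\<kappa> \<le> \<theta> / 2" "\<kappa> powr (s * p) \<le> Y"
    using exists_small_powr[of "\<theta> / 2" Y "s * p"] \<sigma> \<theta> by auto
  have k1: "q2 * \<kappa> powr (s * p) \<le> \<delta> * \<theta> powr (s * p) / 8"
  proof -
    have "\<kappa> powr (s * p) \<le> \<delta> * \<theta> powr (s * p) / 8 / q2" using \<kappa>(3) by (simp add: Y_def)
    then show ?thesis using q2 by (subst (asm) pos_le_divide_eq) (auto simp: mult.commute)
  qed
  have k2: "\<kappa> powr (s * p) * (2 powr (p - 1) * (\<Lambda> + ?c)) + ?c \<le> \<Lambda> * q"
  proof -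
    have "\<kappa> powr (s * p) \<le> \<Lambda> * q / 2 / (2 powr (p - 1) * (\<Lambda> + ?c))" using \<kappa>(3) by (simp add: Y_def)
    moreover have "0 < 2 powr (p - 1) * (\<Lambda> + ?c)" using \<Lambda>0 c by simp
    ultimately have "\<kappa> powr (s * p) * (2 powr (p - 1) * (\<Lambda> + ?c)) \<le> \<Lambda> * q / 2" by (subst (asm) pos_le_divide_eq) auto
    then show ?thesis using \<Lambda>q by linarith
  qed
  have "contraction_params TYPE('a) s p Co C1 h \<theta> \<kappa> \<Lambda>"
    unfolding contraction_params_def using h \<theta>(1,2) \<kappa>(1,2) \<Lambda> t1 t2 k1 k2 by (simp add: \<delta>_def q_def q2_def)
  then show ?thesis by blast
qed

section \<open>Induction over intrinsic cylinders\<close>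

context solution_representative begin

text \<open>The induction hypothesis. Besides confinement of V to an interval of length w it carries
  the tail of V - \<mu> at the scale natural for w and r; without it a far part could spoil the next
  reduction. The cylinder is allowed to start at time 0.\<close>

definition confined :: "'a \<Rightarrow> real \<Rightarrow> real \<Rightarrow> real \<Rightarrow> real \<Rightarrow> real \<Rightarrow> bool" where
  "confined xo to \<Lambda> r w \<mu> \<longleftrightarrow> 0 < r \<and> 0 < w \<and> cball xo r \<subseteq> E \<and> 0 \<le> to - w powr (2 - p) * r powr (s * p) \<and> to \<le> T \<and>
     (AE z in lborel2. fst z \<in> ball xo r \<and> to - w powr (2 - p) * r powr (s * p) < snd z \<and> snd z < to \<longrightarrow> \<mu> \<le> V z \<and> V z \<le> \<mu> + w) \<and>
     (AE t in lborel. to - w powr (2 - p) * r powr (s * p) < t \<and> t < to \<longrightarrow>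
        far (s * p) xo r (\<lambda>y. \<bar>V (y, t) - \<mu>\<bar> powr (p - 1)) xo
          \<le> ennreal (\<Lambda> * (w powr (p - 1) * r powr - (s * p))))"

lemma confined_step:
  assumes P: "contraction_params TYPE('a) s p Co C1 h \<theta> \<kappa> \<Lambda>" and S: "confined xo to \<Lambda> r w \<mu>"
  shows "\<exists>\<mu>'. confined xo to \<Lambda> (\<kappa> * r) ((1 - h / 4) * w) \<mu>'"
proof -
  let ?\<sigma> = "s * p" and ?c = "tail_const TYPE('a) (s * p)" and ?\<delta> = "dwell_const TYPE('a) s p C1"
  have h: "osc_factor TYPE('a) s p Co C1 h" and \<theta>: "0 < \<theta>" "8 * \<theta> \<le> 1" and \<kappa>: "0 < \<kappa>" "\<kappa> \<le> \<theta> / 2"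
    and P1: "2 powr (p - 1) * (1 + ?c) + ?c \<le> \<Lambda>"
    and P2: "?\<delta> * (1 / 2) powr (2 - p) * \<theta> powr ?\<sigma> < 1"
    and P3: "(1 - h / 4) powr (2 - p) * \<kappa> powr ?\<sigma> \<le> ?\<delta> * (1 / 2) powr (2 - p) * \<theta> powr ?\<sigma> / 8"
    and P4: "2 powr (real DIM('a) + ?\<sigma>) * \<Lambda> * \<theta> powr ?\<sigma> \<le> (h / 4) powr (p - 1)"
    and P5: "\<kappa> powr ?\<sigma> * (2 powr (p - 1) * (\<Lambda> + ?c)) + ?c \<le> \<Lambda> * (1 - h / 4) powr (p - 1)"
    using P unfolding contraction_params_def by blast+
  have h01: "0 < h" "h < 1" using h by (auto simp: osc_factor_def)
  have \<sigma>: "0 < ?\<sigma>" using p s by simp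
  have c: "0 < ?c" using \<sigma> by (rule tail_const_nonneg)
  have "0 < 2 powr (p - 1) * (1 + ?c) + ?c" using c by (intro add_pos_pos mult_pos_pos) auto
  then have \<Lambda>0: "0 < \<Lambda>" using P1 by linarith
  have r: "0 < r" and w: "0 < w" and E: "cball xo r \<subseteq> E" and a0: "0 \<le> to - w powr (2 - p) * r powr ?\<sigma>" and tT: "to \<le> T"
    and bnd: "AE z in lborel2. fst z \<in> ball xo r \<and> to - w powr (2 - p) * r powr ?\<sigma> < snd z \<and> snd z < to \<longrightarrow> \<mu> \<le> V z \<and> V z \<le> \<mu> + w"
    and tl: "AE t in lborel. to - w powr (2 - p) * r powr ?\<sigma> < t \<and> t < to \<longrightarrow>
        far ?\<sigma> xo r (\<lambda>y. \<bar>V (y, t) - \<mu>\<bar> powr (p - 1)) xo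
          \<le> ennreal (\<Lambda> * (w powr (p - 1) * r powr - ?\<sigma>))" using S unfolding confined_def by blast+
  define L where "L = w powr (2 - p) * r powr ?\<sigma>"
  have L: "0 < L" using w r by (simp add: L_def)
  define \<tau> where "\<tau> = ?\<delta> * (w / 2) powr (2 - p) * (\<theta> * r) powr ?\<sigma>"
  have \<tau>L: "\<tau> = ?\<delta> * (1 / 2) powr (2 - p) * \<theta> powr ?\<sigma> * L"
    using w r \<theta> powr_mult[of w "1/2" "2 - p"] by (simp add: \<tau>_def L_def powr_mult)
  have \<tau>: "\<tau> < L" unfolding \<tau>L using mult_strict_right_mono[OF P2 L] by simp
  define w' where "w' = (1 - h / 4) * w"
  have w': "0 < w'" using h01 w by (simp add: w'_def)
  have r': "0 < \<kappa> * r" "\<kappa> * r \<le> \<theta> * r / 2" "\<kappa> * r \<le> r"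
    using \<kappa> \<theta> r mult_right_mono[OF \<kappa>(2), of r] mult_right_mono[of \<kappa> 1 r] by auto
  \<comment> \<open>The third of the conditions explained at \<open>contraction_params\<close>: the
    next intrinsic cylinder is no longer than the last eighth of the window.\<close>
  have L': "w' powr (2 - p) * (\<kappa> * r) powr ?\<sigma> \<le> \<tau> / 8"
  proof -
    have "w' powr (2 - p) * (\<kappa> * r) powr ?\<sigma> = (1 - h / 4) powr (2 - p) * \<kappa> powr ?\<sigma> * L"
      using w r \<kappa> h01 by (simp add: w'_def L_def powr_mult)
    also have "\<dots> \<le> ?\<delta> * (1 / 2) powr (2 - p) * \<theta> powr ?\<sigma> / 8 * L" using P3 L by (intro mult_right_mono) auto
    finally show ?thesis by (simp add: \<tau>L)
  qed
  \<comment> \<open>Clipping makes the bounds hold at every point of the cylinder, as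
    \<open>osc_window\<close> demands. Only a null set is changed, so \<open>V'\<close> represents
    the same solution, with its own set of regular times.\<close>
  define V' where "V' = (\<lambda>(x, t). if x \<in> ball xo r \<and> to - L < t \<and> t < to then max \<mu> (min (\<mu> + w) (V (x, t))) else V (x, t))"
  have [measurable]: "ball xo r \<in> sets borel" by simp
  have V'm: "V' \<in> borel_measurable borel2" unfolding V'_def by measurable
  have VV': "AE z in lborel2. V z = V' z" using bnd by eventually_elim (auto simp: V'_def L_def split: prod.splits)
  have V'eq: "AE z in lborel2. snd z \<in> {0<..T} \<longrightarrow> u (fst z) (snd z) = V' z" using V_eq VV' by eventually_elim auto
  interpret c: solution_representative s p Co C1 T E K u K' V' using p s Co adm sol K'_meas V'm K'_eq V'eq by unfold_locales
  interpret d: slice_solution s p Co C1 K' V' T xo r "regular_times T u V'" by (rule c.slice_solution[OF E])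
  have \<tau>0: "0 < \<tau>" unfolding \<tau>_def using d.dwell_const_pos r w \<theta> by simp
  \<comment> \<open>At scale \<theta> r the admissible tail is larger by \<theta>^(-\<sigma>) than
    at scale r; the fourth condition of \<open>contraction_params\<close> says that this beats
    \<Lambda> and the recentring factor.\<close>
  have X: "\<Lambda> * (w powr (p - 1) * r powr - ?\<sigma>) \<le> (h * (w / 2) / 2) powr (p - 1) * (\<theta> * r) powr - ?\<sigma> / 2 powr (real DIM('a) + ?\<sigma>)"
  proof -
    have e1: "(h * (w / 2) / 2) powr (p - 1) = (h / 4) powr (p - 1) * w powr (p - 1)" using h01 w powr_mult[of "h / 4" w "p - 1"] by simp
    have e2: "(\<theta> * r) powr - ?\<sigma> = r powr - ?\<sigma> / \<theta> powr ?\<sigma>" using r \<theta> by (simp add: powr_mult powr_minus field_simps)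
    have "\<Lambda> \<le> (h / 4) powr (p - 1) / \<theta> powr ?\<sigma> / 2 powr (real DIM('a) + ?\<sigma>)"
      using P4 \<theta> by (simp add: pos_le_divide_eq mult_ac)
    then have "\<Lambda> * (w powr (p - 1) * r powr - ?\<sigma>) \<le> (h / 4) powr (p - 1) / \<theta> powr ?\<sigma> / 2 powr (real DIM('a) + ?\<sigma>) * (w powr (p - 1) * r powr - ?\<sigma>)"
      by (rule mult_right_mono) simp
    then show ?thesis unfolding e1 e2 by (simp add: mult_ac)
  qed
  have "\<exists>\<mu>'. \<mu> \<le> \<mu>' \<and> \<mu>' \<le> \<mu> + h / 4 * w \<and>
    (AE z in lborel2. fst z \<in> ball xo (\<theta> * r / 2) \<and> to - \<tau> / 8 < snd z \<and> snd z < to \<longrightarrow> \<mu>' \<le> V' z \<and> V' z \<le> \<mu>' + (1 - h / 4) * w)"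
  proof (rule d.half_oscillation[OF h r w \<theta> tT \<tau>_def])
    \<comment> \<open>The cylinder may begin at time 0, but the window is strictly shorter and so
      starts at a positive time.\<close>
    show "0 < to - \<tau>" using a0 \<tau> by (simp add: L_def)
    show "\<mu> \<le> V' (x, t) \<and> V' (x, t) \<le> \<mu> + w" if "x \<in> ball xo r" "to - \<tau> < t" "t < to" for x t
      using that \<tau> w by (auto simp: V'_def)
    show "AE t in lborel. to - \<tau> < t \<and> t < to \<longrightarrow> far ?\<sigma> xo r (\<lambda>y. \<bar>V' (y, t) - \<mu>\<bar> powr (p - 1)) xo
       \<le> ennreal ((h * (w / 2) / 2) powr (p - 1) * (\<theta> * r) powr - ?\<sigma> / 2 powr (real DIM('a) + ?\<sigma>))" using tl
    proof eventually_elim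
      case (elim t)
      have eq: "far ?\<sigma> xo r (\<lambda>y. \<bar>V' (y, t) - \<mu>\<bar> powr (p - 1)) xo =
         far ?\<sigma> xo r (\<lambda>y. \<bar>V (y, t) - \<mu>\<bar> powr (p - 1)) xo"
        by (intro nn_integral_cong) (auto simp: V'_def indicator_def)
      show ?case unfolding eq
      proof
        assume t: "to - \<tau> < t \<and> t < to"
        then have "far ?\<sigma> xo r (\<lambda>y. \<bar>V (y, t) - \<mu>\<bar> powr (p - 1)) xo
          \<le> ennreal (\<Lambda> * (w powr (p - 1) * r powr - ?\<sigma>))" using elim \<tau> by (simp add: L_def)
        also have "\<dots> \<le> ennreal ((h * (w / 2) / 2) powr (p - 1) * (\<theta> * r) powr - ?\<sigma> / 2 powr (real DIM('a) + ?\<sigma>))"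
          using X by (rule ennreal_leI)
        finally show "far ?\<sigma> xo r (\<lambda>y. \<bar>V (y, t) - \<mu>\<bar> powr (p - 1)) xo
          \<le> ennreal ((h * (w / 2) / 2) powr (p - 1) * (\<theta> * r) powr - ?\<sigma> / 2 powr (real DIM('a) + ?\<sigma>))" .
      qed
    qed
  qed
  then obtain \<mu>' where \<mu>': "\<mu> \<le> \<mu>'" "\<mu>' \<le> \<mu> + h / 4 * w"
    and new: "AE z in lborel2. fst z \<in> ball xo (\<theta> * r / 2) \<and> to - \<tau> / 8 < snd z \<and> snd z < to \<longrightarrow> \<mu>' \<le> V' z \<and> V' z \<le> \<mu>' + (1 - h / 4) * w"
    by blast
  have hw: "h / 4 * w \<le> w" using h01 w mult_right_mono[of "h / 4" 1 w] by simp
  have "confined xo to \<Lambda> (\<kappa> * r) w' \<mu>'" unfolding confined_def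
  proof (intro conjI)
    show "cball xo (\<kappa> * r) \<subseteq> E" using E r'(3) by (auto simp: subset_iff)
    show "0 \<le> to - w' powr (2 - p) * (\<kappa> * r) powr ?\<sigma>" using a0 L' \<tau> \<tau>0 by (simp add: L_def)
    show "AE z in lborel2. fst z \<in> ball xo (\<kappa> * r) \<and> to - w' powr (2 - p) * (\<kappa> * r) powr ?\<sigma> < snd z \<and> snd z < to \<longrightarrow> \<mu>' \<le> V z \<and> V z \<le> \<mu>' + w'"
      using new VV'
    proof eventually_elim
      case (elim z)
      show ?case using elim r'(2) L' by (auto simp: w'_def)
    qed
    show "AE t in lborel. to - w' powr (2 - p) * (\<kappa> * r) powr ?\<sigma> < t \<and> t < to \<longrightarrow>
        far ?\<sigma> xo (\<kappa> * r) (\<lambda>y. \<bar>V (y, t) - \<mu>'\<bar> powr (p - 1)) xo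
          \<le> ennreal (\<Lambda> * (w' powr (p - 1) * (\<kappa> * r) powr - ?\<sigma>))" using tl AE_pair_swap_slices[OF bnd]
    proof eventually_elim
      case (elim t)
      show ?case
      proof
        assume t: "to - w' powr (2 - p) * (\<kappa> * r) powr ?\<sigma> < t \<and> t < to"
        have tL: "to - w powr (2 - p) * r powr ?\<sigma> < t" using t L' \<tau> \<tau>0 by (simp add: L_def)
        have "far ?\<sigma> xo (\<kappa> * r) (\<lambda>y. \<bar>V (y, t) - \<mu>'\<bar> powr (p - 1)) xo
          \<le> ennreal (2 powr (p - 1) * (\<Lambda> * (w powr (p - 1) * r powr - ?\<sigma>) + ?c * w powr (p - 1) * r powr - ?\<sigma>) + ?c * w powr (p - 1) * (\<kappa> * r) powr - ?\<sigma>)"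
        proof (rule nn_integral_tail_shift)
          show "far ?\<sigma> xo r (\<lambda>y. \<bar>V (y, t) - \<mu>\<bar> powr (p - 1)) xo \<le> ennreal (\<Lambda> * (w powr (p - 1) * r powr - ?\<sigma>))"
            using elim(1) tL t by blast
          show "AE y in lborel. y \<in> ball xo r \<longrightarrow> \<bar>V (y, t) - \<mu>'\<bar> \<le> w" using elim(2)
          proof eventually_elim
            case (elim y)
            show ?case
            proof
              assume "y \<in> ball xo r"
              then have "\<mu> \<le> V (y, t) \<and> V (y, t) \<le> \<mu> + w" using elim tL t by simp
              then show "\<bar>V (y, t) - \<mu>'\<bar> \<le> w" using \<mu>' hw by linarith
            qed
          qed
        qed (use \<sigma> p r' \<Lambda>0 \<mu>' hw in auto)
        also have "\<dots> \<le> ennreal (\<Lambda> * (w' powr (p - 1) * (\<kappa> * r) powr - ?\<sigma>))"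
        proof (rule ennreal_leI)
          have e: "r powr - ?\<sigma> = \<kappa> powr ?\<sigma> * (\<kappa> * r) powr - ?\<sigma>"
            using r \<kappa> by (simp add: powr_mult powr_minus field_simps)
          have "2 powr (p - 1) * (\<Lambda> * (w powr (p - 1) * r powr - ?\<sigma>) + ?c * w powr (p - 1) * r powr - ?\<sigma>) + ?c * w powr (p - 1) * (\<kappa> * r) powr - ?\<sigma>
             = (\<kappa> powr ?\<sigma> * (2 powr (p - 1) * (\<Lambda> + ?c)) + ?c) * (w powr (p - 1) * (\<kappa> * r) powr - ?\<sigma>)"
            unfolding e by (simp add: algebra_simps)
          also have "\<dots> \<le> \<Lambda> * (1 - h / 4) powr (p - 1) * (w powr (p - 1) * (\<kappa> * r) powr - ?\<sigma>)"
            using P5 by (rule mult_right_mono) simp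
          also have "\<dots> = \<Lambda> * (w' powr (p - 1) * (\<kappa> * r) powr - ?\<sigma>)" using h01 w by (simp add: w'_def powr_mult)
          finally show "2 powr (p - 1) * (\<Lambda> * (w powr (p - 1) * r powr - ?\<sigma>) + ?c * w powr (p - 1) * r powr - ?\<sigma>) + ?c * w powr (p - 1) * (\<kappa> * r) powr - ?\<sigma> \<le> \<Lambda> * (w' powr (p - 1) * (\<kappa> * r) powr - ?\<sigma>)" .
        qed
        finally show "far ?\<sigma> xo (\<kappa> * r) (\<lambda>y. \<bar>V (y, t) - \<mu>'\<bar> powr (p - 1)) xo \<le> ennreal (\<Lambda> * (w' powr (p - 1) * (\<kappa> * r) powr - ?\<sigma>))" .
      qed
    qed
  qed (use r' w' tT in auto)
  then show ?thesis unfolding w'_def by blast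
qed

lemma confined_iterate:
  assumes P: "contraction_params TYPE('a) s p Co C1 h \<theta> \<kappa> \<Lambda>" and S: "confined xo to \<Lambda> r w \<mu>"
  shows "\<exists>\<mu>'. confined xo to \<Lambda> (\<kappa> ^ n * r) ((1 - h / 4) ^ n * w) \<mu>'"
proof (induction n)
  case 0 show ?case using S by auto
next
  case (Suc n)
  then obtain \<mu>' where "confined xo to \<Lambda> (\<kappa> ^ n * r) ((1 - h / 4) ^ n * w) \<mu>'" by blast
  from confined_step[OF P this] show ?case by (simp add: mult.assoc)
qed

text \<open>The number \<omega> bounds twice the supremum and the tail at radius Rt, so the interval
  is centred at 0. Passing from Rt to R is one tail shift with old base value 0, and the first
  condition on \<Lambda> is made for it.\<close>

lemma confined_initial:
  assumes P: "contraction_params TYPE('a) s p Co C1 h \<theta> \<kappa> \<Lambda>" and R: "0 < R" "R < Rt" and \<omega>: "0 < \<omega>"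
    and E: "ball xo Rt \<subseteq> E" and to: "Rt powr (s * p) \<le> to" "to \<le> T" and wide: "\<omega> powr (2 - p) * R powr (s * p) \<le> Rt powr (s * p)"
    and bnd: "AE z in lborel2. fst z \<in> ball xo Rt \<and> to - Rt powr (s * p) < snd z \<and> snd z < to \<longrightarrow> \<bar>V z\<bar> \<le> \<omega> / 2"
    and tl: "AE t in lborel. to - Rt powr (s * p) < t \<and> t < to \<longrightarrow>
        far (s * p) xo Rt (\<lambda>y. \<bar>V (y, t)\<bar> powr (p - 1)) xo \<le> ennreal (\<omega> powr (p - 1) * Rt powr - (s * p))"
  shows "confined xo to \<Lambda> R \<omega> (- \<omega> / 2)" unfolding confined_def
proof (intro conjI)
  let ?\<sigma> = "s * p" and ?c = "tail_const TYPE('a) (s * p)"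
  have P1: "2 powr (p - 1) * (1 + ?c) + ?c \<le> \<Lambda>" using P unfolding contraction_params_def by blast
  have \<sigma>: "0 < ?\<sigma>" using p s by simp
  have c: "0 < ?c" using \<sigma> by (rule tail_const_nonneg)
  show "cball xo R \<subseteq> E" using E R by (auto simp: subset_iff)
  show "0 \<le> to - \<omega> powr (2 - p) * R powr ?\<sigma>" using to wide by linarith
  show "AE z in lborel2. fst z \<in> ball xo R \<and> to - \<omega> powr (2 - p) * R powr ?\<sigma> < snd z \<and> snd z < to \<longrightarrow> - \<omega> / 2 \<le> V z \<and> V z \<le> - \<omega> / 2 + \<omega>"
    using bnd
  proof eventually_elim
    case (elim z)
    show ?case
    proof
      assume "fst z \<in> ball xo R \<and> to - \<omega> powr (2 - p) * R powr ?\<sigma> < snd z \<and> snd z < to"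
      then have "\<bar>V z\<bar> \<le> \<omega> / 2" using elim R wide by auto
      then show "- \<omega> / 2 \<le> V z \<and> V z \<le> - \<omega> / 2 + \<omega>" by linarith
    qed
  qed
  show "AE t in lborel. to - \<omega> powr (2 - p) * R powr ?\<sigma> < t \<and> t < to \<longrightarrow>
        far ?\<sigma> xo R (\<lambda>y. \<bar>V (y, t) - - \<omega> / 2\<bar> powr (p - 1)) xo
          \<le> ennreal (\<Lambda> * (\<omega> powr (p - 1) * R powr - ?\<sigma>))" using tl AE_pair_swap_slices[OF bnd]
  proof eventually_elim
    case (elim t)
    show ?case
    proof
      assume "to - \<omega> powr (2 - p) * R powr ?\<sigma> < t \<and> t < to"
      then have t: "to - Rt powr ?\<sigma> < t" "t < to" using wide by auto
      have "far ?\<sigma> xo R (\<lambda>y. \<bar>V (y, t) - - \<omega> / 2\<bar> powr (p - 1)) xo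
        \<le> ennreal (2 powr (p - 1) * (\<omega> powr (p - 1) * Rt powr - ?\<sigma> + ?c * \<omega> powr (p - 1) * Rt powr - ?\<sigma>) + ?c * \<omega> powr (p - 1) * R powr - ?\<sigma>)"
      proof (rule nn_integral_tail_shift[where \<mu> = 0])
        show "far ?\<sigma> xo Rt (\<lambda>y. \<bar>V (y, t) - 0\<bar> powr (p - 1)) xo \<le> ennreal (\<omega> powr (p - 1) * Rt powr - ?\<sigma>)"
          using elim(1) t by simp
        show "AE y in lborel. y \<in> ball xo Rt \<longrightarrow> \<bar>V (y, t) - - \<omega> / 2\<bar> \<le> \<omega>" using elim(2)
        proof eventually_elim
          case (elim y)
          show ?case
          proof
            assume "y \<in> ball xo Rt"
            then have "\<bar>V (y, t)\<bar> \<le> \<omega> / 2" using elim t by simp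
            then show "\<bar>V (y, t) - - \<omega> / 2\<bar> \<le> \<omega>" by linarith
          qed
        qed
      qed (use \<sigma> p R \<omega> in auto)
      also have "\<dots> \<le> ennreal (\<Lambda> * (\<omega> powr (p - 1) * R powr - ?\<sigma>))"
      proof (rule ennreal_leI)
        have "Rt powr - ?\<sigma> \<le> R powr - ?\<sigma>" using R \<sigma> by (intro powr_mono2') auto
        then have "2 powr (p - 1) * (1 + ?c) * \<omega> powr (p - 1) * Rt powr - ?\<sigma> \<le> 2 powr (p - 1) * (1 + ?c) * \<omega> powr (p - 1) * R powr - ?\<sigma>"
          using c by (intro mult_left_mono) auto
        moreover have "(2 powr (p - 1) * (1 + ?c) + ?c) * (\<omega> powr (p - 1) * R powr - ?\<sigma>) \<le> \<Lambda> * (\<omega> powr (p - 1) * R powr - ?\<sigma>)"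
          using P1 by (rule mult_right_mono) simp
        ultimately show "2 powr (p - 1) * (\<omega> powr (p - 1) * Rt powr - ?\<sigma> + ?c * \<omega> powr (p - 1) * Rt powr - ?\<sigma>) + ?c * \<omega> powr (p - 1) * R powr - ?\<sigma> \<le> \<Lambda> * (\<omega> powr (p - 1) * R powr - ?\<sigma>)"
          by (simp add: algebra_simps)
      qed
      finally show "far ?\<sigma> xo R (\<lambda>y. \<bar>V (y, t) - - \<omega> / 2\<bar> powr (p - 1)) xo \<le> ennreal (\<Lambda> * (\<omega> powr (p - 1) * R powr - ?\<sigma>))" .
    qed
  qed
qed (use R \<omega> to in auto)

end

lemma geometric_rate:
  fixes k e x :: real
  assumes k: "0 < k" "k < 1" and e: "0 < e" "e < 1" and x: "0 < x" "x < 1"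
  shows "\<exists>n. x \<le> k ^ n \<and> e ^ n \<le> 1 / k * x powr min (1 / 2) (ln e / ln k)"
proof -
  \<comment> \<open>The quotient of logarithms is the exponent with k^\<beta> = e; lowering it to
    1/2 keeps the final exponent below 1.\<close>
  define \<beta> where "\<beta> = min (1 / 2) (ln e / ln k)"
  have lnk: "ln k < 0" "ln e < 0" using k e by auto
  then have "0 < ln e / ln k" by (simp add: divide_neg_neg)
  then have \<beta>: "0 < \<beta>" "\<beta> \<le> 1" "\<beta> \<le> ln e / ln k" unfolding \<beta>_def by auto
  have "ln e \<le> \<beta> * ln k" using \<beta>(3) lnk by (simp add: neg_le_divide_eq)
  then have "exp (ln e) \<le> exp (\<beta> * ln k)" by simp
  then have ek: "e \<le> k powr \<beta>" using e k by (simp add: powr_def)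
  have "\<exists>n. k ^ n < x" using real_arch_pow_inv[OF x(1) k(2)] .
  \<comment> \<open>The last n with x <= k^n. The next power is already below x, and this overshoot
    of one step costs the factor 1/k.\<close>
  define n where "n = (LEAST n. k ^ Suc n < x)"
  have "\<exists>n. k ^ Suc n < x"
  proof -
    obtain n where "k ^ n < x" using \<open>\<exists>n. k ^ n < x\<close> by blast
    moreover have "k ^ Suc n \<le> k ^ n" using k by (simp add: mult_left_le_one_le)
    ultimately show ?thesis by (intro exI[of _ n]) linarith
  qed
  then have n1: "k ^ Suc n < x" unfolding n_def by (rule LeastI_ex)
  have n2: "x \<le> k ^ n"
  proof (cases n)
    case (Suc m)
    then have "\<not> k ^ Suc m < x" using not_less_Least[of m "\<lambda>n. k ^ Suc n < x"] unfolding n_def by simp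
    then show ?thesis using Suc by simp
  qed (use x in simp)
  have "e ^ n \<le> (k powr \<beta>) ^ n" using ek e by (intro power_mono) auto
  also have "(k powr \<beta>) ^ n = (k ^ Suc n) powr \<beta> * k powr - \<beta>"
    using k by (simp add: powr_mult powr_power[symmetric] powr_minus field_simps) (simp add: powr_powr mult.commute powr_realpow[symmetric])
  also have "\<dots> \<le> x powr \<beta> * k powr - 1" using n1 k \<beta> by (intro mult_mono powr_mono2 powr_mono') auto
  finally have "e ^ n \<le> 1 / k * x powr \<beta>" using k by (simp add: powr_minus field_simps)
  then show ?thesis using n2 unfolding \<beta>_def by blast
qed

text \<open>The target cylinders keep the shape factor \<omega>^(2-p), whereas the n-th cylinder of
  the induction has ((1 - h/4)^n \<omega>)^(2-p). For p < 2 the latter is shorter; the second factor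
  shrinks the radius just enough to compensate.\<close>

definition decay_rate :: "real \<Rightarrow> real \<Rightarrow> real \<Rightarrow> real \<Rightarrow> real" where
  "decay_rate s p h \<kappa> = \<kappa> * (1 - h / 4) powr (\<bar>2 - p\<bar> / (s * p))"

lemma decay_rate_bounds:
  assumes "0 < \<kappa>" "\<kappa> < 1" "0 < h" "h < 1" "0 < s" "1 < p"
  shows "0 < decay_rate s p h \<kappa>" "decay_rate s p h \<kappa> \<le> \<kappa>"
proof -
  have "(1 - h / 4) powr (\<bar>2 - p\<bar> / (s * p)) \<le> 1" using assms by (intro powr_le1) auto
  then show "decay_rate s p h \<kappa> \<le> \<kappa>" unfolding decay_rate_def using assms mult_left_mono[of _ 1 \<kappa>] by simp
qed (use assms in \<open>simp add: decay_rate_def\<close>)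

lemma (in solution_representative) confined_decay:
  assumes P: "contraction_params TYPE('a) s p Co C1 h \<theta> \<kappa> \<Lambda>" and S: "confined xo to \<Lambda> R \<omega> \<mu>" and \<rho>: "0 < \<rho>" "\<rho> < R"
  shows "\<exists>\<mu>. AE z in lborel2. fst z \<in> ball xo \<rho> \<and> to - \<omega> powr (2 - p) * \<rho> powr (s * p) < snd z \<and> snd z < to \<longrightarrow>
     \<mu> \<le> V z \<and> V z \<le> \<mu> + 1 / decay_rate s p h \<kappa> * \<omega> * (\<rho> / R) powr min (1 / 2) (ln (1 - h / 4) / ln (decay_rate s p h \<kappa>))"
proof -
  let ?\<sigma> = "s * p" and ?e = "1 - h / 4"
  define k where "k = decay_rate s p h \<kappa>"
  have h: "0 < h" "h < 1" using P by (auto simp: contraction_params_def osc_factor_def)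
  have \<kappa>: "0 < \<kappa>" "\<kappa> < 1" using P by (auto simp: contraction_params_def)
  have \<sigma>: "0 < ?\<sigma>" using p s by simp
  have k: "0 < k" "k \<le> \<kappa>" unfolding k_def using decay_rate_bounds[OF \<kappa> h s(1) p] by auto
  have R: "0 < R" and \<omega>: "0 < \<omega>" using S by (auto simp: confined_def)
  obtain n where n: "\<rho> / R \<le> k ^ n" "?e ^ n \<le> 1 / k * (\<rho> / R) powr min (1 / 2) (ln ?e / ln k)"
    using geometric_rate[of k ?e "\<rho> / R"] k \<kappa> h \<rho> R by auto
  obtain \<mu>' where "confined xo to \<Lambda> (\<kappa> ^ n * R) (?e ^ n * \<omega>) \<mu>'" using confined_iterate[OF P S] by blast
  then have b: "AE z in lborel2. fst z \<in> ball xo (\<kappa> ^ n * R) \<and> to - (?e ^ n * \<omega>) powr (2 - p) * (\<kappa> ^ n * R) powr ?\<sigma> < snd z \<and> snd z < to \<longrightarrow>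
     \<mu>' \<le> V z \<and> V z \<le> \<mu>' + ?e ^ n * \<omega>" unfolding confined_def by blast
  have \<rho>k: "\<rho> \<le> k ^ n * R" using n(1) R by (simp add: pos_divide_le_eq)
  also have "\<dots> \<le> \<kappa> ^ n * R" using k R by (intro mult_right_mono power_mono) auto
  finally have 1: "\<rho> \<le> \<kappa> ^ n * R" .
  have "\<rho> powr ?\<sigma> \<le> (k ^ n * R) powr ?\<sigma>" using \<rho>k \<rho> \<sigma> by (intro powr_mono2) auto
  also have "\<dots> = ((?e powr (\<bar>2 - p\<bar> / ?\<sigma>)) ^ n) powr ?\<sigma> * (\<kappa> ^ n * R) powr ?\<sigma>"
    using k \<kappa> R h by (simp add: k_def decay_rate_def power_mult_distrib powr_mult mult_ac)
  also have "((?e powr (\<bar>2 - p\<bar> / ?\<sigma>)) ^ n) powr ?\<sigma> = (?e ^ n) powr \<bar>2 - p\<bar>"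
  proof -
    have pos: "0 < ?e" using h by simp
    have "((?e powr (\<bar>2 - p\<bar> / ?\<sigma>)) ^ n) powr ?\<sigma> = ((?e powr (\<bar>2 - p\<bar> / ?\<sigma>)) powr real n) powr ?\<sigma>"
      using pos by (simp add: powr_realpow)
    also have "\<dots> = ?e powr (real n * \<bar>2 - p\<bar>)" 
    proof -
      have "\<bar>2 - p\<bar> / ?\<sigma> * real n * ?\<sigma> = real n * \<bar>2 - p\<bar>" using p s by simp
      then show ?thesis unfolding powr_powr by (rule arg_cong)
    qed
    also have "\<dots> = (?e powr real n) powr \<bar>2 - p\<bar>" unfolding powr_powr ..
    also have "?e powr real n = ?e ^ n" using pos by (rule powr_realpow)
    finally show ?thesis .
  qed
  \<comment> \<open>Equality for p <= 2. For p > 2 the base is at most 1 and the exponent on the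
    right is the smaller one.\<close>
  also have "\<dots> * (\<kappa> ^ n * R) powr ?\<sigma> \<le> (?e ^ n) powr (2 - p) * (\<kappa> ^ n * R) powr ?\<sigma>"
    using h by (intro mult_right_mono powr_mono') (auto simp: power_le_one)
  finally have "\<omega> powr (2 - p) * \<rho> powr ?\<sigma> \<le> \<omega> powr (2 - p) * ((?e ^ n) powr (2 - p) * (\<kappa> ^ n * R) powr ?\<sigma>)"
    by (rule mult_left_mono) simp
  also have "\<dots> = (?e ^ n * \<omega>) powr (2 - p) * (\<kappa> ^ n * R) powr ?\<sigma>" using h \<omega> by (simp add: powr_mult)
  finally have 2: "\<omega> powr (2 - p) * \<rho> powr ?\<sigma> \<le> (?e ^ n * \<omega>) powr (2 - p) * (\<kappa> ^ n * R) powr ?\<sigma>" .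
  have 3: "?e ^ n * \<omega> \<le> 1 / k * \<omega> * (\<rho> / R) powr min (1 / 2) (ln ?e / ln k)"
    using mult_right_mono[OF n(2), of \<omega>] \<omega> by (simp add: mult_ac)
  show ?thesis unfolding k_def[symmetric]
  proof (intro exI[of _ \<mu>'])
    show "AE z in lborel2. fst z \<in> ball xo \<rho> \<and> to - \<omega> powr (2 - p) * \<rho> powr ?\<sigma> < snd z \<and> snd z < to \<longrightarrow>
      \<mu>' \<le> V z \<and> V z \<le> \<mu>' + 1 / k * \<omega> * (\<rho> / R) powr min (1 / 2) (ln ?e / ln k)" using b
    proof eventually_elim
      case (elim z)
      show ?case using elim 1 2 3 by auto
    qed
  qed
qed

lemma solution_representative_exists:
  assumes "1 < p" "0 < s" "s < 1" "0 < Co" "Co \<le> C1" and adm: "admissible_kernel s p Co C1 T K" and sol: "weak_solution s p E T K u"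
  shows "\<exists>K' V. solution_representative s p Co C1 T E K u K' V"
proof -
  have "set_borel_measurable lebesgue (UNIV \<times> UNIV \<times> {0<..T}) (\<lambda>z. K (fst z) (fst (snd z)) (snd (snd z)))"
    using adm by (simp add: admissible_kernel_def)
  then have "(\<lambda>z. indicat_real (UNIV \<times> UNIV \<times> {0<..T}) z *\<^sub>R K (fst z) (fst (snd z)) (snd (snd z))) \<in> borel_measurable lebesgue"
    unfolding set_borel_measurable_def .
  from completion_ex_borel_measurable_real[OF this] obtain K' where K': "K' \<in> borel_measurable lborel"
    "AE z in lborel. indicat_real (UNIV \<times> UNIV \<times> {0<..T}) z *\<^sub>R K (fst z) (fst (snd z)) (snd (snd z)) = K' z" by blast
  have "set_borel_measurable lebesgue (UNIV \<times> {0<..T}) (\<lambda>z. u (fst z) (snd z))"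
    using sol by (simp add: weak_solution_def weak_subsolution_def weak_regular_def)
  then have "(\<lambda>z. indicat_real (UNIV \<times> {0<..T}) z *\<^sub>R u (fst z) (snd z)) \<in> borel_measurable lebesgue"
    unfolding set_borel_measurable_def .
  from completion_ex_borel_measurable_real[OF this] obtain V where V: "V \<in> borel_measurable lborel"
    "AE z in lborel. indicat_real (UNIV \<times> {0<..T}) z *\<^sub>R u (fst z) (snd z) = V z" by blast
  have "solution_representative s p Co C1 T E K u K' V"
  proof
    show "K' \<in> borel_measurable borel3" using K'(1) by (simp add: borel_prod)
    show "V \<in> borel_measurable borel2" using V(1) by (simp add: borel_prod)
    show "AE z in lborel3. snd (snd z) \<in> {0<..T} \<longrightarrow> K (fst z) (fst (snd z)) (snd (snd z)) = K' z"
      using K'(2) unfolding lborel_prod by eventually_elim (auto simp: indicator_def split: if_splits)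
    show "AE z in lborel2. snd z \<in> {0<..T} \<longrightarrow> u (fst z) (snd z) = V z"
      using V(2) unfolding lborel_prod by eventually_elim (auto simp: indicator_def split: if_splits)
  qed (use assms in auto)
  then show ?thesis by blast
qed

text \<open>Here \<omega> is any positive number satisfying the two bounds, not the exact sum of
  supremum and tail. This allows one value to be used for all points of a compact set in the Hoelder
  estimate.\<close>

definition interior_decay :: "'a::euclidean_space itself \<Rightarrow> real \<Rightarrow> real \<Rightarrow> real \<Rightarrow> real \<Rightarrow> real \<Rightarrow> real \<Rightarrow> bool" where
  "interior_decay _ s p Co C1 \<gamma> \<beta> \<longleftrightarrow>
    (\<forall>(E :: 'a set) T K u xo to \<rho> R Rt \<omega>.
       admissible_kernel s p Co C1 T K \<longrightarrow> weak_solution s p E T K u \<longrightarrow>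
       0 < \<rho> \<longrightarrow> \<rho> < R \<longrightarrow> R < Rt \<longrightarrow> 0 < \<omega> \<longrightarrow> ball xo Rt \<subseteq> E \<longrightarrow> Rt powr (s * p) \<le> to \<longrightarrow> to \<le> T \<longrightarrow>
       \<omega> powr (2 - p) * R powr (s * p) \<le> Rt powr (s * p) \<longrightarrow>
       (AE z in lebesgue. z \<in> cyl s p xo to Rt 1 \<longrightarrow> \<bar>u (fst z) (snd z)\<bar> \<le> \<omega> / 2) \<longrightarrow>
       (AE t in lebesgue. t \<in> {to - Rt powr (s * p)<..<to} \<longrightarrow>
          outer_tail s p u xo Rt t
            \<le> ennreal (\<omega> powr (p - 1) * Rt powr - (s * p))) \<longrightarrow>
       (\<exists>\<mu>. AE z in lebesgue. z \<in> cyl s p xo to \<rho> (\<omega> powr (2 - p)) \<longrightarrow>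
          \<mu> \<le> u (fst z) (snd z) \<and> u (fst z) (snd z) \<le> \<mu> + \<gamma> * \<omega> * (\<rho> / R) powr \<beta>))"

lemma interior_oscillation:
  assumes p: "1 < p" and s: "0 < s" "s < 1" and Co: "0 < Co" "Co \<le> C1"
  shows "\<exists>\<gamma> \<beta>. 1 < \<gamma> \<and> 0 < \<beta> \<and> \<beta> < 1 \<and>
    interior_decay TYPE('a::euclidean_space) s p Co C1 \<gamma> \<beta>"
proof -
  obtain h \<theta> \<kappa> \<Lambda> where P: "contraction_params TYPE('a) s p Co C1 h \<theta> \<kappa> \<Lambda>" using contraction_params_exist[OF p s Co] by blast
  have h: "0 < h" "h < 1" using P by (auto simp: contraction_params_def osc_factor_def)
  have \<kappa>: "0 < \<kappa>" "\<kappa> < 1" using P by (auto simp: contraction_params_def)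
  define k where "k = decay_rate s p h \<kappa>"
  have k: "0 < k" "k \<le> \<kappa>" unfolding k_def using decay_rate_bounds[OF \<kappa> h s(1) p] by auto
  define \<beta> where "\<beta> = min (1 / 2) (ln (1 - h / 4) / ln k)"
  have "ln (1 - h / 4) < 0" "ln k < 0" using h k \<kappa> by auto
  then have "0 < ln (1 - h / 4) / ln k" by (rule divide_neg_neg)
  moreover have "\<beta> \<le> 1 / 2" unfolding \<beta>_def by (rule min.cobounded1)
  ultimately have \<beta>: "0 < \<beta>" "\<beta> < 1" by (auto simp: \<beta>_def)
  have \<gamma>: "1 < 1 / k" using k \<kappa> by simp
  show ?thesis
  proof (rule exI[of _ "1 / k"], rule exI[of _ \<beta>], unfold interior_decay_def, intro conjI allI impI \<beta> \<gamma>)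
    fix E :: "'a set" and T :: real and K u xo and to \<rho> R Rt \<omega> :: real
    assume adm: "admissible_kernel s p Co C1 T K" and sol: "weak_solution s p E T K u"
      and r: "0 < \<rho>" "\<rho> < R" "R < Rt" "0 < \<omega>" "ball xo Rt \<subseteq> E" "Rt powr (s * p) \<le> to" "to \<le> T" "\<omega> powr (2 - p) * R powr (s * p) \<le> Rt powr (s * p)"
      and bnd: "AE z in lebesgue. z \<in> cyl s p xo to Rt 1 \<longrightarrow> \<bar>u (fst z) (snd z)\<bar> \<le> \<omega> / 2"
      and tl: "AE t in lebesgue. t \<in> {to - Rt powr (s * p)<..<to} \<longrightarrow>
          outer_tail s p u xo Rt t
            \<le> ennreal (\<omega> powr (p - 1) * Rt powr - (s * p))"
    obtain K' V where rep: "solution_representative s p Co C1 T E K u K' V" using solution_representative_exists[OF p s Co adm sol] by blast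
    interpret solution_representative s p Co C1 T E K u K' V by (rule rep)
    have bnd': "AE z in lborel2. z \<in> cyl s p xo to Rt 1 \<longrightarrow> \<bar>u (fst z) (snd z)\<bar> \<le> \<omega> / 2"
      using bnd unfolding AE_completion_iff lborel_prod .
    have "confined xo to \<Lambda> R \<omega> (- \<omega> / 2)"
    proof (rule confined_initial[OF P])
      show "AE z in lborel2. fst z \<in> ball xo Rt \<and> to - Rt powr (s * p) < snd z \<and> snd z < to \<longrightarrow> \<bar>V z\<bar> \<le> \<omega> / 2"
        using bnd' V_eq
      proof eventually_elim
        case (elim z)
        show ?case
        proof
          assume z: "fst z \<in> ball xo Rt \<and> to - Rt powr (s * p) < snd z \<and> snd z < to"
          then have "z \<in> cyl s p xo to Rt 1" by (cases z) (simp add: cyl_def)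
          moreover have "snd z \<in> {0<..T}" using z r(6,7) by auto
          ultimately show "\<bar>V z\<bar> \<le> \<omega> / 2" using elim by simp
        qed
      qed
      have "AE t in lborel. t \<in> {to - Rt powr (s * p)<..<to} \<longrightarrow>
          outer_tail s p u xo Rt t
            \<le> ennreal (\<omega> powr (p - 1) * Rt powr - (s * p))" using tl unfolding AE_completion_iff .
      then show "AE t in lborel. to - Rt powr (s * p) < t \<and> t < to \<longrightarrow>
        far (s * p) xo Rt (\<lambda>y. \<bar>V (y, t)\<bar> powr (p - 1)) xo \<le> ennreal (\<omega> powr (p - 1) * Rt powr - (s * p))"
        using AE_pair_swap_slices[OF V_eq]
      proof eventually_elim
        case (elim t)
        show ?case
        proof
          assume t: "to - Rt powr (s * p) < t \<and> t < to"
          then have "t \<in> {0<..T}" using r(6,7) by auto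
          have "far (s * p) xo Rt (\<lambda>y. \<bar>V (y, t)\<bar> powr (p - 1)) xo =
            (\<integral>\<^sup>+ x \<in> - ball xo Rt. ennreal (\<bar>u x t\<bar> powr (p - 1) / norm (x - xo) powr (real DIM('a) + s * p)) \<partial>lborel)"
          proof (rule nn_integral_cong_AE)
            show "AE y in lborel. ennreal (fkernel (s * p) xo y * \<bar>V (y, t)\<bar> powr (p - 1)) * indicator (- ball xo Rt) y =
              ennreal (\<bar>u y t\<bar> powr (p - 1) / norm (y - xo) powr (real DIM('a) + s * p)) * indicator (- ball xo Rt) y"
              using elim(2) by eventually_elim (use \<open>t \<in> {0<..T}\<close> in \<open>simp add: fkernel_def norm_minus_commute\<close>)
          qed
          then show "far (s * p) xo Rt (\<lambda>y. \<bar>V (y, t)\<bar> powr (p - 1)) xo \<le> ennreal (\<omega> powr (p - 1) * Rt powr - (s * p))"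
            using elim(1) t by (simp add: nn_integral_completion)
        qed
      qed
    qed (use r in auto)
    from confined_decay[OF P this r(1,2)] obtain \<mu> where \<mu>: "AE z in lborel2. fst z \<in> ball xo \<rho> \<and> to - \<omega> powr (2 - p) * \<rho> powr (s * p) < snd z \<and> snd z < to \<longrightarrow>
       \<mu> \<le> V z \<and> V z \<le> \<mu> + 1 / k * \<omega> * (\<rho> / R) powr \<beta>" unfolding k_def \<beta>_def by blast
    have wide: "\<omega> powr (2 - p) * \<rho> powr (s * p) \<le> Rt powr (s * p)"
    proof -
      have "\<omega> powr (2 - p) * \<rho> powr (s * p) \<le> \<omega> powr (2 - p) * R powr (s * p)" using r p s by (intro mult_left_mono powr_mono2) auto
      then show ?thesis using r(8) by linarith
    qed
    have "AE z in lborel2. z \<in> cyl s p xo to \<rho> (\<omega> powr (2 - p)) \<longrightarrow> \<mu> \<le> u (fst z) (snd z) \<and> u (fst z) (snd z) \<le> \<mu> + 1 / k * \<omega> * (\<rho> / R) powr \<beta>"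
      using \<mu> V_eq
    proof eventually_elim
      case (elim z)
      show ?case
      proof
        assume "z \<in> cyl s p xo to \<rho> (\<omega> powr (2 - p))"
        then have z: "fst z \<in> ball xo \<rho> \<and> to - \<omega> powr (2 - p) * \<rho> powr (s * p) < snd z \<and> snd z < to" by (cases z) (simp add: cyl_def)
        then have "snd z \<in> {0<..T}" using r(6,7) wide by auto
        then show "\<mu> \<le> u (fst z) (snd z) \<and> u (fst z) (snd z) \<le> \<mu> + 1 / k * \<omega> * (\<rho> / R) powr \<beta>" using elim z by simp
      qed
    qed
    then show "\<exists>\<mu>. AE z in lebesgue. z \<in> cyl s p xo to \<rho> (\<omega> powr (2 - p)) \<longrightarrow>
          \<mu> \<le> u (fst z) (snd z) \<and> u (fst z) (snd z) \<le> \<mu> + 1 / k * \<omega> * (\<rho> / R) powr \<beta>"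
      unfolding AE_completion_iff lborel_prod by blast
  qed
qed

section \<open>The Hoelder representative\<close>

lemma AE_open_witness:
  fixes U :: "'b::euclidean_space set"
  assumes "open U" "U \<noteq> {}" "AE w in lebesgue. P w"
  shows "\<exists>w\<in>U. P w"
proof (rule ccontr)
  assume "\<not> ?thesis"
  then have "AE w in lebesgue. w \<notin> U" using assms(3) by (auto elim!: eventually_mono)
  then have "U \<in> null_sets lebesgue" using assms(1) by (subst AE_iff_null_sets) auto
  then show False using assms open_not_negligible[of U] by (simp add: negligible_iff_null_sets)
qed

definition backward_cyl :: "'a::euclidean_space \<times> real \<Rightarrow> real \<Rightarrow> real \<Rightarrow> ('a \<times> real) set" where
  "backward_cyl z r \<tau> = ball (fst z) r \<times> {snd z - \<tau><..<snd z}"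

lemma backward_cyl_open: "open (backward_cyl z r \<tau>)"
  by (simp add: backward_cyl_def open_Times)

lemma backward_cyl_mono: "r \<le> r' \<Longrightarrow> \<tau> \<le> \<tau>' \<Longrightarrow> backward_cyl z r \<tau> \<subseteq> backward_cyl z r' \<tau>'"
  by (auto simp: backward_cyl_def)

lemma backward_cyl_nonempty: "0 < r \<Longrightarrow> 0 < \<tau> \<Longrightarrow> backward_cyl z r \<tau> \<noteq> {}"
  by (auto simp: backward_cyl_def intro!: exI[of _ "snd z - \<tau> / 2"])

text \<open>The cylinders point backward in time, so the definition also makes sense at the final
  time T.\<close>

definition upper_bounds_near :: "('a::euclidean_space \<times> real \<Rightarrow> real) \<Rightarrow> 'a \<times> real \<Rightarrow> real set" where
  "upper_bounds_near u z = {m. \<exists>r>0. AE w in lebesgue. w \<in> backward_cyl z r r \<longrightarrow> u w \<le> m}"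

text \<open>A nonempty open set is not a null set. Hence an almost everywhere lower bound on one
  cylinder and an upper bound on a smaller or larger one are both attained at a common point and can
  be compared.\<close>

lemma Inf_upper_bounds_near:
  fixes u :: "'a::euclidean_space \<times> real \<Rightarrow> real"
  assumes b: "AE w in lebesgue. w \<in> U \<longrightarrow> a \<le> u w \<and> u w \<le> b" and r: "0 < r" "backward_cyl z r r \<subseteq> U"
  shows "a \<le> Inf (upper_bounds_near u z)" "Inf (upper_bounds_near u z) \<le> b"
proof -
  have "AE w in lebesgue. w \<in> backward_cyl z r r \<longrightarrow> u w \<le> b" using b by eventually_elim (use r in auto)
  then have mem: "b \<in> upper_bounds_near u z" using r by (auto simp: upper_bounds_near_def)
  have low: "a \<le> m" if "m \<in> upper_bounds_near u z" for m
  proof -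
    obtain q where q: "0 < q" "AE w in lebesgue. w \<in> backward_cyl z q q \<longrightarrow> u w \<le> m" using \<open>m \<in> upper_bounds_near u z\<close> by (auto simp: upper_bounds_near_def)
    let ?e = "min q r"
    have "AE w in lebesgue. (w \<in> U \<longrightarrow> a \<le> u w \<and> u w \<le> b) \<and> (w \<in> backward_cyl z q q \<longrightarrow> u w \<le> m)"
      using b q(2) by eventually_elim blast
    from AE_open_witness[OF backward_cyl_open backward_cyl_nonempty this, of ?e ?e z] q r
    obtain w where w: "w \<in> backward_cyl z ?e ?e" "w \<in> U \<longrightarrow> a \<le> u w \<and> u w \<le> b" "w \<in> backward_cyl z q q \<longrightarrow> u w \<le> m" by auto
    have "w \<in> U" "w \<in> backward_cyl z q q" using w(1) r(2) backward_cyl_mono[of ?e q ?e q z] backward_cyl_mono[of ?e r ?e r z] by auto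
    then show ?thesis using w by linarith
  qed
  show "a \<le> Inf (upper_bounds_near u z)" using mem low by (intro cInf_greatest) auto
  show "Inf (upper_bounds_near u z) \<le> b" by (rule cInf_lower[OF mem bdd_belowI[OF low]])
qed

definition uniform_decay :: "('a::euclidean_space \<times> real \<Rightarrow> real) \<Rightarrow> real \<Rightarrow> ('a \<times> real) set \<Rightarrow> real \<Rightarrow> real \<Rightarrow> real \<Rightarrow> real \<Rightarrow> real \<Rightarrow> bool" where
  "uniform_decay u \<sigma> C A L R \<beta> B \<longleftrightarrow> 0 < A \<and> 0 < L \<and> 0 < R \<and> 0 < \<beta> \<and> 0 < B \<and>
      (\<forall>z\<in>C. \<forall>\<rho>. 0 < \<rho> \<longrightarrow> \<rho> < R \<longrightarrow> (\<exists>\<mu>. AE w in lebesgue. w \<in> backward_cyl z \<rho> (A * \<rho> powr \<sigma>) \<longrightarrow>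
         \<mu> \<le> u w \<and> u w \<le> \<mu> + L * \<rho> powr \<beta> \<and> \<bar>u w\<bar> \<le> B))"

lemma uniform_decayD:
  assumes "uniform_decay u \<sigma> C A L R \<beta> B"
  shows "0 < A" "0 < L" "0 < R" "0 < \<beta>" "0 < B"
    "\<And>z \<rho>. z \<in> C \<Longrightarrow> 0 < \<rho> \<Longrightarrow> \<rho> < R \<Longrightarrow> (\<exists>\<mu>. AE w in lebesgue. w \<in> backward_cyl z \<rho> (A * \<rho> powr \<sigma>) \<longrightarrow>
         \<mu> \<le> u w \<and> u w \<le> \<mu> + L * \<rho> powr \<beta> \<and> \<bar>u w\<bar> \<le> B)"
  using assms unfolding uniform_decay_def by blast+

text \<open>Two points at distance d are compared through a common point of their backward cylinders
  of radius \<rho> = k d^\<nu>. The exponent \<nu> = min 1 (1/\<sigma>) makes d smaller than both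
  \<rho> and the time length A \<rho>^\<sigma> when d <= 1. If d > 1 or \<rho> >= R, then d is
  bounded below and the bound B suffices. That the representative agrees with u almost everywhere
  follows from a countable cover by cylinders of small oscillation.\<close>

lemma hoelder_representative:
  fixes u :: "'a::euclidean_space \<times> real \<Rightarrow> real"
  assumes T: "0 < T" and \<sigma>: "0 < \<sigma>"
    and main: "\<And>C. compact C \<Longrightarrow> C \<subseteq> E \<times> {0<..T} \<Longrightarrow> \<exists>A L R \<beta> B. uniform_decay u \<sigma> C A L R \<beta> B"
  shows "\<exists>v. (AE z in lebesgue. z \<in> E \<times> {0<..T} \<longrightarrow> u z = v z) \<and>
    (\<forall>C. compact C \<and> C \<subseteq> E \<times> {0<..T} \<longrightarrow> (\<exists>\<alpha> L. 0 < \<alpha> \<and> (\<forall>z\<in>C. \<forall>w\<in>C. \<bar>v z - v w\<bar> \<le> L * dist z w powr \<alpha>)))"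
proof (rule exI[of _ "\<lambda>z. Inf (upper_bounds_near u z)"], intro conjI allI impI)
  let ?Q = "\<lambda>z \<rho> A. backward_cyl z \<rho> (A * \<rho> powr \<sigma>)"
  define v where "v = (\<lambda>z. Inf (upper_bounds_near u z))"
  have vb: "a \<le> v z \<and> v z \<le> b" if "AE w in lebesgue. w \<in> backward_cyl z \<rho> \<tau> \<longrightarrow> a \<le> u w \<and> u w \<le> b" "0 < \<rho>" "0 < \<tau>" for z a b \<rho> \<tau>
    unfolding v_def using Inf_upper_bounds_near[OF that(1), of "min \<rho> \<tau>" z] that backward_cyl_mono[of "min \<rho> \<tau>" \<rho> "min \<rho> \<tau>" \<tau> z] by auto
  fix C assume "compact C \<and> C \<subseteq> E \<times> {0<..T}"
  then obtain A L R \<beta> B where "uniform_decay u \<sigma> C A L R \<beta> B" using main[of C] by blast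
  note pos = uniform_decayD(1-5)[OF this] and osc = uniform_decayD(6)[OF this]
  define \<nu> where "\<nu> = min 1 (1 / \<sigma>)"
  have \<nu>: "0 < \<nu>" "\<nu> \<le> 1" "\<nu> * \<sigma> \<le> 1" using \<sigma> mult_right_mono[of \<nu> "1 / \<sigma>" \<sigma>] by (auto simp: \<nu>_def)
  \<comment> \<open>The entry 2 gives d < k d, for the radius; the other entry gives A k^\<sigma> >=
    2, for the time length.\<close>
  define k where "k = max 2 ((2 / A) powr (1 / \<sigma>))"
  have k: "2 \<le> k" by (simp add: k_def)
  have kA: "2 \<le> A * k powr \<sigma>"
  proof -
    have "2 / A = ((2 / A) powr (1 / \<sigma>)) powr \<sigma>" using pos \<sigma> by (simp add: powr_powr)
    also have "\<dots> \<le> k powr \<sigma>" using \<sigma> by (intro powr_mono2) (auto simp: k_def)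
    finally show ?thesis using pos by (simp add: pos_divide_le_eq mult.commute)
  qed
  define c where "c = min 1 (R / k)"
  have c: "0 < c" using pos k by (simp add: c_def)
  \<comment> \<open>The first summand serves pairs whose cylinders meet, the second pairs at
    distance bounded below.\<close>
  define L' where "L' = 2 * L * k powr \<beta> + 2 * B / c powr \<beta>"
  have vB: "\<bar>v z\<bar> \<le> B" if "z \<in> C" for z
  proof -
    obtain \<mu> where "AE w in lebesgue. w \<in> backward_cyl z (R / 2) (A * (R / 2) powr \<sigma>) \<longrightarrow> \<mu> \<le> u w \<and> u w \<le> \<mu> + L * (R / 2) powr \<beta> \<and> \<bar>u w\<bar> \<le> B"
      using osc[OF \<open>z \<in> C\<close>, of "R / 2"] pos by auto
    then have "AE w in lebesgue. w \<in> backward_cyl z (R / 2) (A * (R / 2) powr \<sigma>) \<longrightarrow> - B \<le> u w \<and> u w \<le> B" by eventually_elim auto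
    from vb[OF this] pos have "- B \<le> v z" "v z \<le> B" by auto
    then show ?thesis by linarith
  qed
  have "\<bar>v z - v w\<bar> \<le> L' * dist z w powr (\<nu> * \<beta>)" if zw: "z \<in> C" "w \<in> C" for z w
  proof (cases "z = w")
    case False
    define d where "d = dist z w"
    have d: "0 < d" using False by (simp add: d_def)
    have L': "2 * L * k powr \<beta> * d powr (\<nu> * \<beta>) \<le> L' * d powr (\<nu> * \<beta>)" "2 * B / c powr \<beta> * d powr (\<nu> * \<beta>) \<le> L' * d powr (\<nu> * \<beta>)"
      using pos by (intro mult_right_mono; simp add: L'_def)+
    show ?thesis
    proof (cases "d \<le> 1 \<and> k * d powr \<nu> < R")
      case True
      define \<rho> where "\<rho> = k * d powr \<nu>"
      have dn: "d \<le> d powr \<nu>" using True d \<nu> powr_mono'[of \<nu> 1 d] by simp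
      have "d < k * d" using k d by simp
      also have "\<dots> \<le> \<rho>" unfolding \<rho>_def using dn k by (intro mult_left_mono) auto
      finally have \<rho>: "d < \<rho>" .
      have "d < 2 * d powr (\<nu> * \<sigma>)" using True d \<nu> powr_mono'[of "\<nu> * \<sigma>" 1 d] by simp
      also have "\<dots> \<le> A * k powr \<sigma> * d powr (\<nu> * \<sigma>)" using kA by (intro mult_right_mono) auto
      also have "\<dots> = A * \<rho> powr \<sigma>" using k by (simp add: \<rho>_def powr_mult powr_powr)
      finally have \<tau>: "d < A * \<rho> powr \<sigma>" .
      have \<rho>R: "0 < \<rho>" "\<rho> < R" using \<rho> d True by (auto simp: \<rho>_def)
      obtain \<mu>1 where 1: "AE p in lebesgue. p \<in> ?Q z \<rho> A \<longrightarrow> \<mu>1 \<le> u p \<and> u p \<le> \<mu>1 + L * \<rho> powr \<beta> \<and> \<bar>u p\<bar> \<le> B"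
        using osc[OF zw(1) \<rho>R] by blast
      obtain \<mu>2 where 2: "AE p in lebesgue. p \<in> ?Q w \<rho> A \<longrightarrow> \<mu>2 \<le> u p \<and> u p \<le> \<mu>2 + L * \<rho> powr \<beta> \<and> \<bar>u p\<bar> \<le> B"
        using osc[OF zw(2) \<rho>R] by blast
      have d12: "dist (fst w) (fst z) < \<rho>" "\<bar>snd z - snd w\<bar> < A * \<rho> powr \<sigma>"
        using dist_fst_le[of w z] dist_snd_le[of z w] \<rho> \<tau> by (auto simp: d_def dist_commute dist_real_def)
      \<comment> \<open>The midpoint of the overlap of the two time intervals; in space,
        \<open>fst z\<close> belongs to both balls.\<close>
      define t where "t = (max (snd z) (snd w) - A * \<rho> powr \<sigma> + min (snd z) (snd w)) / 2"
      have "(fst z, t) \<in> ?Q z \<rho> A \<inter> ?Q w \<rho> A"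
        using d12 \<rho>R by (auto simp: backward_cyl_def t_def max_def min_def abs_if field_simps split: if_splits)
      then have ne: "?Q z \<rho> A \<inter> ?Q w \<rho> A \<noteq> {}" by blast
      have "\<exists>p\<in>?Q z \<rho> A \<inter> ?Q w \<rho> A.
         (p \<in> ?Q z \<rho> A \<longrightarrow> \<mu>1 \<le> u p \<and> u p \<le> \<mu>1 + L * \<rho> powr \<beta> \<and> \<bar>u p\<bar> \<le> B) \<and>
         (p \<in> ?Q w \<rho> A \<longrightarrow> \<mu>2 \<le> u p \<and> u p \<le> \<mu>2 + L * \<rho> powr \<beta> \<and> \<bar>u p\<bar> \<le> B)"
        using 1 2 by (intro AE_open_witness open_Int backward_cyl_open ne) (auto intro: AE_conjI)
      then obtain p where p: "\<mu>1 \<le> u p" "u p \<le> \<mu>1 + L * \<rho> powr \<beta>" "\<mu>2 \<le> u p" "u p \<le> \<mu>2 + L * \<rho> powr \<beta>" by blast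
      have "AE p in lebesgue. p \<in> ?Q z \<rho> A \<longrightarrow> \<mu>1 \<le> u p \<and> u p \<le> \<mu>1 + L * \<rho> powr \<beta>" using 1 by eventually_elim blast
      from vb[OF this] have v1: "\<mu>1 \<le> v z" "v z \<le> \<mu>1 + L * \<rho> powr \<beta>" using \<rho>R pos by auto
      have "AE p in lebesgue. p \<in> ?Q w \<rho> A \<longrightarrow> \<mu>2 \<le> u p \<and> u p \<le> \<mu>2 + L * \<rho> powr \<beta>" using 2 by eventually_elim blast
      from vb[OF this] have v2: "\<mu>2 \<le> v w" "v w \<le> \<mu>2 + L * \<rho> powr \<beta>" using \<rho>R pos by auto
      have "\<bar>v z - v w\<bar> \<le> 2 * (L * \<rho> powr \<beta>)" using p v1 v2 by linarith
      also have "\<dots> = 2 * L * k powr \<beta> * d powr (\<nu> * \<beta>)" using k by (simp add: \<rho>_def powr_mult powr_powr)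
      finally show ?thesis using L'(1) by (simp add: d_def)
    next
      case False
      have "c \<le> d powr \<nu>"
      proof (cases "d \<le> 1")
        case True
        then have "R \<le> d powr \<nu> * k" using False by (simp add: mult.commute)
        then have "R / k \<le> d powr \<nu>" using k by (simp add: pos_divide_le_eq)
        then show ?thesis by (simp add: c_def)
      next
        case False
        then have "1 \<le> d powr \<nu>" using \<nu> by (intro ge_one_powr_ge_zero) auto
        then show ?thesis by (simp add: c_def)
      qed
      then have "c powr \<beta> \<le> (d powr \<nu>) powr \<beta>" using c pos by (intro powr_mono2) auto
      then have "c powr \<beta> \<le> d powr (\<nu> * \<beta>)" by (simp add: powr_powr)
      then have "2 * B / c powr \<beta> * c powr \<beta> \<le> 2 * B / c powr \<beta> * d powr (\<nu> * \<beta>)" using pos by (intro mult_left_mono) auto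
      then have "2 * B \<le> 2 * B / c powr \<beta> * d powr (\<nu> * \<beta>)" using c by simp
      moreover have "\<bar>v z - v w\<bar> \<le> 2 * B" using vB[OF zw(1)] vB[OF zw(2)] by linarith
      ultimately show ?thesis using L'(2) unfolding d_def[symmetric] by linarith
    qed
  qed simp
  then show "\<exists>\<alpha> L. 0 < \<alpha> \<and> (\<forall>z\<in>C. \<forall>w\<in>C. \<bar>Inf (upper_bounds_near u z) - Inf (upper_bounds_near u w)\<bar> \<le> L * dist z w powr \<alpha>)"
    using \<nu> pos by (intro exI[of _ "\<nu> * \<beta>"] exI[of _ L']) (simp add: v_def)
next
  let ?Q = "\<lambda>z \<rho> A. backward_cyl z \<rho> (A * \<rho> powr \<sigma>)"
  let ?v = "\<lambda>z. Inf (upper_bounds_near u z)"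
  have close: "AE w in lebesgue. w \<in> E \<times> {0<..<T} \<longrightarrow> \<bar>u w - ?v w\<bar> \<le> \<epsilon>" if \<epsilon>: "0 < \<epsilon>" for \<epsilon>
  proof -
    define F where "F = {U. open U \<and> (\<exists>\<mu>. AE w in lebesgue. w \<in> U \<longrightarrow> \<mu> \<le> u w \<and> u w \<le> \<mu> + \<epsilon>)}"
    have cover: "E \<times> {0<..<T} \<subseteq> \<Union>F"
    proof
      fix w assume w: "w \<in> E \<times> {0<..<T}"
      obtain x t where xt: "w = (x, t)" using surj_pair[of w] by blast
      have xE: "x \<in> E" and t: "0 < t" "t < T" using w xt by auto
      have "compact ({x} \<times> {t..T})" by (intro compact_Times) auto
      moreover have "{x} \<times> {t..T} \<subseteq> E \<times> {0<..T}" using xE t by auto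
      ultimately obtain A L R \<beta> B where "uniform_decay u \<sigma> ({x} \<times> {t..T}) A L R \<beta> B"
        using main[of "{x} \<times> {t..T}"] by blast
      note pos = uniform_decayD(1-5)[OF this] and osc = uniform_decayD(6)[OF this]
      obtain \<rho> where \<rho>: "0 < \<rho>" "\<rho> \<le> R / 2" "\<rho> powr \<beta> \<le> \<epsilon> / L" using exists_small_powr[of "R / 2" "\<epsilon> / L" \<beta>] pos \<epsilon> by auto
      \<comment> \<open>A backward cylinder at (x, t) does not contain the time t itself. Its vertex
        is moved to a slightly later time, at most T, so that (x, t) becomes an interior
        point.\<close>
      define t' where "t' = min T (t + A * \<rho> powr \<sigma> / 2)"
      have "0 < A * \<rho> powr \<sigma>" using pos \<rho> by simp
      then have t': "t < t'" "t' \<le> T" "t' - A * \<rho> powr \<sigma> < t" using t by (auto simp: t'_def min_def)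
      obtain \<mu> where \<mu>: "AE w in lebesgue. w \<in> ?Q (x, t') \<rho> A \<longrightarrow> \<mu> \<le> u w \<and> u w \<le> \<mu> + L * \<rho> powr \<beta> \<and> \<bar>u w\<bar> \<le> B"
        using osc[of "(x, t')" \<rho>] t' \<rho> pos by auto
      have "L * \<rho> powr \<beta> \<le> \<epsilon>" using \<rho>(3) pos by (simp add: pos_le_divide_eq mult.commute)
      then have "AE w in lebesgue. w \<in> ?Q (x, t') \<rho> A \<longrightarrow> \<mu> \<le> u w \<and> u w \<le> \<mu> + \<epsilon>"
        using \<mu> by (auto elim!: eventually_mono)
      then have "?Q (x, t') \<rho> A \<in> F" by (auto simp: F_def backward_cyl_open)
      moreover have "w \<in> ?Q (x, t') \<rho> A" using xt t' \<rho> by (auto simp: backward_cyl_def)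
      ultimately show "w \<in> \<Union>F" by blast
    qed
    obtain F' where F': "F' \<subseteq> F" "countable F'" "\<Union>F' = \<Union>F" using Lindelof[of F] by (auto simp: F_def)
    have "AE w in lebesgue. w \<in> U \<longrightarrow> \<bar>u w - ?v w\<bar> \<le> \<epsilon>" if "U \<in> F'" for U
    proof -
      obtain \<mu> where U: "open U" "AE w in lebesgue. w \<in> U \<longrightarrow> \<mu> \<le> u w \<and> u w \<le> \<mu> + \<epsilon>" using \<open>U \<in> F'\<close> F'(1) by (auto simp: F_def)
      have vU: "\<mu> \<le> ?v w \<and> ?v w \<le> \<mu> + \<epsilon>" if "w \<in> U" for w
      proof -
        obtain A B where AB: "open A" "open B" "w \<in> A \<times> B" "A \<times> B \<subseteq> U" using open_prod_elim[OF U(1) \<open>w \<in> U\<close>] by blast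
        obtain a where a: "0 < a" "ball (fst w) a \<subseteq> A" using AB by (auto simp: open_contains_ball)
        obtain b where b: "0 < b" "ball (snd w) b \<subseteq> B" using AB by (auto simp: open_contains_ball)
        have "backward_cyl w (min a b) (min a b) \<subseteq> U"
        proof
          fix q assume "q \<in> backward_cyl w (min a b) (min a b)"
          then have "fst q \<in> ball (fst w) a" "snd q \<in> ball (snd w) b" by (auto simp: backward_cyl_def dist_real_def)
          then have "q \<in> A \<times> B" using a b by (auto simp: mem_Times_iff simp del: mem_ball)
          then show "q \<in> U" using AB(4) by blast
        qed
        then show ?thesis using Inf_upper_bounds_near[OF U(2), of "min a b" w] a b by auto
      qed
      show ?thesis using U(2)
      proof eventually_elim
        case (elim w)
        show ?case
        proof
          assume "w \<in> U"
          then show "\<bar>u w - ?v w\<bar> \<le> \<epsilon>" using elim vU[of w] by linarith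
        qed
      qed
    qed
    then have "AE w in lebesgue. \<forall>U\<in>F'. w \<in> U \<longrightarrow> \<bar>u w - ?v w\<bar> \<le> \<epsilon>" using F'(2) by (subst AE_ball_countable) auto
    then show ?thesis
    proof eventually_elim
      case (elim w)
      then show ?case using cover F'(3) by blast
    qed
  qed
  have "AE w in lebesgue. \<forall>n. w \<in> E \<times> {0<..<T} \<longrightarrow> \<bar>u w - ?v w\<bar> \<le> inverse (real (Suc n))"
    by (subst AE_all_countable) (auto intro!: close)
  moreover have "AE w in (lebesgue :: ('a \<times> real) measure). snd w \<noteq> T"
    using AE_time_neq[where 'a = 'a and c = T] unfolding AE_completion_iff lborel_prod .
  ultimately show "AE z in lebesgue. z \<in> E \<times> {0<..T} \<longrightarrow> u z = ?v z"
  proof eventually_elim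
    case (elim z)
    show ?case
    proof
      assume "z \<in> E \<times> {0<..T}"
      then have "z \<in> E \<times> {0<..<T}" using elim(2) by (cases z) auto
      then have b: "\<bar>u z - ?v z\<bar> \<le> inverse (real (Suc n))" for n using elim(1) by blast
      show "u z = ?v z"
      proof (rule ccontr)
        assume "u z \<noteq> ?v z"
        then obtain n where "inverse (real (Suc n)) < \<bar>u z - ?v z\<bar>" using reals_Archimedean[of "\<bar>u z - ?v z\<bar>"] by auto
        then show False using b[of n] by linarith
      qed
    qed
  qed
qed

section \<open>Essential suprema, tails, and uniform bounds on compact sets\<close>

lemma ess_sup_on_le_imp_AE:
  fixes f :: "'b::euclidean_space \<Rightarrow> ereal" and x :: real
  assumes "ess_sup_on S f \<le> ereal x"
  shows "AE z in lebesgue. z \<in> S \<longrightarrow> f z \<le> ereal x"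
proof -
  have "AE z in lebesgue. z \<in> S \<longrightarrow> f z \<le> ereal (x + inverse (real (Suc n)))" for n
  proof -
    have "ess_sup_on S f < ereal (x + inverse (real (Suc n)))" using assms by (rule order_le_less_trans) simp
    then obtain c where c: "AE z in lebesgue. z \<in> S \<longrightarrow> f z \<le> c" "c < ereal (x + inverse (real (Suc n)))"
      unfolding ess_sup_on_def by (auto simp: Inf_less_iff)
    from c(1) show ?thesis
    proof eventually_elim
      case (elim z)
      then show ?case using c(2) by (auto intro: order_trans less_imp_le)
    qed
  qed
  then have "AE z in lebesgue. \<forall>n. z \<in> S \<longrightarrow> f z \<le> ereal (x + inverse (real (Suc n)))" unfolding AE_all_countable by blast
  then show ?thesis
  proof eventually_elim
    case (elim z)
    show ?case
    proof
      assume "z \<in> S"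
      then have b: "f z \<le> ereal (x + inverse (real (Suc n)))" for n using elim by blast
      show "f z \<le> ereal x"
      proof (rule ereal_le_epsilon2)
        fix e :: real assume "0 < e"
        then obtain n where "inverse (real (Suc n)) < e" using reals_Archimedean by blast
        then have "ereal (x + inverse (real (Suc n))) \<le> ereal x + ereal e" by simp
        then show "f z \<le> ereal x + ereal e" using b[of n] by (rule order_trans[rotated])
      qed
    qed
  qed
qed

lemma ess_sup_on_finite_imp_AE:
  fixes f :: "'b::euclidean_space \<Rightarrow> ereal"
  assumes "ess_sup_on S f < \<infinity>"
  shows "\<exists>B>0. AE z in lebesgue. z \<in> S \<longrightarrow> f z \<le> ereal B"
proof -
  obtain c where c: "AE z in lebesgue. z \<in> S \<longrightarrow> f z \<le> c" "c < \<infinity>"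
    using assms unfolding ess_sup_on_def Inf_less_iff by blast
  have "c \<le> ereal (max 1 (real_of_ereal c))" using c(2) by (cases c) auto
  with c(1) have "AE z in lebesgue. z \<in> S \<longrightarrow> f z \<le> ereal (max 1 (real_of_ereal c))"
    by (auto elim!: eventually_mono intro: order_trans)
  then show ?thesis by (intro exI[of _ "max 1 (real_of_ereal c)"]) auto
qed

lemma ess_sup_on_nonneg:
  fixes f :: "'b::euclidean_space \<Rightarrow> ereal"
  assumes "open S" "S \<noteq> {}" "\<And>z. 0 \<le> f z"
  shows "0 \<le> ess_sup_on S f" unfolding ess_sup_on_def
proof (rule Inf_greatest)
  fix c assume "c \<in> {c. AE z in lebesgue. z \<in> S \<longrightarrow> f z \<le> c}"
  then obtain z where "z \<in> S \<longrightarrow> f z \<le> c" "z \<in> S" using AE_open_witness[OF assms(1,2), of "\<lambda>z. z \<in> S \<longrightarrow> f z \<le> c"] by blast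
  then show "0 \<le> c" using assms(3)[of z] by (auto intro: order_trans)
qed

lemma ess_osc_on_le:
  fixes f :: "'b::euclidean_space \<Rightarrow> real"
  assumes "AE z in lebesgue. z \<in> S \<longrightarrow> \<mu> \<le> f z \<and> f z \<le> \<mu> + l"
  shows "ess_osc_on S (\<lambda>z. ereal (f z)) \<le> ereal l"
proof -
  have "ess_sup_on S (\<lambda>z. ereal (f z)) \<le> ereal (\<mu> + l)"
    unfolding ess_sup_on_def by (rule Inf_lower) (use assms in \<open>auto elim!: eventually_mono\<close>)
  moreover have "ess_sup_on S (\<lambda>z. - ereal (f z)) \<le> - ereal \<mu>"
    unfolding ess_sup_on_def by (rule Inf_lower) (use assms in \<open>auto elim!: eventually_mono\<close>)
  then have "- (- ereal \<mu>) \<le> - ess_sup_on S (\<lambda>z. - ereal (f z))" by (simp only: ereal_minus_le_minus)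
  then have "ereal \<mu> \<le> ess_inf_on S (\<lambda>z. ereal (f z))" unfolding ess_inf_on_def by (simp only: ereal_uminus_uminus)
  ultimately have "ess_osc_on S (\<lambda>z. ereal (f z)) \<le> ereal (\<mu> + l) - ereal \<mu>" unfolding ess_osc_on_def by (rule ereal_minus_mono)
  then show ?thesis by simp
qed

lemma cyl_subset_space_time:
  fixes E :: "'a::euclidean_space set"
  assumes Rt: "0 < Rt" and sub: "cyl s p xo to Rt 1 \<subseteq> E \<times> {0<..T}"
  shows "ball xo Rt \<subseteq> E" "Rt powr (s * p) \<le> to" "to \<le> T"
proof -
  define l where "l = Rt powr (s * p)"
  have l: "0 < l" using Rt by (simp add: l_def)
  have mem: "x \<in> E \<and> 0 < t \<and> t \<le> T" if "x \<in> ball xo Rt" "to - l < t" "t < to" for x t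
  proof -
    have "(x, t) \<in> cyl s p xo to Rt 1" using that by (simp add: cyl_def l_def)
    then show ?thesis using sub by auto
  qed
  show "ball xo Rt \<subseteq> E" using mem[of _ "to - l / 2"] l by auto
  have xo: "xo \<in> ball xo Rt" using Rt by simp
  have to0: "0 < to" using mem[OF xo, of "to - l / 2"] l by simp
  have "l \<le> to"
  proof (rule ccontr)
    assume "\<not> l \<le> to"
    then show False using mem[OF xo, of "(to - l) / 2"] to0 by simp
  qed
  then show "Rt powr (s * p) \<le> to" by (simp add: l_def)
  show "to \<le> T"
  proof (rule ccontr)
    assume "\<not> to \<le> T"
    then have "to - l < max ((T + to) / 2) (to - l / 2)" "max ((T + to) / 2) (to - l / 2) < to" "T < max ((T + to) / 2) (to - l / 2)"
      using l by (auto simp: less_max_iff_disj)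
    then show False using mem[OF xo] by fastforce
  qed
qed

lemma cyl_subset_cyl:
  fixes xo :: "'a::euclidean_space"
  assumes R: "0 < R" "R < Rt" and sub: "cyl s p xo to R \<theta> \<subseteq> cyl s p xo to Rt 1"
  shows "\<theta> * R powr (s * p) \<le> Rt powr (s * p)"
proof (rule ccontr)
  assume n: "\<not> ?thesis"
  have "0 < Rt powr (s * p)" using R by simp
  then have "(xo, to - Rt powr (s * p)) \<in> cyl s p xo to R \<theta>" using n R by (simp add: cyl_def)
  then have "(xo, to - Rt powr (s * p)) \<in> cyl s p xo to Rt 1" using sub by blast
  then show False by (simp add: cyl_def)
qed

text \<open>An infinite integral is excluded because \<open>ereal_powr\<close> sends infinity to
  infinity, which contradicts a finite bound; for finite values the power is inverted.\<close>

lemma ereal_powr_le_imp: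
  fixes I :: ennreal
  assumes le: "ereal_powr (ereal a * enn2ereal I) (1 / q) \<le> ereal \<omega>" and a: "0 < a" and q: "0 < q" and \<omega>: "0 < \<omega>"
  shows "I \<le> ennreal (\<omega> powr q / a)"
proof (cases I)
  case (real i)
  then have "ereal_powr (ereal a * enn2ereal I) (1 / q) = ereal ((a * i) powr (1 / q))" by (simp add: ereal_powr_def)
  then have "(a * i) powr (1 / q) \<le> \<omega>" using le by simp
  then have "((a * i) powr (1 / q)) powr q \<le> \<omega> powr q" using q by (intro powr_mono2) auto
  then have "a * i \<le> \<omega> powr q" using q a real by (simp add: powr_powr)
  then have "i \<le> \<omega> powr q / a" using a by (simp add: pos_le_divide_eq mult.commute)
  then show ?thesis using real by (simp add: ennreal_leI)
next
  case top
  then have "ereal a * enn2ereal I = \<infinity>" using a by simp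
  then show ?thesis using le by (simp add: ereal_powr_def)
qed

text \<open>Outside the ball |x| <= (1 + D/R) |x - xo|, and 1 <= |x - xo|/R. Adding the q-th powers
  compares the two weights with a constant common to all centres of norm at most D.\<close>

lemma kernel_le_global_weight:
  fixes x xo :: "'a::real_normed_vector"
  assumes "0 < R" "x \<notin> ball xo R" "norm xo \<le> D" "0 < q"
  shows "1 / norm (x - xo) powr q \<le> (R powr - q + (1 + D / R) powr q) / (1 + norm x powr q)"
proof -
  define d where "d = norm (x - xo)"
  have d: "R \<le> d" using assms(2) by (simp add: d_def dist_norm norm_minus_commute)
  have D: "0 \<le> D" using assms(3) norm_ge_zero[of xo] by linarith
  have "norm x \<le> d + D" using norm_triangle_ineq[of "x - xo" xo] assms(3) by (simp add: d_def)
  also have "\<dots> \<le> (1 + D / R) * d"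
  proof -
    have "D / R * R \<le> D / R * d" using d D assms(1) by (intro mult_left_mono) auto
    then show ?thesis using assms(1) by (simp add: distrib_right)
  qed
  finally have "norm x powr q \<le> ((1 + D / R) * d) powr q" using assms(4) by (intro powr_mono2) auto
  also have "\<dots> = (1 + D / R) powr q * d powr q" using D d assms(1) by (simp add: powr_mult)
  finally have 1: "norm x powr q \<le> (1 + D / R) powr q * d powr q" .
  have "R powr q \<le> d powr q" using d assms by (intro powr_mono2) auto
  then have "1 \<le> R powr - q * d powr q" using assms(1) by (simp add: powr_minus field_simps)
  then have "1 + norm x powr q \<le> (R powr - q + (1 + D / R) powr q) * d powr q" using 1 by (simp add: distrib_right)
  moreover have "0 < d powr q" "0 < 1 + norm x powr q" using d assms(1) by (auto intro: add_pos_nonneg)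
  ultimately show ?thesis unfolding d_def[symmetric] by (simp add: divide_simps mult.commute)
qed

lemma solution_slice_measurable:
  assumes "1 < p" "0 < s" "s < 1" "0 < Co" "Co \<le> C1" "admissible_kernel s p Co C1 T K" "weak_solution s p E T K u"
  shows "AE t in lborel. t \<in> {0<..<T} \<longrightarrow> (\<lambda>x. u x t) \<in> borel_measurable lebesgue"
proof -
  obtain K' V where "solution_representative s p Co C1 T E K u K' V" using solution_representative_exists[OF assms] by blast
  then interpret solution_representative s p Co C1 T E K u K' V .
  show ?thesis using times_AE
  proof eventually_elim
    case (elim t)
    show ?case
    proof
      assume "t \<in> {0<..<T}"
      then have "AE x in lborel. u x t = V (x, t)" using elim timesD(3) by simp
      then have "AE x in lebesgue. V (x, t) = u x t" unfolding AE_completion_iff by eventually_elim simp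
      moreover have "(\<lambda>x. V (x, t)) \<in> borel_measurable lebesgue" by (intro measurable_completion) simp
      ultimately show "(\<lambda>x. u x t) \<in> borel_measurable lebesgue" by (rule borel_measurable_AE[rotated])
    qed
  qed
qed

text \<open>The weighted integral in the definition of weak solutions is bounded on (t1, T) and
  dominates the tails at all centres of a bounded set, with one constant.\<close>

lemma uniform_tail_bound:
  fixes E :: "'a::euclidean_space set"
  assumes p: "1 < p" and s: "0 < s" "s < 1" and Co: "0 < Co" "Co \<le> C1" and adm: "admissible_kernel s p Co C1 T K" and sol: "weak_solution s p E T K u"
    and t1: "0 < t1" "t1 < T" and R: "0 < R"
  shows "\<exists>W>0. \<forall>xo. norm xo \<le> D \<longrightarrow> (AE t in lebesgue. t \<in> {t1<..<T} \<longrightarrow>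
     outer_tail s p u xo R t \<le> ennreal W)"
proof -
  let ?q = "real DIM('a) + s * p"
  have q: "0 < ?q" using p s by (intro add_nonneg_pos) auto
  let ?J = "\<lambda>t. \<integral>\<^sup>+ x. ennreal (\<bar>u x t\<bar> powr (p - 1) / (1 + norm x powr ?q)) \<partial>lebesgue"
  have "weak_regular s p E T u" using sol by (simp add: weak_solution_def weak_subsolution_def)
  then have "ess_sup_on {t1<..<T} (\<lambda>t. enn2ereal (?J t)) < \<infinity>" using t1 unfolding weak_regular_def by simp
  then obtain B where B: "0 < B" "AE t in lebesgue. t \<in> {t1<..<T} \<longrightarrow> enn2ereal (?J t) \<le> ereal B" using ess_sup_on_finite_imp_AE by blast
  define c where "c = R powr - ?q + (1 + \<bar>D\<bar> / R) powr ?q"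
  have c: "0 < c" using R by (auto simp: c_def intro: add_pos_nonneg)
  have sm: "AE t in lebesgue. t \<in> {0<..<T} \<longrightarrow> (\<lambda>x. u x t) \<in> borel_measurable lebesgue"
    unfolding AE_completion_iff by (rule solution_slice_measurable[OF p s Co adm sol])
  have "AE t in lebesgue. t \<in> {t1<..<T} \<longrightarrow>
     outer_tail s p u xo R t \<le> ennreal (c * B)" if xo: "norm xo \<le> D" for xo
    using B(2) sm
  proof eventually_elim
    case (elim t)
    show ?case
    proof
      assume t: "t \<in> {t1<..<T}"
      then have J: "?J t \<le> ennreal B" using elim(1) B(1) by (simp add: less_eq_ennreal.rep_eq)
      have [measurable]: "(\<lambda>x. u x t) \<in> borel_measurable lebesgue" using elim(2) t t1 by simp
      have [measurable]: "(\<lambda>x :: 'a. norm x) \<in> borel_measurable lebesgue" by (intro measurable_completion) simp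
      have "outer_tail s p u xo R t
         \<le> (\<integral>\<^sup>+ x. ennreal c * ennreal (\<bar>u x t\<bar> powr (p - 1) / (1 + norm x powr ?q)) \<partial>lebesgue)"
      proof (intro nn_integral_mono)
        fix x
        show "ennreal (\<bar>u x t\<bar> powr (p - 1) / norm (x - xo) powr ?q) * indicator (- ball xo R) x \<le> ennreal c * ennreal (\<bar>u x t\<bar> powr (p - 1) / (1 + norm x powr ?q))"
        proof (cases "x \<in> ball xo R")
          case False
          have "1 / norm (x - xo) powr ?q \<le> c / (1 + norm x powr ?q)" unfolding c_def using xo by (intro kernel_le_global_weight R False q) auto
          then have "\<bar>u x t\<bar> powr (p - 1) * (1 / norm (x - xo) powr ?q) \<le> \<bar>u x t\<bar> powr (p - 1) * (c / (1 + norm x powr ?q))"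
            by (rule mult_left_mono) simp
          then have "\<bar>u x t\<bar> powr (p - 1) / norm (x - xo) powr ?q \<le> c * (\<bar>u x t\<bar> powr (p - 1) / (1 + norm x powr ?q))" by (simp add: mult.commute)
          then have "ennreal (\<bar>u x t\<bar> powr (p - 1) / norm (x - xo) powr ?q) \<le> ennreal c * ennreal (\<bar>u x t\<bar> powr (p - 1) / (1 + norm x powr ?q))"
            using c by (subst ennreal_mult[symmetric]) (auto intro: ennreal_leI add_nonneg_nonneg)
          then show ?thesis using False by simp
        qed simp
      qed
      also have "\<dots> = ennreal c * ?J t" by (rule nn_integral_cmult) measurable
      also have "\<dots> \<le> ennreal c * ennreal B" by (rule mult_left_mono[OF J]) simp
      also have "\<dots> = ennreal (c * B)" using c B by (simp add: ennreal_mult)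
      finally show "outer_tail s p u xo R t \<le> ennreal (c * B)" .
    qed
  qed
  then show ?thesis using c B by (intro exI[of _ "c * B"]) auto
qed

text \<open>The radius is small against the distance of the spatial projection from the complement
  of E, and its power \<sigma> is at most half the earliest time in C. All cylinders then lie in one
  compact set of the form \<open>K2 \<times> {t0 / 2..T}\<close>, where local boundedness gives a
  single B.\<close>

lemma compact_neighbourhood_bound:
  fixes E :: "'a::euclidean_space set"
  assumes E: "open E" and lb: "locally_bounded E T u" and \<sigma>: "0 < \<sigma>" and C: "compact C" "C \<noteq> {}" "C \<subseteq> E \<times> {0<..T}"
  shows "\<exists>Rt t1 B D. 0 < Rt \<and> 0 < t1 \<and> t1 < T \<and> 0 < B \<and> (\<forall>z\<in>C. cball (fst z) Rt \<subseteq> E \<and> t1 \<le> snd z - Rt powr \<sigma> \<and> snd z \<le> T \<and> norm (fst z) \<le> D \<and>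
     (AE w in lebesgue. w \<in> ball (fst z) Rt \<times> {snd z - Rt powr \<sigma><..<snd z} \<longrightarrow> \<bar>u (fst w) (snd w)\<bar> \<le> B))"
proof -
  have Kx: "compact (fst ` C)" using C(1) by (intro compact_continuous_image continuous_on_fst continuous_on_id)
  have Kt: "compact (snd ` C)" using C(1) by (intro compact_continuous_image continuous_on_snd continuous_on_id)
  have sE: "fst ` C \<subseteq> E" using C(3) by auto
  obtain e where e: "0 < e" "(\<Union>x\<in>fst ` C. cball x e) \<subseteq> E" using compact_subset_open_imp_cball_epsilon_subset[OF Kx E sE] by blast
  obtain t0 where t0: "t0 \<in> snd ` C" "\<And>t. t \<in> snd ` C \<Longrightarrow> t0 \<le> t" using compact_attains_inf[OF Kt] C(2) by auto
  have t0T: "0 < t0" "t0 \<le> T" using t0(1) C(3) by auto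
  obtain D where D: "\<And>x. x \<in> fst ` C \<Longrightarrow> norm x \<le> D" using compact_imp_bounded[OF Kx] by (auto simp: bounded_iff)
  obtain Rt where Rt: "0 < Rt" "Rt \<le> e" "Rt powr \<sigma> \<le> t0 / 2" using exists_small_powr[of e "t0 / 2" \<sigma>] e t0T \<sigma> by auto
  define K2 where "K2 = {x + y |x y. x \<in> fst ` C \<and> y \<in> cball 0 Rt}"
  have K2: "compact K2" unfolding K2_def by (intro compact_sums Kx compact_cball)
  have cb: "cball x Rt \<subseteq> K2" if "x \<in> fst ` C" for x
  proof
    fix y assume "y \<in> cball x Rt"
    then have "y = x + (y - x)" "y - x \<in> cball 0 Rt" by (auto simp: dist_norm norm_minus_commute)
    then show "y \<in> K2" using that unfolding K2_def by blast
  qed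
  have K2E: "K2 \<subseteq> E"
  proof
    fix z assume "z \<in> K2"
    then obtain x y where xy: "z = x + y" "x \<in> fst ` C" "y \<in> cball 0 Rt" by (auto simp: K2_def)
    then have "z \<in> cball x e" using Rt by (simp add: dist_norm)
    then show "z \<in> E" using e xy by blast
  qed
  have "compact (K2 \<times> {t0 / 2..T})" by (intro compact_Times K2) simp
  moreover have "K2 \<times> {t0 / 2..T} \<subseteq> E \<times> {0<..T}" using K2E t0T by auto
  ultimately have "ess_sup_on (K2 \<times> {t0 / 2..T}) (\<lambda>z. ereal \<bar>u (fst z) (snd z)\<bar>) < \<infinity>"
    using lb unfolding locally_bounded_def by blast
  from ess_sup_on_finite_imp_AE[OF this] obtain B where B: "0 < B" "AE z in lebesgue. z \<in> K2 \<times> {t0 / 2..T} \<longrightarrow> ereal \<bar>u (fst z) (snd z)\<bar> \<le> ereal B" by blast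
  have "cball (fst z) Rt \<subseteq> E \<and> t0 / 2 \<le> snd z - Rt powr \<sigma> \<and> snd z \<le> T \<and> norm (fst z) \<le> D \<and>
     (AE w in lebesgue. w \<in> ball (fst z) Rt \<times> {snd z - Rt powr \<sigma><..<snd z} \<longrightarrow> \<bar>u (fst w) (snd w)\<bar> \<le> B)" if z: "z \<in> C" for z
  proof (intro conjI)
    show "cball (fst z) Rt \<subseteq> E" using cb[of "fst z"] K2E z by blast
    have t: "t0 \<le> snd z" using t0(2) z by blast
    then show t': "t0 / 2 \<le> snd z - Rt powr \<sigma>" using Rt(3) by linarith
    show "snd z \<le> T" using z C(3) by auto
    then have sub: "ball (fst z) Rt \<times> {snd z - Rt powr \<sigma><..<snd z} \<subseteq> K2 \<times> {t0 / 2..T}"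
      using cb[of "fst z"] z t' ball_subset_cball[of "fst z" Rt] by (intro Sigma_mono) auto
    show "norm (fst z) \<le> D" using D z by blast
    show "AE w in lebesgue. w \<in> ball (fst z) Rt \<times> {snd z - Rt powr \<sigma><..<snd z} \<longrightarrow> \<bar>u (fst w) (snd w)\<bar> \<le> B"
      using B(2) by eventually_elim (use sub in auto)
  qed
  then show ?thesis using Rt(1) t0T B(1) by (intro exI[of _ Rt] exI[of _ "t0 / 2"] exI[of _ B] exI[of _ D]) auto
qed

theorem theorem1p1:
  fixes s p Co C1 :: real
  assumes "1 < p" and "0 < s" and "s < 1" and "0 < Co" and "Co \<le> C1"
  shows "\<exists>\<gamma> \<beta>. 1 < \<gamma> \<and> 0 < \<beta> \<and> \<beta> < 1 \<and>
    (\<forall>(E :: 'a::euclidean_space set) T K u.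
       open E \<and> 0 < T \<and> admissible_kernel s p Co C1 T K \<and>
       weak_solution s p E T K u \<and> locally_bounded E T u \<longrightarrow>
         locally_hoelder E T u \<and>
         (\<forall>xo to \<rho> R Rt \<omega>. 0 < \<rho> \<and> \<rho> < R \<and> R < Rt \<and> 0 < \<omega> \<and>
            ereal \<omega> = 2 * ess_sup_on (cyl s p xo to Rt 1) (\<lambda>z. ereal \<bar>u (fst z) (snd z)\<bar>)
                      + tail s p u xo to Rt (Rt powr (s * p)) \<and>
            cyl s p xo to R (\<omega> powr (2 - p)) \<subseteq> cyl s p xo to Rt 1 \<and>
            cyl s p xo to Rt 1 \<subseteq> E \<times> {0<..T} \<longrightarrow>
              ess_osc_on (cyl s p xo to \<rho> (\<omega> powr (2 - p))) (\<lambda>z. ereal (u (fst z) (snd z)))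
                \<le> ereal (\<gamma> * \<omega> * (\<rho> / R) powr \<beta>)))"
proof -
  obtain \<gamma> \<beta> where \<gamma>\<beta>: "1 < \<gamma>" "0 < \<beta>" "\<beta> < 1" and "interior_decay TYPE('a) s p Co C1 \<gamma> \<beta>"
    using interior_oscillation[OF assms, where 'a = 'a] by blast
  note decay = this(4)[unfolded interior_decay_def, rule_format]
  let ?\<sigma> = "s * p" and ?q = "real DIM('a) + s * p"
  have \<sigma>: "0 < ?\<sigma>" using assms by simp
  have hoelder: "locally_hoelder E T u"
    if h: "open E" "0 < T" "admissible_kernel s p Co C1 T K" "weak_solution s p E T K u" "locally_bounded E T u"
    for E :: "'a set" and T K u unfolding locally_hoelder_def
  proof (rule hoelder_representative[OF h(2) \<sigma>])
    fix C assume C: "compact C" "C \<subseteq> E \<times> {0<..T}"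
    show "\<exists>A L R \<beta> B. uniform_decay (\<lambda>z. u (fst z) (snd z)) ?\<sigma> C A L R \<beta> B"
    proof (cases "C = {}")
      case True
      then show ?thesis by (intro exI[of _ 1]) (simp add: uniform_decay_def)
    next
      case False
      obtain Rt t1 B D where Rt: "0 < Rt" "0 < t1" "t1 < T" "0 < B"
        and nb: "\<And>z. z \<in> C \<Longrightarrow> cball (fst z) Rt \<subseteq> E \<and> t1 \<le> snd z - Rt powr ?\<sigma> \<and> snd z \<le> T \<and> norm (fst z) \<le> D \<and>
         (AE w in lebesgue. w \<in> ball (fst z) Rt \<times> {snd z - Rt powr ?\<sigma><..<snd z} \<longrightarrow> \<bar>u (fst w) (snd w)\<bar> \<le> B)"
        using compact_neighbourhood_bound[OF h(1,5) \<sigma> C(1) False C(2)] by blast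
      obtain W where W: "0 < W" "\<And>xo. norm xo \<le> D \<Longrightarrow> AE t in lebesgue. t \<in> {t1<..<T} \<longrightarrow>
         outer_tail s p u xo Rt t \<le> ennreal W"
        using uniform_tail_bound[OF assms h(3,4) Rt(2,3,1)] by blast
      \<comment> \<open>It takes the role of \<omega> simultaneously for all points of C: the first
        summand covers the supremum and the second the tail bound W.\<close>
      define \<Omega> where "\<Omega> = 2 * B + (Rt powr ?\<sigma> * W) powr (1 / (p - 1))"
      have \<Omega>: "0 < \<Omega>" "B \<le> \<Omega> / 2" using Rt by (auto simp: \<Omega>_def intro: add_pos_nonneg)
      have "Rt powr ?\<sigma> * W = ((Rt powr ?\<sigma> * W) powr (1 / (p - 1))) powr (p - 1)" using Rt W assms by (simp add: powr_powr)
      also have "\<dots> \<le> \<Omega> powr (p - 1)" using assms Rt by (intro powr_mono2) (auto simp: \<Omega>_def)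
      finally have W\<Omega>: "W \<le> \<Omega> powr (p - 1) * Rt powr - ?\<sigma>" using Rt by (simp add: powr_minus field_simps)
      \<comment> \<open>R is reduced until the intrinsic cylinder with shape factor \<Omega>^(2-p)
        fits into the cylinder of radius Rt.\<close>
      obtain R where R: "0 < R" "R \<le> Rt / 2" "R powr ?\<sigma> \<le> Rt powr ?\<sigma> / \<Omega> powr (2 - p)"
        using exists_small_powr[of "Rt / 2" "Rt powr ?\<sigma> / \<Omega> powr (2 - p)" ?\<sigma>] Rt \<Omega> \<sigma> by auto
      have wide: "\<Omega> powr (2 - p) * R powr ?\<sigma> \<le> Rt powr ?\<sigma>" using R(3) \<Omega> by (simp add: pos_le_divide_eq mult.commute)
      define L where "L = \<gamma> * \<Omega> * (1 / R) powr \<beta>"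
      have "uniform_decay (\<lambda>z. u (fst z) (snd z)) ?\<sigma> C (\<Omega> powr (2 - p)) L R \<beta> B" unfolding uniform_decay_def
      proof (intro conjI ballI allI impI)
        show "0 < \<Omega> powr (2 - p)" "0 < L" using \<Omega> \<gamma>\<beta> R by (auto simp: L_def)
        fix z \<rho> assume z: "z \<in> C" and \<rho>: "0 < \<rho>" "\<rho> < R"
        note n = nb[OF z]
        have cy: "backward_cyl z \<rho> (\<Omega> powr (2 - p) * \<rho> powr ?\<sigma>) = cyl s p (fst z) (snd z) \<rho> (\<Omega> powr (2 - p))"
          by (simp add: backward_cyl_def cyl_def)
        have RRt: "R < Rt" using R Rt by linarith
        have \<rho>w: "\<Omega> powr (2 - p) * \<rho> powr ?\<sigma> \<le> Rt powr ?\<sigma>"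
        proof -
          have "\<Omega> powr (2 - p) * \<rho> powr ?\<sigma> \<le> \<Omega> powr (2 - p) * R powr ?\<sigma>" using \<rho> \<sigma> by (intro mult_left_mono powr_mono2) auto
          then show ?thesis using wide by linarith
        qed
        have bB: "AE w in lebesgue. w \<in> cyl s p (fst z) (snd z) Rt 1 \<longrightarrow> \<bar>u (fst w) (snd w)\<bar> \<le> B" using n by (simp add: cyl_def)
        have "\<exists>\<mu>. AE w in lebesgue. w \<in> cyl s p (fst z) (snd z) \<rho> (\<Omega> powr (2 - p)) \<longrightarrow>
          \<mu> \<le> u (fst w) (snd w) \<and> u (fst w) (snd w) \<le> \<mu> + \<gamma> * \<Omega> * (\<rho> / R) powr \<beta>"
        proof (rule decay[OF h(3,4) \<rho> RRt \<Omega>(1) _ _ _ wide])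
          show "ball (fst z) Rt \<subseteq> E" using n ball_subset_cball by blast
          show "Rt powr ?\<sigma> \<le> snd z" "snd z \<le> T" using n Rt by auto
          show "AE w in lebesgue. w \<in> cyl s p (fst z) (snd z) Rt 1 \<longrightarrow> \<bar>u (fst w) (snd w)\<bar> \<le> \<Omega> / 2"
            using bB by eventually_elim (use \<Omega> in auto)
          have "norm (fst z) \<le> D" using n by blast
          from W(2)[OF this]
          show "AE t in lebesgue. t \<in> {snd z - Rt powr ?\<sigma><..<snd z} \<longrightarrow>
            outer_tail s p u (fst z) Rt t
              \<le> ennreal (\<Omega> powr (p - 1) * Rt powr - ?\<sigma>)"
          proof eventually_elim
            case (elim t)
            have "ennreal W \<le> ennreal (\<Omega> powr (p - 1) * Rt powr - ?\<sigma>)" using W\<Omega> by (rule ennreal_leI)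
            then show ?case using elim n by (auto intro: order_trans)
          qed
        qed
        then obtain \<mu> where \<mu>: "AE w in lebesgue. w \<in> cyl s p (fst z) (snd z) \<rho> (\<Omega> powr (2 - p)) \<longrightarrow>
          \<mu> \<le> u (fst w) (snd w) \<and> u (fst w) (snd w) \<le> \<mu> + \<gamma> * \<Omega> * (\<rho> / R) powr \<beta>" by blast
        have Lr: "\<gamma> * \<Omega> * (\<rho> / R) powr \<beta> = L * \<rho> powr \<beta>" using \<rho> R by (simp add: L_def powr_divide)
        have sub: "cyl s p (fst z) (snd z) \<rho> (\<Omega> powr (2 - p)) \<subseteq> cyl s p (fst z) (snd z) Rt 1"
          using \<rho>w \<rho> RRt by (auto simp: cyl_def)
        have "AE w in lebesgue. w \<in> cyl s p (fst z) (snd z) \<rho> (\<Omega> powr (2 - p)) \<longrightarrow>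
          \<mu> \<le> u (fst w) (snd w) \<and> u (fst w) (snd w) \<le> \<mu> + L * \<rho> powr \<beta> \<and> \<bar>u (fst w) (snd w)\<bar> \<le> B"
          using \<mu> bB by eventually_elim (use sub Lr in auto)
        then show "\<exists>\<mu>. AE w in lebesgue. w \<in> backward_cyl z \<rho> (\<Omega> powr (2 - p) * \<rho> powr ?\<sigma>) \<longrightarrow>
          \<mu> \<le> u (fst w) (snd w) \<and> u (fst w) (snd w) \<le> \<mu> + L * \<rho> powr \<beta> \<and> \<bar>u (fst w) (snd w)\<bar> \<le> B"
          unfolding cy by blast
      qed (use R \<gamma>\<beta> Rt in auto)
      then show ?thesis by blast
    qed
  qed
  have osc: "ess_osc_on (cyl s p xo to \<rho> (\<omega> powr (2 - p))) (\<lambda>z. ereal (u (fst z) (snd z))) \<le> ereal (\<gamma> * \<omega> * (\<rho> / R) powr \<beta>)"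
    if h: "admissible_kernel s p Co C1 T K" "weak_solution s p E T K u"
      and r: "0 < \<rho>" "\<rho> < R" "R < Rt" "0 < \<omega>"
      and \<omega>: "ereal \<omega> = 2 * ess_sup_on (cyl s p xo to Rt 1) (\<lambda>z. ereal \<bar>u (fst z) (snd z)\<bar>) + tail s p u xo to Rt (Rt powr (s * p))"
      and sub: "cyl s p xo to R (\<omega> powr (2 - p)) \<subseteq> cyl s p xo to Rt 1" "cyl s p xo to Rt 1 \<subseteq> E \<times> {0<..T}"
    for E :: "'a set" and T K u xo to \<rho> R Rt \<omega>
  proof -
    have Rt: "0 < Rt" using r by linarith
    let ?X = "ess_sup_on (cyl s p xo to Rt 1) (\<lambda>z. ereal \<bar>u (fst z) (snd z)\<bar>)" and ?Y = "tail s p u xo to Rt (Rt powr (s * p))"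
    have lpos: "0 < Rt powr ?\<sigma>" using Rt by simp
    have cy: "open (cyl s p xo to Rt 1)" "cyl s p xo to Rt 1 \<noteq> {}"
      using backward_cyl_open[of "(xo, to)" Rt "Rt powr ?\<sigma>"] backward_cyl_nonempty[OF Rt lpos, of "(xo, to)"] by (simp_all add: backward_cyl_def cyl_def)
    \<comment> \<open>Over a nonempty open set the essential supremum of a nonnegative function
      cannot be minus infinity. With both summands nonnegative, each one is bounded by
      \<omega>.\<close>
    have X0: "0 \<le> ?X" using cy by (rule ess_sup_on_nonneg) simp
    have Y0: "0 \<le> ?Y" unfolding tail_def
    proof (rule ess_sup_on_nonneg)
      show "{to - Rt powr ?\<sigma><..<to} \<noteq> {}" using lpos by simp
    qed (auto simp: ereal_powr_def)
    have "2 * ?X \<le> ereal \<omega>" unfolding \<omega> using Y0 by (simp add: add_increasing2)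
    then have "?X \<le> ereal (\<omega> / 2)" using X0 by (cases ?X) auto
    from ess_sup_on_le_imp_AE[OF this]
    have bnd: "AE z in lebesgue. z \<in> cyl s p xo to Rt 1 \<longrightarrow> \<bar>u (fst z) (snd z)\<bar> \<le> \<omega> / 2" by simp
    have "?Y \<le> ereal \<omega>" unfolding \<omega> using X0 by (intro add_increasing) (auto intro: mult_nonneg_nonneg)
    from ess_sup_on_le_imp_AE[OF this[unfolded tail_def]]
    have tl: "AE t in lebesgue. t \<in> {to - Rt powr ?\<sigma><..<to} \<longrightarrow>
          outer_tail s p u xo Rt t
            \<le> ennreal (\<omega> powr (p - 1) * Rt powr - ?\<sigma>)"
    proof eventually_elim
      case (elim t)
      show ?case
      proof
        assume "t \<in> {to - Rt powr ?\<sigma><..<to}"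
        then have "outer_tail s p u xo Rt t \<le> ennreal (\<omega> powr (p - 1) / Rt powr ?\<sigma>)"
          using elim lpos assms r(4) by (intro ereal_powr_le_imp) auto
        then show "outer_tail s p u xo Rt t \<le> ennreal (\<omega> powr (p - 1) * Rt powr - ?\<sigma>)"
          by (simp add: powr_minus divide_inverse)
      qed
    qed
    have R: "0 < R" using r by linarith
    obtain \<mu> where "AE z in lebesgue. z \<in> cyl s p xo to \<rho> (\<omega> powr (2 - p)) \<longrightarrow> \<mu> \<le> u (fst z) (snd z) \<and> u (fst z) (snd z) \<le> \<mu> + \<gamma> * \<omega> * (\<rho> / R) powr \<beta>"
      using decay[OF h r cyl_subset_space_time[OF Rt sub(2)] cyl_subset_cyl[OF R r(3) sub(1)] bnd tl] by blast
    then show ?thesis by (rule ess_osc_on_le)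
  qed
  show ?thesis
  proof (rule exI[of _ \<gamma>], rule exI[of _ \<beta>], intro conjI \<gamma>\<beta> allI impI)
    fix E :: "'a set" and T K u
    assume h: "open E \<and> 0 < T \<and> admissible_kernel s p Co C1 T K \<and> weak_solution s p E T K u \<and> locally_bounded E T u"
    then have h': "open E" "0 < T" "admissible_kernel s p Co C1 T K" "weak_solution s p E T K u" "locally_bounded E T u" by blast+
    then show "locally_hoelder E T u" by (rule hoelder)
    fix xo to \<rho> R Rt \<omega>
    assume r: "0 < \<rho> \<and> \<rho> < R \<and> R < Rt \<and> 0 < \<omega> \<and>
            ereal \<omega> = 2 * ess_sup_on (cyl s p xo to Rt 1) (\<lambda>z. ereal \<bar>u (fst z) (snd z)\<bar>)
                      + tail s p u xo to Rt (Rt powr (s * p)) \<and>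
            cyl s p xo to R (\<omega> powr (2 - p)) \<subseteq> cyl s p xo to Rt 1 \<and>
            cyl s p xo to Rt 1 \<subseteq> E \<times> {0<..T}"
    show "ess_osc_on (cyl s p xo to \<rho> (\<omega> powr (2 - p))) (\<lambda>z. ereal (u (fst z) (snd z))) \<le> ereal (\<gamma> * \<omega> * (\<rho> / R) powr \<beta>)"
      by (rule osc[OF h'(3,4)]) (use r in blast)+
  qed
qed

end
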